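(* Let $1<\gamma<2$ and let $\rho,u$ be a solution in the sense of distributions on $(0,T)\times\mathbb{T}^d$ of the isentropic compressible Euler system $$\partial_t(\rho u)+\operatorname{div}(\rho u\otimes u)+\nabla p(\rho)=0,\qquad \partial_t\rho+\operatorname{div}(\rho u)=0.$$ Assume $$u\in B_r^{\alpha,\infty}((0,T)\times\mathbb{T}^d),\qquad \rho,\ \rho u\in B_q^{\beta,\infty}((0,T)\times\mathbb{T}^d),\qquad 0\le\underline{\rho}\le\rho\le\overline{\rho}\ \text{ a.e. in }(0,T)\times\mathbb{T}^d,$$ for some constants $\underline{\rho},\overline{\rho}$, exponents $r,q$ and $0\le\alpha,\beta\le1$ such that $$\frac1r+\frac2q\le1,\qquad\frac2r+\frac1q\le1,\qquad r,q\ge2,\qquad\alpha+\gamma\beta>1\qquad\text{and}\qquad2\alpha+\beta>1.$$ Define $\mathcal{E}:=\{y\in(0,T)\times\mathbb{T}^d:\ \rho(y)\ne0\}$ and assume that $$\frac1\rho\in L^q(\mathcal{E}).$$ Assume further that $p\in C^{1,\gamma-1}([\underline{\rho},\overline{\rho}])$ and, in addition, $p'(0)=0$ as soon as $\underline{\rho}=0$. Then the energy is locally conserved, i.e. $$\partial_t\left(\tfrac12\rho|u|^2+P(\rho)\right)+\operatorname{div}\left[\left(\tfrac12\rho|u|^2+p(\rho)+P(\rho)\right)u\right]=0$$ in the sense of distributions on $(0,T)\times\mathbb{T}^d$.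
   Context: $\mathbb{T}^d$ is the $d$-dimensional torus; $u$ is the velocity, $\rho\ge0$ the density, $p=p(\rho)$ the pressure law. $\operatorname{div}$ and $\nabla$ act in the space variable. The pressure potential is $P(\rho)=\rho\int_1^\rho\frac{p(s)}{s^2}\,ds$, with the value at $\rho=0$ understood as the limit $\rho\to0^+$; the pressure is understood to be given on an interval for which this integral makes sense. For $\Omega=(0,T)\times\mathbb{T}^d$, the Besov space $B_q^{\alpha,\infty}(\Omega)$ consists of those $w$ for which $$\|w\|_{B_q^{\alpha,\infty}(\Omega)}:=\|w\|_{L^q(\Omega)}+\sup_{\xi\in\Omega}\frac{\|w(\cdot+\xi)-w\|_{L^q(\Omega\cap(\Omega-\xi))}}{|\xi|^\alpha}<\infty,$$ where $\xi$ ranges over (nonzero) space-time shifts. *)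

theory Defs
  imports "HOL-Probability.Essential_Supremum"
begin

section \<open>The space-time domain\<close>

text \<open>
  A function on \<open>(0,T) \<times> \<T>\<^sup>d\<close>, with \<open>\<T>\<^sup>d = \<real>\<^sup>d/\<int>\<^sup>d\<close> and \<open>d = CARD('n)\<close>, is represented by a
  function on \<open>\<real> \<times> \<real>\<^sup>d\<close> that is 1-periodic in each space variable; its values at times outside
  \<open>(0,T)\<close> are irrelevant. Integrals over \<open>(0,T) \<times> \<T>\<^sup>d\<close> are taken over one period cell, with respect
  to (complete) Lebesgue measure.
\<close>

definition unit_cell :: "(real ^ 'n::finite) set" where
  "unit_cell = {x. \<forall>k. 0 \<le> x $ k \<and> x $ k < 1}"

definition Omega :: "real \<Rightarrow> (real \<times> (real ^ 'n::finite)) set" where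
  "Omega T = {0<..<T} \<times> unit_cell"

definition space_periodic :: "real set \<Rightarrow> (real \<times> (real ^ 'n::finite) \<Rightarrow> 'b) \<Rightarrow> bool" where
  "space_periodic I f \<longleftrightarrow> (\<forall>t\<in>I. \<forall>x k. f (t, x + axis k 1) = f (t, x))"

section \<open>Lebesgue and Besov spaces\<close>

text \<open>Exponents range over \<open>[1,\<infinity>]\<close>; the norms take values in \<open>[0,\<infinity>]\<close>.\<close>

definition Lp_norm :: "ennreal \<Rightarrow> 'a measure \<Rightarrow> ('a \<Rightarrow> 'b::real_normed_vector) \<Rightarrow> ennreal" where
  "Lp_norm q M f =
     (if q = \<infinity> then esssup M (\<lambda>x. ennreal (norm (f x)))
      else let I = (\<integral>\<^sup>+ x. ennreal (norm (f x) powr enn2real q) \<partial>M)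
           in if I = \<infinity> then \<infinity> else ennreal (enn2real I powr (1 / enn2real q)))"

definition Lp :: "ennreal \<Rightarrow> 'a measure \<Rightarrow> ('a \<Rightarrow> 'b::real_normed_vector) set" where
  "Lp q M = {f. f \<in> borel_measurable M \<and> Lp_norm q M f < \<infinity>}"

text \<open>
  The set \<open>\<Omega> \<inter> (\<Omega> - \<xi>)\<close>: in the space directions a shift maps the torus onto itself, so
  only the time component of \<open>\<xi>\<close> matters.
\<close>

definition Omega_shift :: "real \<Rightarrow> real \<times> (real ^ 'n) \<Rightarrow> (real \<times> (real ^ 'n::finite)) set" where
  "Omega_shift T \<xi> = {y \<in> Omega T. fst (y + \<xi>) \<in> {0<..<T}}"

text \<open>
  The shifts range over all nonzero \<open>\<xi> \<in> \<real> \<times> \<real>\<^sup>d\<close>. As the numerator depends on the space part of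
  \<open>\<xi>\<close> only modulo \<open>\<int>\<^sup>d\<close>, the supremum is the one in which \<open>\<bar>\<xi>\<bar>\<close> is measured by the shortest
  representative, i.e. by the distance on the torus.
\<close>

definition Besov_norm ::
  "real \<Rightarrow> real \<Rightarrow> ennreal \<Rightarrow> (real \<times> (real ^ 'n::finite) \<Rightarrow> 'b::real_normed_vector) \<Rightarrow> ennreal" where
  "Besov_norm T \<alpha> q w =
     Lp_norm q (lebesgue_on (Omega T)) w +
     (SUP \<xi>\<in>-{0}. Lp_norm q (lebesgue_on (Omega_shift T \<xi>)) (\<lambda>y. w (y + \<xi>) - w y)
                    / ennreal (norm \<xi> powr \<alpha>))"

definition Besov ::
  "real \<Rightarrow> real \<Rightarrow> ennreal \<Rightarrow> (real \<times> (real ^ 'n::finite) \<Rightarrow> 'b::real_normed_vector) set" where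
  "Besov T \<alpha> q =
     {w. space_periodic {0<..<T} w \<and> w \<in> borel_measurable (lebesgue_on (Omega T)) \<and>
         Besov_norm T \<alpha> q w < \<infinity>}"

section \<open>Distributions on \<open>(0,T) \<times> \<T>\<^sup>d\<close>\<close>

primrec Ck :: "nat \<Rightarrow> ('a::real_normed_vector \<Rightarrow> real) \<Rightarrow> bool" where
  "Ck 0 f \<longleftrightarrow> continuous_on UNIV f"
| "Ck (Suc k) f \<longleftrightarrow>
     (\<forall>x. f differentiable (at x)) \<and> (\<forall>v. Ck k (\<lambda>x. frechet_derivative f (at x) v))"

text \<open>Since the torus is compact, only the support in time has to be restricted.\<close>

definition test_functions :: "real \<Rightarrow> (real \<times> (real ^ 'n::finite) \<Rightarrow> real) set" where
  "test_functions T =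
     {\<phi>. (\<forall>k. Ck k \<phi>) \<and> space_periodic UNIV \<phi> \<and>
         (\<exists>a b. 0 < a \<and> b < T \<and> (\<forall>t x. \<phi> (t, x) \<noteq> 0 \<longrightarrow> t \<in> {a..b}))}"

definition L1_loc ::
  "real \<Rightarrow> (real \<times> (real ^ 'n::finite) \<Rightarrow> 'b::{banach, second_countable_topology}) set" where
  "L1_loc T = {f. space_periodic {0<..<T} f \<and>
     (\<forall>a b. 0 < a \<longrightarrow> b < T \<longrightarrow> integrable (lebesgue_on ({a..b} \<times> unit_cell)) f)}"

text \<open>Distributional derivatives of locally integrable functions, as functionals of the test
  function \<open>\<phi>\<close>.\<close>

definition dist_dt ::
  "real \<Rightarrow> (real \<times> (real ^ 'n::finite) \<Rightarrow> real) \<Rightarrow> (real \<times> (real ^ 'n) \<Rightarrow> real) \<Rightarrow> real" where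
  "dist_dt T f \<phi> =
     - (LINT y|lebesgue_on (Omega T). f y * frechet_derivative \<phi> (at y) (1, 0))"

definition dist_dx ::
  "real \<Rightarrow> 'n \<Rightarrow> (real \<times> (real ^ 'n::finite) \<Rightarrow> real) \<Rightarrow> (real \<times> (real ^ 'n) \<Rightarrow> real) \<Rightarrow> real" where
  "dist_dx T j f \<phi> =
     - (LINT y|lebesgue_on (Omega T). f y * frechet_derivative \<phi> (at y) (0, axis j 1))"

definition dist_div ::
  "real \<Rightarrow> (real \<times> (real ^ 'n::finite) \<Rightarrow> real ^ 'n) \<Rightarrow> (real \<times> (real ^ 'n) \<Rightarrow> real) \<Rightarrow> real" where
  "dist_div T F \<phi> = (\<Sum>j\<in>UNIV. dist_dx T j (\<lambda>y. F y $ j) \<phi>)"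

section \<open>The isentropic compressible Euler system\<close>

text \<open>
  The \<open>i\<close>-th row of \<open>\<rho> u \<otimes> u\<close> is \<open>(\<rho> u\<^sub>i) u\<close>. That every term is
  locally integrable is part of what it means to solve an equation in the sense of distributions.
\<close>

definition momentum_equation ::
  "real \<Rightarrow> (real \<Rightarrow> real) \<Rightarrow> (real \<times> (real ^ 'n::finite) \<Rightarrow> real) \<Rightarrow>
   (real \<times> (real ^ 'n) \<Rightarrow> real ^ 'n) \<Rightarrow> bool" where
  "momentum_equation T p \<rho> u \<longleftrightarrow> (\<forall>i.
     (\<lambda>y. \<rho> y * u y $ i) \<in> L1_loc T \<and>
     (\<lambda>y. (\<rho> y * u y $ i) *\<^sub>R u y) \<in> L1_loc T \<and>
     (\<lambda>y. p (\<rho> y)) \<in> L1_loc T \<and>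
     (\<forall>\<phi>\<in>test_functions T.
        dist_dt T (\<lambda>y. \<rho> y * u y $ i) \<phi> +
        dist_div T (\<lambda>y. (\<rho> y * u y $ i) *\<^sub>R u y) \<phi> +
        dist_dx T i (\<lambda>y. p (\<rho> y)) \<phi> = 0))"

definition continuity_equation ::
  "real \<Rightarrow> (real \<times> (real ^ 'n::finite) \<Rightarrow> real) \<Rightarrow> (real \<times> (real ^ 'n) \<Rightarrow> real ^ 'n) \<Rightarrow> bool" where
  "continuity_equation T \<rho> u \<longleftrightarrow>
     \<rho> \<in> L1_loc T \<and> (\<lambda>y. \<rho> y *\<^sub>R u y) \<in> L1_loc T \<and>
     (\<forall>\<phi>\<in>test_functions T. dist_dt T \<rho> \<phi> + dist_div T (\<lambda>y. \<rho> y *\<^sub>R u y) \<phi> = 0)"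

definition euler_solution ::
  "real \<Rightarrow> (real \<Rightarrow> real) \<Rightarrow> (real \<times> (real ^ 'n::finite) \<Rightarrow> real) \<Rightarrow>
   (real \<times> (real ^ 'n) \<Rightarrow> real ^ 'n) \<Rightarrow> bool" where
  "euler_solution T p \<rho> u \<longleftrightarrow> momentum_equation T p \<rho> u \<and> continuity_equation T \<rho> u"

section \<open>Pressure law and energy\<close>

text \<open>
  \<open>p \<in> C\<^sup>1\<^sup>,\<^sup>\<delta>([a,b])\<close> with derivative \<open>p'\<close> (one-sided at the endpoints).
\<close>

definition C1_Hoelder ::
  "real \<Rightarrow> real \<Rightarrow> real \<Rightarrow> (real \<Rightarrow> real) \<Rightarrow> (real \<Rightarrow> real) \<Rightarrow> bool" where
  "C1_Hoelder \<delta> a b p p' \<longleftrightarrow>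
     (\<forall>s\<in>{a..b}. (p has_real_derivative p' s) (at s within {a..b})) \<and>
     (\<exists>C. \<forall>s\<in>{a..b}. \<forall>s'\<in>{a..b}. \<bar>p' s - p' s'\<bar> \<le> C * \<bar>s - s'\<bar> powr \<delta>)"

text \<open>
  The integral in the pressure potential starts at 1, which need not lie in the range \<open>[a,b]\<close> of the
  density. The pressure law is therefore given on the interval spanned by 1 and
  \<open>[a,b]\<close>, with \<open>p(s)/s\<^sup>2\<close> integrable between 1 and every positive point of it. The last clause,
  which makes the limit of the potential at \<open>0\<close> exist, follows from differentiability on
  \<open>[a,b]\<close> unless \<open>a = b = 0\<close>.
\<close>

definition pressure_law_on :: "real \<Rightarrow> real \<Rightarrow> (real \<Rightarrow> real) \<Rightarrow> bool" where
  "pressure_law_on a b p \<longleftrightarrow>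
     (\<forall>s. 0 < s \<and> min 1 a \<le> s \<and> s \<le> max 1 b \<longrightarrow>
        interval_lebesgue_integrable lborel 1 s (\<lambda>\<sigma>. p \<sigma> / \<sigma>\<^sup>2)) \<and>
     (a = 0 \<longrightarrow> (p \<longlongrightarrow> p 0) (at_right 0))"

definition pressure_potential :: "(real \<Rightarrow> real) \<Rightarrow> real \<Rightarrow> real" where
  "pressure_potential p s =
     (let P = (\<lambda>s. s * (LBINT \<sigma>=1..s. p \<sigma> / \<sigma>\<^sup>2))
      in if s = 0 then Lim (at_right 0) P else P s)"

definition energy_density ::
  "(real \<Rightarrow> real) \<Rightarrow> ('a \<Rightarrow> real) \<Rightarrow> ('a \<Rightarrow> real ^ 'n::finite) \<Rightarrow> 'a \<Rightarrow> real" where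
  "energy_density p \<rho> u y = 1/2 * \<rho> y * (norm (u y))\<^sup>2 + pressure_potential p (\<rho> y)"

definition energy_flux ::
  "(real \<Rightarrow> real) \<Rightarrow> ('a \<Rightarrow> real) \<Rightarrow> ('a \<Rightarrow> real ^ 'n::finite) \<Rightarrow> 'a \<Rightarrow> real ^ 'n" where
  "energy_flux p \<rho> u y =
     (1/2 * \<rho> y * (norm (u y))\<^sup>2 + p (\<rho> y) + pressure_potential p (\<rho> y)) *\<^sub>R u y"

definition energy_locally_conserved ::
  "real \<Rightarrow> (real \<Rightarrow> real) \<Rightarrow> (real \<times> (real ^ 'n::finite) \<Rightarrow> real) \<Rightarrow>
   (real \<times> (real ^ 'n) \<Rightarrow> real ^ 'n) \<Rightarrow> bool" where
  "energy_locally_conserved T p \<rho> u \<longleftrightarrow>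
     energy_density p \<rho> u \<in> L1_loc T \<and> energy_flux p \<rho> u \<in> L1_loc T \<and>
     (\<forall>\<phi>\<in>test_functions T.
        dist_dt T (energy_density p \<rho> u) \<phi> + dist_div T (energy_flux p \<rho> u) \<phi> = 0)"

end

theory Submission
  imports Defs
begin

text \<open>
  The proof is the commutator argument that Constantin, E and Titi introduced for the incompressible
  equations. Let \<open>U, R, M, PP\<close> be the mollifications of \<open>u, \<rho>, \<rho> u, p \<rho>\<close> in space and time at
  scale \<open>\<epsilon>\<close>, and \<open>FF\<close> that of \<open>\<rho> u \<otimes> u\<close>. They satisfy the mass and momentum equations pointwise.
  Multiplying the momentum equation by \<open>U\<close>, and the mass equation by \<open>b' R - \<bar>U\<bar>\<^sup>2 / 2\<close> for a
  \<open>C\<^sup>2\<close> function \<open>b\<close>, gives a local energy balance up to the four terms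
  \<open>\<partial>\<^sub>t U\<^sub>i (M\<^sub>i - R U\<^sub>i)\<close>, \<open>\<partial>\<^sub>j U\<^sub>i (FF\<^sub>i\<^sub>j - M\<^sub>j U\<^sub>i)\<close>, \<open>\<partial>\<^sub>j U\<^sub>j (PP - q)\<close> and
  \<open>b'' R \<partial>\<^sub>j R (M\<^sub>j - R U\<^sub>j)\<close>, where \<open>q = R b' R - b R\<close> is the pressure that belongs to \<open>b\<close>
  (\<open>energy_flux_divergence\<close>). Each pairs a derivative with a commutator; in the
  third, the deviation of \<open>q\<close> from the pressure enters as well.

  Increments of \<open>u\<close> are of order \<open>\<epsilon> powr \<alpha>\<close> and increments of \<open>\<rho>\<close> and \<open>\<rho> u\<close> of order
  \<open>\<epsilon> powr \<beta>\<close> in their Lebesgue spaces; a derivative costs a factor \<open>1 / \<epsilon>\<close>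
  (\<open>decay_moll_pdiff\<close>), and the commutator of mollification with a product gains both orders
  (\<open>decay_moll_commutator\<close>). So the first two terms are of order \<open>\<epsilon> powr (2 * \<alpha> + \<beta> - 1)\<close>.

  The natural choice of \<open>b\<close> is the pressure potential \<open>P\<close>, but \<open>P'' s = p' s / s\<close> is unbounded near
  vacuum; Hoelder continuity and \<open>p' 0 = 0\<close> only give \<open>\<bar>p' s\<bar> \<le> C * s powr (\<gamma> - 1)\<close>. Therefore \<open>b\<close>
  is the potential with \<open>b'' s = p' s / max s \<delta>\<close> (\<open>regularised_potential\<close>): then \<open>b''\<close> is of order
  \<open>\<delta> powr (\<gamma> - 2)\<close>, while \<open>b\<close> and \<open>s * b' s - b s\<close> differ from \<open>P\<close> and \<open>p\<close> by at most
  \<open>C * \<delta> powr \<gamma>\<close>. The choice \<open>\<delta> = \<epsilon> powr \<beta>\<close> balances these. The commutator \<open>PP - p R\<close> is of order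
  \<open>\<epsilon> powr (\<gamma> * \<beta>)\<close> by Taylor expansion, hence so is \<open>PP - q\<close>, and the third term is of order
  \<open>\<epsilon> powr (\<alpha> - 1 + \<gamma> * \<beta>)\<close>. The fourth is of order
  \<open>\<delta> powr (\<gamma> - 2) * \<epsilon> powr (\<beta> - 1) * \<epsilon> powr (\<alpha> + \<beta>) = \<epsilon> powr (\<alpha> - 1 + \<gamma> * \<beta>)\<close> as well. Both exponents
  are positive by hypothesis. The regularised energy and flux converge with a positive rate too, so
  that the balance passes to the limit (\<open>energy_conserved_slab\<close>).

  The conditions on \<open>r\<close> and \<open>q\<close> say that every product above is integrable. All estimates are made
  with a notion of \<open>L\<^sup>1\<^sup>/\<^sup>s\<close> bound that treats \<open>0 < s \<le> 1\<close> and \<open>s = 0\<close> alike (\<open>Lq_bound\<close>), and with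
  Borel representatives of the fields on \<open>\<real> \<times> \<T>\<^sup>d\<close>, on which translations preserve the measure.
\<close>

section \<open>Translations of the cylinder \<open>\<real> \<times> \<T>\<^sup>d\<close>\<close>

definition lattice :: "(real ^ 'n::finite) set" where
  "lattice = {k. \<forall>i. k $ i \<in> \<int>}"

definition fold_cell :: "real \<times> (real ^ 'n::finite) \<Rightarrow> real \<times> (real ^ 'n)" where
  "fold_cell y = (fst y, \<chi> i. frac (snd y $ i))"

text \<open>The measure of \<open>\<real> \<times> \<T>\<^sup>d\<close>, carried by the strip over one period cell. It is a Borel measure
  rather than its completion, so that Tonelli's theorem applies to products.\<close>

definition cylinder :: "(real \<times> (real ^ 'n::finite)) measure" where
  "cylinder = restrict_space lborel (UNIV \<times> unit_cell)"

lemma periodic_lattice_shift: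
  assumes per: "space_periodic I f" and t: "t \<in> I" and k: "k \<in> lattice"
  shows "f (t, x + k) = f (t, x)"
proof -
  have nat: "f (t, z + of_nat n *\<^sub>R axis i 1) = f (t, z)" for z i n
  proof (induction n)
    case (Suc n)
    have "f (t, z + of_nat (Suc n) *\<^sub>R axis i 1) = f (t, (z + of_nat n *\<^sub>R axis i 1) + axis i 1)"
      by (simp add: algebra_simps)
    also have "\<dots> = f (t, z + of_nat n *\<^sub>R axis i 1)"
      using per t unfolding space_periodic_def by blast
    finally show ?case using Suc by simp
  qed simp
  have int: "f (t, z + of_int n *\<^sub>R axis i 1) = f (t, z)" for z i n
  proof (cases "n \<ge> 0")
    case True
    then show ?thesis using nat[of z "nat n" i] by simp
  next
    case False
    then show ?thesis using nat[of "z + of_int n *\<^sub>R axis i 1" "nat (- n)" i] by simp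
  qed
  have "f (t, x + (\<Sum>i\<in>A. k $ i *\<^sub>R axis i 1)) = f (t, x)" if "finite A" for A
    using that
  proof (induction A)
    case (insert i A)
    obtain n where n: "k $ i = of_int n" using k by (auto simp: lattice_def elim: Ints_cases)
    have "f (t, x + (\<Sum>i\<in>insert i A. k $ i *\<^sub>R axis i 1))
        = f (t, (x + (\<Sum>i\<in>A. k $ i *\<^sub>R axis i 1)) + of_int n *\<^sub>R axis i 1)"
      using insert.hyps n by (simp add: algebra_simps)
    then show ?case using int insert.IH by simp
  qed simp
  from this[of UNIV] show ?thesis
    using basis_expansion[of k] by (simp add: scalar_mult_eq_scaleR)
qed

lemma fold_cell_eq: "\<exists>k\<in>lattice. fold_cell y = y - (0, k)"
proof
  show "(\<chi> i. of_int \<lfloor>snd y $ i\<rfloor>) \<in> lattice" by (simp add: lattice_def)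
  show "fold_cell y = y - (0, \<chi> i. of_int \<lfloor>snd y $ i\<rfloor>)"
    by (cases y) (simp add: fold_cell_def frac_def vec_eq_iff)
qed

lemma lattice_uminus: "k \<in> lattice \<Longrightarrow> - k \<in> lattice"
  by (simp add: lattice_def)

lemma periodic_fold_cell:
  assumes "space_periodic I f" "fst y \<in> I"
  shows "f (fold_cell y) = f y"
proof -
  obtain k where k: "k \<in> lattice" "fold_cell y = y - (0, k)" using fold_cell_eq by blast
  obtain t x where y: "y = (t, x)" by (cases y)
  show ?thesis
    using periodic_lattice_shift[OF assms(1), of t "-k" x] k assms(2) lattice_uminus[of k]
    by (simp add: y)
qed

lemma fst_fold_cell [simp]: "fst (fold_cell y) = fst y"
  by (simp add: fold_cell_def)

lemma fold_cell_in: "fold_cell y \<in> UNIV \<times> unit_cell"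
  by (simp add: fold_cell_def unit_cell_def frac_lt_1)

lemma fold_cell_id: "y \<in> UNIV \<times> unit_cell \<Longrightarrow> fold_cell y = y"
  by (cases y) (auto simp: fold_cell_def unit_cell_def vec_eq_iff frac_eq)

lemma unit_cell_lattice_unique:
  assumes "x \<in> unit_cell" "x + k \<in> unit_cell" "k \<in> lattice"
  shows "k = 0"
proof -
  have "k $ i = 0" for i
  proof -
    obtain n where n: "k $ i = of_int n" using assms(3) by (auto simp: lattice_def elim: Ints_cases)
    have "0 \<le> x $ i" "x $ i < 1" "0 \<le> x $ i + of_int n" "x $ i + of_int n < 1"
      using assms(1,2) by (auto simp: unit_cell_def n[symmetric])
    then have "-1 < n" "n < 1" by linarith+
    then show ?thesis by (simp add: n)
  qed
  then show ?thesis by (simp add: vec_eq_iff)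
qed

lemma fold_cell_in_iff:
  assumes "A \<subseteq> UNIV \<times> unit_cell"
  shows "fold_cell y \<in> A \<longleftrightarrow> (\<exists>k\<in>lattice. y - (0, k) \<in> A)"
proof
  assume "\<exists>k\<in>lattice. y - (0, k) \<in> A"
  then obtain k where k: "k \<in> lattice" "y - (0, k) \<in> A" by blast
  obtain l where l: "l \<in> lattice" "fold_cell y = y - (0, l)" using fold_cell_eq by blast
  have "k - l \<in> lattice" using k l by (simp add: lattice_def)
  moreover have "snd y - k \<in> unit_cell" using k(2) assms by (cases y) auto
  moreover have "snd y - k + (k - l) \<in> unit_cell" using fold_cell_in[of y] l(2) by (cases y) simp
  ultimately have "k = l" using unit_cell_lattice_unique by fastforce
  then show "fold_cell y \<in> A" using k l by simp
qed (use fold_cell_eq in metis)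

lemma countable_lattice [simp]: "countable (lattice :: (real ^ 'n::finite) set)"
proof -
  have "countable (Pi\<^sub>E (UNIV :: 'n set) (\<lambda>_. \<int> :: real set))"
    by (intro countable_PiE) (auto simp: Ints_def)
  moreover have "lattice = vec_lambda ` Pi\<^sub>E (UNIV :: 'n set) (\<lambda>_. \<int> :: real set)"
  proof (intro set_eqI iffI)
    fix k :: "real ^ 'n" assume "k \<in> lattice"
    then show "k \<in> vec_lambda ` Pi\<^sub>E (UNIV :: 'n set) (\<lambda>_. \<int>)"
      by (intro image_eqI[where x = "vec_nth k"]) (auto simp: lattice_def)
  qed (auto simp: lattice_def PiE_UNIV_domain)
  ultimately show ?thesis by (metis countable_image)
qed

lemma unit_cell_borel [measurable]: "unit_cell \<in> sets (borel :: (real ^ 'n::finite) measure)"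
  unfolding unit_cell_def by measurable

lemma strip_borel [measurable]:
  "UNIV \<times> unit_cell \<in> sets (borel :: (real \<times> (real ^ 'n::finite)) measure)"
  by (auto simp: borel_prod[symmetric])

lemma time_in_borel:
  "{y :: real \<times> (real ^ 'n::finite). fst (y + c) \<in> {0<..<T}} \<in> sets borel"
proof -
  have "open {y :: real \<times> (real ^ 'n). fst (y + c) \<in> {0<..<T}}"
    by (auto intro!: open_Collect_conj open_Collect_less continuous_intros)
  then show ?thesis by simp
qed

lemma borel_measurable_snd_nth [measurable]:
  "(\<lambda>y::real \<times> (real ^ 'n::finite). snd y $ i) \<in> borel_measurable borel"
  by (intro borel_measurable_continuous_onI continuous_intros)

lemma fold_cell_borel [measurable]: "fold_cell \<in> borel \<rightarrow>\<^sub>M borel"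
proof -
  have "(\<lambda>y::real \<times> (real ^ 'n). \<chi> i. frac (snd y $ i)) \<in> borel_measurable borel"
    by (subst borel_measurable_euclidean_space)
       (auto simp: Basis_vec_def inner_axis frac_def)
  then show ?thesis unfolding fold_cell_def
    by (intro borel_measurable_Pair) (auto intro!: borel_measurable_continuous_onI continuous_intros)
qed

lemma space_cylinder: "space cylinder = UNIV \<times> unit_cell"
  by (simp add: cylinder_def space_restrict_space)

lemma sets_cylinder: "A \<in> sets cylinder \<longleftrightarrow> A \<in> sets borel \<and> A \<subseteq> UNIV \<times> unit_cell"
  unfolding cylinder_def by (subst sets_restrict_space_iff) auto

lemma borel_measurable_cylinder [measurable (raw)]:
  "f \<in> borel_measurable borel \<Longrightarrow> f \<in> borel_measurable cylinder"
  unfolding cylinder_def by (intro measurable_restrict_space1) simp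

lemma emeasure_lborel_translate:
  fixes X :: "'a::euclidean_space set"
  assumes "X \<in> sets borel"
  shows "emeasure lborel {y. y + c \<in> X} = emeasure lborel X"
proof -
  have "emeasure lborel X = emeasure (distr lborel borel (\<lambda>y. c + y)) X"
    by (subst lborel_distr_plus) simp
  also have "\<dots> = emeasure lborel ((\<lambda>y. c + y) -` X \<inter> space lborel)"
    by (rule emeasure_distr) (use assms in auto)
  also have "(\<lambda>y. c + y) -` X \<inter> space lborel = {y. y + c \<in> X}"
    by (auto simp: add.commute)
  finally show ?thesis by simp
qed

text \<open>Translation invariance: the translate of a fundamental domain is cut by the lattice into
  pieces that reassemble to the original domain.\<close>

lemma distr_fold_cell_shift:
  "distr cylinder cylinder (\<lambda>y. fold_cell (y + a)) = (cylinder :: (real \<times> (real ^ 'n::finite)) measure)"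
proof (rule measure_eqI)
  have meas: "(\<lambda>y. fold_cell (y + a)) \<in> cylinder \<rightarrow>\<^sub>M (cylinder :: (real \<times> (real ^ 'n::finite)) measure)"
    unfolding cylinder_def
    by (intro measurable_restrict_space2 measurable_restrict_space1) (auto simp: fold_cell_in)
  fix A assume "A \<in> sets (distr cylinder cylinder (\<lambda>y. fold_cell (y + a)))"
  then have A: "A \<in> sets cylinder" by simp
  then have [measurable]: "A \<in> sets borel" and sub: "A \<subseteq> UNIV \<times> unit_cell"
    by (auto simp: sets_cylinder)
  let ?S = "UNIV \<times> unit_cell :: (real \<times> (real ^ 'n)) set"
  \<comment> \<open>The piece that the lattice vector \<open>k\<close> brings back to the strip, before and after the translation.\<close>
  let ?X = "\<lambda>k. {y \<in> ?S. y + (a - (0, k)) \<in> A}"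
  let ?Y = "\<lambda>k. {z \<in> A. z - (a - (0, k)) \<in> ?S}"
  have X[measurable]: "?X k \<in> sets borel" for k
    by measurable
  have Y[measurable]: "?Y k \<in> sets borel" for k
    by measurable
  have restr: "emeasure cylinder B = emeasure lborel B" if "B \<in> sets cylinder" for B
    using that unfolding cylinder_def by (subst emeasure_restrict_space) (auto simp: sets_restrict_space)
  have "emeasure (distr cylinder cylinder (\<lambda>y. fold_cell (y + a))) A
      = emeasure cylinder ((\<lambda>y. fold_cell (y + a)) -` A \<inter> space cylinder)"
    using meas A by (rule emeasure_distr)
  also have "\<dots> = emeasure lborel ((\<lambda>y. fold_cell (y + a)) -` A \<inter> space cylinder)"
    by (rule restr) (use meas A in \<open>auto intro: measurable_sets\<close>)
  also have "(\<lambda>y. fold_cell (y + a)) -` A \<inter> space cylinder = (\<Union>k\<in>lattice. ?X k)"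
    by (simp add: space_cylinder vimage_def fold_cell_in_iff[OF sub] add_diff_eq) blast
  also have "emeasure lborel (\<Union>k\<in>lattice. ?X k) = (\<integral>\<^sup>+k. emeasure lborel (?X k) \<partial>count_space lattice)"
  proof (rule emeasure_UN_countable)
    have "k = l" if kl: "k \<in> lattice" "l \<in> lattice"
      and yk: "y + (a - (0, k)) \<in> A" and yl: "y + (a - (0, l)) \<in> A" for k l y
    proof -
      have "snd y + snd a - k \<in> unit_cell" "snd y + snd a - k + (k - l) \<in> unit_cell"
        using subsetD[OF sub yk] subsetD[OF sub yl] by (auto simp: mem_Times_iff algebra_simps)
      moreover have "k - l \<in> lattice" using kl by (simp add: lattice_def)
      ultimately show ?thesis using unit_cell_lattice_unique by fastforce
    qed
    then show "disjoint_family_on ?X lattice"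
      by (auto simp: disjoint_family_on_def)
  qed auto
  also have "\<dots> = (\<integral>\<^sup>+k. emeasure lborel (?Y k) \<partial>count_space lattice)"
  proof (rule nn_integral_cong)
    fix k :: "real ^ 'n"
    have "?X k = {y. y + (a - (0, k)) \<in> ?Y k}" by auto
    then show "emeasure lborel (?X k) = emeasure lborel (?Y k)"
      by (simp only: emeasure_lborel_translate[OF Y])
  qed
  also have "\<dots> = emeasure lborel (\<Union>k\<in>lattice. ?Y k)"
  proof (rule emeasure_UN_countable[symmetric])
    have uniq: "k = l" if kl: "k \<in> lattice" "l \<in> lattice"
      and yk: "z - (a - (0, k)) \<in> ?S" and yl: "z - (a - (0, l)) \<in> ?S" for k l z
    proof -
      have "snd z - snd a + k \<in> unit_cell" "snd z - snd a + k + (l - k) \<in> unit_cell"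
        using yk yl by (auto simp: mem_Times_iff algebra_simps)
      moreover have "l - k \<in> lattice" using kl by (simp add: lattice_def)
      ultimately show ?thesis using unit_cell_lattice_unique by fastforce
    qed
    show "disjoint_family_on ?Y lattice"
      unfolding disjoint_family_on_def
    proof (intro ballI impI equals0I)
      fix k l z assume kl: "k \<in> lattice" "l \<in> lattice" "k \<noteq> l" and z: "z \<in> ?Y k \<inter> ?Y l"
      from IntD1[OF z] have zk: "z - (a - (0, k)) \<in> ?S" by (elim CollectE conjE)
      from IntD2[OF z] have zl: "z - (a - (0, l)) \<in> ?S" by (elim CollectE conjE)
      from uniq[OF kl(1,2) zk zl] kl(3) show False by contradiction
    qed
  qed auto
  also have "(\<Union>k\<in>lattice. ?Y k) = A"
  proof (intro equalityI subsetI)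
    fix z assume z: "z \<in> A"
    obtain k where k: "k \<in> lattice" "fold_cell (z - a) = z - a - (0, k)" using fold_cell_eq by blast
    have "z - (a - (0, - k)) = fold_cell (z - a)"
      unfolding k(2) by (cases z; cases a) simp
    then have "z - (a - (0, - k)) \<in> ?S" using fold_cell_in by metis
    with z have "z \<in> ?Y (- k)" by (intro CollectI conjI)
    then show "z \<in> (\<Union>k\<in>lattice. ?Y k)" by (rule UN_I[OF lattice_uminus[OF k(1)]])
  next
    fix z assume "z \<in> (\<Union>k\<in>lattice. ?Y k)"
    then show "z \<in> A" by (elim UN_E CollectE conjE)
  qed
  also have "emeasure lborel A = emeasure cylinder A" by (rule restr[OF A, symmetric])
  finally show "emeasure (distr cylinder cylinder (\<lambda>y. fold_cell (y + a))) A = emeasure cylinder A" .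
qed simp

lemma fold_cell_shift_measurable:
  "(\<lambda>y. fold_cell (y + a)) \<in> cylinder \<rightarrow>\<^sub>M cylinder"
  unfolding cylinder_def
  by (intro measurable_restrict_space2 measurable_restrict_space1) (auto simp: fold_cell_in)

lemma periodic_UNIV_fold_cell: "space_periodic UNIV f \<Longrightarrow> f (fold_cell y) = f y"
  by (rule periodic_fold_cell) auto

lemma integral_cylinder_shift:
  fixes f :: "real \<times> (real ^ 'n::finite) \<Rightarrow> real"
  assumes "space_periodic UNIV f" and [measurable]: "f \<in> borel_measurable borel"
  shows "(\<integral>y. f (y + a) \<partial>cylinder) = (\<integral>y. f y \<partial>cylinder)"
proof -
  have "(\<integral>y. f y \<partial>cylinder) = (\<integral>y. f y \<partial>distr cylinder cylinder (\<lambda>y. fold_cell (y + a)))"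
    by (simp add: distr_fold_cell_shift)
  also have "\<dots> = (\<integral>y. f (fold_cell (y + a)) \<partial>cylinder)"
    by (rule integral_distr[OF fold_cell_shift_measurable]) measurable
  finally show ?thesis by (simp add: periodic_UNIV_fold_cell[OF assms(1)])
qed

lemma integrable_cylinder_shift:
  fixes f :: "real \<times> (real ^ 'n::finite) \<Rightarrow> real"
  assumes "space_periodic UNIV f" and [measurable]: "f \<in> borel_measurable borel"
    and "integrable cylinder f"
  shows "integrable cylinder (\<lambda>y. f (y + a))"
proof -
  have "integrable (distr cylinder cylinder (\<lambda>y. fold_cell (y + a))) f"
    using assms(3) by (simp add: distr_fold_cell_shift)
  then have "integrable cylinder (\<lambda>y. f (fold_cell (y + a)))"
    by (rule integrable_distr[OF fold_cell_shift_measurable])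
  then show ?thesis by (simp add: periodic_UNIV_fold_cell[OF assms(1)])
qed

lemma sigma_finite_cylinder: "sigma_finite_measure (cylinder :: (real \<times> (real ^ 'n::finite)) measure)"
  unfolding cylinder_def by (rule sigma_finite_measure_restrict_space) (auto intro: sigma_finite_lborel)

section \<open>Smooth functions\<close>

lemma Ck_const: "Ck k (\<lambda>x. c)"
  by (induction k arbitrary: c) (auto simp: frechet_derivative_const)

lemma Ck_Suc_I:
  assumes "\<And>x. (f has_derivative D x) (at x)" "\<And>v. Ck k (\<lambda>x. D x v)"
  shows "Ck (Suc k) f"
proof -
  have "frechet_derivative f (at x) = D x" for x
    using assms(1) frechet_derivative_at by metis
  then show ?thesis using assms by (auto simp: differentiable_def)
qed

lemma Ck_Suc_D:
  assumes "Ck (Suc k) f"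
  shows "(f has_derivative frechet_derivative f (at x)) (at x)" "Ck k (\<lambda>x. frechet_derivative f (at x) v)"
  using assms frechet_derivative_works by auto

definition pdiff :: "('a::real_normed_vector \<Rightarrow> real) \<Rightarrow> 'a \<Rightarrow> 'a \<Rightarrow> real" where
  "pdiff f b y = frechet_derivative f (at y) b"

text \<open>Mollified fields and their products are only ever differentiated along one coordinate direction,
  so no joint differentiability is carried along.\<close>

definition has_pdiff :: "'a::real_normed_vector \<Rightarrow> ('a \<Rightarrow> real) \<Rightarrow> ('a \<Rightarrow> real) \<Rightarrow> bool" where
  "has_pdiff b f f' \<longleftrightarrow> (\<forall>y. ((\<lambda>s. f (y + s *\<^sub>R b)) has_real_derivative f' y) (at 0))"

lemma Ck_has_pdiff:
  assumes "\<And>k. Ck k \<phi>"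
  shows "has_pdiff v \<phi> (pdiff \<phi> v)"
  unfolding has_pdiff_def
proof
  fix y
  have D: "(\<phi> has_derivative frechet_derivative \<phi> (at y)) (at y)"
    using Ck_Suc_D(1) assms by blast
  have "((\<lambda>s. \<phi> (y + s *\<^sub>R v)) has_derivative (\<lambda>s. frechet_derivative \<phi> (at y) (s *\<^sub>R v))) (at 0)"
    using D by (intro has_derivative_compose[where g = \<phi> and f = "\<lambda>s. y + s *\<^sub>R v"])
      (auto intro!: derivative_eq_intros)
  then show "((\<lambda>s. \<phi> (y + s *\<^sub>R v)) has_real_derivative pdiff \<phi> v y) (at 0)"
    unfolding has_field_derivative_def pdiff_def
    by (rule has_derivative_eq_rhs)
       (use linear_scale[OF has_derivative_linear[OF D]] in \<open>auto simp: fun_eq_iff\<close>)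
qed

lemma Ck_decrease: "Ck (Suc k) f \<Longrightarrow> Ck k f"
proof (induction k arbitrary: f)
  case 0
  then have "continuous (at x) f" for x
    using Ck_Suc_D(1) has_derivative_continuous by blast
  then show ?case by (simp add: continuous_on_eq_continuous_at)
next
  case (Suc k)
  show ?case
    by (rule Ck_Suc_I[OF Ck_Suc_D(1)[OF Suc.prems]]) (use Suc Ck_Suc_D(2)[OF Suc.prems] in blast)
qed

lemma Ck_add: "Ck k f \<Longrightarrow> Ck k g \<Longrightarrow> Ck k (\<lambda>x. f x + g x)"
proof (induction k arbitrary: f g)
  case (Suc k)
  show ?case
    by (rule Ck_Suc_I[OF has_derivative_add[OF Ck_Suc_D(1)[OF Suc.prems(1)] Ck_Suc_D(1)[OF Suc.prems(2)]]])
       (use Suc Ck_Suc_D(2) in blast)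
qed (auto intro: continuous_intros)

lemma Ck_mult: "Ck k f \<Longrightarrow> Ck k g \<Longrightarrow> Ck k (\<lambda>x. f x * g x)"
proof (induction k arbitrary: f g)
  case (Suc k)
  show ?case
    by (rule Ck_Suc_I[OF has_derivative_mult[OF Ck_Suc_D(1)[OF Suc.prems(1)] Ck_Suc_D(1)[OF Suc.prems(2)]]])
       (intro Ck_add Suc.IH Ck_decrease[OF Suc.prems(1)] Ck_decrease[OF Suc.prems(2)]
          Ck_Suc_D(2)[OF Suc.prems(1)] Ck_Suc_D(2)[OF Suc.prems(2)])
qed (auto intro: continuous_intros)

lemma Ck_prod: "finite A \<Longrightarrow> (\<And>i. i \<in> A \<Longrightarrow> Ck k (f i)) \<Longrightarrow> Ck k (\<lambda>x. \<Prod>i\<in>A. f i x)"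
  by (induction A rule: finite_induct) (auto intro: Ck_const Ck_mult)

lemma Ck_power: "Ck k f \<Longrightarrow> Ck k (\<lambda>x. f x ^ n)"
  by (induction n) (auto intro: Ck_const Ck_mult)

lemma Ck_linear: "bounded_linear l \<Longrightarrow> Ck k (\<lambda>x. l x + c)"
proof (cases k)
  case 0
  assume "bounded_linear l"
  then show ?thesis
    using 0 continuous_on_add[OF linear_continuous_on continuous_on_const] by auto
next
  case (Suc j)
  assume l: "bounded_linear l"
  have "((\<lambda>x. l x + c) has_derivative l) (at x)" for x
    using has_derivative_add[OF bounded_linear.has_derivative[OF l has_derivative_ident] has_derivative_const[of c]]
    by simp
  then show ?thesis unfolding Suc by (rule Ck_Suc_I) (rule Ck_const)
qed

text \<open>A family of functions on the line that is closed under differentiation consists of smooth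
  functions; this form of the chain rule avoids iterated derivatives.\<close>

lemma Ck_compose:
  assumes "h \<in> F" and F: "\<And>h. h \<in> F \<Longrightarrow> \<exists>h'\<in>F. \<forall>x. (h has_real_derivative h' x) (at x)"
    and "\<And>j. Ck j f"
  shows "Ck k (\<lambda>x. h (f x))"
  using assms(1)
proof (induction k arbitrary: h)
  case 0
  then have "continuous_on UNIV h"
    using F by (meson DERIV_isCont continuous_at_imp_continuous_on)
  moreover have "continuous_on UNIV f" using assms(3)[of 0] by simp
  ultimately show ?case by (auto intro: continuous_on_compose2)
next
  case (Suc k)
  obtain h' where h': "h' \<in> F" "\<And>x. (h has_real_derivative h' x) (at x)"
    using F[OF Suc.prems] by blast
  have f: "(f has_derivative frechet_derivative f (at x)) (at x)" for x
    using Ck_Suc_D(1) assms(3) by blast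
  show ?case
  proof (rule Ck_Suc_I)
    show "((\<lambda>x. h (f x)) has_derivative (\<lambda>v. frechet_derivative f (at x) v * h' (f x))) (at x)" for x
      using has_derivative_compose[OF f has_field_derivative_imp_has_derivative[OF h'(2)]]
      by (simp add: mult.commute)
    show "Ck k (\<lambda>x. frechet_derivative f (at x) v * h' (f x))" for v
      by (intro Ck_mult Suc.IH[OF h'(1)]) (use Ck_Suc_D(2) assms(3) in blast)
  qed
qed

text \<open>For \<open>q = 1\<close> this is the function \<open>exp (- 1 / x)\<close>, continued by zero. With a polynomial factor in
  \<open>1 / x\<close> the family is closed under differentiation, as \<open>Ck_compose\<close> requires.\<close>

definition flat_exp :: "real poly \<Rightarrow> real \<Rightarrow> real" where
  "flat_exp q x = (if x > 0 then poly q (1 / x) * exp (- (1 / x)) else 0)"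

lemma poly_exp_tendsto_0: "((\<lambda>y. poly q y * exp (- y)) \<longlongrightarrow> (0::real)) at_top"
proof -
  have "((\<lambda>y. \<Sum>i\<le>degree q. coeff q i * (y ^ i / exp y)) \<longlongrightarrow> (\<Sum>i\<le>degree q. coeff q i * 0)) at_top"
    by (intro tendsto_intros tendsto_power_div_exp_0)
  then show ?thesis
    by (simp add: poly_altdef exp_minus divide_inverse sum_distrib_right mult.assoc)
qed

lemma flat_exp_tendsto_0: "(flat_exp q \<longlongrightarrow> 0) (at 0)"
proof -
  have "((\<lambda>x. poly q (inverse x) * exp (- inverse x)) \<longlongrightarrow> 0) (at_right (0::real))"
    using poly_exp_tendsto_0 filterlim_inverse_at_top_right by (rule filterlim_compose)
  then have "(flat_exp q \<longlongrightarrow> 0) (at_right 0)"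
    by (rule Lim_transform_eventually)
       (auto simp: eventually_at_filter flat_exp_def inverse_eq_divide)
  moreover have "(flat_exp q \<longlongrightarrow> 0) (at_left 0)"
    by (rule tendsto_eventually) (auto simp: eventually_at_filter flat_exp_def)
  ultimately show ?thesis by (simp add: filterlim_at_split)
qed

lemma flat_exp_deriv:
  "(flat_exp q has_real_derivative flat_exp ([:0, 0, 1:] * (q - pderiv q)) x) (at x)"
proof -
  consider "x > 0" | "x < 0" | "x = 0" by linarith
  then show ?thesis
  proof cases
    case 1
    have "((\<lambda>x. poly q (1 / x) * exp (- (1 / x))) has_real_derivative
        flat_exp ([:0, 0, 1:] * (q - pderiv q)) x) (at x)"
      using 1 by (auto intro!: derivative_eq_intros DERIV_chain'[OF _ poly_DERIV]
          simp: flat_exp_def field_simps power2_eq_square)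
    then show ?thesis
      by (rule has_field_derivative_transform_within_open[where S = "{0<..}"])
         (use 1 in \<open>auto simp: flat_exp_def\<close>)
  next
    case 2
    have "((\<lambda>x. 0) has_real_derivative flat_exp ([:0, 0, 1:] * (q - pderiv q)) x) (at x)"
      using 2 by (simp add: flat_exp_def)
    then show ?thesis
      by (rule has_field_derivative_transform_within_open[where S = "{..<0}"])
         (use 2 in \<open>auto simp: flat_exp_def\<close>)
  next
    case 3
    \<comment> \<open>The difference quotient at zero is again a member of the family.\<close>
    have "((\<lambda>h. (flat_exp q (0 + h) - flat_exp q 0) / h) \<longlongrightarrow> 0) (at 0)"
      by (rule Lim_transform_eventually[OF flat_exp_tendsto_0[of "[:0, 1:] * q"]])
         (auto simp: eventually_at_filter flat_exp_def)
    then show ?thesis using 3 by (simp add: DERIV_def flat_exp_def)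
  qed
qed

lemma Ck_flat_exp: "(\<And>j. Ck j f) \<Longrightarrow> Ck k (\<lambda>x. flat_exp q (f x))"
  by (rule Ck_compose[where F = "range flat_exp"]) (auto intro: flat_exp_deriv)

lemma Ck_sin: "(\<And>j. Ck j f) \<Longrightarrow> Ck k (\<lambda>x. sin (f x))"
  by (rule Ck_compose[where F = "{sin, cos, \<lambda>x. - sin x, \<lambda>x. - cos x}"])
     (auto intro!: derivative_eq_intros)

text \<open>The function \<open>exp (- 1 / (1 - x\<^sup>2))\<close> on \<open>(-1,1)\<close>.\<close>

definition bump :: "real \<Rightarrow> real" where
  "bump x = flat_exp 1 (1 - x\<^sup>2)"

definition bump' :: "real \<Rightarrow> real" where
  "bump' x = flat_exp [:0, 0, 1:] (1 - x\<^sup>2) * (- 2 * x)"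

lemma bump_deriv: "(bump has_real_derivative bump' x) (at x)"
proof -
  have "((\<lambda>x. flat_exp 1 (1 - x\<^sup>2)) has_real_derivative flat_exp ([:0, 0, 1:] * (1 - pderiv 1)) (1 - x\<^sup>2) * (- 2 * x)) (at x)"
    by (rule DERIV_chain2[OF flat_exp_deriv]) (auto intro!: derivative_eq_intros)
  then show ?thesis by (simp add: bump_def[abs_def] bump'_def pderiv_1)
qed

lemma bump_nonneg [simp]: "0 \<le> bump x"
  by (simp add: bump_def flat_exp_def)

lemma bump_support: "\<bar>x\<bar> \<ge> 1 \<Longrightarrow> bump x = 0 \<and> bump' x = 0"
proof -
  assume "\<bar>x\<bar> \<ge> 1"
  then have "1 \<le> x\<^sup>2" using abs_le_square_iff[of 1 x] by simp
  then show ?thesis by (simp add: bump_def bump'_def flat_exp_def)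
qed

lemma continuous_bump: "continuous_on S bump" "continuous_on S bump'"
proof -
  have "continuous_on UNIV (flat_exp q)" for q
    using flat_exp_deriv DERIV_isCont continuous_at_imp_continuous_on by blast
  then have "continuous_on S (\<lambda>x. flat_exp q (1 - x\<^sup>2))" for q
    by (rule continuous_on_compose2) (auto intro!: continuous_intros)
  then show "continuous_on S bump" "continuous_on S bump'"
    unfolding bump_def[abs_def] bump'_def[abs_def] by (auto intro!: continuous_intros)
qed

lemma bump'_bounded: "\<exists>B>0. \<forall>x. \<bar>bump' x\<bar> \<le> B"
proof -
  have "compact (bump' ` {-1..1})"
    by (intro compact_continuous_image continuous_bump) auto
  then have "bounded (bump' ` {-1..1})" by (rule compact_imp_bounded)
  then obtain B where "B > 0" "\<forall>y\<in>bump' ` {-1..1}. norm y \<le> B"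
    unfolding bounded_pos by blast
  then have B: "B > 0" "\<And>x. x \<in> {-1..1} \<Longrightarrow> \<bar>bump' x\<bar> \<le> B"
    by (simp_all add: image_iff)
  have "\<bar>bump' x\<bar> \<le> B" for x
    using B(1) B(2)[of x] bump_support[of x] by (cases "\<bar>x\<bar> \<ge> 1") (simp_all add: not_le abs_less_iff)
  then show ?thesis using B(1) by blast
qed

lemma bump_lower: "\<bar>x\<bar> \<le> 1 / 2 \<Longrightarrow> exp (-2) \<le> bump x"
proof -
  assume "\<bar>x\<bar> \<le> 1 / 2"
  then have "x\<^sup>2 \<le> (1/2)\<^sup>2" by (simp add: abs_le_square_iff[symmetric])
  then have x: "1/2 \<le> 1 - x\<^sup>2" by (simp add: power2_eq_square)
  then have "1 / (1 - x\<^sup>2) \<le> 2" by (simp add: field_simps)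
  then show ?thesis using x by (simp add: bump_def flat_exp_def)
qed

section \<open>Periodic mollifiers\<close>

lemma sin_ge_linear:
  assumes "0 \<le> x" "x \<le> 1 / 2"
  shows "2 * x \<le> sin (pi * x)"
proof -
  have "convex_on {0..pi} (\<lambda>x. - sin x)"
    by (rule f''_ge0_imp_convex[where f' = "\<lambda>x. - cos x" and f'' = sin])
       (auto intro!: derivative_eq_intros sin_ge_zero)
  then have "- sin ((1 - 2 * x) *\<^sub>R 0 + (2 * x) *\<^sub>R (pi / 2)) \<le> (1 - 2 * x) * (- sin 0) + (2 * x) * (- sin (pi / 2))"
    by (rule convex_onD) (use assms in auto)
  then show ?thesis by (simp add: mult.commute)
qed

text \<open>By concavity of the sine on a quarter period, \<open>\<bar>sin (\<pi> x)\<bar>\<close> is comparable to the distance of \<open>x\<close>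
  to the nearest integer.\<close>

lemma abs_sin_pi_ge: "2 * \<bar>x - of_int (round x)\<bar> \<le> \<bar>sin (pi * x)\<bar>"
proof -
  define z where "z = x - of_int (round x)"
  have z: "\<bar>z\<bar> \<le> 1 / 2" using of_int_round_abs_le[of x] by (simp add: z_def abs_minus_commute)
  have "pi * x = pi * z + pi * of_int (round x)" by (simp add: z_def algebra_simps)
  then have "\<bar>sin (pi * x)\<bar> = \<bar>sin (pi * z)\<bar>"
    by (simp add: sin_add sin_npi_int cos_npi_int abs_mult)
  moreover have "2 * \<bar>z\<bar> \<le> \<bar>sin (pi * z)\<bar>"
    using sin_ge_linear[of z] sin_ge_linear[of "- z"] z by (cases "z \<ge> 0") auto
  ultimately show ?thesis by (simp add: z_def)
qed

text \<open>The kernels have to be periodic in space. Instead of summing a bump over the lattice, the bump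
  is composed with \<open>sin (\<pi> x)\<close>, which up to sign is 1-periodic and vanishes exactly at the
  integers. The time direction is the basis vector \<open>(1, 0)\<close>, and \<open>coord_cell\<close> below is one period
  of a coordinate.\<close>

definition coord_scale :: "real \<times> (real ^ 'n::finite) \<Rightarrow> real \<Rightarrow> real" where
  "coord_scale b x = (if b = (1, 0) then x else sin (pi * x))"

definition coord_cell :: "real \<times> (real ^ 'n::finite) \<Rightarrow> real set" where
  "coord_cell b = (if b = (1, 0) then UNIV else {0..<1})"

definition profile :: "real \<Rightarrow> real \<times> (real ^ 'n::finite) \<Rightarrow> real \<Rightarrow> real" where
  "profile \<epsilon> b x = bump (coord_scale b x / \<epsilon>)"

definition profile' :: "real \<Rightarrow> real \<times> (real ^ 'n::finite) \<Rightarrow> real \<Rightarrow> real" where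
  "profile' \<epsilon> b x = bump' (coord_scale b x / \<epsilon>) * ((if b = (1, 0) then 1 else pi * cos (pi * x)) / \<epsilon>)"

lemma profile_deriv: "\<epsilon> > 0 \<Longrightarrow> (profile \<epsilon> b has_real_derivative profile' \<epsilon> b x) (at x)"
proof -
  assume e: "\<epsilon> > 0"
  have "((\<lambda>x. coord_scale b x / \<epsilon>) has_real_derivative (if b = (1, 0) then 1 else pi * cos (pi * x)) / \<epsilon>) (at x)"
    using e unfolding coord_scale_def
    by (cases "b = (1, 0)") (auto intro!: derivative_eq_intros)
  from DERIV_chain2[OF bump_deriv this] show ?thesis
    by (simp add: profile_def[abs_def] profile'_def)
qed

lemma profile_nonneg [simp]: "0 \<le> profile \<epsilon> b x"
  by (simp add: profile_def)

lemma borel_bump [measurable]: "bump \<in> borel_measurable borel" "bump' \<in> borel_measurable borel"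
  by (auto intro: borel_measurable_continuous_onI continuous_bump)

lemma borel_profile [measurable]:
  "profile \<epsilon> b \<in> borel_measurable borel" "profile' \<epsilon> b \<in> borel_measurable borel"
  unfolding profile_def[abs_def] profile'_def[abs_def] coord_scale_def by (cases "b = (1, 0)"; simp; measurable)+

lemma borel_coord_cell [measurable]: "coord_cell b \<in> sets borel"
  by (simp add: coord_cell_def)

lemma profile_support: "\<epsilon> > 0 \<Longrightarrow> profile \<epsilon> b x \<noteq> 0 \<or> profile' \<epsilon> b x \<noteq> 0 \<Longrightarrow> \<bar>coord_scale b x\<bar> \<le> \<epsilon>"
  using bump_support[of "coord_scale b x / \<epsilon>"]
  by (cases "\<bar>coord_scale b x\<bar> \<le> \<epsilon>") (auto simp: profile_def profile'_def)

text \<open>In a space direction the support consists of the two ends of the period cell, each of length at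
  most \<open>\<epsilon> / 2\<close>.\<close>

lemma coord_scale_support_measure:
  assumes "0 < \<epsilon>"
  shows "emeasure lborel {x \<in> coord_cell b. \<bar>coord_scale b x\<bar> \<le> \<epsilon>} \<le> ennreal (2 * \<epsilon>)"
proof (cases "b = (1, 0)")
  case True
  then have "{x \<in> coord_cell b. \<bar>coord_scale b x\<bar> \<le> \<epsilon>} = {-\<epsilon>..\<epsilon>}"
    by (auto simp: coord_cell_def coord_scale_def)
  then show ?thesis using assms by simp
next
  case False
  have "{x \<in> coord_cell b. \<bar>coord_scale b x\<bar> \<le> \<epsilon>} \<subseteq> {0..\<epsilon>/2} \<union> {1-\<epsilon>/2..1}"
  proof clarify
    fix x assume x: "x \<in> coord_cell b" "\<bar>coord_scale b x\<bar> \<le> \<epsilon>" "x \<notin> {1-\<epsilon>/2..1}"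
    then have c: "0 \<le> x" "x < 1" and s: "\<bar>sin (pi * x)\<bar> \<le> \<epsilon>"
      using False by (auto simp: coord_cell_def coord_scale_def)
    have "round x = 0 \<or> round x = 1"
      using c by (simp add: round_def) linarith
    then show "x \<in> {0..\<epsilon>/2}" using abs_sin_pi_ge[of x] s c x(3) by auto
  qed
  then have "emeasure lborel {x \<in> coord_cell b. \<bar>coord_scale b x\<bar> \<le> \<epsilon>} \<le> emeasure lborel ({0..\<epsilon>/2} \<union> {1-\<epsilon>/2..1})"
    by (intro emeasure_mono) auto
  also have "\<dots> \<le> emeasure lborel {0..\<epsilon>/2} + emeasure lborel {1-\<epsilon>/2..1}"
    by (intro emeasure_subadditive) auto
  also have "\<dots> \<le> ennreal (2 * \<epsilon>)"
    using assms by (simp flip: ennreal_plus)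
  finally show ?thesis .
qed

lemma profile_mass_lower:
  assumes "0 < \<epsilon>" "\<epsilon> < 1"
  shows "ennreal (exp (-2) * (\<epsilon> / (2 * pi))) \<le> (\<integral>\<^sup>+x. ennreal (profile \<epsilon> b x) * indicator (coord_cell b) x \<partial>lborel)"
proof -
  have "\<epsilon> / (2 * pi) \<le> \<epsilon> / 2"
    by (rule divide_left_mono) (use assms pi_ge_two in auto)
  then have pi: "\<epsilon> / (2 * pi) \<le> \<epsilon> / 2" "\<epsilon> / 2 < 1"
    using assms by auto
  have "ennreal (exp (-2)) * indicator {0..\<epsilon> / (2 * pi)} x \<le> ennreal (profile \<epsilon> b x) * indicator (coord_cell b) x" for x
  proof (cases "x \<in> {0..\<epsilon> / (2 * pi)}")
    case True
    then have x: "0 \<le> x" "x \<le> \<epsilon> / (2 * pi)" by auto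
    then have "pi * x \<le> \<epsilon> / 2" using pi_gt_zero by (simp add: field_simps)
    then have "\<bar>coord_scale b x\<bar> \<le> \<epsilon> / 2"
      using x pi abs_sin_x_le_abs_x[of "pi * x"] by (auto simp: coord_scale_def)
    then have "exp (-2) \<le> profile \<epsilon> b x"
      unfolding profile_def using assms by (intro bump_lower) (simp add: field_simps)
    moreover have "x \<in> coord_cell b" using x pi by (auto simp: coord_cell_def)
    ultimately show ?thesis using True by (simp add: ennreal_leI)
  qed simp
  then have "(\<integral>\<^sup>+x. ennreal (exp (-2)) * indicator {0..\<epsilon> / (2 * pi)} x \<partial>lborel)
      \<le> (\<integral>\<^sup>+x. ennreal (profile \<epsilon> b x) * indicator (coord_cell b) x \<partial>lborel)"
    by (intro nn_integral_mono)
  then show ?thesis using assms by (simp add: nn_integral_cmult_indicator ennreal_mult del: times_divide_eq_right)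
qed

lemma profile_mass_upper:
  assumes "0 < \<epsilon>"
  shows "(\<integral>\<^sup>+x. ennreal (profile \<epsilon> b x) * indicator (coord_cell b) x \<partial>lborel) \<le> ennreal (2 * \<epsilon>)"
proof -
  have "bump x \<le> 1" for x by (simp add: bump_def flat_exp_def)
  then have "ennreal (profile \<epsilon> b x) * indicator (coord_cell b) x
      \<le> indicator {x \<in> coord_cell b. \<bar>coord_scale b x\<bar> \<le> \<epsilon>} x" for x
    using profile_support[OF assms, of b x]
    by (cases "profile \<epsilon> b x = 0") (auto simp: profile_def indicator_def)
  then have "(\<integral>\<^sup>+x. ennreal (profile \<epsilon> b x) * indicator (coord_cell b) x \<partial>lborel)
      \<le> (\<integral>\<^sup>+x. indicator {x \<in> coord_cell b. \<bar>coord_scale b x\<bar> \<le> \<epsilon>} x \<partial>lborel)"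
    by (intro nn_integral_mono)
  also have "\<dots> = emeasure lborel {x \<in> coord_cell b. \<bar>coord_scale b x\<bar> \<le> \<epsilon>}"
    by (intro nn_integral_indicator) (cases "b = (1, 0)"; simp add: coord_cell_def coord_scale_def)
  finally show ?thesis using coord_scale_support_measure[OF assms] by (rule order_trans)
qed

text \<open>The derivative is at most a multiple of \<open>1 / \<epsilon>\<close>, on a set of measure \<open>2 \<epsilon>\<close>, so its mass is
  bounded; the mass of the profile is at least a multiple of \<open>\<epsilon>\<close>. Only this ratio matters after
  normalisation, and in a product over the coordinates the other factors cancel.\<close>

lemma profile'_mass:
  "\<exists>C>0. \<forall>\<epsilon>. \<forall>b::real \<times> (real ^ 'n::finite). 0 < \<epsilon> \<longrightarrow> \<epsilon> < 1 \<longrightarrow>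
    (\<integral>\<^sup>+x. ennreal \<bar>profile' \<epsilon> b x\<bar> * indicator (coord_cell b) x \<partial>lborel)
    \<le> ennreal (C / \<epsilon>) * (\<integral>\<^sup>+x. ennreal (profile \<epsilon> b x) * indicator (coord_cell b) x \<partial>lborel)"
proof -
  obtain B where B: "B > 0" "\<And>x. \<bar>bump' x\<bar> \<le> B" using bump'_bounded by blast
  define C where "C = 4 * pi\<^sup>2 * B / exp (-2)"
  have "(\<integral>\<^sup>+x. ennreal \<bar>profile' \<epsilon> b x\<bar> * indicator (coord_cell b) x \<partial>lborel)
    \<le> ennreal (C / \<epsilon>) * (\<integral>\<^sup>+x. ennreal (profile \<epsilon> b x) * indicator (coord_cell b) x \<partial>lborel)"
    if e: "0 < \<epsilon>" "\<epsilon> < 1" for \<epsilon> and b :: "real \<times> (real ^ 'n)"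
  proof -
    let ?A = "{x \<in> coord_cell b. \<bar>coord_scale b x\<bar> \<le> \<epsilon>}"
    have "ennreal \<bar>profile' \<epsilon> b x\<bar> * indicator (coord_cell b) x \<le> ennreal (B * (pi / \<epsilon>)) * indicator ?A x" for x
    proof (cases "x \<in> ?A")
      case True
      have "1 \<le> pi" using pi_ge_two by simp
      then have "\<bar>if b = (1, 0) then 1 else pi * cos (pi * x)\<bar> \<le> pi"
        using abs_cos_le_one[of "pi * x"] by (auto simp: abs_mult)
      then have "\<bar>bump' (coord_scale b x / \<epsilon>)\<bar> * (\<bar>if b = (1, 0) then 1 else pi * cos (pi * x)\<bar> / \<epsilon>) \<le> B * (pi / \<epsilon>)"
        using e B by (intro mult_mono divide_right_mono) auto
      then have "\<bar>profile' \<epsilon> b x\<bar> \<le> B * (pi / \<epsilon>)"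
        using e by (simp add: profile'_def abs_mult abs_divide)
      then show ?thesis using True by (simp add: ennreal_leI)
    next
      case False
      then show ?thesis using profile_support[OF e(1), of b x] by (auto simp: indicator_def)
    qed
    then have "(\<integral>\<^sup>+x. ennreal \<bar>profile' \<epsilon> b x\<bar> * indicator (coord_cell b) x \<partial>lborel)
        \<le> (\<integral>\<^sup>+x. ennreal (B * (pi / \<epsilon>)) * indicator ?A x \<partial>lborel)"
      by (intro nn_integral_mono)
    also have "\<dots> = ennreal (B * (pi / \<epsilon>)) * emeasure lborel ?A"
      by (intro nn_integral_cmult_indicator) (cases "b = (1, 0)"; simp add: coord_cell_def coord_scale_def)
    also have "\<dots> \<le> ennreal (B * (pi / \<epsilon>)) * ennreal (2 * \<epsilon>)"
      by (intro mult_left_mono coord_scale_support_measure e) auto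
    also have "\<dots> = ennreal (C / \<epsilon>) * ennreal (exp (-2) * (\<epsilon> / (2 * pi)))"
      using e B by (simp add: C_def power2_eq_square flip: ennreal_mult)
    also have "\<dots> \<le> ennreal (C / \<epsilon>) * (\<integral>\<^sup>+x. ennreal (profile \<epsilon> b x) * indicator (coord_cell b) x \<partial>lborel)"
      by (intro mult_left_mono profile_mass_lower e) auto
    finally show ?thesis .
  qed
  moreover have "C > 0" using B by (simp add: C_def)
  ultimately show ?thesis by blast
qed

lemma Basis_spacetime:
  "(Basis :: (real \<times> (real ^ 'n::finite)) set) = insert (1, 0) (range (\<lambda>i. (0, axis i 1)))"
  by (auto simp: Basis_prod_def Basis_vec_def)

lemma nn_integral_cylinder_prod:
  fixes f :: "real \<times> (real ^ 'n::finite) \<Rightarrow> real \<Rightarrow> ennreal"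
  assumes [measurable]: "\<And>b. f b \<in> borel_measurable borel"
  shows "(\<integral>\<^sup>+y. (\<Prod>b\<in>Basis. f b (y \<bullet> b)) \<partial>cylinder)
    = (\<Prod>b\<in>Basis. \<integral>\<^sup>+x. f b x * indicator (coord_cell b) x \<partial>lborel)"
proof -
  have ind: "indicator (UNIV \<times> unit_cell) y = (\<Prod>b\<in>Basis. indicator (coord_cell b) (y \<bullet> b) :: ennreal)"
    for y :: "real \<times> (real ^ 'n)"
  proof (cases "y \<in> UNIV \<times> unit_cell")
    case True
    then have "y \<bullet> b \<in> coord_cell b" if "b \<in> Basis" for b
      using that by (auto simp: Basis_spacetime coord_cell_def unit_cell_def inner_axis)
    then have "(\<Prod>b\<in>Basis. indicator (coord_cell b) (y \<bullet> b) :: ennreal) = 1"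
      by (intro prod.neutral) (auto simp: indicator_def)
    then show ?thesis using True by simp
  next
    case False
    then obtain i where "snd y $ i \<notin> {0..<1}" by (cases y) (auto simp: unit_cell_def)
    then have i: "y \<bullet> (0, axis i 1) \<notin> coord_cell (0, axis i 1)"
      by (cases y) (simp add: coord_cell_def inner_axis)
    have "(\<Prod>b\<in>Basis. indicator (coord_cell b) (y \<bullet> b) :: ennreal) = 0"
    proof (rule prod_zero)
      have "indicator (coord_cell (0, axis i 1)) (y \<bullet> (0, axis i 1)) = (0::ennreal)"
        using i by (rule indicator_simps)
      then show "\<exists>b\<in>Basis. indicator (coord_cell b) (y \<bullet> b) = (0::ennreal)"
        by (rule bexI[of _ "(0, axis i 1)"]) (simp add: Basis_spacetime)
    qed simp
    then show ?thesis using False by simp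
  qed
  have "(\<integral>\<^sup>+y. (\<Prod>b\<in>Basis. f b (y \<bullet> b)) \<partial>cylinder)
      = (\<integral>\<^sup>+y. (\<Prod>b\<in>Basis. f b (y \<bullet> b)) * indicator (UNIV \<times> unit_cell) y \<partial>lborel)"
    unfolding cylinder_def by (subst nn_integral_restrict_space) auto
  also have "\<dots> = (\<integral>\<^sup>+y. (\<Prod>b\<in>Basis. f b (y \<bullet> b) * indicator (coord_cell b) (y \<bullet> b)) \<partial>lborel)"
    by (simp add: ind prod.distrib)
  also have "\<dots> = (\<Prod>b\<in>Basis. \<integral>\<^sup>+x. f b x * indicator (coord_cell b) x \<partial>lborel)"
    by (rule nn_integral_lborel_prod) auto
  finally show ?thesis .
qed

text \<open>What the estimates use of a kernel at scale \<open>\<epsilon>\<close>, with a constant \<open>C\<close> common to all scales. The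
  lattice vector makes the support condition one on the torus.\<close>

definition mollifier :: "real \<Rightarrow> real \<Rightarrow> (real \<times> (real ^ 'n::finite) \<Rightarrow> real) \<Rightarrow> bool" where
  "mollifier C \<epsilon> K \<longleftrightarrow> (\<forall>k. Ck k K) \<and> space_periodic UNIV K \<and> (\<forall>y. 0 \<le> K y) \<and>
     (\<integral>\<^sup>+y. ennreal (K y) \<partial>cylinder) = 1 \<and>
     (\<forall>y. K y \<noteq> 0 \<or> (\<exists>b\<in>Basis. pdiff K b y \<noteq> 0) \<longrightarrow>
        \<bar>fst y\<bar> \<le> \<epsilon> \<and> (\<exists>k\<in>lattice. norm (y - (0, k)) \<le> C * \<epsilon>)) \<and>
     (\<forall>b\<in>Basis. (\<integral>\<^sup>+y. ennreal \<bar>pdiff K b y\<bar> \<partial>cylinder) \<le> ennreal (C / \<epsilon>))"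

lemma Ck_profile:
  assumes "\<And>j. Ck j f"
  shows "Ck k (\<lambda>x. profile \<epsilon> b (f x))"
proof -
  have "Ck j (\<lambda>x. coord_scale b (f x))" for j
    using assms Ck_sin[OF Ck_mult[OF Ck_const[of _ pi] assms]]
    by (cases "b = (1, 0)") (auto simp: coord_scale_def)
  then have "Ck j (\<lambda>x. 1 + (-1) * ((1 / \<epsilon>) * coord_scale b (f x))\<^sup>2)" for j
    by (intro Ck_add Ck_mult Ck_power Ck_const)
  then have "Ck k (\<lambda>x. flat_exp 1 (1 + (-1) * ((1 / \<epsilon>) * coord_scale b (f x))\<^sup>2))"
    by (rule Ck_flat_exp)
  then show ?thesis by (simp add: profile_def bump_def)
qed

lemma profile_periodic: "b \<noteq> (1, 0) \<Longrightarrow> profile \<epsilon> b (x + 1) = profile \<epsilon> b x"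
  by (simp add: profile_def coord_scale_def distrib_left bump_def)

lemma coord_scale_near_lattice:
  fixes y :: "real \<times> (real ^ 'n::finite)" and \<epsilon> :: real
  assumes "\<And>b. b \<in> Basis \<Longrightarrow> \<bar>coord_scale b (y \<bullet> b)\<bar> \<le> \<epsilon>"
  shows "\<bar>fst y\<bar> \<le> \<epsilon> \<and> (\<exists>k\<in>lattice. norm (y - (0, k)) \<le> DIM(real \<times> (real ^ 'n)) * \<epsilon>)"
proof
  show t: "\<bar>fst y\<bar> \<le> \<epsilon>"
    using assms[of "(1, 0)"] by (cases y) (simp add: Basis_spacetime coord_scale_def)
  let ?k = "\<chi> i. of_int (round (snd y $ i)) :: real ^ 'n"
  have "\<bar>(y - (0, ?k)) \<bullet> b\<bar> \<le> \<epsilon>" if b: "b \<in> Basis" for b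
  proof (cases "b = (1, 0)")
    case True
    then show ?thesis using t by (cases y) simp
  next
    case False
    then obtain i where i: "b = (0, axis i 1)" using b by (auto simp: Basis_spacetime)
    have "\<bar>sin (pi * snd y $ i)\<bar> \<le> \<epsilon>"
      using assms[OF b] by (cases y) (simp add: i coord_scale_def inner_axis)
    with abs_sin_pi_ge have 2: "2 * \<bar>snd y $ i - of_int (round (snd y $ i))\<bar> \<le> \<epsilon>"
      by (rule order_trans)
    have "a \<le> \<epsilon>" if "2 * a \<le> \<epsilon>" "0 \<le> a" for a using that by simp
    from this[OF 2 abs_ge_zero] have "\<bar>snd y $ i - of_int (round (snd y $ i))\<bar> \<le> \<epsilon>" .
    then show ?thesis by (cases y) (simp add: i inner_axis)
  qed
  then have "(\<Sum>b\<in>Basis. \<bar>(y - (0, ?k)) \<bullet> b\<bar>) \<le> (\<Sum>b\<in>(Basis :: (real \<times> (real ^ 'n)) set). \<epsilon>)"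
    by (rule sum_mono)
  then have "norm (y - (0, ?k)) \<le> DIM(real \<times> (real ^ 'n)) * \<epsilon>"
    using norm_le_l1[of "y - (0, ?k)"] by simp
  then show "\<exists>k\<in>lattice. norm (y - (0, k)) \<le> DIM(real \<times> (real ^ 'n)) * \<epsilon>"
    by (intro bexI[of _ ?k]) (auto simp: lattice_def)
qed

text \<open>The kernel is the product of the profiles, divided by its mass; a partial derivative replaces
  one factor by its derivative. The constant absorbs the number of coordinates, which bounds the
  ratio of the norm to the largest coordinate.\<close>

lemma mollifier_exists:
  "\<exists>C>0. \<forall>\<epsilon>. 0 < \<epsilon> \<longrightarrow> \<epsilon> < 1 \<longrightarrow> (\<exists>K :: real \<times> (real ^ 'n::finite) \<Rightarrow> real. mollifier C \<epsilon> K)"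
proof -
  let ?E = "Basis :: (real \<times> (real ^ 'n)) set"
  obtain C0 where C0: "C0 > 0" and deriv: "\<And>\<epsilon> b. 0 < \<epsilon> \<Longrightarrow> \<epsilon> < 1 \<Longrightarrow>
    (\<integral>\<^sup>+x. ennreal \<bar>profile' \<epsilon> (b::real \<times> (real ^ 'n)) x\<bar> * indicator (coord_cell b) x \<partial>lborel)
    \<le> ennreal (C0 / \<epsilon>) * (\<integral>\<^sup>+x. ennreal (profile \<epsilon> b x) * indicator (coord_cell b) x \<partial>lborel)"
    using profile'_mass by blast
  define C where "C = max C0 (DIM(real \<times> (real ^ 'n)))"
  have "\<exists>K :: real \<times> (real ^ 'n) \<Rightarrow> real. mollifier C \<epsilon> K" if e: "0 < \<epsilon>" "\<epsilon> < 1" for \<epsilon>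
  proof -
    define k where "k y = (\<Prod>b\<in>?E. profile \<epsilon> b (y \<bullet> b))" for y :: "real \<times> (real ^ 'n)"
    let ?m = "\<lambda>b::real \<times> (real ^ 'n). \<integral>\<^sup>+x. ennreal (profile \<epsilon> b x) * indicator (coord_cell b) x \<partial>lborel"
    have mass: "(\<integral>\<^sup>+y. ennreal (k y) \<partial>cylinder) = (\<Prod>b\<in>?E. ?m b)"
      unfolding k_def by (subst prod_ennreal[symmetric], simp, rule nn_integral_cylinder_prod) simp
    have m_pos: "?m b > 0" for b
      by (rule less_le_trans[OF _ profile_mass_lower[OF e]]) (use e in simp)
    have m_fin: "?m b < \<infinity>" for b
      by (rule le_less_trans[OF profile_mass_upper[OF e(1)]]) simp
    define m where "m = enn2real (\<Prod>b\<in>?E. ?m b)"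
    have fin: "(\<Prod>b\<in>?E. ?m b) < \<infinity>"
      using m_fin by (simp add: ennreal_prod_eq_top less_top[symmetric])
    have "?m b \<noteq> 0" for b using m_pos[of b] by (metis less_irrefl)
    then have "(\<Prod>b\<in>?E. ?m b) \<noteq> 0" by (induction rule: finite_induct[OF finite_Basis]) auto
    then have m: "m > 0" "ennreal m = (\<Prod>b\<in>?E. ?m b)"
      using fin by (auto simp: m_def enn2real_positive_iff zero_less_iff_neq_zero)
    define K where "K y = k y * (1 / m)" for y
    have smooth_k: "Ck j k" for j
      unfolding k_def[abs_def]
      by (intro Ck_prod Ck_profile)
         (use Ck_linear[OF bounded_linear_inner_left, where c = 0] in auto)
    have smooth: "Ck j K" for j
      unfolding K_def[abs_def] by (intro Ck_mult Ck_const smooth_k)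
    have K_nonneg: "0 \<le> K y" for y
      using m(1) by (auto simp: K_def k_def intro!: prod_nonneg divide_nonneg_pos)
    have periodic: "space_periodic UNIV K"
    proof -
      have "profile \<epsilon> b ((t, x + axis i 1) \<bullet> b) = profile \<epsilon> b ((t, x) \<bullet> b)" if bE: "b \<in> ?E" for b t x i
      proof (cases "b = (1, 0)")
        case False
        then obtain j where b: "b = (0, axis j 1)" using bE by (auto simp: Basis_spacetime)
        have "(t, x + axis i 1) \<bullet> b = x $ j + (if i = j then 1 else 0)" "(t, x) \<bullet> b = x $ j"
          by (simp_all add: b inner_add_left inner_axis_axis inner_axis) (simp add: axis_def)
        then show ?thesis using profile_periodic[OF False, of \<epsilon> "x $ j"] by auto
      qed simp
      then show ?thesis by (simp add: space_periodic_def K_def k_def cong: prod.cong)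
    qed
    have mass_K: "(\<integral>\<^sup>+y. ennreal (K y) \<partial>cylinder) = 1"
    proof -
      have [measurable]: "k \<in> borel_measurable borel"
        using smooth_k[of 0] by (auto intro: borel_measurable_continuous_onI)
      have eq: "ennreal (K y) = ennreal (k y) * ennreal (1 / m)" for y
        unfolding K_def by (rule ennreal_mult) (use m(1) in \<open>auto simp: k_def intro!: prod_nonneg\<close>)
      have "(\<integral>\<^sup>+y. ennreal (K y) \<partial>cylinder) = (\<integral>\<^sup>+y. ennreal (k y) \<partial>cylinder) * ennreal (1 / m)"
        unfolding eq by (rule nn_integral_multc) measurable
      then show ?thesis
        unfolding mass m(2)[symmetric] using m(1) by (simp flip: ennreal_mult)
    qed
    define k' where "k' b y = (\<Prod>c\<in>?E. (if c = b then profile' \<epsilon> c (y \<bullet> c) else profile \<epsilon> c (y \<bullet> c)))"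
      for b y :: "real \<times> (real ^ 'n)"
    have pdiff_K: "pdiff K b y = k' b y * (1 / m)" if b: "b \<in> ?E" for b y
    proof -
      have 1: "((\<lambda>s. K (y + s *\<^sub>R b)) has_real_derivative pdiff K b y) (at 0)"
        using Ck_has_pdiff[OF smooth] unfolding has_pdiff_def by blast
      have eq: "K (y + s *\<^sub>R b) = profile \<epsilon> b (y \<bullet> b + s) * (\<Prod>c\<in>?E - {b}. profile \<epsilon> c (y \<bullet> c)) * (1 / m)" for s
      proof -
        have "k (y + s *\<^sub>R b) = profile \<epsilon> b ((y + s *\<^sub>R b) \<bullet> b) * (\<Prod>c\<in>?E - {b}. profile \<epsilon> c ((y + s *\<^sub>R b) \<bullet> c))"
          unfolding k_def by (rule prod.remove) (use b in auto)
        also have "(\<Prod>c\<in>?E - {b}. profile \<epsilon> c ((y + s *\<^sub>R b) \<bullet> c)) = (\<Prod>c\<in>?E - {b}. profile \<epsilon> c (y \<bullet> c))"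
          by (intro prod.cong refl) (use b in \<open>auto simp: inner_add_left inner_not_same_Basis\<close>)
        finally show ?thesis using b by (simp add: K_def inner_add_left inner_same_Basis)
      qed
      have k': "k' b y = profile' \<epsilon> b (y \<bullet> b) * (\<Prod>c\<in>?E - {b}. profile \<epsilon> c (y \<bullet> c))"
        unfolding k'_def by (subst prod.remove[of _ b]) (use b in \<open>auto intro!: prod.cong\<close>)
      have "((\<lambda>s. profile \<epsilon> b (y \<bullet> b + s)) has_real_derivative profile' \<epsilon> b (y \<bullet> b)) (at 0)"
        using DERIV_shift[of "profile \<epsilon> b" _ 0 "y \<bullet> b"] profile_deriv[OF e(1), of b "y \<bullet> b"]
        by (simp add: add.commute)
      then have "((\<lambda>s. K (y + s *\<^sub>R b)) has_real_derivative k' b y * (1 / m)) (at 0)"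
        unfolding eq k' by (intro DERIV_cmult_right)
      then show ?thesis using 1 DERIV_unique by blast
    qed
    have support: "\<bar>fst y\<bar> \<le> \<epsilon> \<and> (\<exists>l\<in>lattice. norm (y - (0, l)) \<le> C * \<epsilon>)"
      if "K y \<noteq> 0 \<or> (\<exists>b\<in>?E. pdiff K b y \<noteq> 0)" for y
    proof -
      have "\<bar>coord_scale c (y \<bullet> c)\<bar> \<le> \<epsilon>" if c: "c \<in> ?E" for c
      proof -
        have "profile \<epsilon> c (y \<bullet> c) \<noteq> 0 \<or> profile' \<epsilon> c (y \<bullet> c) \<noteq> 0"
        proof (cases "K y = 0")
          case True
          then obtain b where b: "b \<in> ?E" "pdiff K b y \<noteq> 0" using \<open>K y \<noteq> 0 \<or> _\<close> by blast
          then have "k' b y \<noteq> 0" using pdiff_K by auto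
          then show ?thesis using c by (auto simp: k'_def prod_zero_iff split: if_splits)
        qed (use c in \<open>auto simp: K_def k_def prod_zero_iff\<close>)
        then show ?thesis by (rule profile_support[OF e(1)])
      qed
      then have "\<bar>fst y\<bar> \<le> \<epsilon> \<and> (\<exists>l\<in>lattice. norm (y - (0, l)) \<le> DIM(real \<times> (real ^ 'n)) * \<epsilon>)"
        by (rule coord_scale_near_lattice)
      moreover have "DIM(real \<times> (real ^ 'n)) * \<epsilon> \<le> C * \<epsilon>"
        using e by (intro mult_right_mono) (auto simp: C_def)
      ultimately show ?thesis by (meson order_trans)
    qed
    have grad: "(\<integral>\<^sup>+y. ennreal \<bar>pdiff K b y\<bar> \<partial>cylinder) \<le> ennreal (C / \<epsilon>)" if b: "b \<in> ?E" for b
    proof -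
      let ?f = "\<lambda>c x. ennreal (if c = b then \<bar>profile' \<epsilon> c x\<bar> else profile \<epsilon> c x)"
      have f_meas: "?f c \<in> borel_measurable borel" for c by (cases "c = b") auto
      have eq: "ennreal \<bar>pdiff K b y\<bar> = (\<Prod>c\<in>?E. ?f c (y \<bullet> c)) * ennreal (1 / m)" for y
      proof -
        have "\<bar>k' b y\<bar> = (\<Prod>c\<in>?E. (if c = b then \<bar>profile' \<epsilon> c (y \<bullet> c)\<bar> else profile \<epsilon> c (y \<bullet> c)))"
          unfolding k'_def abs_prod by (intro prod.cong) auto
        then have "\<bar>pdiff K b y\<bar> = (\<Prod>c\<in>?E. (if c = b then \<bar>profile' \<epsilon> c (y \<bullet> c)\<bar> else profile \<epsilon> c (y \<bullet> c))) * (1 / m)"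
          using m(1) by (simp add: pdiff_K[OF b] abs_mult)
        moreover have "ennreal ((\<Prod>c\<in>?E. (if c = b then \<bar>profile' \<epsilon> c (y \<bullet> c)\<bar> else profile \<epsilon> c (y \<bullet> c))) * (1 / m))
            = ennreal (\<Prod>c\<in>?E. (if c = b then \<bar>profile' \<epsilon> c (y \<bullet> c)\<bar> else profile \<epsilon> c (y \<bullet> c))) * ennreal (1 / m)"
          by (rule ennreal_mult) (use m(1) in \<open>auto intro!: prod_nonneg\<close>)
        moreover have "(\<Prod>c\<in>?E. ?f c (y \<bullet> c)) = ennreal (\<Prod>c\<in>?E. (if c = b then \<bar>profile' \<epsilon> c (y \<bullet> c)\<bar> else profile \<epsilon> c (y \<bullet> c)))"
          by (rule prod_ennreal) simp
        ultimately show ?thesis by (simp only:)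
      qed
      have [measurable]: "(\<lambda>y::real \<times> (real ^ 'n). \<Prod>c\<in>?E. ?f c (y \<bullet> c)) \<in> borel_measurable borel"
        by (intro borel_measurable_prod_ennreal measurable_compose[OF _ f_meas]) auto
      have "(\<integral>\<^sup>+y. ennreal \<bar>pdiff K b y\<bar> \<partial>cylinder) = (\<integral>\<^sup>+y. (\<Prod>c\<in>?E. ?f c (y \<bullet> c)) \<partial>cylinder) * ennreal (1 / m)"
        unfolding eq by (rule nn_integral_multc) measurable
      also have "(\<integral>\<^sup>+y. (\<Prod>c\<in>?E. ?f c (y \<bullet> c)) \<partial>cylinder) = (\<Prod>c\<in>?E. \<integral>\<^sup>+x. ?f c x * indicator (coord_cell c) x \<partial>lborel)"
        by (rule nn_integral_cylinder_prod[OF f_meas])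
      also have "\<dots> = (\<integral>\<^sup>+x. ennreal \<bar>profile' \<epsilon> b x\<bar> * indicator (coord_cell b) x \<partial>lborel) * (\<Prod>c\<in>?E - {b}. ?m c)"
        by (subst prod.remove[of _ b]) (use b in \<open>auto intro!: prod.cong arg_cong2[where f = "(*)"]\<close>)
      also have "\<dots> \<le> (ennreal (C0 / \<epsilon>) * ?m b) * (\<Prod>c\<in>?E - {b}. ?m c)"
        by (intro mult_right_mono deriv e) auto
      also have "\<dots> = ennreal (C0 / \<epsilon>) * ennreal m"
        unfolding m(2) by (subst (2) prod.remove[of _ b]) (use b in \<open>auto simp: mult.assoc\<close>)
      finally have "(\<integral>\<^sup>+y. ennreal \<bar>pdiff K b y\<bar> \<partial>cylinder) \<le> ennreal (C0 / \<epsilon>) * ennreal m * ennreal (1 / m)"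
        by (simp add: mult_right_mono)
      also have "\<dots> = ennreal (C0 / \<epsilon>)"
        using m(1) C0 e by (simp flip: ennreal_mult)
      also have "\<dots> \<le> ennreal (C / \<epsilon>)"
        using e by (intro ennreal_leI divide_right_mono) (auto simp: C_def)
      finally show ?thesis .
    qed
    show ?thesis
      unfolding mollifier_def using smooth periodic K_nonneg mass_K support grad by blast
  qed
  moreover have "C > 0" using C0 by (simp add: C_def)
  ultimately show ?thesis by blast
qed

section \<open>Bounds in Lebesgue spaces\<close>

text \<open>Up to a constant depending on \<open>M\<close> only, \<open>f\<close> is in \<open>A\<close> times the unit ball of \<open>L\<^sup>1\<^sup>/\<^sup>s\<close>; the
  witness \<open>g\<close> stands for \<open>(\<bar>f\<bar> / A) powr (1 / s)\<close>. In this form \<open>s = 0\<close> gives essential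
  boundedness without a case distinction, exponents \<open>s\<close> add up in products, and the maximum with 1
  makes a larger \<open>s\<close> a weaker condition, as it is on spaces of finite measure. The condition is
  pointwise off the null set where \<open>g\<close> is infinite, so that \<open>f\<close> need not be measurable.\<close>

definition Lq_bound :: "'a measure \<Rightarrow> real \<Rightarrow> real \<Rightarrow> ('a \<Rightarrow> real) \<Rightarrow> bool" where
  "Lq_bound M s A f \<longleftrightarrow> 0 \<le> A \<and> (\<exists>g::'a \<Rightarrow> ennreal. g \<in> borel_measurable M \<and> (\<integral>\<^sup>+y. g y \<partial>M) \<le> 1 \<and>
     (\<forall>y\<in>space M. g y < \<infinity> \<longrightarrow> \<bar>f y\<bar> \<le> A * max 1 (enn2real (g y)) powr s))"

lemma Lq_boundI:
  assumes "0 \<le> A" "g \<in> borel_measurable M" "(\<integral>\<^sup>+y. g y \<partial>M) \<le> 1"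
    "\<And>y. y \<in> space M \<Longrightarrow> g y < \<infinity> \<Longrightarrow> \<bar>f y\<bar> \<le> A * max 1 (enn2real (g y)) powr s"
  shows "Lq_bound M s A f"
  using assms unfolding Lq_bound_def by blast

lemma Lq_boundE:
  assumes "Lq_bound M s A f"
  obtains g where "0 \<le> A" "g \<in> borel_measurable M" "(\<integral>\<^sup>+y. g y \<partial>M) \<le> 1"
    "\<And>y. y \<in> space M \<Longrightarrow> g y < \<infinity> \<Longrightarrow> \<bar>f y\<bar> \<le> A * max 1 (enn2real (g y)) powr s"
  using assms unfolding Lq_bound_def by blast

lemma Lq_bound_mono:
  assumes "Lq_bound M s A h" "\<And>y. y \<in> space M \<Longrightarrow> \<bar>f y\<bar> \<le> \<bar>h y\<bar>" "s \<le> s'" "A \<le> A'"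
  shows "Lq_bound M s' A' f"
proof -
  obtain g where g: "0 \<le> A" "g \<in> borel_measurable M" "(\<integral>\<^sup>+y. g y \<partial>M) \<le> 1"
    "\<And>y. y \<in> space M \<Longrightarrow> g y < \<infinity> \<Longrightarrow> \<bar>h y\<bar> \<le> A * max 1 (enn2real (g y)) powr s"
    using Lq_boundE[OF assms(1)] by blast
  show ?thesis
  proof (rule Lq_boundI[OF _ g(2,3)])
    fix y assume y: "y \<in> space M" "g y < \<infinity>"
    have "\<bar>f y\<bar> \<le> A * max 1 (enn2real (g y)) powr s"
      using assms(2)[OF y(1)] g(4)[OF y] by linarith
    also have "\<dots> \<le> A' * max 1 (enn2real (g y)) powr s'"
      using assms(3,4) g(1) by (intro mult_mono powr_mono) auto
    finally show "\<bar>f y\<bar> \<le> A' * max 1 (enn2real (g y)) powr s'" .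
  qed (use g assms in linarith)
qed

lemma Lq_bound_const: "0 \<le> A \<Longrightarrow> (\<And>y. y \<in> space M \<Longrightarrow> \<bar>f y\<bar> \<le> A) \<Longrightarrow> Lq_bound M 0 A f"
  by (rule Lq_boundI[of _ "\<lambda>_. 0"]) auto

lemma ennreal_mean_bounds:
  assumes "ennreal (1/2) * (g1 + g2) < \<infinity>"
  shows "g1 < \<infinity>" "g2 < \<infinity>"
    "max 1 (enn2real g1) \<le> 2 * max 1 (enn2real (ennreal (1/2) * (g1 + g2)))"
    "max 1 (enn2real g2) \<le> 2 * max 1 (enn2real (ennreal (1/2) * (g1 + g2)))"
proof -
  show fin: "g1 < \<infinity>" "g2 < \<infinity>"
    using assms by (auto simp: ennreal_mult_less_top less_top[symmetric] ennreal_mult_eq_top_iff)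
  then obtain a b where ab: "g1 = ennreal a" "g2 = ennreal b" "0 \<le> a" "0 \<le> b"
    by (metis ennreal_enn2real enn2real_nonneg infinity_ennreal_def)
  have "ennreal (1/2) * (g1 + g2) = ennreal (1/2) * ennreal (a + b)"
    unfolding ab(1,2) using ab(3,4) by (subst ennreal_plus) auto
  also have "\<dots> = ennreal (1/2 * (a + b))"
    using ab(3,4) by (intro ennreal_mult[symmetric]) auto
  finally have e: "enn2real (ennreal (1/2) * (g1 + g2)) = (a + b) / 2" using ab by simp
  show "max 1 (enn2real g1) \<le> 2 * max 1 (enn2real (ennreal (1/2) * (g1 + g2)))"
    "max 1 (enn2real g2) \<le> 2 * max 1 (enn2real (ennreal (1/2) * (g1 + g2)))"
    unfolding e using ab by (auto simp: max_def)
qed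

lemma nn_integral_mean_le_1:
  assumes [measurable]: "g1 \<in> borel_measurable M" "g2 \<in> borel_measurable M"
    and "(\<integral>\<^sup>+y. g1 y \<partial>M) \<le> 1" "(\<integral>\<^sup>+y. g2 y \<partial>M) \<le> 1"
  shows "(\<integral>\<^sup>+y. ennreal (1/2) * (g1 y + g2 y) \<partial>M) \<le> 1"
proof -
  have "(\<integral>\<^sup>+y. ennreal (1/2) * (g1 y + g2 y) \<partial>M) = ennreal (1/2) * ((\<integral>\<^sup>+y. g1 y \<partial>M) + (\<integral>\<^sup>+y. g2 y \<partial>M))"
    by (subst nn_integral_cmult) (auto simp: nn_integral_add)
  also have "\<dots> \<le> ennreal (1/2) * (1 + 1)"
    by (intro mult_left_mono add_mono assms) auto
  also have "\<dots> = ennreal (1/2) * ennreal 2" by simp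
  also have "\<dots> = 1" by (subst ennreal_mult[symmetric]) auto
  finally show ?thesis .
qed

text \<open>Two witnesses are merged into their mean, which dominates half of each.\<close>

lemma Lq_bound_pair:
  assumes "Lq_bound M s A f" "Lq_bound M s' B h" "0 \<le> s" "0 \<le> s'"
  obtains g where "g \<in> borel_measurable M" "(\<integral>\<^sup>+y. g y \<partial>M) \<le> 1"
    "\<And>y. y \<in> space M \<Longrightarrow> g y < \<infinity> \<Longrightarrow> \<bar>f y\<bar> \<le> A * (2 * max 1 (enn2real (g y))) powr s"
    "\<And>y. y \<in> space M \<Longrightarrow> g y < \<infinity> \<Longrightarrow> \<bar>h y\<bar> \<le> B * (2 * max 1 (enn2real (g y))) powr s'"
proof -
  obtain g1 where g1: "0 \<le> A" "g1 \<in> borel_measurable M" "(\<integral>\<^sup>+y. g1 y \<partial>M) \<le> 1"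
    "\<And>y. y \<in> space M \<Longrightarrow> g1 y < \<infinity> \<Longrightarrow> \<bar>f y\<bar> \<le> A * max 1 (enn2real (g1 y)) powr s"
    using Lq_boundE[OF assms(1)] by blast
  obtain g2 where g2: "0 \<le> B" "g2 \<in> borel_measurable M" "(\<integral>\<^sup>+y. g2 y \<partial>M) \<le> 1"
    "\<And>y. y \<in> space M \<Longrightarrow> g2 y < \<infinity> \<Longrightarrow> \<bar>h y\<bar> \<le> B * max 1 (enn2real (g2 y)) powr s'"
    using Lq_boundE[OF assms(2)] by blast
  note [measurable] = g1(2) g2(2)
  let ?g = "\<lambda>y. ennreal (1/2) * (g1 y + g2 y)"
  show ?thesis
  proof (rule that[of ?g])
    show "(\<integral>\<^sup>+y. ?g y \<partial>M) \<le> 1" by (rule nn_integral_mean_le_1) (use g1 g2 in auto)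
    fix y assume y: "y \<in> space M" "?g y < \<infinity>"
    note m = ennreal_mean_bounds[OF y(2)]
    have "\<bar>f y\<bar> \<le> A * max 1 (enn2real (g1 y)) powr s" by (rule g1(4)[OF y(1) m(1)])
    also have "\<dots> \<le> A * (2 * max 1 (enn2real (?g y))) powr s"
      by (intro mult_left_mono powr_mono2 m(3) g1(1) assms(3)) auto
    finally show "\<bar>f y\<bar> \<le> A * (2 * max 1 (enn2real (?g y))) powr s" .
    have "\<bar>h y\<bar> \<le> B * max 1 (enn2real (g2 y)) powr s'" by (rule g2(4)[OF y(1) m(2)])
    also have "\<dots> \<le> B * (2 * max 1 (enn2real (?g y))) powr s'"
      by (intro mult_left_mono powr_mono2 m(4) g2(1) assms(4)) auto
    finally show "\<bar>h y\<bar> \<le> B * (2 * max 1 (enn2real (?g y))) powr s'" .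
  qed auto
qed

lemma Lq_bound_nonneg: "Lq_bound M s A f \<Longrightarrow> 0 \<le> A"
  by (simp add: Lq_bound_def)

text \<open>Hoelder's inequality.\<close>

lemma Lq_bound_mult:
  assumes "Lq_bound M s A f" "Lq_bound M s' B h" "0 \<le> s" "0 \<le> s'"
  shows "Lq_bound M (s + s') (2 powr (s + s') * A * B) (\<lambda>y. f y * h y)"
proof -
  have AB: "0 \<le> A" "0 \<le> B" using assms Lq_bound_nonneg by blast+
  obtain g where g: "g \<in> borel_measurable M" "(\<integral>\<^sup>+y. g y \<partial>M) \<le> 1"
    "\<And>y. y \<in> space M \<Longrightarrow> g y < \<infinity> \<Longrightarrow> \<bar>f y\<bar> \<le> A * (2 * max 1 (enn2real (g y))) powr s"
    "\<And>y. y \<in> space M \<Longrightarrow> g y < \<infinity> \<Longrightarrow> \<bar>h y\<bar> \<le> B * (2 * max 1 (enn2real (g y))) powr s'"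
    using Lq_bound_pair[OF assms] by blast
  show ?thesis
  proof (rule Lq_boundI[OF _ g(1,2)])
    fix y assume y: "y \<in> space M" "g y < \<infinity>"
    let ?m = "max 1 (enn2real (g y))"
    have "\<bar>f y * h y\<bar> \<le> (A * (2 * ?m) powr s) * (B * (2 * ?m) powr s')"
      unfolding abs_mult using AB by (intro mult_mono g(3,4)[OF y]) auto
    also have "\<dots> = 2 powr (s + s') * A * B * ?m powr (s + s')"
      by (simp add: powr_mult powr_add mult_ac)
    finally show "\<bar>f y * h y\<bar> \<le> 2 powr (s + s') * A * B * ?m powr (s + s')" .
  qed (use AB in auto)
qed

lemma Lq_bound_add:
  assumes "Lq_bound M s A f" "Lq_bound M s B h" "0 \<le> s"
  shows "Lq_bound M s (2 powr s * (A + B)) (\<lambda>y. f y + h y)"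
proof -
  have AB: "0 \<le> A" "0 \<le> B" using assms Lq_bound_nonneg by blast+
  obtain g where g: "g \<in> borel_measurable M" "(\<integral>\<^sup>+y. g y \<partial>M) \<le> 1"
    "\<And>y. y \<in> space M \<Longrightarrow> g y < \<infinity> \<Longrightarrow> \<bar>f y\<bar> \<le> A * (2 * max 1 (enn2real (g y))) powr s"
    "\<And>y. y \<in> space M \<Longrightarrow> g y < \<infinity> \<Longrightarrow> \<bar>h y\<bar> \<le> B * (2 * max 1 (enn2real (g y))) powr s"
    using Lq_bound_pair[OF assms(1,2,3,3)] by blast
  show ?thesis
  proof (rule Lq_boundI[OF _ g(1,2)])
    fix y assume y: "y \<in> space M" "g y < \<infinity>"
    let ?m = "max 1 (enn2real (g y))"
    have "\<bar>f y + h y\<bar> \<le> A * (2 * ?m) powr s + B * (2 * ?m) powr s"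
      using g(3,4)[OF y] by linarith
    also have "\<dots> = 2 powr s * (A + B) * ?m powr s"
      by (simp add: powr_mult algebra_simps)
    finally show "\<bar>f y + h y\<bar> \<le> 2 powr s * (A + B) * ?m powr s" .
  qed (use AB in auto)
qed

lemma Lq_bound_powr:
  assumes "Lq_bound M s A f" "0 \<le> \<gamma>"
  shows "Lq_bound M (\<gamma> * s) (A powr \<gamma>) (\<lambda>y. \<bar>f y\<bar> powr \<gamma>)"
proof -
  obtain g where g: "0 \<le> A" "g \<in> borel_measurable M" "(\<integral>\<^sup>+y. g y \<partial>M) \<le> 1"
    "\<And>y. y \<in> space M \<Longrightarrow> g y < \<infinity> \<Longrightarrow> \<bar>f y\<bar> \<le> A * max 1 (enn2real (g y)) powr s"
    using Lq_boundE[OF assms(1)] by blast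
  show ?thesis
  proof (rule Lq_boundI[OF _ g(2,3)])
    fix y assume y: "y \<in> space M" "g y < \<infinity>"
    have "\<bar>f y\<bar> powr \<gamma> \<le> (A * max 1 (enn2real (g y)) powr s) powr \<gamma>"
      using g(4)[OF y] assms(2) by (intro powr_mono2) auto
    also have "\<dots> = A powr \<gamma> * max 1 (enn2real (g y)) powr (\<gamma> * s)"
      using g(1) by (simp add: powr_mult powr_powr mult.commute)
    finally show "\<bar>\<bar>f y\<bar> powr \<gamma>\<bar> \<le> A powr \<gamma> * max 1 (enn2real (g y)) powr (\<gamma> * s)" by simp
  qed simp
qed

lemma Lq_bound_integral:
  assumes "Lq_bound M s A f" "s \<le> 1"
  shows "(\<integral>\<^sup>+y. ennreal \<bar>f y\<bar> \<partial>M) \<le> ennreal A * (emeasure M (space M) + 1)"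
proof -
  obtain g where g: "0 \<le> A" "g \<in> borel_measurable M" "(\<integral>\<^sup>+y. g y \<partial>M) \<le> 1"
    "\<And>y. y \<in> space M \<Longrightarrow> g y < \<infinity> \<Longrightarrow> \<bar>f y\<bar> \<le> A * max 1 (enn2real (g y)) powr s"
    using Lq_boundE[OF assms(1)] by blast
  note [measurable] = g(2)
  have "AE y in M. g y \<noteq> \<infinity>"
    using g(3) by (intro nn_integral_PInf_AE g(2)) (auto simp: top_unique)
  then have "AE y in M. ennreal \<bar>f y\<bar> \<le> ennreal A * (1 + g y)"
    using AE_space
  proof eventually_elim
    case (elim y)
    then have y: "y \<in> space M" "g y < \<infinity>" by (auto simp: less_top)
    let ?x = "enn2real (g y)"
    have "max 1 ?x powr s \<le> max 1 ?x powr 1" using assms(2) by (intro powr_mono) auto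
    also have "\<dots> \<le> 1 + ?x" by (simp add: max_def)
    finally have "\<bar>f y\<bar> \<le> A * (1 + ?x)"
      using g(4)[OF y] mult_left_mono[OF _ g(1)] by (meson order_trans)
    then have "ennreal \<bar>f y\<bar> \<le> ennreal (A * (1 + ?x))" by (rule ennreal_leI)
    also have "\<dots> = ennreal A * (1 + ennreal ?x)" using g(1) by (simp add: ennreal_mult)
    also have "ennreal ?x = g y" using y by simp
    finally show ?case .
  qed
  then have "(\<integral>\<^sup>+y. ennreal \<bar>f y\<bar> \<partial>M) \<le> (\<integral>\<^sup>+y. ennreal A * (1 + g y) \<partial>M)"
    by (rule nn_integral_mono_AE)
  also have "\<dots> = ennreal A * (emeasure M (space M) + (\<integral>\<^sup>+y. g y \<partial>M))"
    by (subst nn_integral_cmult) (auto simp: nn_integral_add)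
  also have "\<dots> \<le> ennreal A * (emeasure M (space M) + 1)"
    by (intro mult_left_mono add_mono g) auto
  finally show ?thesis .
qed

text \<open>Averages of uniformly bounded families: the average of the witnesses is a witness, by Tonelli
  and the concavity of \<open>x powr s\<close>, used in the form \<open>x powr s \<le> 1 + x\<close>.\<close>

lemma Lq_bound_average:
  fixes F :: "'z \<Rightarrow> 'y \<Rightarrow> real" and G :: "'z \<Rightarrow> 'y \<Rightarrow> ennreal"
  assumes sf: "sigma_finite_measure Z" "sigma_finite_measure M"
    and k [measurable]: "k \<in> borel_measurable Z" and k0: "\<And>z. 0 \<le> k z" and k1: "(\<integral>\<^sup>+z. ennreal (k z) \<partial>Z) \<le> 1"
    and G [measurable]: "(\<lambda>(z, y). G z y) \<in> borel_measurable (Z \<Otimes>\<^sub>M M)"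
    and G1: "\<And>z. z \<in> space Z \<Longrightarrow> k z \<noteq> 0 \<Longrightarrow> (\<integral>\<^sup>+y. G z y \<partial>M) \<le> 1"
    and F: "\<And>z y. z \<in> space Z \<Longrightarrow> y \<in> space M \<Longrightarrow> G z y < \<infinity> \<Longrightarrow> k z \<noteq> 0 \<Longrightarrow>
      \<bar>F z y\<bar> \<le> A * max 1 (enn2real (G z y)) powr s"
    and s: "0 \<le> s" "s \<le> 1" and A: "0 \<le> A"
  shows "Lq_bound M s (3 * A) (\<lambda>y. \<integral>z. k z * \<bar>F z y\<bar> \<partial>Z)"
proof -
  interpret P: pair_sigma_finite Z M using sf by (simp add: pair_sigma_finite_def)
  define g where "g y = (\<integral>\<^sup>+z. ennreal (k z) * G z y \<partial>Z)" for y
  have [measurable]: "(\<lambda>(z, y). ennreal (k z) * G z y) \<in> borel_measurable (Z \<Otimes>\<^sub>M M)"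
    by measurable
  have g_meas: "g \<in> borel_measurable M"
    unfolding g_def by (rule P.M1.borel_measurable_nn_integral) (subst measurable_pair_swap_iff, simp add: case_prod_beta')
  have "(\<integral>\<^sup>+y. g y \<partial>M) = (\<integral>\<^sup>+z. (\<integral>\<^sup>+y. ennreal (k z) * G z y \<partial>M) \<partial>Z)"
    unfolding g_def by (rule P.Fubini') measurable
  also have "\<dots> \<le> (\<integral>\<^sup>+z. ennreal (k z) \<partial>Z)"
  proof (rule nn_integral_mono)
    fix z assume z: "z \<in> space Z"
    then have [measurable]: "G z \<in> borel_measurable M" using measurable_Pair2[OF G] by simp
    have "(\<integral>\<^sup>+y. ennreal (k z) * G z y \<partial>M) = ennreal (k z) * (\<integral>\<^sup>+y. G z y \<partial>M)"
      by (rule nn_integral_cmult) measurable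
    also have "\<dots> \<le> ennreal (k z)"
      using mult_left_mono[OF G1[OF z], of "ennreal (k z)"] by (cases "k z = 0") auto
    finally show "(\<integral>\<^sup>+y. ennreal (k z) * G z y \<partial>M) \<le> ennreal (k z)" .
  qed
  finally have g1: "(\<integral>\<^sup>+y. g y \<partial>M) \<le> 1" using k1 by (rule order_trans)
  show ?thesis
  proof (rule Lq_boundI[OF _ g_meas g1])
    fix y assume y: "y \<in> space M" "g y < \<infinity>"
    \<comment> \<open>With \<open>x = max 1 (G z y) / N\<close>, the bound \<open>x powr s \<le> 1 + x\<close> splits off \<open>N powr s\<close>, and what
      remains has a bounded average over \<open>z\<close>.\<close>
    define N where "N = max 1 (enn2real (g y))"
    have N: "N \<ge> 1" "enn2real (g y) \<le> N" by (auto simp: N_def)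
    have Gy [measurable]: "(\<lambda>z. G z y) \<in> borel_measurable Z"
      using measurable_Pair1[OF G y(1)] by simp
    have "AE z in Z. ennreal (k z) * G z y \<noteq> \<infinity>"
      using y(2) unfolding g_def by (intro nn_integral_PInf_AE) auto
    then have ae: "AE z in Z. ennreal (k z * \<bar>F z y\<bar>) \<le>
        ennreal (A * N powr s) * (2 * ennreal (k z) + ennreal (1 / N) * (ennreal (k z) * G z y))"
      using AE_space
    proof eventually_elim
      case (elim z)
      show ?case
      proof (cases "k z = 0")
        case False
        then have kz: "k z > 0" using k0[of z] by simp
        then have fin: "G z y < \<infinity>" using elim by (auto simp: ennreal_mult_eq_top_iff less_top)
        let ?x = "enn2real (G z y)"
        let ?t = "max 1 ?x / N"
        have t: "0 \<le> ?t" using N by simp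
        have t1: "?t powr s \<le> 1 + ?t"
        proof (cases "?t \<le> 1")
          case True
          then have "?t powr s \<le> 1 powr s" using t s by (intro powr_mono2) auto
          then show ?thesis using t by simp
        next
          case False
          then have "?t powr s \<le> ?t powr 1" using s by (intro powr_mono) auto
          then show ?thesis using t by simp
        qed
        have "?t \<le> (N + ?x) / N"
        proof (rule divide_right_mono)
          show "max 1 ?x \<le> N + ?x" using N(1) enn2real_nonneg[of "G z y"] by linarith
        qed (use N in simp)
        also have "\<dots> = 1 + ?x / N"
          using N by (simp add: add_divide_distrib)
        finally have *: "?t powr s \<le> 2 + ?x / N" using t1 by linarith
        have "max 1 ?x powr s = N powr s * ?t powr s"
          using N by (subst powr_mult[symmetric]) auto
        also have "\<dots> \<le> N powr s * (2 + ?x / N)"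
          using * by (intro mult_left_mono) auto
        finally have "A * max 1 ?x powr s \<le> A * (N powr s * (2 + ?x / N))"
          using A by (intro mult_left_mono)
        then have "\<bar>F z y\<bar> \<le> A * (N powr s * (2 + ?x / N))"
          using F[OF elim(2) y(1) fin False] by linarith
        then have "k z * \<bar>F z y\<bar> \<le> k z * (A * (N powr s * (2 + ?x / N)))"
          using kz by (intro mult_left_mono) auto
        also have "\<dots> = A * N powr s * (2 * k z + 1 / N * (k z * ?x))"
          by (simp add: algebra_simps)
        finally have "ennreal (k z * \<bar>F z y\<bar>) \<le> ennreal (A * N powr s * (2 * k z + 1 / N * (k z * ?x)))"
          by (rule ennreal_leI)
        also have "\<dots> = ennreal (A * N powr s) * (ennreal (2 * k z) + ennreal (1 / N * (k z * ?x)))"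
          using A N kz by (subst ennreal_mult, simp, simp, subst ennreal_plus, auto)
        also have "ennreal (1 / N * (k z * ?x)) = ennreal (1 / N) * (ennreal (k z) * ennreal ?x)"
          using N kz by (subst ennreal_mult, simp, simp, subst ennreal_mult, auto)
        also have "ennreal ?x = G z y" using fin by simp
        also have "ennreal (2 * k z) = 2 * ennreal (k z)" using kz by (subst ennreal_mult) auto
        finally show ?thesis .
      qed simp
    qed
    have "(\<integral>\<^sup>+z. ennreal (k z * \<bar>F z y\<bar>) \<partial>Z) \<le>
        (\<integral>\<^sup>+z. ennreal (A * N powr s) * (2 * ennreal (k z) + ennreal (1 / N) * (ennreal (k z) * G z y)) \<partial>Z)"
      using ae by (rule nn_integral_mono_AE)
    also have "\<dots> = ennreal (A * N powr s) * (2 * (\<integral>\<^sup>+z. ennreal (k z) \<partial>Z) + ennreal (1 / N) * g y)"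
      unfolding g_def by (simp add: nn_integral_cmult nn_integral_add)
    also have "\<dots> \<le> ennreal (A * N powr s) * (2 * 1 + 1)"
    proof (intro mult_left_mono add_mono k1)
      have "ennreal (1 / N) * g y = ennreal (1 / N * enn2real (g y))"
        using y(2) N by (subst ennreal_mult) auto
      also have "\<dots> \<le> 1" using N by (simp add: field_simps)
      finally show "ennreal (1 / N) * g y \<le> 1" .
    qed auto
    also have "\<dots> = ennreal (3 * A * N powr s)"
    proof -
      have "(2 * 1 + 1 :: ennreal) = ennreal 3" by simp
      moreover have "ennreal (A * N powr s) * ennreal 3 = ennreal (A * N powr s * 3)"
        using A by (intro ennreal_mult[symmetric]) auto
      ultimately show ?thesis by (simp add: mult_ac)
    qed
    finally have nn: "(\<integral>\<^sup>+z. ennreal (k z * \<bar>F z y\<bar>) \<partial>Z) \<le> ennreal (3 * A * N powr s)" .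
    have "(\<integral>z. k z * \<bar>F z y\<bar> \<partial>Z) \<le> 3 * A * N powr s"
    proof (cases "integrable Z (\<lambda>z. k z * \<bar>F z y\<bar>)")
      case True
      then have "(\<integral>\<^sup>+z. ennreal (k z * \<bar>F z y\<bar>) \<partial>Z) = ennreal (\<integral>z. k z * \<bar>F z y\<bar> \<partial>Z)"
        using k0 by (intro nn_integral_eq_integral) auto
      then show ?thesis using nn A by (simp add: ennreal_le_iff)
    next
      case False
      then show ?thesis using A by (simp add: not_integrable_integral_eq)
    qed
    moreover have "0 \<le> (\<integral>z. k z * \<bar>F z y\<bar> \<partial>Z)"
      using k0 by (intro integral_nonneg_AE) auto
    ultimately show "\<bar>\<integral>z. k z * \<bar>F z y\<bar> \<partial>Z\<bar> \<le> 3 * A * max 1 (enn2real (g y)) powr s"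
      by (simp add: N_def)
  qed (use A in simp)
qed

text \<open>The modular of \<open>L\<^sup>1\<^sup>/\<^sup>s\<close>: its integral over \<open>f\<close> is at most 1 iff the norm of \<open>f\<close> is at most \<open>A\<close>.
  For \<open>s = 0\<close> this needs the value \<open>\<infinity>\<close>.\<close>

definition modular :: "real \<Rightarrow> real \<Rightarrow> real \<Rightarrow> ennreal" where
  "modular s A x = (if s = 0 then (if \<bar>x\<bar> \<le> A then 0 else \<infinity>) else ennreal ((\<bar>x\<bar> / A) powr (1 / s)))"

lemma modular_bound:
  assumes "0 \<le> s" "0 < A" "modular s A x < \<infinity>"
  shows "\<bar>x\<bar> \<le> A * max 1 (enn2real (modular s A x)) powr s"
proof (cases "s = 0")
  case True
  then show ?thesis using assms by (auto simp: modular_def split: if_splits)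
next
  case False
  have "\<bar>x\<bar> / A = ((\<bar>x\<bar> / A) powr (1 / s)) powr s"
    using False assms by (simp add: powr_powr)
  also have "\<dots> \<le> max 1 ((\<bar>x\<bar> / A) powr (1 / s)) powr s"
    using assms by (intro powr_mono2) auto
  finally show ?thesis using False assms by (simp add: modular_def field_simps)
qed

lemma modular_antimono:
  assumes "0 \<le> s" "0 < A" "A \<le> B" "\<bar>x\<bar> \<le> \<bar>x'\<bar>"
  shows "modular s B x \<le> modular s A x'"
proof (cases "s = 0")
  case False
  have "\<bar>x\<bar> / B \<le> \<bar>x'\<bar> / A" using assms by (intro frac_le) auto
  then have "(\<bar>x\<bar> / B) powr (1 / s) \<le> (\<bar>x'\<bar> / A) powr (1 / s)"
    using False assms by (intro powr_mono2) auto
  then show ?thesis using False by (simp add: modular_def ennreal_leI)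
qed (use assms in \<open>auto simp: modular_def\<close>)

lemma borel_modular [measurable]: "modular s A \<in> borel_measurable borel"
  unfolding modular_def[abs_def] by (cases "s = 0"; simp; measurable)

lemma modular_0: "0 \<le> s \<Longrightarrow> 0 < A \<Longrightarrow> modular s A 0 = 0"
  by (simp add: modular_def)

lemma Lq_bound_modular:
  assumes "0 \<le> s" "0 < A" and [measurable]: "f \<in> borel_measurable M"
    and "(\<integral>\<^sup>+y. modular s A (f y) \<partial>M) \<le> 1"
  shows "Lq_bound M s A f"
  by (rule Lq_boundI[where g = "\<lambda>y. modular s A (f y)"]) (use assms modular_bound in auto)

section \<open>Rates of convergence\<close>

text \<open>\<open>F \<epsilon> = O(\<epsilon> powr \<kappa>)\<close> in \<open>L\<^sup>1\<^sup>/\<^sup>s\<close>, as \<open>\<epsilon> \<rightarrow> 0\<close>; the rate \<open>\<kappa>\<close> may be negative.\<close>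

definition decay :: "'a measure \<Rightarrow> real \<Rightarrow> real \<Rightarrow> (real \<Rightarrow> 'a \<Rightarrow> real) \<Rightarrow> bool" where
  "decay M s \<kappa> F \<longleftrightarrow> (\<exists>C. \<exists>e>0. \<forall>\<epsilon>. 0 < \<epsilon> \<longrightarrow> \<epsilon> < e \<longrightarrow> Lq_bound M s (C * \<epsilon> powr \<kappa>) (F \<epsilon>))"

lemma decayI:
  assumes "0 < e" "\<And>\<epsilon>. 0 < \<epsilon> \<Longrightarrow> \<epsilon> < e \<Longrightarrow> Lq_bound M s (C * \<epsilon> powr \<kappa>) (F \<epsilon>)"
  shows "decay M s \<kappa> F"
  using assms unfolding decay_def by blast

lemma decayD:
  assumes "decay M s \<kappa> F"
  shows "\<exists>C e. 0 < e \<and> e \<le> 1 \<and> 0 \<le> C \<and> (\<forall>\<epsilon>. 0 < \<epsilon> \<longrightarrow> \<epsilon> < e \<longrightarrow> Lq_bound M s (C * \<epsilon> powr \<kappa>) (F \<epsilon>))"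
proof -
  obtain C e where e: "0 < e" "\<forall>\<epsilon>. 0 < \<epsilon> \<longrightarrow> \<epsilon> < e \<longrightarrow> Lq_bound M s (C * \<epsilon> powr \<kappa>) (F \<epsilon>)"
    using assms unfolding decay_def by blast
  have "0 \<le> C * (e / 2) powr \<kappa>" using e(2)[rule_format, of "e / 2"] e(1) Lq_bound_nonneg by simp
  then have "0 \<le> C" using e(1) by (simp add: zero_le_mult_iff)
  then show ?thesis using e by (intro exI[of _ C] exI[of _ "min e 1"]) auto
qed

lemma decay_mono:
  assumes "decay M s \<kappa> H" "s \<le> s'" "\<kappa>' \<le> \<kappa>" "0 < e"
    and "\<And>\<epsilon> y. 0 < \<epsilon> \<Longrightarrow> \<epsilon> < e \<Longrightarrow> y \<in> space M \<Longrightarrow> \<bar>F \<epsilon> y\<bar> \<le> \<bar>H \<epsilon> y\<bar>"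
  shows "decay M s' \<kappa>' F"
proof -
  obtain C e1 where C: "0 < e1" "e1 \<le> 1" "0 \<le> C"
    "\<forall>\<epsilon>. 0 < \<epsilon> \<longrightarrow> \<epsilon> < e1 \<longrightarrow> Lq_bound M s (C * \<epsilon> powr \<kappa>) (H \<epsilon>)" using decayD[OF assms(1)] by blast
  show ?thesis
  proof (rule decayI[of "min e e1"])
    fix \<epsilon> assume e: "0 < \<epsilon>" "\<epsilon> < min e e1"
    have "\<epsilon> powr \<kappa> \<le> \<epsilon> powr \<kappa>'" using e C assms(3) by (intro powr_mono') auto
    then show "Lq_bound M s' (C * \<epsilon> powr \<kappa>') (F \<epsilon>)"
      using e C assms by (intro Lq_bound_mono[OF C(4)[rule_format, of \<epsilon>]] mult_left_mono) auto
  qed (use C assms in auto)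
qed

lemma decay_weaken: "decay M s \<kappa> F \<Longrightarrow> s \<le> s' \<Longrightarrow> \<kappa>' \<le> \<kappa> \<Longrightarrow> decay M s' \<kappa>' F"
  by (rule decay_mono[where e = 1 and H = F]) auto

lemma decay_bounded:
  assumes "0 < e" "\<And>\<epsilon> y. 0 < \<epsilon> \<Longrightarrow> \<epsilon> < e \<Longrightarrow> y \<in> space M \<Longrightarrow> \<bar>F \<epsilon> y\<bar> \<le> C * \<epsilon> powr \<kappa>" "0 \<le> C"
  shows "decay M 0 \<kappa> F"
proof (rule decayI[OF assms(1)], rule Lq_bound_const)
  fix \<epsilon> y assume e: "0 < \<epsilon>" "\<epsilon> < e"
  show "0 \<le> C * \<epsilon> powr \<kappa>" using assms(3) by simp
  assume "y \<in> space M"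
  with e show "\<bar>F \<epsilon> y\<bar> \<le> C * \<epsilon> powr \<kappa>" by (rule assms(2))
qed

lemma decay_mult:
  assumes "decay M s \<kappa> F" "decay M s' \<kappa>' H" "0 \<le> s" "0 \<le> s'"
  shows "decay M (s + s') (\<kappa> + \<kappa>') (\<lambda>\<epsilon> y. F \<epsilon> y * H \<epsilon> y)"
proof -
  obtain C e where C: "0 < e" "e \<le> 1" "0 \<le> C"
    "\<forall>\<epsilon>. 0 < \<epsilon> \<longrightarrow> \<epsilon> < e \<longrightarrow> Lq_bound M s (C * \<epsilon> powr \<kappa>) (F \<epsilon>)" using decayD[OF assms(1)] by blast
  obtain D e' where D: "0 < e'" "e' \<le> 1" "0 \<le> D"
    "\<forall>\<epsilon>. 0 < \<epsilon> \<longrightarrow> \<epsilon> < e' \<longrightarrow> Lq_bound M s' (D * \<epsilon> powr \<kappa>') (H \<epsilon>)" using decayD[OF assms(2)] by blast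
  show ?thesis
  proof (rule decayI[of "min e e'"])
    fix \<epsilon> assume e: "0 < \<epsilon>" "\<epsilon> < min e e'"
    show "Lq_bound M (s + s') ((2 powr (s + s') * C * D) * \<epsilon> powr (\<kappa> + \<kappa>')) (\<lambda>y. F \<epsilon> y * H \<epsilon> y)"
      using Lq_bound_mult[OF C(4)[rule_format, of \<epsilon>] D(4)[rule_format, of \<epsilon>] assms(3,4)] e by (simp add: powr_add mult_ac)
  qed (use C D in auto)
qed

lemma decay_add:
  assumes "decay M s \<kappa> F" "decay M s \<kappa> H" "0 \<le> s"
  shows "decay M s \<kappa> (\<lambda>\<epsilon> y. F \<epsilon> y + H \<epsilon> y)"
proof -
  obtain C e where C: "0 < e" "e \<le> 1" "0 \<le> C"
    "\<forall>\<epsilon>. 0 < \<epsilon> \<longrightarrow> \<epsilon> < e \<longrightarrow> Lq_bound M s (C * \<epsilon> powr \<kappa>) (F \<epsilon>)" using decayD[OF assms(1)] by blast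
  obtain D e' where D: "0 < e'" "e' \<le> 1" "0 \<le> D"
    "\<forall>\<epsilon>. 0 < \<epsilon> \<longrightarrow> \<epsilon> < e' \<longrightarrow> Lq_bound M s (D * \<epsilon> powr \<kappa>) (H \<epsilon>)" using decayD[OF assms(2)] by blast
  show ?thesis
  proof (rule decayI[of "min e e'"])
    fix \<epsilon> assume e: "0 < \<epsilon>" "\<epsilon> < min e e'"
    show "Lq_bound M s ((2 powr s * (C + D)) * \<epsilon> powr \<kappa>) (\<lambda>y. F \<epsilon> y + H \<epsilon> y)"
      using Lq_bound_add[OF C(4)[rule_format, of \<epsilon>] D(4)[rule_format, of \<epsilon>] assms(3)] e by (simp add: algebra_simps)
  qed (use C D in auto)
qed

lemma decay_uminus: "decay M s \<kappa> F \<Longrightarrow> decay M s \<kappa> (\<lambda>\<epsilon> y. - F \<epsilon> y)"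
  by (rule decay_mono[where H = F and e = 1]) auto

lemma decay_diff: "decay M s \<kappa> F \<Longrightarrow> decay M s \<kappa> H \<Longrightarrow> 0 \<le> s \<Longrightarrow> decay M s \<kappa> (\<lambda>\<epsilon> y. F \<epsilon> y - H \<epsilon> y)"
  using decay_add[OF _ decay_uminus] by fastforce

lemma decay_zero: "decay M s \<kappa> (\<lambda>_ _. 0)"
  by (rule decayI[of 1 _ _ 0]) (auto intro: Lq_boundI[of _ "\<lambda>_. 0"])

lemma decay_sum:
  assumes "finite I" "\<And>i. i \<in> I \<Longrightarrow> decay M s \<kappa> (F i)" "0 \<le> s"
  shows "decay M s \<kappa> (\<lambda>\<epsilon> y. \<Sum>i\<in>I. F i \<epsilon> y)"
  using assms by (induction I rule: finite_induct) (auto intro: decay_zero decay_add)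

lemma decay_powr:
  assumes "decay M s \<kappa> F" "0 \<le> \<gamma>"
  shows "decay M (\<gamma> * s) (\<gamma> * \<kappa>) (\<lambda>\<epsilon> y. \<bar>F \<epsilon> y\<bar> powr \<gamma>)"
proof -
  obtain C e where C: "0 < e" "e \<le> 1" "0 \<le> C"
    "\<forall>\<epsilon>. 0 < \<epsilon> \<longrightarrow> \<epsilon> < e \<longrightarrow> Lq_bound M s (C * \<epsilon> powr \<kappa>) (F \<epsilon>)" using decayD[OF assms(1)] by blast
  show ?thesis
  proof (rule decayI[OF C(1)])
    fix \<epsilon> assume e: "0 < \<epsilon>" "\<epsilon> < e"
    show "Lq_bound M (\<gamma> * s) (C powr \<gamma> * \<epsilon> powr (\<gamma> * \<kappa>)) (\<lambda>y. \<bar>F \<epsilon> y\<bar> powr \<gamma>)"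
      using Lq_bound_powr[OF C(4)[rule_format, OF e] assms(2)] C(3) by (simp add: powr_mult powr_powr mult.commute)
  qed
qed

text \<open>The form in which the limit \<open>\<epsilon> \<rightarrow> 0\<close> is taken: the pairing of the energy balance with a test
  function does not depend on \<open>\<epsilon>\<close>, but equals an integral of error terms.\<close>

lemma decay_integral_zero:
  assumes F: "decay M s \<kappa> F" and "s \<le> 1" "0 < \<kappa>" "emeasure M (space M) < \<infinity>" "0 < e"
    and X: "\<And>\<epsilon>. 0 < \<epsilon> \<Longrightarrow> \<epsilon> < e \<Longrightarrow> X = (\<integral>y. F \<epsilon> y \<partial>M)"
  shows "X = 0"
proof -
  obtain C e1 where C: "0 < e1" "e1 \<le> 1" "0 \<le> C"
    "\<forall>\<epsilon>. 0 < \<epsilon> \<longrightarrow> \<epsilon> < e1 \<longrightarrow> Lq_bound M s (C * \<epsilon> powr \<kappa>) (F \<epsilon>)" using decayD[OF F] by blast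
  define \<mu> where "\<mu> = enn2real (emeasure M (space M))"
  have \<mu>: "emeasure M (space M) = ennreal \<mu>" "0 \<le> \<mu>" using assms(4) by (auto simp: \<mu>_def)
  have bound: "\<bar>X\<bar> \<le> C * (\<mu> + 1) * \<epsilon> powr \<kappa>" if e: "0 < \<epsilon>" "\<epsilon> < min e e1" for \<epsilon>
  proof (cases "integrable M (F \<epsilon>)")
    case True
    have "ennreal \<bar>X\<bar> \<le> (\<integral>\<^sup>+y. ennreal \<bar>F \<epsilon> y\<bar> \<partial>M)"
      using integral_norm_bound_ennreal[OF True] X[of \<epsilon>] e by simp
    also have "\<dots> \<le> ennreal (C * \<epsilon> powr \<kappa>) * (ennreal \<mu> + 1)"
      using Lq_bound_integral[OF C(4)[rule_format] assms(2)] e \<mu> by simp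
    also have "\<dots> = ennreal (C * \<epsilon> powr \<kappa> * (\<mu> + 1))"
      using C \<mu> by (subst ennreal_mult) (auto simp: ennreal_plus)
    finally show ?thesis using C \<mu> by (simp add: ennreal_le_iff mult_ac)
  next
    case False
    then show ?thesis using X[of \<epsilon>] e C \<mu> by (simp add: not_integrable_integral_eq)
  qed
  have "((\<lambda>\<epsilon>. C * (\<mu> + 1) * \<epsilon> powr \<kappa>) \<longlongrightarrow> C * (\<mu> + 1) * 0 powr \<kappa>) (at_right 0)"
    using assms(3) by (intro tendsto_intros tendsto_powr') (auto simp: eventually_at_filter)
  then have "((\<lambda>\<epsilon>. C * (\<mu> + 1) * \<epsilon> powr \<kappa>) \<longlongrightarrow> 0) (at_right 0)" by simp
  moreover have "\<forall>\<^sub>F \<epsilon> in at_right 0. \<bar>X\<bar> \<le> C * (\<mu> + 1) * \<epsilon> powr \<kappa>"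
    using bound C assms(5) by (intro eventually_at_rightI[of 0 "min e e1"]) auto
  ultimately have "\<bar>X\<bar> \<le> 0" by (intro tendsto_lowerbound) auto
  then show ?thesis by simp
qed

section \<open>Pressure and regularised potentials\<close>

text \<open>If the range of densities contains vacuum, Hoelder continuity at \<open>0\<close> and \<open>p' 0 = 0\<close> control \<open>p'\<close>
  by \<open>s powr (\<gamma> - 1)\<close>; otherwise that power is bounded below.\<close>

lemma C1_Hoelder_bound:
  assumes "C1_Hoelder (\<gamma> - 1) lo hi p p'" "1 < \<gamma>" "0 \<le> lo" "lo = 0 \<Longrightarrow> p' 0 = 0"
  shows "\<exists>C\<ge>0. (\<forall>s\<in>{lo..hi}. \<bar>p' s\<bar> \<le> C * s powr (\<gamma> - 1)) \<and>
    (\<forall>s\<in>{lo..hi}. \<forall>t\<in>{lo..hi}. \<bar>p' s - p' t\<bar> \<le> C * \<bar>s - t\<bar> powr (\<gamma> - 1))"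
proof -
  obtain C where C: "\<And>s s'. s \<in> {lo..hi} \<Longrightarrow> s' \<in> {lo..hi} \<Longrightarrow> \<bar>p' s - p' s'\<bar> \<le> C * \<bar>s - s'\<bar> powr (\<gamma> - 1)"
    using assms(1) unfolding C1_Hoelder_def by blast
  define C1 where "C1 = max 0 C"
  have C1: "\<bar>p' s - p' s'\<bar> \<le> C1 * \<bar>s - s'\<bar> powr (\<gamma> - 1)" if "s \<in> {lo..hi}" "s' \<in> {lo..hi}" for s s'
    using C[OF that] mult_right_mono[of C C1 "\<bar>s - s'\<bar> powr (\<gamma> - 1)"] by (simp add: C1_def)
  show ?thesis
  proof (cases "lo = 0")
    case True
    have "\<bar>p' s\<bar> \<le> C1 * s powr (\<gamma> - 1)" if "s \<in> {lo..hi}" for s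
      using C1[OF that, of 0] True that assms(4) by simp
    then show ?thesis using C1 by (intro exI[of _ C1]) (auto simp: C1_def)
  next
    case False
    define K where "K = (\<bar>p' lo\<bar> + C1 * (hi - lo) powr (\<gamma> - 1)) / lo powr (\<gamma> - 1)"
    have lo: "lo > 0" using False assms by simp
    have K: "0 \<le> K" using lo by (auto simp: K_def C1_def)
    have "\<bar>p' s\<bar> \<le> K * s powr (\<gamma> - 1)" if s: "s \<in> {lo..hi}" for s
    proof -
      have "\<bar>p' s\<bar> \<le> \<bar>p' lo\<bar> + C1 * \<bar>s - lo\<bar> powr (\<gamma> - 1)"
        using C1[OF s, of lo] s by simp
      also have "C1 * \<bar>s - lo\<bar> powr (\<gamma> - 1) \<le> C1 * (hi - lo) powr (\<gamma> - 1)"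
        using s assms(2) by (intro mult_left_mono powr_mono2) (auto simp: C1_def)
      finally have "\<bar>p' s\<bar> \<le> K * lo powr (\<gamma> - 1)" using lo by (simp add: K_def)
      also have "\<dots> \<le> K * s powr (\<gamma> - 1)"
        using s lo K assms(2) by (intro mult_left_mono powr_mono2) auto
      finally show ?thesis .
    qed
    moreover have "\<bar>p' s - p' t\<bar> \<le> max C1 K * \<bar>s - t\<bar> powr (\<gamma> - 1)" if "s \<in> {lo..hi}" "t \<in> {lo..hi}" for s t
      using C1[OF that] mult_right_mono[of C1 "max C1 K" "\<bar>s - t\<bar> powr (\<gamma> - 1)"] by simp
    moreover have "K * s powr (\<gamma> - 1) \<le> max C1 K * s powr (\<gamma> - 1)" for s
      by (intro mult_right_mono) auto
    ultimately show ?thesis using K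
      by (intro exI[of _ "max C1 K"] conjI) (auto intro: order_trans, meson atLeastAtMost_iff order_trans)
  qed
qed

lemma mean_value_within:
  fixes f :: "real \<Rightarrow> real"
  assumes "a \<noteq> b" "\<And>x. x \<in> {min a b..max a b} \<Longrightarrow> (f has_real_derivative f' x) (at x within {min a b..max a b})"
  shows "\<exists>x\<in>{min a b<..<max a b}. f b - f a = f' x * (b - a)"
proof -
  have "\<exists>x\<in>{min a b<..<max a b}. f (max a b) - f (min a b) = f' x * (max a b - min a b)"
    by (rule mvt_simple) (use assms has_field_derivative_imp_has_derivative in auto)
  then obtain x where x: "x \<in> {min a b<..<max a b}"
    "f (max a b) - f (min a b) = f' x * (max a b - min a b)" by blast
  then have "f b - f a = f' x * (b - a)"
    by (cases "a \<le> b") (simp_all add: max_def min_def algebra_simps)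
  with x(1) show ?thesis by blast
qed

lemma C1_Hoelder_Taylor:
  assumes "C1_Hoelder (\<gamma> - 1) lo hi p p'" "1 < \<gamma>" "0 \<le> lo" "lo = 0 \<Longrightarrow> p' 0 = 0"
  shows "\<exists>C\<ge>0. \<forall>s\<in>{lo..hi}. \<forall>t\<in>{lo..hi}. \<bar>p s - p t\<bar> \<le> C * \<bar>s - t\<bar> \<and>
    \<bar>p s - p t - p' t * (s - t)\<bar> \<le> C * \<bar>s - t\<bar> powr \<gamma>"
proof -
  obtain C where C: "0 \<le> C" "\<And>s. s \<in> {lo..hi} \<Longrightarrow> \<bar>p' s\<bar> \<le> C * s powr (\<gamma> - 1)"
    "\<And>s t. s \<in> {lo..hi} \<Longrightarrow> t \<in> {lo..hi} \<Longrightarrow> \<bar>p' s - p' t\<bar> \<le> C * \<bar>s - t\<bar> powr (\<gamma> - 1)"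
    using C1_Hoelder_bound[OF assms] by blast
  have deriv: "(p has_real_derivative p' x) (at x within {lo..hi})" if "x \<in> {lo..hi}" for x
    using assms(1) that unfolding C1_Hoelder_def by blast
  define D where "D = max C (C * hi powr (\<gamma> - 1))"
  have "\<bar>p s - p t\<bar> \<le> D * \<bar>s - t\<bar> \<and> \<bar>p s - p t - p' t * (s - t)\<bar> \<le> D * \<bar>s - t\<bar> powr \<gamma>"
    if s: "s \<in> {lo..hi}" and t: "t \<in> {lo..hi}" for s t
  proof (cases "s = t")
    case False
    have sub: "{min t s..max t s} \<subseteq> {lo..hi}" using s t by auto
    then have "(p has_real_derivative p' x) (at x within {min t s..max t s})" if "x \<in> {min t s..max t s}" for x
      using that deriv[of x] by (blast intro: has_field_derivative_subset)
    then obtain x where x: "x \<in> {min t s<..<max t s}" "p s - p t = p' x * (s - t)"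
      using mean_value_within[of t s p p'] False by auto
    have xin: "x \<in> {lo..hi}" "\<bar>x - t\<bar> \<le> \<bar>s - t\<bar>" using x(1) s t by (auto simp: min_def max_def split: if_splits)
    have "\<bar>p' x\<bar> \<le> C * x powr (\<gamma> - 1)" using C(2) xin by blast
    also have "\<dots> \<le> C * hi powr (\<gamma> - 1)"
      using xin assms(2,3) C(1) by (intro mult_left_mono powr_mono2) auto
    also have "\<dots> \<le> D" by (simp add: D_def)
    finally have 1: "\<bar>p s - p t\<bar> \<le> D * \<bar>s - t\<bar>"
      unfolding x(2) abs_mult by (intro mult_right_mono) auto
    have "p s - p t - p' t * (s - t) = (p' x - p' t) * (s - t)" using x(2) by (simp add: algebra_simps)
    then have "\<bar>p s - p t - p' t * (s - t)\<bar> = \<bar>p' x - p' t\<bar> * \<bar>s - t\<bar>" by (simp add: abs_mult)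
    also have "\<dots> \<le> (C * \<bar>x - t\<bar> powr (\<gamma> - 1)) * \<bar>s - t\<bar>"
      by (intro mult_right_mono C(3) xin t) auto
    also have "\<dots> \<le> (C * \<bar>s - t\<bar> powr (\<gamma> - 1)) * \<bar>s - t\<bar>"
      using xin assms(2) C(1) by (intro mult_right_mono mult_left_mono powr_mono2) auto
    also have "\<dots> = C * \<bar>s - t\<bar> powr \<gamma>"
      using False by (simp add: powr_diff)
    also have "\<dots> \<le> D * \<bar>s - t\<bar> powr \<gamma>" by (intro mult_right_mono) (auto simp: D_def)
    finally show ?thesis using 1 by blast
  qed simp
  moreover have "D \<ge> 0" using C(1) by (simp add: D_def)
  ultimately show ?thesis by blast
qed

lemma Hoelder_continuous_on:
  fixes f :: "real \<Rightarrow> real"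
  assumes "\<And>s t. s \<in> S \<Longrightarrow> t \<in> S \<Longrightarrow> \<bar>f s - f t\<bar> \<le> C * \<bar>s - t\<bar> powr \<kappa>" "0 < \<kappa>"
  shows "continuous_on S f"
  unfolding continuous_on
proof
  fix x assume x: "x \<in> S"
  have "((\<lambda>s. C * \<bar>s - x\<bar> powr \<kappa>) \<longlongrightarrow> C * \<bar>x - x\<bar> powr \<kappa>) (at x within S)"
    using assms(2) by (intro tendsto_mult tendsto_const tendsto_powr' tendsto_rabs tendsto_diff tendsto_ident_at) auto
  then have lim: "((\<lambda>s. C * \<bar>s - x\<bar> powr \<kappa>) \<longlongrightarrow> 0) (at x within S)" by simp
  have "((\<lambda>s. f s - f x) \<longlongrightarrow> 0) (at x within S)"
    by (rule Lim_null_comparison[OF _ lim]) (use assms(1) x in \<open>auto simp: eventually_at_filter\<close>)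
  then show "(f \<longlongrightarrow> f x) (at x within S)" by (simp add: LIM_zero_iff)
qed

lemma antiderivative_real:
  fixes f :: "real \<Rightarrow> real"
  assumes "continuous_on UNIV f"
  shows "\<exists>F. \<forall>x. (F has_real_derivative f x) (at x)"
proof -
  have "\<exists>F. \<forall>x :: real. -\<infinity> < ereal x \<longrightarrow> ereal x < \<infinity> \<longrightarrow> (F has_vector_derivative f x) (at x)"
    using assms by (intro einterval_antiderivative) (auto simp: continuous_on_eq_continuous_at)
  then show ?thesis by (simp add: has_real_derivative_iff_has_vector_derivative)
qed

lemma interval_integral_inverse_square:
  fixes a b :: real
  assumes "0 < a" "a \<le> b"
  shows "set_integrable lborel {a..b} (\<lambda>x. 1 / x\<^sup>2)" "(LBINT x:{a..b}. 1 / x\<^sup>2) = 1 / a - 1 / b"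
proof -
  have int: "((\<lambda>x. 1 / x\<^sup>2) has_integral (- 1 / b) - (- 1 / a)) {a..b}"
    using assms by (intro fundamental_theorem_of_calculus)
      (auto intro!: derivative_eq_intros simp: has_real_derivative_iff_has_vector_derivative[symmetric] field_simps power2_eq_square)
  have "continuous_on {a..b} (\<lambda>x. 1 / x\<^sup>2)" using assms by (auto intro!: continuous_intros)
  then show s: "set_integrable lborel {a..b} (\<lambda>x. 1 / x\<^sup>2)" by (rule borel_integrable_atLeastAtMost')
  show "(LBINT x:{a..b}. 1 / x\<^sup>2) = 1 / a - 1 / b"
    using set_borel_integral_eq_integral(2)[OF s] integral_unique[OF int] by simp
qed

text \<open>Close to vacuum \<open>p\<close> is nearly constant, and the integral of \<open>1 / \<sigma>\<^sup>2\<close> over \<open>[s,h]\<close> is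
  \<open>1 / s - 1 / h\<close>; multiplication by \<open>s\<close> leaves \<open>p 0\<close> as \<open>s \<rightarrow> 0\<close>, with the sign of an integral taken
  from \<open>1\<close> down to \<open>s\<close>.\<close>

lemma pressure_potential_0:
  assumes "pressure_law_on 0 hi p"
  shows "pressure_potential p 0 = - p 0"
proof -
  define I where "I s = (LBINT \<sigma>=1..s. p \<sigma> / \<sigma>\<^sup>2)" for s :: real
  have int: "interval_lebesgue_integrable lborel 1 s (\<lambda>\<sigma>. p \<sigma> / \<sigma>\<^sup>2)" if "0 < s" "s \<le> 1" for s :: real
    using assms that unfolding pressure_law_on_def by simp
  have lim_p: "(p \<longlongrightarrow> p 0) (at_right 0)" using assms unfolding pressure_law_on_def by simp
  have "((\<lambda>s. s * I s) \<longlongrightarrow> - p 0) (at_right 0)"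
  proof (rule tendstoI)
    fix e :: real assume e: "0 < e"
    have "\<forall>\<^sub>F s in at_right 0. dist (p s) (p 0) < e / 2" using lim_p e by (intro tendstoD) auto
    then obtain a where a: "a > 0" "\<And>s. 0 < s \<Longrightarrow> s < a \<Longrightarrow> \<bar>p s - p 0\<bar> < e / 2"
      unfolding eventually_at_right_field dist_real_def by blast
    define h where "h = min (a / 2) (1 / 2)"
    have h: "0 < h" "h < 1" "h < a" using a by (auto simp: h_def)
    define B where "B = \<bar>I h\<bar> + \<bar>p 0\<bar> / h"
    have bound: "\<bar>s * I s - - p 0\<bar> \<le> s * B + e / 2" if s: "0 < s" "s \<le> h" for s
    proof -
      have "(LBINT \<sigma>=1..s. p \<sigma> / \<sigma>\<^sup>2) + (LBINT \<sigma>=s..h. p \<sigma> / \<sigma>\<^sup>2) = (LBINT \<sigma>=1..h. p \<sigma> / \<sigma>\<^sup>2)"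
      proof (rule interval_integral_sum)
        have "interval_lebesgue_integrable lborel s 1 (\<lambda>\<sigma>. p \<sigma> / \<sigma>\<^sup>2)"
          using int[of s] s h interval_integrable_endpoints_reverse by fastforce
        then show "interval_lebesgue_integrable lborel (min 1 (min (ereal s) (ereal h))) (max 1 (max (ereal s) (ereal h))) (\<lambda>\<sigma>. p \<sigma> / \<sigma>\<^sup>2)"
          by (cases "s = 1") (use s h in \<open>auto simp: min_def max_def one_ereal_def\<close>)
      qed
      then have I: "I s = I h - (LBINT \<sigma>:{s..h}. p \<sigma> / \<sigma>\<^sup>2)"
        using s h by (simp add: I_def interval_integral_Icc)
      have "interval_lebesgue_integrable lborel (ereal (s / 2)) 1 (\<lambda>\<sigma>. p \<sigma> / \<sigma>\<^sup>2)"
        using int[of "s / 2"] s h interval_integrable_endpoints_reverse by fastforce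
      then have "set_integrable lborel {s / 2<..<1} (\<lambda>\<sigma>. p \<sigma> / \<sigma>\<^sup>2)"
        using s h by (simp add: interval_lebesgue_integrable_def one_ereal_def)
      then have ip: "set_integrable lborel {s..h} (\<lambda>\<sigma>. p \<sigma> / \<sigma>\<^sup>2)"
        by (rule set_integrable_subset) (use s h in auto)
      note inv = interval_integral_inverse_square[OF s]
      have ic: "set_integrable lborel {s..h} (\<lambda>\<sigma>. c * (1 / \<sigma>\<^sup>2))" for c
        using inv(1) by (intro set_integrable_mult_right) auto
      have c: "(LBINT \<sigma>:{s..h}. c * (1 / \<sigma>\<^sup>2)) = c * (1 / s - 1 / h)" for c
        using inv(2) by (simp only: set_integral_mult_right)
      have up: "p \<sigma> / \<sigma>\<^sup>2 \<le> (p 0 + e / 2) * (1 / \<sigma>\<^sup>2)" and low: "(p 0 - e / 2) * (1 / \<sigma>\<^sup>2) \<le> p \<sigma> / \<sigma>\<^sup>2"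
        if "\<sigma> \<in> {s..h}" for \<sigma>
      proof -
        have "\<bar>p \<sigma> - p 0\<bar> < e / 2" by (rule a(2)) (use that s h in auto)
        then have "p \<sigma> \<le> p 0 + e / 2" "p 0 - e / 2 \<le> p \<sigma>" by linarith+
        then show "p \<sigma> / \<sigma>\<^sup>2 \<le> (p 0 + e / 2) * (1 / \<sigma>\<^sup>2)" "(p 0 - e / 2) * (1 / \<sigma>\<^sup>2) \<le> p \<sigma> / \<sigma>\<^sup>2"
          using mult_right_mono[of "p \<sigma>" "p 0 + e / 2" "1 / \<sigma>\<^sup>2"] mult_right_mono[of "p 0 - e / 2" "p \<sigma>" "1 / \<sigma>\<^sup>2"]
          by simp_all
      qed
      define Q where "Q = (LBINT \<sigma>:{s..h}. p \<sigma> / \<sigma>\<^sup>2)"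
      have Q: "Q \<le> (p 0 + e / 2) * (1 / s - 1 / h)" "(p 0 - e / 2) * (1 / s - 1 / h) \<le> Q"
        unfolding Q_def c[symmetric] by (intro set_integral_mono ip ic up low; assumption)+
      have sh: "0 \<le> 1 - s / h" "1 - s / h \<le> 1" "s * (1 / s - 1 / h) = 1 - s / h"
        using s h by (auto simp: field_simps)
      have "s * Q \<le> (p 0 + e / 2) * (s * (1 / s - 1 / h))" "(p 0 - e / 2) * (s * (1 / s - 1 / h)) \<le> s * Q"
        unfolding mult.left_commute[of _ s] using s by (intro mult_left_mono Q; simp)+
      then have "s * Q \<le> (p 0 + e / 2) * (1 - s / h)" "(p 0 - e / 2) * (1 - s / h) \<le> s * Q"
        unfolding sh(3) by blast+
      moreover have "(p 0 + e / 2) * z = p 0 * z + e / 2 * z" for z by (rule distrib_right)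
      moreover have "(p 0 - e / 2) * z = p 0 * z - e / 2 * z" for z by (rule left_diff_distrib)
      ultimately have "\<bar>s * Q - p 0 * (1 - s / h)\<bar> \<le> e / 2 * (1 - s / h)"
        by (simp only: abs_le_iff) linarith
      also have "\<dots> \<le> e / 2" using sh e by (simp add: mult_left_le)
      finally have "\<bar>s * Q - p 0 * (1 - s / h)\<bar> \<le> e / 2" .
      moreover have "s * I s + p 0 = s * I h + p 0 * (s / h) - (s * Q - p 0 * (1 - s / h))"
      proof -
        have "s * I s = s * I h - s * Q" unfolding Q_def I by (rule right_diff_distrib)
        then show ?thesis by (simp add: algebra_simps)
      qed
      moreover have "\<bar>s * I h\<bar> + \<bar>p 0 * (s / h)\<bar> = s * B"
        using s h by (simp add: B_def abs_mult distrib_left)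
      ultimately show ?thesis by linarith
    qed
    have "((\<lambda>s. s * B + e / 2) \<longlongrightarrow> 0 * B + e / 2) (at_right 0)" by (intro tendsto_intros)
    then have "\<forall>\<^sub>F s in at_right 0. s * B + e / 2 < e"
      using e by (intro order_tendstoD(2)[where y = "0 * B + e / 2"]) auto
    moreover have "\<forall>\<^sub>F s in at_right 0. 0 < s \<and> s \<le> h"
      using h by (intro eventually_at_rightI[of 0 h]) auto
    ultimately show "\<forall>\<^sub>F s in at_right 0. dist (s * I s) (- p 0) < e"
    proof eventually_elim
      case (elim s)
      then show ?case using bound[of s] unfolding dist_real_def by linarith
    qed
  qed
  then have "Lim (at_right 0) (\<lambda>s. s * I s) = - p 0" by (intro tendsto_Lim) auto
  then show ?thesis by (simp add: pressure_potential_def I_def)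
qed

lemma potential_integral_split:
  assumes "pressure_law_on lo hi p" "continuous_on {lo..hi} p" "0 < a" "lo \<le> a" "a \<le> b" "b \<le> hi"
  shows "(LBINT \<sigma>=1..b. p \<sigma> / \<sigma>\<^sup>2) = (LBINT \<sigma>=1..a. p \<sigma> / \<sigma>\<^sup>2) + (LBINT \<sigma>=a..b. p \<sigma> / \<sigma>\<^sup>2)"
proof -
  have int: "interval_lebesgue_integrable lborel 1 s (\<lambda>\<sigma>. p \<sigma> / \<sigma>\<^sup>2)" if "s \<in> {a, b}" for s :: real
  proof -
    have "0 < s" "min 1 lo \<le> s" "s \<le> max 1 hi" using that assms(3-6) by auto
    then show ?thesis using assms(1) unfolding pressure_law_on_def by blast
  qed
  have cont: "continuous_on {a..b} (\<lambda>\<sigma>. p \<sigma> / \<sigma>\<^sup>2)"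
    using assms by (intro continuous_intros continuous_on_subset[OF assms(2)]) auto
  have "interval_lebesgue_integrable lborel (min 1 (min (ereal a) (ereal b))) (max 1 (max (ereal a) (ereal b))) (\<lambda>\<sigma>. p \<sigma> / \<sigma>\<^sup>2)"
  proof -
    consider "1 \<le> a" | "b \<le> 1" | "a \<le> 1" "1 \<le> b" by linarith
    then show ?thesis
    proof cases
      case 1
      then show ?thesis using int[of b] assms(5) by (simp add: min_def max_def one_ereal_def)
    next
      case 2
      have "interval_lebesgue_integrable lborel a 1 (\<lambda>\<sigma>. p \<sigma> / \<sigma>\<^sup>2)"
        using int[of a] interval_integrable_endpoints_reverse by fastforce
      then show ?thesis
        by (cases "a = 1") (use 2 assms(5) in \<open>auto simp: min_def max_def one_ereal_def\<close>)
    next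
      case 3
      have "interval_lebesgue_integrable lborel a b (\<lambda>\<sigma>. p \<sigma> / \<sigma>\<^sup>2)"
        using cont assms(5) by (intro interval_integrable_continuous_on)
      then show ?thesis using 3 assms(5) by (auto simp add: min_def max_def one_ereal_def)
    qed
  qed
  then show ?thesis by (rule interval_integral_sum[symmetric])
qed

text \<open>Regularised potentials: \<open>b'' s = p' s / max s \<delta>\<close> instead of \<open>P'' s = p' s / s\<close>. The induced
  pressure \<open>s * b' s - b s\<close> has derivative \<open>s * b'' s\<close>, hence deviates from \<open>p\<close> only below \<open>\<delta>\<close>, where
  \<open>p'\<close> is of order \<open>\<delta> powr (\<gamma> - 1)\<close> and the deviation of order \<open>\<delta> powr \<gamma>\<close>. The deviation of \<open>b\<close> from
  \<open>P\<close> is recovered from it by the equation \<open>(P s / s)' = p s / s\<^sup>2\<close>, which \<open>b\<close> satisfies with its own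
  pressure.\<close>

lemma regularised_potential:
  assumes hoelder: "C1_Hoelder (\<gamma> - 1) lo hi p p'" and \<gamma>: "1 < \<gamma>" "\<gamma> < 2"
    and lo: "0 \<le> lo" "lo \<le> hi" "lo = 0 \<Longrightarrow> p' 0 = 0"
    and law: "pressure_law_on lo hi p"
  shows "\<exists>C\<ge>0. \<forall>\<delta>. 0 < \<delta> \<longrightarrow> \<delta> \<le> 1 \<longrightarrow> (\<exists>b b' b''.
    (\<forall>s. (b has_real_derivative b' s) (at s)) \<and> (\<forall>s. (b' has_real_derivative b'' s) (at s)) \<and>
    continuous_on UNIV b'' \<and>
    (\<forall>s\<in>{lo..hi}. \<bar>b'' s\<bar> \<le> C * \<delta> powr (\<gamma> - 2) \<and> \<bar>b' s\<bar> \<le> C * \<delta> powr (\<gamma> - 2) \<and>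
       \<bar>s * b' s - b s - p s\<bar> \<le> C * \<delta> powr \<gamma> \<and> \<bar>b s - pressure_potential p s\<bar> \<le> C * \<delta> powr \<gamma>))"
proof -
  let ?P = "pressure_potential p"
  obtain C where C: "0 \<le> C" "\<And>s. s \<in> {lo..hi} \<Longrightarrow> \<bar>p' s\<bar> \<le> C * s powr (\<gamma> - 1)"
    "\<And>s t. s \<in> {lo..hi} \<Longrightarrow> t \<in> {lo..hi} \<Longrightarrow> \<bar>p' s - p' t\<bar> \<le> C * \<bar>s - t\<bar> powr (\<gamma> - 1)"
    using C1_Hoelder_bound[OF hoelder \<gamma>(1) lo(1,3)] by blast
  have deriv_p: "(p has_real_derivative p' x) (at x within {lo..hi})" if "x \<in> {lo..hi}" for x
    using hoelder that unfolding C1_Hoelder_def by blast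
  then have cont_p: "continuous_on {lo..hi} p" by (intro DERIV_continuous_on)
  \<comment> \<open>The coefficients are continued by constants, so that the potentials are defined on the whole line.\<close>
  define cl where "cl s = max lo (min hi s)" for s
  have cl_in: "cl s \<in> {lo..hi}" for s using lo by (auto simp: cl_def)
  have cl_id: "cl s = s" if "s \<in> {lo..hi}" for s using that by (auto simp: cl_def)
  have "continuous_on {lo..hi} p'"
    using \<gamma> by (intro Hoelder_continuous_on[OF C(3)]) auto
  then have cont_p': "continuous_on UNIV (\<lambda>s. p' (cl s))"
    by (rule continuous_on_compose2) (use cl_in in \<open>auto simp: cl_def intro!: continuous_intros\<close>)
  \<comment> \<open>The value of \<open>b'\<close> at \<open>hi\<close> for which \<open>b hi = P hi\<close> once the pressures agree there.\<close>
  define c1 where "c1 = (?P hi + p hi) / hi"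
  define D where "D = \<bar>c1\<bar> + C * hi + C"
  have D: "C \<le> D" "0 \<le> D" "\<bar>c1\<bar> + C * hi \<le> D" using C(1) lo by (auto simp: D_def)
  show ?thesis
  proof (intro exI[of _ D] conjI allI impI)
    fix \<delta> :: real assume \<delta>: "0 < \<delta>" "\<delta> \<le> 1"
    define f where "f s = p' (cl s) / max s \<delta>" for s
    have cont_f: "continuous_on UNIV f"
      unfolding f_def[abs_def] using \<delta> by (intro continuous_intros cont_p') auto
    have "continuous_on UNIV (\<lambda>s. s * f s)" by (intro continuous_intros cont_f)
    then obtain H0 where H0: "\<And>s. (H0 has_real_derivative s * f s) (at s)" using antiderivative_real by blast
    obtain G0 where G0: "\<And>s. (G0 has_real_derivative f s) (at s)" using antiderivative_real[OF cont_f] by blast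
    \<comment> \<open>\<open>b\<close> is recovered from \<open>b'\<close> and its pressure \<open>q\<close>, not by a third integration.\<close>
    define b' where "b' s = G0 s - G0 hi + c1" for s
    define q where "q s = H0 s - H0 hi + p hi" for s
    define b where "b s = s * b' s - q s" for s
    have db': "(b' has_real_derivative f s) (at s)" for s
      unfolding b'_def[abs_def] using G0 by (auto intro!: derivative_eq_intros)
    have dq: "(q has_real_derivative s * f s) (at s)" for s
      unfolding q_def[abs_def] using H0 by (auto intro!: derivative_eq_intros)
    have db: "(b has_real_derivative b' s) (at s)" for s
      unfolding b_def[abs_def] using db' dq by (auto intro!: derivative_eq_intros)
    have \<delta>\<gamma>: "\<delta> powr (\<gamma> - 1) = \<delta> powr (\<gamma> - 2) * \<delta>" "\<delta> powr \<gamma> = \<delta> powr (\<gamma> - 1) * \<delta>" "1 \<le> \<delta> powr (\<gamma> - 2)"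
    proof -
      have "\<delta> powr (\<gamma> - 2) * \<delta> powr 1 = \<delta> powr (\<gamma> - 1)" by (subst powr_add[symmetric]) simp
      then show "\<delta> powr (\<gamma> - 1) = \<delta> powr (\<gamma> - 2) * \<delta>" using \<delta> by simp
      have "\<delta> powr (\<gamma> - 1) * \<delta> powr 1 = \<delta> powr \<gamma>" by (subst powr_add[symmetric]) simp
      then show "\<delta> powr \<gamma> = \<delta> powr (\<gamma> - 1) * \<delta>" using \<delta> by simp
      have "\<delta> powr 0 \<le> \<delta> powr (\<gamma> - 2)" using \<delta> \<gamma> by (intro powr_mono') auto
      then show "1 \<le> \<delta> powr (\<gamma> - 2)" using \<delta> by simp
    qed
    have f_bound: "\<bar>f s\<bar> \<le> C * \<delta> powr (\<gamma> - 2)" if s: "s \<in> {lo..hi}" for s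
    proof -
      have "\<bar>f s\<bar> = \<bar>p' s\<bar> / max s \<delta>" using \<delta> by (simp add: f_def cl_id[OF s] abs_divide)
      also have "\<dots> \<le> (C * s powr (\<gamma> - 1)) / max s \<delta>"
        using \<delta> C(2)[OF s] by (intro divide_right_mono) auto
      also have "\<dots> \<le> (C * max s \<delta> powr (\<gamma> - 1)) / max s \<delta>"
        using \<delta> C(1) s lo \<gamma> by (intro divide_right_mono mult_left_mono powr_mono2) auto
      also have "\<dots> = C * max s \<delta> powr (\<gamma> - 2)"
      proof -
        have "max s \<delta> powr (\<gamma> - 2) * max s \<delta> powr 1 = max s \<delta> powr (\<gamma> - 1)"
          by (subst powr_add[symmetric]) simp
        then show ?thesis using \<delta> by (simp add: field_simps)
      qed
      also have "\<dots> \<le> C * \<delta> powr (\<gamma> - 2)"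
        using \<delta> C(1) \<gamma> by (intro mult_left_mono powr_mono2') auto
      finally show ?thesis .
    qed
    have b'_bound: "\<bar>b' s\<bar> \<le> (\<bar>c1\<bar> + C * hi) * \<delta> powr (\<gamma> - 2)" if s: "s \<in> {lo..hi}" for s
    proof (cases "s = hi")
      case True
      have "\<bar>c1\<bar> * 1 + 0 \<le> \<bar>c1\<bar> * \<delta> powr (\<gamma> - 2) + C * hi * \<delta> powr (\<gamma> - 2)"
        using \<delta>\<gamma>(3) C(1) lo by (intro add_mono mult_left_mono) auto
      then show ?thesis using True by (simp add: b'_def algebra_simps)
    next
      case False
      have "\<exists>x\<in>{min s hi<..<max s hi}. b' hi - b' s = f x * (hi - s)"
        by (rule mean_value_within) (use False db' in \<open>auto intro: has_field_derivative_at_within\<close>)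
      then obtain x where x0: "x \<in> {min s hi<..<max s hi}" and x: "b' hi - b' s = f x * (hi - s)"
        by blast
      from x0 s have xin: "x \<in> {lo..hi}" by auto
      have "\<bar>b' s\<bar> \<le> \<bar>c1\<bar> + \<bar>f x\<bar> * \<bar>hi - s\<bar>"
        using x by (simp add: b'_def flip: abs_mult)
      also have "\<dots> \<le> \<bar>c1\<bar> * \<delta> powr (\<gamma> - 2) + (C * \<delta> powr (\<gamma> - 2)) * hi"
      proof (intro add_mono mult_mono f_bound xin)
        show "\<bar>c1\<bar> \<le> \<bar>c1\<bar> * \<delta> powr (\<gamma> - 2)"
          using mult_left_mono[OF \<delta>\<gamma>(3), of "\<bar>c1\<bar>"] by simp
      qed (use s lo C(1) in auto)
      finally show ?thesis by (simp add: algebra_simps)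
    qed
    \<comment> \<open>The pressure deviation is integrated downwards from \<open>hi\<close>, where it vanishes.\<close>
    define d where "d s = p s - q s" for s
    have dd: "(d has_real_derivative p' s - s * f s) (at s within S)" if "s \<in> {lo..hi}" "S \<subseteq> {lo..hi}" for s S
      unfolding d_def[abs_def]
      by (intro DERIV_diff has_field_derivative_subset[OF deriv_p[OF that(1)] that(2)]
            has_field_derivative_at_within[OF dq])
    have d_hi: "d hi = 0" by (simp add: d_def q_def)
    have d_above: "d s = 0" if s: "s \<in> {lo..hi}" "\<delta> \<le> s" for s
    proof (cases "s = hi")
      case False
      have "\<exists>x\<in>{min s hi<..<max s hi}. d hi - d s = (p' x - x * f x) * (hi - s)"
        by (rule mean_value_within) (use False dd s in \<open>auto simp: subset_iff\<close>)
      then obtain x where x0: "x \<in> {min s hi<..<max s hi}" and x3: "d hi - d s = (p' x - x * f x) * (hi - s)"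
        by blast
      from x0 s have x: "x \<in> {lo..hi}" "\<delta> < x" by auto
      have "x * f x = p' x" using x \<delta> by (simp add: f_def cl_id max_def)
      then show ?thesis using x3 d_hi by simp
    qed (use d_hi in simp)
    have d_bound: "\<bar>d s\<bar> \<le> C * \<delta> powr \<gamma>" if s: "s \<in> {lo..hi}" for s
    proof (cases "\<delta> \<le> s \<or> s = hi")
      case True
      then show ?thesis using d_above[OF s] d_hi C(1) by auto
    next
      case False
      define t where "t = min \<delta> hi"
      have t: "s < t" "t \<in> {lo..hi}" "t \<le> \<delta>" "d t = 0"
        using False s d_hi d_above[of \<delta>] by (auto simp: t_def min_def)
      have "\<exists>x\<in>{min s t<..<max s t}. d t - d s = (p' x - x * f x) * (t - s)"
        by (rule mean_value_within) (use t s dd in \<open>auto simp: subset_iff\<close>)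
      then obtain x where x0: "x \<in> {min s t<..<max s t}" and x4: "d t - d s = (p' x - x * f x) * (t - s)"
        by blast
      from x0 s t lo have x: "x \<in> {lo..hi}" "x < \<delta>" "0 \<le> x" by auto
      have "x * f x = p' x * (x / \<delta>)" using x \<delta> by (simp add: f_def cl_id max_def)
      then have "p' x - x * f x = p' x * (1 - x / \<delta>)" by (simp add: algebra_simps)
      moreover have "\<bar>1 - x / \<delta>\<bar> \<le> 1" using x \<delta> by (auto simp: abs_le_iff field_simps)
      ultimately have "\<bar>p' x - x * f x\<bar> \<le> \<bar>p' x\<bar>" by (simp add: abs_mult mult_left_le)
      also have "\<dots> \<le> C * \<delta> powr (\<gamma> - 1)"
        using C(2)[OF x(1)] mult_left_mono[OF powr_mono2[of "\<gamma> - 1" x \<delta>] C(1)] x \<gamma> by simp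
      finally have *: "\<bar>p' x - x * f x\<bar> \<le> C * \<delta> powr (\<gamma> - 1)" .
      have "\<bar>d s\<bar> \<le> (C * \<delta> powr (\<gamma> - 1)) * \<delta>"
      proof -
        have "\<bar>d s\<bar> = \<bar>p' x - x * f x\<bar> * \<bar>t - s\<bar>"
          using x4 t(4) by (simp flip: abs_mult)
        also have "\<dots> \<le> (C * \<delta> powr (\<gamma> - 1)) * \<delta>"
          using * t(1,3) s lo C(1) by (intro mult_mono) auto
        finally show ?thesis .
      qed
      then show ?thesis using \<delta>\<gamma>(2) by simp
    qed
    have P_pos: "?P s = s * (LBINT \<sigma>=1..s. p \<sigma> / \<sigma>\<^sup>2)" if "0 < s" for s
      using that by (simp add: pressure_potential_def)
    have P_bound: "\<bar>b s - ?P s\<bar> \<le> C * \<delta> powr \<gamma>" if s: "s \<in> {lo..hi}" for s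
    proof (cases "s = 0")
      case True
      then have "lo = 0" using s lo by auto
      then have "?P 0 = - p 0" using law pressure_potential_0 by blast
      then have "b s - ?P s = d s" using True by (simp add: b_def d_def)
      then show ?thesis using d_bound[OF s] by simp
    next
      case False
      then have s0: "0 < s" using s lo by auto
      define I where "I x = (LBINT \<sigma>=1..s. p \<sigma> / \<sigma>\<^sup>2) + (LBINT \<sigma>=s..x. p \<sigma> / \<sigma>\<^sup>2)" for x :: real
      have I: "?P x = x * I x" if "x \<in> {s..hi}" for x
        using P_pos[of x] potential_integral_split[OF law cont_p s0, of x] that s s0 by (simp add: I_def)
      have cont: "continuous_on {s..hi} (\<lambda>\<sigma>. p \<sigma> / \<sigma>\<^sup>2)"
        using s s0 by (intro continuous_intros continuous_on_subset[OF cont_p]) auto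
      have dI: "(I has_real_derivative p x / x\<^sup>2) (at x within {s..hi})" if "x \<in> {s..hi}" for x
      proof -
        have "((\<lambda>x. LBINT \<sigma>=s..x. p \<sigma> / \<sigma>\<^sup>2) has_vector_derivative p x / x\<^sup>2) (at x within {s..hi})"
          by (rule interval_integral_FTC2[OF _ _ cont]) (use s that in auto)
        then have "((\<lambda>x. LBINT \<sigma>=s..x. p \<sigma> / \<sigma>\<^sup>2) has_real_derivative p x / x\<^sup>2) (at x within {s..hi})"
          by (simp only: has_real_derivative_iff_has_vector_derivative)
        from DERIV_add[OF DERIV_const this] show ?thesis unfolding I_def[abs_def] by simp
      qed
      \<comment> \<open>\<open>E\<close> is \<open>(P - b) / x\<close>, with derivative \<open>d x / x\<^sup>2\<close>.\<close>
      define E where "E x = I x - b x / x" for x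
      have dE: "(E has_real_derivative d x / x\<^sup>2) (at x within {s..hi})" if x: "x \<in> {s..hi}" for x
      proof -
        have "((\<lambda>x. b x / x) has_real_derivative (b' x * x - b x * 1) / (x * x)) (at x within {s..hi})"
          using x s0 by (intro DERIV_divide has_field_derivative_at_within[OF db] DERIV_ident) auto
        then have "(E has_real_derivative p x / x\<^sup>2 - (b' x * x - b x * 1) / (x * x)) (at x within {s..hi})"
          unfolding E_def[abs_def] by (intro DERIV_diff dI[OF x])
        moreover have "p x / x\<^sup>2 - (b' x * x - b x * 1) / (x * x) = d x / x\<^sup>2"
          by (simp add: b_def d_def power2_eq_square diff_divide_distrib algebra_simps)
        ultimately show ?thesis by simp
      qed
      have hi0: "0 < hi" using s s0 by auto
      have E_hi: "E hi = 0"
      proof -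
        have "b hi = ?P hi" using hi0 by (simp add: b_def b'_def q_def c1_def)
        then show ?thesis using I[of hi] s hi0 by (simp add: E_def)
      qed
      \<comment> \<open>A function whose derivative dominates that of \<open>E\<close>: both \<open>h + E\<close> and \<open>h - E\<close> increase.\<close>
      define h where "h x = - (C * \<delta> powr \<gamma>) / x" for x
      have dh: "(h has_real_derivative C * \<delta> powr \<gamma> / x\<^sup>2) (at x)" if "0 < x" for x
        unfolding h_def[abs_def] using that by (auto intro!: derivative_eq_intros simp: power2_eq_square)
      have mono: "h s + c * E s \<le> h hi + c * E hi" if c: "\<bar>c\<bar> = 1" for c
      proof (rule DERIV_nonneg_imp_increasing_open[of s hi "\<lambda>x. h x + c * E x"])
        fix x assume x: "s < x" "x < hi"
        have "(E has_real_derivative d x / x\<^sup>2) (at x)"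
          using dE[of x] x at_within_Icc_at[of s x hi] by simp
        then have "((\<lambda>x. h x + c * E x) has_real_derivative C * \<delta> powr \<gamma> / x\<^sup>2 + c * (d x / x\<^sup>2)) (at x)"
          using x s0 by (intro DERIV_add DERIV_cmult dh) auto
        moreover have "0 \<le> C * \<delta> powr \<gamma> / x\<^sup>2 + c * (d x / x\<^sup>2)"
        proof -
          have "\<bar>c * d x\<bar> \<le> C * \<delta> powr \<gamma>" using d_bound[of x] x s c by (simp add: abs_mult)
          then have "0 \<le> (C * \<delta> powr \<gamma> + c * d x) / x\<^sup>2" by (intro divide_nonneg_nonneg) auto
          then show ?thesis by (simp add: add_divide_distrib)
        qed
        ultimately show "\<exists>y. ((\<lambda>x. h x + c * E x) has_real_derivative y) (at x) \<and> 0 \<le> y" by blast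
      next
        have "continuous_on {s..hi} E" using dE by (rule DERIV_continuous_on)
        moreover have "continuous_on {s..hi} h"
          unfolding h_def[abs_def] using s0 by (intro continuous_intros) auto
        ultimately show "continuous_on {s..hi} (\<lambda>x. h x + c * E x)" by (intro continuous_intros)
      qed (use s in auto)
      have "h hi \<le> 0" using C(1) hi0 by (simp add: h_def)
      then have "\<bar>E s\<bar> \<le> - h s" using mono[of 1] mono[of "-1"] E_hi by (simp add: abs_le_iff)
      then have "s * \<bar>E s\<bar> \<le> C * \<delta> powr \<gamma>" using s0 by (simp add: h_def field_simps)
      moreover have "b s - ?P s = - (s * E s)"
        using I[of s] s s0 by (simp add: E_def algebra_simps)
      ultimately show ?thesis using s0 by (simp add: abs_mult)
    qed
    have CD: "C * \<delta> powr x \<le> D * \<delta> powr x" "(\<bar>c1\<bar> + C * hi) * \<delta> powr x \<le> D * \<delta> powr x" for x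
      using D by (auto intro: mult_right_mono)
    have dq: "s * b' s - b s - p s = - d s" for s by (simp add: b_def d_def)
    show "\<exists>b b' b''. (\<forall>s. (b has_real_derivative b' s) (at s)) \<and> (\<forall>s. (b' has_real_derivative b'' s) (at s)) \<and>
      continuous_on UNIV b'' \<and>
      (\<forall>s\<in>{lo..hi}. \<bar>b'' s\<bar> \<le> D * \<delta> powr (\<gamma> - 2) \<and> \<bar>b' s\<bar> \<le> D * \<delta> powr (\<gamma> - 2) \<and>
         \<bar>s * b' s - b s - p s\<bar> \<le> D * \<delta> powr \<gamma> \<and> \<bar>b s - ?P s\<bar> \<le> D * \<delta> powr \<gamma>)"
    proof (rule exI[of _ b], rule exI[of _ b'], rule exI[of _ f], intro conjI allI ballI)
      fix s assume s: "s \<in> {lo..hi}"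
      show "\<bar>f s\<bar> \<le> D * \<delta> powr (\<gamma> - 2)" using f_bound[OF s] CD by (meson order_trans)
      show "\<bar>b' s\<bar> \<le> D * \<delta> powr (\<gamma> - 2)" using b'_bound[OF s] CD by (meson order_trans)
      show "\<bar>s * b' s - b s - p s\<bar> \<le> D * \<delta> powr \<gamma>" unfolding dq abs_minus_cancel using d_bound[OF s] CD by (meson order_trans)
      show "\<bar>b s - ?P s\<bar> \<le> D * \<delta> powr \<gamma>" using P_bound[OF s] CD by (meson order_trans)
    qed (rule db db' cont_f)+
  qed (use D in auto)
qed

section \<open>Functions with a directional derivative\<close>

lemma has_pdiff_along_line:
  assumes "has_pdiff b f f'"
  shows "((\<lambda>s. f (y + s *\<^sub>R b)) has_real_derivative f' (y + s *\<^sub>R b)) (at s)"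
proof -
  have "((\<lambda>h. f ((y + s *\<^sub>R b) + h *\<^sub>R b)) has_real_derivative f' (y + s *\<^sub>R b)) (at 0)"
    using assms unfolding has_pdiff_def by blast
  then have "((\<lambda>h. f (y + (h + s) *\<^sub>R b)) has_real_derivative f' (y + s *\<^sub>R b)) (at 0)"
    by (simp add: algebra_simps)
  then show ?thesis using DERIV_shift[of "\<lambda>s. f (y + s *\<^sub>R b)" _ 0 s] by simp
qed

lemma has_pdiff_Lipschitz:
  assumes "has_pdiff b f f'" "\<And>y. \<bar>f' y\<bar> \<le> B"
  shows "\<bar>f (y + h *\<^sub>R b) - f y\<bar> \<le> B * \<bar>h\<bar>"
proof (cases "h = 0")
  case False
  have "\<exists>x\<in>{min 0 h<..<max 0 h}. f (y + h *\<^sub>R b) - f (y + 0 *\<^sub>R b) = f' (y + x *\<^sub>R b) * (h - 0)"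
    by (rule mean_value_within[where f = "\<lambda>s. f (y + s *\<^sub>R b)"])
       (use False has_pdiff_along_line[OF assms(1)] in \<open>auto intro: has_field_derivative_at_within\<close>)
  then obtain x where "f (y + h *\<^sub>R b) - f y = f' (y + x *\<^sub>R b) * h" by auto
  then show ?thesis using assms(2) by (simp add: abs_mult mult_right_mono)
qed simp

lemma has_pdiff_quotient:
  assumes "has_pdiff b f f'" "\<And>i. X i \<noteq> 0" "X \<longlonglongrightarrow> 0"
  shows "(\<lambda>i. (f (y + X i *\<^sub>R b) - f y) / X i) \<longlonglongrightarrow> f' y"
proof -
  have "((\<lambda>h. (f (y + h *\<^sub>R b) - f y) / h) \<longlongrightarrow> f' y) (at 0)"
    using assms(1) unfolding has_pdiff_def DERIV_def by simp
  then show ?thesis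
    using assms(2,3) unfolding tendsto_at_iff_sequentially comp_def by auto
qed

text \<open>The functions to which dominated convergence of difference quotients applies. They are closed
  under the operations that build the regularised energy flux.\<close>

definition bounded_pdiff :: "'a::real_normed_vector \<Rightarrow> ('a \<Rightarrow> real) \<Rightarrow> ('a \<Rightarrow> real) \<Rightarrow> bool" where
  "bounded_pdiff b f f' \<longleftrightarrow> f \<in> borel_measurable borel \<and> has_pdiff b f f' \<and>
     (\<exists>B. \<forall>y. \<bar>f y\<bar> \<le> B \<and> \<bar>f' y\<bar> \<le> B)"

lemma bounded_pdiffI:
  assumes "f \<in> borel_measurable borel" "has_pdiff b f f'" "\<And>y. \<bar>f y\<bar> \<le> B" "\<And>y. \<bar>f' y\<bar> \<le> B'"
  shows "bounded_pdiff b f f'"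
proof -
  have "\<bar>f y\<bar> \<le> max B B' \<and> \<bar>f' y\<bar> \<le> max B B'" for y
    using assms(3,4)[of y] by auto
  then show ?thesis using assms(1,2) unfolding bounded_pdiff_def by blast
qed

lemma bounded_pdiffD:
  assumes "bounded_pdiff b f f'"
  shows "f \<in> borel_measurable borel" "has_pdiff b f f'" "\<exists>B\<ge>0. \<forall>y. \<bar>f y\<bar> \<le> B \<and> \<bar>f' y\<bar> \<le> B"
proof -
  obtain B where B: "\<And>y. \<bar>f y\<bar> \<le> B \<and> \<bar>f' y\<bar> \<le> B"
    using assms unfolding bounded_pdiff_def by blast
  then have "0 \<le> B" using abs_ge_zero order_trans by blast
  then show "\<exists>B\<ge>0. \<forall>y. \<bar>f y\<bar> \<le> B \<and> \<bar>f' y\<bar> \<le> B" using B by blast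
qed (use assms in \<open>auto simp: bounded_pdiff_def\<close>)

lemma bounded_pdiff_borel_deriv:
  assumes "bounded_pdiff b f (f' :: 'a::euclidean_space \<Rightarrow> real)"
  shows "f' \<in> borel_measurable borel"
proof (rule borel_measurable_LIMSEQ_real)
  note [measurable] = bounded_pdiffD(1)[OF assms]
  show "(\<lambda>i. (f (y + (1 / real (Suc i)) *\<^sub>R b) - f y) / (1 / real (Suc i))) \<longlonglongrightarrow> f' y" for y
    by (rule has_pdiff_quotient[OF bounded_pdiffD(2)[OF assms]]) (simp, rule LIMSEQ_Suc[OF lim_1_over_n])
  show "(\<lambda>y. (f (y + (1 / real (Suc i)) *\<^sub>R b) - f y) / (1 / real (Suc i))) \<in> borel_measurable borel" for i
    by measurable
qed

lemma bounded_pdiff_const: "bounded_pdiff b (\<lambda>y. c) (\<lambda>y. 0)"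
  by (rule bounded_pdiffI[of _ _ _ "\<bar>c\<bar>" 0]) (auto simp: has_pdiff_def)

lemma bounded_pdiff_add:
  assumes "bounded_pdiff b f f'" "bounded_pdiff b g g'"
  shows "bounded_pdiff b (\<lambda>y. f y + g y) (\<lambda>y. f' y + g' y)"
proof -
  obtain A B where A: "\<forall>y. \<bar>f y\<bar> \<le> A \<and> \<bar>f' y\<bar> \<le> A" and B: "\<forall>y. \<bar>g y\<bar> \<le> B \<and> \<bar>g' y\<bar> \<le> B"
    using assms bounded_pdiffD(3) by metis
  show ?thesis
  proof (rule bounded_pdiffI[of _ _ _ "A + B" "A + B"])
    show "has_pdiff b (\<lambda>y. f y + g y) (\<lambda>y. f' y + g' y)"
      using assms[THEN bounded_pdiffD(2)] unfolding has_pdiff_def by (auto intro: DERIV_add)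
    show "(\<lambda>y. f y + g y) \<in> borel_measurable borel"
      using assms[THEN bounded_pdiffD(1)] by simp
    show "\<bar>f y + g y\<bar> \<le> A + B" "\<bar>f' y + g' y\<bar> \<le> A + B" for y
      using A[rule_format, of y] B[rule_format, of y] by linarith+
  qed
qed

lemma bounded_pdiff_mult:
  assumes "bounded_pdiff b f f'" "bounded_pdiff b g g'"
  shows "bounded_pdiff b (\<lambda>y. f y * g y) (\<lambda>y. f' y * g y + g' y * f y)"
proof -
  obtain A B where A: "\<forall>y. \<bar>f y\<bar> \<le> A \<and> \<bar>f' y\<bar> \<le> A" "0 \<le> A" and B: "\<forall>y. \<bar>g y\<bar> \<le> B \<and> \<bar>g' y\<bar> \<le> B" "0 \<le> B"
    using assms bounded_pdiffD(3) by metis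
  show ?thesis
  proof (rule bounded_pdiffI[of _ _ _ "A * B" "A * B + B * A"])
    have "((\<lambda>s. f (y + s *\<^sub>R b) * g (y + s *\<^sub>R b)) has_real_derivative
        f' y * g (y + 0 *\<^sub>R b) + g' y * f (y + 0 *\<^sub>R b)) (at 0)" for y
      using assms[THEN bounded_pdiffD(2)] unfolding has_pdiff_def by (intro DERIV_mult) auto
    then show "has_pdiff b (\<lambda>y. f y * g y) (\<lambda>y. f' y * g y + g' y * f y)"
      unfolding has_pdiff_def by simp
    show "(\<lambda>y. f y * g y) \<in> borel_measurable borel"
      using assms[THEN bounded_pdiffD(1)] by simp
    show "\<bar>f y * g y\<bar> \<le> A * B" for y
      unfolding abs_mult using A B by (intro mult_mono) auto
    have "\<bar>f' y * g y\<bar> \<le> A * B" "\<bar>g' y * f y\<bar> \<le> B * A" for y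
      unfolding abs_mult using A B by (intro mult_mono; auto)+
    then show "\<bar>f' y * g y + g' y * f y\<bar> \<le> A * B + B * A" for y
      by (meson abs_triangle_ineq add_mono order_trans)
  qed
qed

lemma bounded_pdiff_cmult:
  "bounded_pdiff b f f' \<Longrightarrow> bounded_pdiff b (\<lambda>y. c * f y) (\<lambda>y. c * f' y)"
  using bounded_pdiff_mult[OF bounded_pdiff_const[of b c]] by (simp add: mult.commute)

lemma bounded_pdiff_diff:
  "bounded_pdiff b f f' \<Longrightarrow> bounded_pdiff b g g' \<Longrightarrow> bounded_pdiff b (\<lambda>y. f y - g y) (\<lambda>y. f' y - g' y)"
  using bounded_pdiff_add[OF _ bounded_pdiff_cmult[of b g g' "-1"]] by simp

lemma bounded_pdiff_sum:
  assumes "finite I" "\<And>i. i \<in> I \<Longrightarrow> bounded_pdiff b (f i) (f' i)"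
  shows "bounded_pdiff b (\<lambda>y. \<Sum>i\<in>I. f i y) (\<lambda>y. \<Sum>i\<in>I. f' i y)"
  using assms by (induction I rule: finite_induct) (auto intro: bounded_pdiff_const bounded_pdiff_add)

lemma bounded_pdiff_compose:
  assumes f: "bounded_pdiff b f f'" and h: "\<And>x. (h has_real_derivative h' x) (at x)" "continuous_on UNIV h'"
  shows "bounded_pdiff b (\<lambda>y. h (f y)) (\<lambda>y. h' (f y) * f' y)"
proof -
  obtain B where B: "\<forall>y. \<bar>f y\<bar> \<le> B \<and> \<bar>f' y\<bar> \<le> B" "0 \<le> B" using bounded_pdiffD(3)[OF f] by blast
  have h_cont: "continuous_on UNIV h" using h(1) DERIV_isCont continuous_at_imp_continuous_on by blast
  have "\<exists>C. \<forall>x\<in>{-B..B}. \<bar>g x\<bar> \<le> C" if "continuous_on UNIV g" for g :: "real \<Rightarrow> real"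
  proof -
    have "bounded (g ` {-B..B})"
      by (intro compact_imp_bounded compact_continuous_image continuous_on_subset[OF that]) auto
    then show ?thesis unfolding bounded_iff by auto
  qed
  then obtain C C' where C: "\<And>x. x \<in> {-B..B} \<Longrightarrow> \<bar>h x\<bar> \<le> C" "\<And>x. x \<in> {-B..B} \<Longrightarrow> \<bar>h' x\<bar> \<le> C'"
    using h_cont h(2) by metis
  have fB: "f y \<in> {-B..B}" for y using B(1)[rule_format, of y] by auto
  show ?thesis
  proof (rule bounded_pdiffI[of _ _ _ C "C' * B"])
    have "((\<lambda>s. h (f (y + s *\<^sub>R b))) has_real_derivative h' (f (y + 0 *\<^sub>R b)) * f' y) (at 0)" for y
      using bounded_pdiffD(2)[OF f] unfolding has_pdiff_def by (intro DERIV_chain2[OF h(1)]) auto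
    then show "has_pdiff b (\<lambda>y. h (f y)) (\<lambda>y. h' (f y) * f' y)" unfolding has_pdiff_def by simp
    have [measurable]: "h \<in> borel_measurable borel" "f \<in> borel_measurable borel"
      using h_cont f by (auto intro: borel_measurable_continuous_onI bounded_pdiffD)
    show "(\<lambda>y. h (f y)) \<in> borel_measurable borel" by measurable
    show "\<bar>h (f y)\<bar> \<le> C" for y using C(1) fB by blast
    show "\<bar>h' (f y) * f' y\<bar> \<le> C' * B" for y
    proof -
      have "0 \<le> C'" using C(2)[OF fB[of y]] by linarith
      then show ?thesis unfolding abs_mult using C(2)[OF fB] B by (intro mult_mono) auto
    qed
  qed
qed

lemma cylinder_slab_finite:
  "emeasure cylinder ({a..b} \<times> UNIV \<inter> space (cylinder :: (real \<times> (real ^ 'n::finite)) measure)) < \<infinity>"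
proof -
  let ?S = "{a..b} \<times> unit_cell :: (real \<times> (real ^ 'n)) set"
  have sub: "?S \<subseteq> cbox (a, 0) (b, \<chi> i. 1)"
    by (auto simp: unit_cell_def cbox_Pair_eq mem_box_cart) (meson less_imp_le)
  have eq: "{a..b} \<times> UNIV \<inter> space (cylinder :: (real \<times> (real ^ 'n)) measure) = ?S"
    by (auto simp: space_cylinder)
  have S: "?S \<in> sets borel" by (auto simp: borel_prod[symmetric])
  have "emeasure cylinder ?S = emeasure lborel ?S"
    unfolding cylinder_def by (subst emeasure_restrict_space) (use S in auto)
  also have "\<dots> < \<infinity>"
    using bounded_subset[OF bounded_cbox sub] by (intro emeasure_bounded_finite) 
  finally show ?thesis unfolding eq .
qed

lemma integrable_cylinder_bounded:
  fixes f :: "real \<times> (real ^ 'n::finite) \<Rightarrow> real"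
  assumes [measurable]: "f \<in> borel_measurable borel"
    and B: "\<And>y. \<bar>f y\<bar> \<le> B" and supp: "\<And>y. f y \<noteq> 0 \<Longrightarrow> fst y \<in> {a..b}"
  shows "integrable cylinder f"
proof -
  let ?A = "{a..b} \<times> UNIV \<inter> space (cylinder :: (real \<times> (real ^ 'n)) measure)"
  have A: "?A \<in> sets cylinder"
    by (auto simp: space_cylinder sets_cylinder Times_Int_Times borel_prod[symmetric])
  have "integrable cylinder (\<lambda>y. B * indicator ?A y)"
    using A cylinder_slab_finite[of a b] by (intro integrable_mult_right integrable_real_indicator) auto
  then show ?thesis
  proof (rule Bochner_Integration.integrable_bound)
    show "AE y in cylinder. norm (f y) \<le> norm (B * indicator ?A y)"
    proof (rule AE_I2)
      fix y :: "real \<times> (real ^ 'n)" assume "y \<in> space cylinder"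
      then show "norm (f y) \<le> norm (B * indicator ?A y)"
        using B[of y] supp[of y] by (cases "f y = 0"; cases y) (auto simp: indicator_def)
    qed
  qed measurable
qed

text \<open>Translation invariance of the integral, differentiated.\<close>

lemma integral_pdiff_zero:
  fixes V :: "real \<times> (real ^ 'n::finite) \<Rightarrow> real"
  assumes V: "bounded_pdiff v V V'" and per: "space_periodic UNIV V"
    and supp: "\<And>y. V y \<noteq> 0 \<Longrightarrow> fst y \<in> {a..b}"
  shows "(\<integral>y. V' y \<partial>cylinder) = 0"
proof -
  define X where "X i = 1 / real (Suc i)" for i
  have X: "X i \<noteq> 0" "0 < X i" "X i \<le> 1" for i by (auto simp: X_def)
  have X0: "X \<longlonglongrightarrow> 0" unfolding X_def[abs_def] by (rule LIMSEQ_Suc[OF lim_1_over_n])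
  obtain B where B: "\<And>y. \<bar>V y\<bar> \<le> B" "\<And>y. \<bar>V' y\<bar> \<le> B" "0 \<le> B" using bounded_pdiffD(3)[OF V] by blast
  note [measurable] = bounded_pdiffD(1)[OF V] bounded_pdiff_borel_deriv[OF V]
  let ?q = "\<lambda>i y. (V (y + X i *\<^sub>R v) - V y) / X i"
  have int_V: "integrable cylinder V" by (rule integrable_cylinder_bounded[OF _ B(1) supp]) auto
  have zero: "(\<integral>y. ?q i y \<partial>cylinder) = 0" for i
  proof -
    have "(\<integral>y. ?q i y \<partial>cylinder) = ((\<integral>y. V (y + X i *\<^sub>R v) \<partial>cylinder) - (\<integral>y. V y \<partial>cylinder)) / X i"
      using int_V integrable_cylinder_shift[OF per _ int_V] by simp
    then show ?thesis using integral_cylinder_shift[OF per] by simp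
  qed
  let ?I = "\<lambda>y::real \<times> (real ^ 'n). B * indicator ({a - norm v..b + norm v} \<times> UNIV) y"
  have "(\<lambda>i. \<integral>y. ?q i y \<partial>cylinder) \<longlonglongrightarrow> (\<integral>y. V' y \<partial>cylinder)"
  proof (rule integral_dominated_convergence[where w = ?I])
    show "integrable cylinder ?I"
      by (rule integrable_cylinder_bounded[where B = B and a = "a - norm v" and b = "b + norm v"])
         (use B(3) in \<open>auto simp: indicator_def borel_prod[symmetric]\<close>)
    show "AE y in cylinder. (\<lambda>i. ?q i y) \<longlonglongrightarrow> V' y"
      using has_pdiff_quotient[OF bounded_pdiffD(2)[OF V] X(1) X0] by simp
    show "AE y in cylinder. norm (?q i y) \<le> ?I y" for i
    proof (rule AE_I2)
      fix y :: "real \<times> (real ^ 'n)"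
      have le: "\<bar>?q i y\<bar> \<le> B"
        using has_pdiff_Lipschitz[OF bounded_pdiffD(2)[OF V] B(2), of y "X i"] X[of i]
        by (simp add: abs_divide field_simps)
      show "norm (?q i y) \<le> ?I y"
      proof (cases "fst y \<in> {a - norm v..b + norm v}")
        case True
        then show ?thesis using le by (cases y) simp
      next
        case False
        have "\<bar>X i * fst v\<bar> \<le> 1 * norm v"
          unfolding abs_mult using X[of i] norm_fst_le[of "fst v" "snd v"] by (intro mult_mono) auto
        then have "fst (y + X i *\<^sub>R v) \<notin> {a..b}" "fst y \<notin> {a..b}" using False by auto
        then have "V (y + X i *\<^sub>R v) = 0" "V y = 0" using supp by blast+
        then show ?thesis using B(3) by simp
      qed
    qed
  qed measurable
  then show ?thesis unfolding zero using LIMSEQ_unique tendsto_const by blast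
qed

text \<open>Smooth periodic functions supported in the times \<open>[a,b]\<close>: the test functions and the kernels.\<close>

definition smooth_in :: "real \<Rightarrow> real \<Rightarrow> (real \<times> (real ^ 'n::finite) \<Rightarrow> real) \<Rightarrow> bool" where
  "smooth_in a b \<phi> \<longleftrightarrow> (\<forall>k. Ck k \<phi>) \<and> space_periodic UNIV \<phi> \<and> (\<forall>y. \<phi> y \<noteq> 0 \<longrightarrow> fst y \<in> {a..b})"

lemma periodic_bounded:
  assumes "continuous_on UNIV f" "space_periodic UNIV f" "\<And>y. f y \<noteq> 0 \<Longrightarrow> fst y \<in> {a..b}"
  shows "\<exists>B\<ge>0. \<forall>y::real \<times> (real ^ 'n::finite). \<bar>f y\<bar> \<le> (B::real)"
proof -
  let ?C = "cbox (a, 0) (b, \<chi> i. 1) :: (real \<times> (real ^ 'n)) set"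
  have "bounded (f ` ?C)"
    by (intro compact_imp_bounded compact_continuous_image continuous_on_subset[OF assms(1)]) auto
  then obtain B where B: "0 < B" "\<And>y. y \<in> ?C \<Longrightarrow> \<bar>f y\<bar> \<le> B" unfolding bounded_pos by auto
  have "\<bar>f y\<bar> \<le> B" for y
  proof (cases "f y = 0")
    case False
    have "snd (fold_cell y) \<in> unit_cell" using fold_cell_in[of y] by (auto simp: mem_Times_iff)
    then have "fold_cell y \<in> ?C"
      using assms(3)[OF False]
      by (cases "fold_cell y") (auto simp: fold_cell_def unit_cell_def cbox_Pair_eq mem_box_cart intro: less_imp_le)
    then show ?thesis using B(2) periodic_UNIV_fold_cell[OF assms(2), of y] by metis
  qed (use B in simp)
  then show ?thesis using B(1) less_imp_le by blast
qed

lemma smooth_in_pdiff: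
  assumes "smooth_in a b \<phi>"
  shows "continuous_on UNIV (pdiff \<phi> v)" "space_periodic UNIV (pdiff \<phi> v)"
    "\<And>y. pdiff \<phi> v y \<noteq> 0 \<Longrightarrow> fst y \<in> {a..b}"
proof -
  have Ck: "Ck k \<phi>" for k using assms by (simp add: smooth_in_def)
  have per: "\<phi> (t, x + axis k 1) = \<phi> (t, x)" for t x k
    using assms by (simp add: smooth_in_def space_periodic_def)
  have supp: "\<phi> y \<noteq> 0 \<Longrightarrow> fst y \<in> {a..b}" for y using assms unfolding smooth_in_def by blast
  note D = Ck_has_pdiff[OF Ck, unfolded has_pdiff_def, rule_format]
  show "continuous_on UNIV (pdiff \<phi> v)"
    using Ck_Suc_D(2)[OF Ck, of 0] by (simp add: pdiff_def[abs_def])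
  have "pdiff \<phi> v (t, x + axis k 1) = pdiff \<phi> v (t, x)" for t x k
  proof (rule DERIV_unique[OF _ D])
    have "\<phi> ((t, x) + s *\<^sub>R v) = \<phi> ((t, x + axis k 1) + s *\<^sub>R v)" for s
      using per[of "t + s * fst v" "x + s *\<^sub>R snd v" k] by (cases v) (simp add: algebra_simps)
    then show "((\<lambda>s. \<phi> ((t, x) + s *\<^sub>R v)) has_real_derivative pdiff \<phi> v (t, x + axis k 1)) (at 0)"
      using D[of "(t, x + axis k 1)" v] by simp
  qed
  then show "space_periodic UNIV (pdiff \<phi> v)" by (simp add: space_periodic_def)
  fix y assume nz: "pdiff \<phi> v y \<noteq> 0"
  show "fst y \<in> {a..b}"
  proof (rule ccontr)
    assume "fst y \<notin> {a..b}"
    then have "open (- {a..b})" "fst (y + 0 *\<^sub>R v) \<in> - {a..b}" by (auto intro: open_Compl)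
    moreover have "((\<lambda>s. fst (y + s *\<^sub>R v)) \<longlongrightarrow> fst (y + 0 *\<^sub>R v)) (at 0)" by (intro tendsto_intros)
    ultimately have "\<forall>\<^sub>F s in at 0. fst (y + s *\<^sub>R v) \<in> - {a..b}" using topological_tendstoD by blast
    then have "\<forall>\<^sub>F s in at 0. \<phi> (y + s *\<^sub>R v) = 0"
      by eventually_elim (use supp in blast)
    then have "\<forall>\<^sub>F s in nhds 0. \<phi> (y + s *\<^sub>R v) = 0"
      using \<open>fst (y + 0 *\<^sub>R v) \<in> - {a..b}\<close> supp[of y] by (auto simp: eventually_nhds_conv_at)
    then have "((\<lambda>s. \<phi> (y + s *\<^sub>R v)) has_real_derivative 0) (at 0)"
      by (subst DERIV_cong_ev[OF refl _ refl, where g = "\<lambda>_. 0"]) auto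
    then show False using nz DERIV_unique D by blast
  qed
qed

lemma smooth_in_bounded_pdiff:
  assumes "smooth_in a b \<phi>"
  shows "bounded_pdiff v \<phi> (pdiff \<phi> v)"
proof -
  have Ck: "Ck k \<phi>" for k using assms by (simp add: smooth_in_def)
  have cont: "continuous_on UNIV \<phi>" using Ck[of 0] by simp
  obtain B where "\<And>y. \<bar>\<phi> y\<bar> \<le> B"
    using periodic_bounded[OF cont] assms unfolding smooth_in_def by blast
  moreover obtain B' where "\<And>y. \<bar>pdiff \<phi> v y\<bar> \<le> B'"
    using periodic_bounded[OF smooth_in_pdiff(1,2)[OF assms] smooth_in_pdiff(3)[OF assms, where v = v]] by blast
  moreover have "\<phi> \<in> borel_measurable borel" using cont by (rule borel_measurable_continuous_onI)
  ultimately show ?thesis using Ck_has_pdiff[OF Ck] by (intro bounded_pdiffI)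
qed

section \<open>Mollification\<close>

text \<open>The kernel appears as \<open>k (y' - y)\<close>, reflected in comparison with a convolution. Thus the test
  function that mollifies an equation at \<open>y\<close> is a translate of \<open>k\<close>, and a derivative in \<open>y\<close> falls
  on \<open>k\<close> with a minus sign.\<close>

definition moll :: "(real \<times> (real ^ 'n::finite) \<Rightarrow> real) \<Rightarrow> (real \<times> (real ^ 'n) \<Rightarrow> real) \<Rightarrow> real \<times> (real ^ 'n) \<Rightarrow> real" where
  "moll k f y = (\<integral>y'. k (y' - y) * f y' \<partial>cylinder)"

definition periodic_L1 :: "(real \<times> (real ^ 'n::finite) \<Rightarrow> real) \<Rightarrow> bool" where
  "periodic_L1 f \<longleftrightarrow> f \<in> borel_measurable borel \<and> space_periodic UNIV f \<and> integrable cylinder f"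

lemma space_periodic_shift:
  assumes "space_periodic UNIV (k :: real \<times> (real ^ 'n::finite) \<Rightarrow> 'a)"
  shows "space_periodic UNIV (\<lambda>y'. k (y' + a))"
proof -
  have "k (t + fst a, (x + snd a) + axis i 1) = k (t + fst a, x + snd a)" for t x i
    using assms by (simp add: space_periodic_def)
  then show ?thesis by (cases a) (simp add: space_periodic_def algebra_simps)
qed

lemma moll_eq:
  assumes f: "periodic_L1 f" and [measurable]: "k \<in> borel_measurable borel" and k: "space_periodic UNIV k"
  shows "moll k f y = (\<integral>z. k z * f (y + z) \<partial>cylinder)"
proof -
  have [measurable]: "f \<in> borel_measurable borel" using f by (simp add: periodic_L1_def)
  have per: "space_periodic UNIV (\<lambda>y'. k (y' - y) * f y')"
    using space_periodic_shift[OF k, of "- y"] f by (simp add: periodic_L1_def space_periodic_def)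
  show ?thesis
    using integral_cylinder_shift[OF per, of y] by (simp add: moll_def add.commute)
qed

lemma periodic_L1_integrable_mult:
  assumes f: "periodic_L1 f" and [measurable]: "k \<in> borel_measurable borel" and k: "\<And>z. \<bar>k z\<bar> \<le> B"
  shows "integrable cylinder (\<lambda>z. k z * f (y + z))"
proof -
  have [measurable]: "f \<in> borel_measurable borel" using f by (simp add: periodic_L1_def)
  have "integrable cylinder (\<lambda>z. f (y + z))"
    using integrable_cylinder_shift[of f y] f by (simp add: periodic_L1_def add.commute)
  then have "integrable cylinder (\<lambda>z. B * f (y + z))" by simp
  then show ?thesis
  proof (rule Bochner_Integration.integrable_bound)
    have "0 \<le> B" using k abs_ge_zero order_trans by blast
    then show "AE z in cylinder. norm (k z * f (y + z)) \<le> norm (B * f (y + z))"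
      using k by (intro AE_I2) (simp add: abs_mult mult_right_mono)
  qed measurable
qed

lemma moll_bounded:
  assumes f: "periodic_L1 f" and k: "k \<in> borel_measurable borel" "space_periodic UNIV k" "\<And>z. \<bar>k z\<bar> \<le> B"
  shows "\<bar>moll k f y\<bar> \<le> B * (\<integral>z. \<bar>f z\<bar> \<partial>cylinder)"
proof -
  note [measurable] = k(1)
  have fm[measurable]: "f \<in> borel_measurable borel" and fi: "integrable cylinder f" and fp: "space_periodic UNIV f"
    using f by (auto simp: periodic_L1_def)
  have sh: "integrable cylinder (\<lambda>z. f (y + z))"
    using integrable_cylinder_shift[OF fp fm fi, of y] by (simp add: add.commute)
  have pa: "space_periodic UNIV (\<lambda>z. \<bar>f z\<bar>)" using fp by (simp add: space_periodic_def)
  have "\<bar>moll k f y\<bar> \<le> (\<integral>z. \<bar>k z * f (y + z)\<bar> \<partial>cylinder)"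
    unfolding moll_eq[OF f k(1,2)] by (rule integral_abs_bound)
  also have "\<dots> \<le> (\<integral>z. B * \<bar>f (y + z)\<bar> \<partial>cylinder)"
  proof (rule integral_mono)
    show "integrable cylinder (\<lambda>z. \<bar>k z * f (y + z)\<bar>)"
      by (intro integrable_abs periodic_L1_integrable_mult[OF f k(1,3)])
    show "integrable cylinder (\<lambda>z. B * \<bar>f (y + z)\<bar>)" using sh by simp
    show "\<bar>k z * f (y + z)\<bar> \<le> B * \<bar>f (y + z)\<bar>" for z
      unfolding abs_mult using k(3) by (intro mult_right_mono) auto
  qed
  also have "\<dots> = B * (\<integral>z. \<bar>f (z + y)\<bar> \<partial>cylinder)" by (simp add: add.commute)
  also have "\<dots> = B * (\<integral>z. \<bar>f z\<bar> \<partial>cylinder)" using integral_cylinder_shift[OF pa, of y] by simp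
  finally show ?thesis .
qed

lemma moll_periodic:
  assumes "space_periodic UNIV k"
  shows "space_periodic UNIV (moll k f)"
proof -
  have "k (y' - (t, x + axis i 1)) = k (y' - (t, x))" for y' t x i
    using assms[unfolded space_periodic_def, rule_format, of "fst y' - t" "snd y' - x - axis i 1" i]
    by (cases y') (simp add: algebra_simps)
  then show ?thesis by (simp add: space_periodic_def moll_def)
qed

lemma moll_borel:
  assumes [measurable]: "k \<in> borel_measurable borel" "f \<in> borel_measurable borel"
  shows "moll k f \<in> borel_measurable borel"
proof -
  interpret sigma_finite_measure "cylinder :: (real \<times> (real ^ 'a)) measure" by (rule sigma_finite_cylinder)
  have id: "(\<lambda>y. y) \<in> cylinder \<rightarrow>\<^sub>M (borel :: (real \<times> (real ^ 'a)) measure)"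
    by (rule borel_measurable_cylinder) simp
  have [measurable]: "snd \<in> ((borel :: (real \<times> (real ^ 'a)) measure) \<Otimes>\<^sub>M cylinder) \<rightarrow>\<^sub>M (borel :: (real \<times> (real ^ 'a)) measure)"
    by (rule measurable_compose[OF measurable_snd id])
  show ?thesis
    unfolding moll_def[abs_def] by (rule borel_measurable_lebesgue_integral) (simp add: case_prod_beta', measurable)
qed

lemma moll_has_pdiff:
  assumes f: "periodic_L1 f" and k: "bounded_pdiff v k k'" "space_periodic UNIV k"
  shows "has_pdiff v (moll k f) (\<lambda>y. - moll k' f y)"
  unfolding has_pdiff_def DERIV_def tendsto_at_iff_sequentially comp_def
proof (intro allI impI)
  fix y :: "real \<times> (real ^ 'a)" and X :: "nat \<Rightarrow> real"
  assume X: "\<forall>i. X i \<in> UNIV - {0}" "X \<longlonglongrightarrow> 0"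
  have [measurable]: "f \<in> borel_measurable borel" and fi: "integrable cylinder f"
    using f by (auto simp: periodic_L1_def)
  note [measurable] = bounded_pdiffD(1)[OF k(1)] bounded_pdiff_borel_deriv[OF k(1)]
  obtain B where B: "\<And>y. \<bar>k y\<bar> \<le> B" "\<And>y. \<bar>k' y\<bar> \<le> B" "0 \<le> B" using bounded_pdiffD(3)[OF k(1)] by blast
  have int: "integrable cylinder (\<lambda>y'. k (y' - x) * f y')" for x
  proof -
    have "integrable cylinder (\<lambda>y'. B * f y')" using fi by simp
    then show ?thesis
      by (rule Bochner_Integration.integrable_bound)
         (use B in \<open>auto intro!: AE_I2 simp: abs_mult mult_right_mono\<close>)
  qed
  let ?q = "\<lambda>i y'. (k (y' - y + (- X i) *\<^sub>R v) - k (y' - y)) / X i * f y'"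
  have eq: "(moll k f (y + (0 + X i) *\<^sub>R v) - moll k f (y + 0 *\<^sub>R v)) / X i = (\<integral>y'. ?q i y' \<partial>cylinder)" for i
  proof -
    have "moll k f (y + (0 + X i) *\<^sub>R v) - moll k f (y + 0 *\<^sub>R v)
        = (\<integral>y'. k (y' - (y + X i *\<^sub>R v)) * f y' - k (y' - y) * f y' \<partial>cylinder)"
      unfolding moll_def by (subst Bochner_Integration.integral_diff[OF int int]) simp
    also have "\<dots> / X i = (\<integral>y'. (k (y' - (y + X i *\<^sub>R v)) * f y' - k (y' - y) * f y') / X i \<partial>cylinder)"
      by simp
    also have "\<dots> = (\<integral>y'. ?q i y' \<partial>cylinder)"
      by (intro Bochner_Integration.integral_cong) (auto simp: diff_divide_distrib algebra_simps)
    finally show ?thesis .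
  qed
  have "(\<lambda>i. \<integral>y'. ?q i y' \<partial>cylinder) \<longlonglongrightarrow> (\<integral>y'. - k' (y' - y) * f y' \<partial>cylinder)"
  proof (rule integral_dominated_convergence[where w = "\<lambda>y'. B * \<bar>f y'\<bar>"])
    show "integrable cylinder (\<lambda>y'. B * \<bar>f y'\<bar>)" using fi by simp
    show "AE y' in cylinder. (\<lambda>i. ?q i y') \<longlonglongrightarrow> - k' (y' - y) * f y'"
    proof (rule AE_I2)
      fix y' :: "real \<times> (real ^ 'a)"
      have "(\<lambda>i. (k (y' - y + (- X i) *\<^sub>R v) - k (y' - y)) / (- X i)) \<longlonglongrightarrow> k' (y' - y)"
        by (rule has_pdiff_quotient[OF bounded_pdiffD(2)[OF k(1)]])
           (use X in \<open>auto intro: tendsto_minus_cancel\<close>)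
      then have "(\<lambda>i. - ((k (y' - y + (- X i) *\<^sub>R v) - k (y' - y)) / (- X i)) * f y') \<longlonglongrightarrow> - k' (y' - y) * f y'"
        by (intro tendsto_intros)
      then show "(\<lambda>i. ?q i y') \<longlonglongrightarrow> - k' (y' - y) * f y'" by simp
    qed
    show "AE y' in cylinder. norm (?q i y') \<le> B * \<bar>f y'\<bar>" for i
    proof (rule AE_I2)
      fix y' :: "real \<times> (real ^ 'a)"
      have "X i \<noteq> 0" using X(1) by simp
      then have "\<bar>(k (y' - y + (- X i) *\<^sub>R v) - k (y' - y)) / X i\<bar> \<le> B"
        using has_pdiff_Lipschitz[OF bounded_pdiffD(2)[OF k(1)] B(2), of "y' - y" "- X i"]
        by (simp add: abs_divide field_simps)
      then show "norm (?q i y') \<le> B * \<bar>f y'\<bar>"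
        unfolding real_norm_def abs_mult by (rule mult_right_mono) simp
    qed
  qed measurable
  then show "(\<lambda>i. (moll k f (y + (0 + X i) *\<^sub>R v) - moll k f (y + 0 *\<^sub>R v)) / X i) \<longlonglongrightarrow> - moll k' f y"
    unfolding eq by (simp add: moll_def)
qed

lemma moll_bounded_pdiff:
  assumes f: "periodic_L1 f" and k: "smooth_in a b k"
  shows "bounded_pdiff v (moll k f) (\<lambda>y. - moll (pdiff k v) f y)"
proof -
  note kb = smooth_in_bounded_pdiff[OF k, of v]
  have per: "space_periodic UNIV k" using k by (simp add: smooth_in_def)
  obtain B where B: "\<And>y. \<bar>k y\<bar> \<le> B" "\<And>y. \<bar>pdiff k v y\<bar> \<le> B" using bounded_pdiffD(3)[OF kb] by blast
  show ?thesis
  proof (rule bounded_pdiffI)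
    show "moll k f \<in> borel_measurable borel"
      using f bounded_pdiffD(1)[OF kb] by (intro moll_borel) (auto simp: periodic_L1_def)
    show "has_pdiff v (moll k f) (\<lambda>y. - moll (pdiff k v) f y)"
      by (rule moll_has_pdiff[OF f kb per])
    show "\<bar>moll k f y\<bar> \<le> B * (\<integral>z. \<bar>f z\<bar> \<partial>cylinder)" for y
      by (rule moll_bounded[OF f bounded_pdiffD(1)[OF kb] per B(1)])
    show "\<bar>- moll (pdiff k v) f y\<bar> \<le> B * (\<integral>z. \<bar>f z\<bar> \<partial>cylinder)" for y
      unfolding abs_minus_cancel
      by (rule moll_bounded[OF f bounded_pdiff_borel_deriv[OF kb] smooth_in_pdiff(2)[OF k] B(2)])
  qed
qed

section \<open>Increments and commutators in Besov spaces\<close>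

text \<open>Times \<open>[a,b]\<close> inside \<open>(0,T)\<close>: there all estimates take place, since mollification at scale \<open>\<epsilon>\<close>
  needs the distance \<open>\<epsilon>\<close> to the times \<open>0\<close> and \<open>T\<close>.\<close>

definition slab :: "real \<Rightarrow> real \<Rightarrow> (real \<times> (real ^ 'n::finite)) measure" where
  "slab a b = restrict_space lborel ({a..b} \<times> unit_cell)"

lemma slab_set_borel [measurable]:
  "{a..b} \<times> unit_cell \<in> sets (borel :: (real \<times> (real ^ 'n::finite)) measure)"
  by (auto simp: borel_prod[symmetric])

lemma space_slab: "space (slab a b) = {a..b} \<times> unit_cell"
  by (simp add: slab_def space_restrict_space)

lemma borel_measurable_slab [measurable (raw)]:
  "f \<in> borel_measurable borel \<Longrightarrow> f \<in> borel_measurable (slab a b)"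
  unfolding slab_def by (intro measurable_restrict_space1) simp

lemma sigma_finite_slab: "sigma_finite_measure (slab a b :: (real \<times> (real ^ 'n::finite)) measure)"
  unfolding slab_def by (rule sigma_finite_measure_restrict_space) (auto intro: sigma_finite_lborel)

lemma slab_finite: "emeasure (slab a b) (space (slab a b :: (real \<times> (real ^ 'n::finite)) measure)) < \<infinity>"
proof -
  have eq: "{a..b} \<times> UNIV \<inter> space (cylinder :: (real \<times> (real ^ 'n)) measure) = {a..b} \<times> unit_cell"
    by (auto simp: space_cylinder)
  have "emeasure (slab a b) ({a..b} \<times> unit_cell :: (real \<times> (real ^ 'n)) set)
      = emeasure lborel ({a..b} \<times> unit_cell :: (real \<times> (real ^ 'n)) set)"
    unfolding slab_def by (subst emeasure_restrict_space) auto
  also have "\<dots> = emeasure cylinder ({a..b} \<times> unit_cell :: (real \<times> (real ^ 'n)) set)"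
    unfolding cylinder_def by (subst emeasure_restrict_space) auto
  finally show ?thesis using cylinder_slab_finite[of a b, where 'n = 'n] unfolding eq space_slab by simp
qed

lemma nn_integral_slab_le:
  assumes [measurable]: "f \<in> borel_measurable borel" "g \<in> borel_measurable borel"
    and "\<And>y. fst y \<in> {a..b} \<Longrightarrow> f y \<le> g y"
  shows "(\<integral>\<^sup>+y. f y \<partial>slab a b) \<le> (\<integral>\<^sup>+y. g y \<partial>(cylinder :: (real \<times> (real ^ 'n::finite)) measure))"
proof -
  have "(\<integral>\<^sup>+y. f y \<partial>slab a b) = (\<integral>\<^sup>+y. f y * indicator ({a..b} \<times> unit_cell) y \<partial>lborel)"
    unfolding slab_def by (subst nn_integral_restrict_space) auto
  also have "\<dots> \<le> (\<integral>\<^sup>+y. g y * indicator (UNIV \<times> unit_cell) y \<partial>lborel)"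
    using assms(3) by (intro nn_integral_mono) (auto simp: indicator_def)
  also have "\<dots> = (\<integral>\<^sup>+y. g y \<partial>cylinder)"
    unfolding cylinder_def by (subst nn_integral_restrict_space) auto
  finally show ?thesis .
qed

lemma integral_cylinder_eq_slab:
  fixes f :: "real \<times> (real ^ 'n::finite) \<Rightarrow> real"
  assumes "\<And>y. f y \<noteq> 0 \<Longrightarrow> fst y \<in> {a..b}"
  shows "(\<integral>y. f y \<partial>cylinder) = (\<integral>y. f y \<partial>slab a b)"
proof -
  have "(\<integral>y. f y \<partial>cylinder) = (\<integral>y. indicator (UNIV \<times> unit_cell) y *\<^sub>R f y \<partial>lborel)"
    unfolding cylinder_def by (subst integral_restrict_space) auto
  also have "\<dots> = (\<integral>y. indicator ({a..b} \<times> unit_cell) y *\<^sub>R f y \<partial>lborel)"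
    using assms by (intro Bochner_Integration.integral_cong) (auto simp: indicator_def)
  also have "\<dots> = (\<integral>y. f y \<partial>slab a b)"
    unfolding slab_def by (subst integral_restrict_space) auto
  finally show ?thesis .
qed

lemma integrable_cylinder_iff_slab:
  fixes f :: "real \<times> (real ^ 'n::finite) \<Rightarrow> real"
  assumes "\<And>y. f y \<noteq> 0 \<Longrightarrow> fst y \<in> {a..b}"
  shows "integrable cylinder f \<longleftrightarrow> integrable (slab a b) f"
proof -
  have "integrable cylinder f \<longleftrightarrow> integrable lborel (\<lambda>y. indicator (UNIV \<times> unit_cell) y *\<^sub>R f y)"
    unfolding cylinder_def by (subst integrable_restrict_space) auto
  also have "(\<lambda>y. indicator (UNIV \<times> unit_cell) y *\<^sub>R f y) = (\<lambda>y. indicator ({a..b} \<times> unit_cell) y *\<^sub>R f y)"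
  proof
    fix y
    show "indicator (UNIV \<times> unit_cell) y *\<^sub>R f y = indicator ({a..b} \<times> unit_cell) y *\<^sub>R f y"
      using assms[of y] by (cases "f y = 0") (auto simp: indicator_def mem_Times_iff)
  qed
  also have "integrable lborel (\<lambda>y. indicator ({a..b} \<times> unit_cell) y *\<^sub>R f y) \<longleftrightarrow> integrable (slab a b) f"
    unfolding slab_def by (subst integrable_restrict_space) auto
  finally show ?thesis .
qed

lemma integrable_slab_pdiff_mult:
  fixes f :: "real \<times> (real ^ 'n::finite) \<Rightarrow> real"
  assumes \<phi>: "smooth_in c d \<phi>" and f: "integrable (slab a b) f"
  shows "integrable (slab a b) (\<lambda>y. pdiff \<phi> v y * f y)"
proof -
  obtain A where A: "0 \<le> A" "\<And>y. \<bar>pdiff \<phi> v y\<bar> \<le> A"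
    using bounded_pdiffD(3)[OF smooth_in_bounded_pdiff[OF \<phi>]] by blast
  have [measurable]: "pdiff \<phi> v \<in> borel_measurable (slab a b)"
    by (intro borel_measurable_slab bounded_pdiff_borel_deriv[OF smooth_in_bounded_pdiff[OF \<phi>]])
  have "integrable (slab a b) (\<lambda>y. A * f y)" using f by simp
  then show ?thesis
    by (rule Bochner_Integration.integrable_bound)
       (use f A in \<open>auto intro!: AE_I2 simp: abs_mult mult_right_mono\<close>)
qed

lemma pair_borel_measurable:
  assumes "f \<in> borel_measurable (borel \<Otimes>\<^sub>M borel)"
  shows "f \<in> borel_measurable (cylinder \<Otimes>\<^sub>M slab a b)"
proof -
  have "(\<lambda>p. (fst p, snd p)) \<in> (cylinder \<Otimes>\<^sub>M slab a b) \<rightarrow>\<^sub>M (borel \<Otimes>\<^sub>M borel)"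
    by (intro measurable_Pair measurable_compose[OF measurable_fst] measurable_compose[OF measurable_snd])
       (auto intro: borel_measurable_cylinder borel_measurable_slab)
  then show ?thesis using measurable_compose[OF _ assms] by simp
qed

text \<open>The Besov seminorm, with its \<open>L\<^sup>1\<^sup>/\<^sup>s\<close> norms expressed by modulars.\<close>

definition besov_shift :: "real \<Rightarrow> real \<Rightarrow> real \<Rightarrow> (real \<times> (real ^ 'n::finite) \<Rightarrow> real) \<Rightarrow> bool" where
  "besov_shift T s \<kappa> f \<longleftrightarrow> (\<exists>A>0. \<forall>\<xi>. \<xi> \<noteq> 0 \<longrightarrow>
     (\<integral>\<^sup>+y. modular s (A * norm \<xi> powr \<kappa>) (f (y + \<xi>) - f y) *
        indicator {y. fst y \<in> {0<..<T} \<and> fst (y + \<xi>) \<in> {0<..<T}} y \<partial>cylinder) \<le> 1)"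

text \<open>The shifts in the support of a kernel. The time shift is bounded by \<open>\<epsilon>\<close> itself, without the
  constant, so that a condition on \<open>\<epsilon>\<close> alone keeps shifted times in \<open>(0,T)\<close>.\<close>

definition close_shift :: "real \<Rightarrow> real \<Rightarrow> real \<times> (real ^ 'n::finite) \<Rightarrow> bool" where
  "close_shift C \<epsilon> z \<longleftrightarrow> \<bar>fst z\<bar> \<le> \<epsilon> \<and> (\<exists>k\<in>lattice. norm (z - (0, k)) \<le> C * \<epsilon>)"

text \<open>The increments in question only depend on the shift modulo the lattice, so the shift can be
  replaced by a representative of norm at most \<open>C \<epsilon>\<close>.\<close>

lemma besov_slab:
  fixes f :: "real \<times> (real ^ 'n::finite) \<Rightarrow> real"
  assumes "besov_shift T s \<kappa> f" and per: "space_periodic UNIV f" and [measurable]: "f \<in> borel_measurable borel"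
    and s: "0 \<le> s" "0 \<le> \<kappa>" "0 < C"
  shows "\<exists>A>0. \<forall>\<epsilon>. 0 < \<epsilon> \<longrightarrow> \<epsilon> < min a (T - b) \<longrightarrow> (\<forall>z. close_shift C \<epsilon> z \<longrightarrow>
    (\<integral>\<^sup>+y. modular s (A * \<epsilon> powr \<kappa>) (f (y + z) - f y) \<partial>slab a b) \<le> 1)"
proof -
  obtain A where A: "A > 0" "\<And>\<xi>. \<xi> \<noteq> 0 \<Longrightarrow>
     (\<integral>\<^sup>+y. modular s (A * norm \<xi> powr \<kappa>) (f (y + \<xi>) - f y) *
        indicator {y. fst y \<in> {0<..<T} \<and> fst (y + \<xi>) \<in> {0<..<T}} y \<partial>cylinder) \<le> 1"
    using assms(1) unfolding besov_shift_def by blast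
  define A' where "A' = A * C powr \<kappa>"
  have A': "A' > 0" using A(1) s by (simp add: A'_def)
  have "(\<integral>\<^sup>+y. modular s (A' * \<epsilon> powr \<kappa>) (f (y + z) - f y) \<partial>slab a b) \<le> 1"
    if e: "0 < \<epsilon>" "\<epsilon> < min a (T - b)" and z: "close_shift C \<epsilon> z" for \<epsilon> z
  proof -
    obtain k where k: "k \<in> lattice" "norm (z - (0, k)) \<le> C * \<epsilon>" and tz: "\<bar>fst z\<bar> \<le> \<epsilon>"
      using z unfolding close_shift_def by blast
    define \<zeta> where "\<zeta> = z - (0, k)"
    have f\<zeta>: "f (y + z) = f (y + \<zeta>)" for y
    proof -
      have "f (fst (y + \<zeta>), snd (y + \<zeta>) + k) = f (fst (y + \<zeta>), snd (y + \<zeta>))"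
        by (rule periodic_lattice_shift[OF per UNIV_I k(1)])
      then show ?thesis by (cases y; cases z) (simp add: \<zeta>_def)
    qed
    show ?thesis
    proof (cases "\<zeta> = 0")
      case True
      then show ?thesis using A' e s by (simp add: f\<zeta> modular_0)
    next
      case False
      have "(\<integral>\<^sup>+y. modular s (A' * \<epsilon> powr \<kappa>) (f (y + \<zeta>) - f y) \<partial>slab a b)
         \<le> (\<integral>\<^sup>+y. modular s (A * norm \<zeta> powr \<kappa>) (f (y + \<zeta>) - f y) *
            indicator {y. fst y \<in> {0<..<T} \<and> fst (y + \<zeta>) \<in> {0<..<T}} y \<partial>cylinder)"
      proof (rule nn_integral_slab_le)
        show "(\<lambda>y. modular s (A * norm \<zeta> powr \<kappa>) (f (y + \<zeta>) - f y) *
            indicator {y. fst y \<in> {0<..<T} \<and> fst (y + \<zeta>) \<in> {0<..<T}} y) \<in> borel_measurable borel"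
        proof (intro borel_measurable_times_ennreal borel_measurable_indicator)
          have "{y :: real \<times> (real ^ 'n). fst y \<in> {0<..<T} \<and> fst (y + \<zeta>) \<in> {0<..<T}}
              = {y. fst (y + 0) \<in> {0<..<T}} \<inter> {y. fst (y + \<zeta>) \<in> {0<..<T}}" by auto
          then show "{y :: real \<times> (real ^ 'n). fst y \<in> {0<..<T} \<and> fst (y + \<zeta>) \<in> {0<..<T}} \<in> sets borel"
            by (simp only: sets.Int time_in_borel)
        qed measurable
        fix y :: "real \<times> (real ^ 'n)" assume y: "fst y \<in> {a..b}"
        have t: "fst y \<in> {0<..<T} \<and> fst (y + \<zeta>) \<in> {0<..<T}"
          using y e tz by (auto simp: \<zeta>_def)
        have "A * norm \<zeta> powr \<kappa> \<le> A * (C * \<epsilon>) powr \<kappa>"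
          using A(1) k(2) s by (intro mult_left_mono powr_mono2) (auto simp: \<zeta>_def)
        also have "\<dots> = A' * \<epsilon> powr \<kappa>" using s e by (simp add: A'_def powr_mult)
        finally show "modular s (A' * \<epsilon> powr \<kappa>) (f (y + \<zeta>) - f y) \<le>
            modular s (A * norm \<zeta> powr \<kappa>) (f (y + \<zeta>) - f y) *
            indicator {y. fst y \<in> {0<..<T} \<and> fst (y + \<zeta>) \<in> {0<..<T}} y"
          using t A(1) False s by (auto intro!: modular_antimono)
      qed measurable
      also have "\<dots> \<le> 1" by (rule A(2)[OF False])
      finally show ?thesis by (simp add: f\<zeta>)
    qed
  qed
  then show ?thesis using A' by blast
qed

text \<open>Averages against kernels of mass \<open>\<epsilon> powr m\<close>: mass one for the mollifiers themselves (\<open>m = 0\<close>),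
  and \<open>m = -1\<close> for their derivatives.\<close>

lemma decay_average:
  fixes k :: "real \<Rightarrow> real \<times> (real ^ 'n::finite) \<Rightarrow> real"
  assumes e: "0 < e" and c: "0 < c" and s: "0 \<le> s" "s \<le> 1" and A: "0 \<le> A"
    and k: "\<And>\<epsilon>. 0 < \<epsilon> \<Longrightarrow> \<epsilon> < e \<Longrightarrow> k \<epsilon> \<in> borel_measurable borel" "\<And>\<epsilon> z. 0 \<le> k \<epsilon> z"
      "\<And>\<epsilon>. 0 < \<epsilon> \<Longrightarrow> \<epsilon> < e \<Longrightarrow> (\<integral>\<^sup>+z. ennreal (k \<epsilon> z) \<partial>cylinder) \<le> ennreal (c * \<epsilon> powr m)"
    and G: "\<And>\<epsilon>. case_prod (G \<epsilon>) \<in> borel_measurable (borel \<Otimes>\<^sub>M borel)"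
      "\<And>\<epsilon> z. 0 < \<epsilon> \<Longrightarrow> \<epsilon> < e \<Longrightarrow> k \<epsilon> z \<noteq> 0 \<Longrightarrow> (\<integral>\<^sup>+y. G \<epsilon> z y \<partial>slab a b) \<le> 1"
    and F: "\<And>\<epsilon> z y. 0 < \<epsilon> \<Longrightarrow> \<epsilon> < e \<Longrightarrow> G \<epsilon> z y < \<infinity> \<Longrightarrow>
      \<bar>F \<epsilon> z y\<bar> \<le> (A * \<epsilon> powr \<kappa>) * max 1 (enn2real (G \<epsilon> z y)) powr s"
  shows "decay (slab a b) s (\<kappa> + m) (\<lambda>\<epsilon> y. \<integral>z. k \<epsilon> z * \<bar>F \<epsilon> z y\<bar> \<partial>cylinder)"
proof (rule decayI[OF e])
  fix \<epsilon> assume \<epsilon>: "0 < \<epsilon>" "\<epsilon> < e"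
  define N where "N = c * \<epsilon> powr m"
  have N: "N > 0" using c \<epsilon> by (simp add: N_def)
  note [measurable] = k(1)[OF \<epsilon>]
  have "Lq_bound (slab a b) s (3 * (A * \<epsilon> powr \<kappa>)) (\<lambda>y. \<integral>z. (1 / N * k \<epsilon> z) * \<bar>F \<epsilon> z y\<bar> \<partial>cylinder)"
  proof (rule Lq_bound_average[where G = "G \<epsilon>"])
    have "(\<integral>\<^sup>+z. ennreal (1 / N * k \<epsilon> z) \<partial>cylinder) = (\<integral>\<^sup>+z. ennreal (1 / N) * ennreal (k \<epsilon> z) \<partial>cylinder)"
      using N k(2) by (intro nn_integral_cong ennreal_mult) auto
    also have "\<dots> = ennreal (1 / N) * (\<integral>\<^sup>+z. ennreal (k \<epsilon> z) \<partial>cylinder)"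
      by (rule nn_integral_cmult) measurable
    also have "\<dots> \<le> ennreal (1 / N) * ennreal N"
      using k(3)[OF \<epsilon>] by (intro mult_left_mono) (auto simp: N_def)
    also have "\<dots> = 1" using N by (subst ennreal_mult[symmetric]) auto
    finally show "(\<integral>\<^sup>+z. ennreal (1 / N * k \<epsilon> z) \<partial>cylinder) \<le> 1" .
    show "case_prod (G \<epsilon>) \<in> borel_measurable (cylinder \<Otimes>\<^sub>M slab a b)"
      by (rule pair_borel_measurable[OF G(1)])
    show "(\<integral>\<^sup>+y. G \<epsilon> z y \<partial>slab a b) \<le> 1" if "1 / N * k \<epsilon> z \<noteq> 0" for z
      using that by (intro G(2)[OF \<epsilon>]) auto
    show "\<bar>F \<epsilon> z y\<bar> \<le> A * \<epsilon> powr \<kappa> * max 1 (enn2real (G \<epsilon> z y)) powr s" if "G \<epsilon> z y < \<infinity>" for z y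
      by (rule F[OF \<epsilon> that])
  qed (use sigma_finite_cylinder sigma_finite_slab s A N k(2) in auto)
  from Lq_bound_mult[OF Lq_bound_const[of N _ "\<lambda>_. N"] this]
  have "Lq_bound (slab a b) s (2 powr s * N * (3 * (A * \<epsilon> powr \<kappa>)))
      (\<lambda>y. N * (\<integral>z. (1 / N * k \<epsilon> z) * \<bar>F \<epsilon> z y\<bar> \<partial>cylinder))"
    using N s by simp
  moreover have "N * (\<integral>z. (1 / N * k \<epsilon> z) * \<bar>F \<epsilon> z y\<bar> \<partial>cylinder) = (\<integral>z. k \<epsilon> z * \<bar>F \<epsilon> z y\<bar> \<partial>cylinder)" for y
    using N by (subst integral_mult_right_zero[symmetric]) simp
  ultimately show "Lq_bound (slab a b) s ((2 powr s * c * 3 * A) * \<epsilon> powr (\<kappa> + m)) (\<lambda>y. \<integral>z. k \<epsilon> z * \<bar>F \<epsilon> z y\<bar> \<partial>cylinder)"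
    by (simp add: N_def powr_add mult_ac)
qed

text \<open>Besov regularity of a scalar field, as far as increments are concerned; a bound in \<open>L\<^sup>1\<^sup>/\<^sup>s\<close> for the
  field itself is stated separately by \<open>decay\<close> with rate 0.\<close>

definition besov_comp :: "real \<Rightarrow> real \<Rightarrow> real \<Rightarrow> (real \<times> (real ^ 'n::finite) \<Rightarrow> real) \<Rightarrow> bool" where
  "besov_comp T s \<kappa> f \<longleftrightarrow> periodic_L1 f \<and> besov_shift T s \<kappa> f \<and> 0 \<le> s \<and> s \<le> 1 \<and> 0 \<le> \<kappa>"

lemma besov_comp_zero: "besov_comp T 0 0 (\<lambda>y::real \<times> (real ^ 'n::finite). 0)"
  by (auto simp: besov_comp_def periodic_L1_def space_periodic_def besov_shift_def modular_def intro!: exI[of _ 1])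

lemma mollifier_facts:
  assumes K: "mollifier C \<epsilon> (K :: real \<times> (real ^ 'n::finite) \<Rightarrow> real)" and v: "v \<in> Basis"
  shows "smooth_in (-\<epsilon>) \<epsilon> K" "\<And>z. 0 \<le> K z" "integrable cylinder K" "(\<integral>z. K z \<partial>cylinder) = 1"
    "\<And>z. K z \<noteq> 0 \<Longrightarrow> close_shift C \<epsilon> z" "\<And>z. pdiff K v z \<noteq> 0 \<Longrightarrow> close_shift C \<epsilon> z"
    "(\<integral>\<^sup>+z. ennreal (K z) \<partial>cylinder) = 1" "(\<integral>\<^sup>+z. ennreal \<bar>pdiff K v z\<bar> \<partial>cylinder) \<le> ennreal (C / \<epsilon>)"
    "integrable cylinder (pdiff K v)" "(\<integral>z. pdiff K v z \<partial>cylinder) = 0"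
proof -
  show nn: "\<And>z. 0 \<le> K z" and mass: "(\<integral>\<^sup>+z. ennreal (K z) \<partial>cylinder) = 1"
    and "(\<integral>\<^sup>+z. ennreal \<bar>pdiff K v z\<bar> \<partial>cylinder) \<le> ennreal (C / \<epsilon>)"
    and cl: "\<And>z. K z \<noteq> 0 \<Longrightarrow> close_shift C \<epsilon> z" and "\<And>z. pdiff K v z \<noteq> 0 \<Longrightarrow> close_shift C \<epsilon> z"
    using K v unfolding mollifier_def close_shift_def by blast+
  have "fst y \<in> {-\<epsilon>..\<epsilon>}" if "K y \<noteq> 0" for y
    using cl[OF that] by (auto simp: close_shift_def)
  then show sm: "smooth_in (-\<epsilon>) \<epsilon> K" using K unfolding mollifier_def smooth_in_def by blast
  have supp: "fst y \<in> {-\<epsilon>..\<epsilon>}" if "K y \<noteq> 0" for y using sm that unfolding smooth_in_def by blast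
  note kb = smooth_in_bounded_pdiff[OF sm, of v]
  obtain B where B: "\<And>y. \<bar>K y\<bar> \<le> B" "\<And>y. \<bar>pdiff K v y\<bar> \<le> B" using bounded_pdiffD(3)[OF kb] by blast
  show int: "integrable cylinder K"
    by (rule integrable_cylinder_bounded[OF bounded_pdiffD(1)[OF kb] B(1) supp])
  show "integrable cylinder (pdiff K v)"
    by (rule integrable_cylinder_bounded[OF bounded_pdiff_borel_deriv[OF kb] B(2) smooth_in_pdiff(3)[OF sm]])
  have "ennreal (\<integral>z. K z \<partial>cylinder) = 1"
    using nn_integral_eq_integral[OF int] nn mass by simp
  then show "(\<integral>z. K z \<partial>cylinder) = 1" by simp
  have per: "space_periodic UNIV K" using sm by (simp add: smooth_in_def)
  show "(\<integral>z. pdiff K v z \<partial>cylinder) = 0" by (rule integral_pdiff_zero[OF kb per supp])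
qed

lemma kernel_borel_bounded:
  assumes "smooth_in a b K"
  shows "K \<in> borel_measurable borel" "pdiff K v \<in> borel_measurable borel" "space_periodic UNIV K"
    "space_periodic UNIV (pdiff K v)" "\<exists>B. \<forall>z. \<bar>K z\<bar> \<le> B \<and> \<bar>pdiff K v z\<bar> \<le> B"
proof -
  note kb = smooth_in_bounded_pdiff[OF assms, of v]
  show "K \<in> borel_measurable borel" "pdiff K v \<in> borel_measurable borel"
    using bounded_pdiffD(1)[OF kb] bounded_pdiff_borel_deriv[OF kb] by blast+
  show "space_periodic UNIV K" using assms by (simp add: smooth_in_def)
  show "space_periodic UNIV (pdiff K v)" by (rule smooth_in_pdiff(2)[OF assms])
  show "\<exists>B. \<forall>z. \<bar>K z\<bar> \<le> B \<and> \<bar>pdiff K v z\<bar> \<le> B" using bounded_pdiffD(3)[OF kb] by blast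
qed

text \<open>The error of mollification and the derivatives of a mollified function only see the increments
  of the function, as the kernel has mass one and its derivatives have mean zero.\<close>

lemma moll_diff_eq:
  assumes f: "periodic_L1 f" and k: "k \<in> borel_measurable borel" "space_periodic UNIV k" "\<And>z. \<bar>k z\<bar> \<le> B"
    and ki: "integrable cylinder k"
  shows "moll k f y - (\<integral>z. k z \<partial>cylinder) * f y = (\<integral>z. k z * (f (y + z) - f y) \<partial>cylinder)"
    "integrable cylinder (\<lambda>z. k z * (f (y + z) - f y))"
proof -
  have i1: "integrable cylinder (\<lambda>z. k z * f (y + z))" by (rule periodic_L1_integrable_mult[OF f k(1,3)])
  have i2: "integrable cylinder (\<lambda>z. k z * f y)" using ki by simp
  show "moll k f y - (\<integral>z. k z \<partial>cylinder) * f y = (\<integral>z. k z * (f (y + z) - f y) \<partial>cylinder)"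
    unfolding moll_eq[OF f k(1,2)] right_diff_distrib using i1 i2 by simp
  show "integrable cylinder (\<lambda>z. k z * (f (y + z) - f y))"
    unfolding right_diff_distrib using i1 i2 by (rule Bochner_Integration.integrable_diff)
qed

lemma moll_error_le:
  assumes K: "mollifier C \<epsilon> K" and f: "periodic_L1 f"
  shows "\<bar>moll K f y - f y\<bar> \<le> (\<integral>z. K z * \<bar>f (y + z) - f y\<bar> \<partial>cylinder)"
proof -
  obtain v :: "real \<times> (real ^ 'a)" where v: "v \<in> Basis" using nonempty_Basis by blast
  note m = mollifier_facts[OF K v]
  obtain B where B: "\<And>z. \<bar>K z\<bar> \<le> B" using kernel_borel_bounded(5)[OF m(1), of v] by blast
  have "moll K f y - f y = (\<integral>z. K z * (f (y + z) - f y) \<partial>cylinder)"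
    using moll_diff_eq(1)[OF f kernel_borel_bounded(1,3)[OF m(1)] B m(3), of y] m(4) by simp
  also have "\<bar>\<dots>\<bar> \<le> (\<integral>z. \<bar>K z * (f (y + z) - f y)\<bar> \<partial>cylinder)" by (rule integral_abs_bound)
  finally show ?thesis using m(2) by (simp add: abs_mult)
qed

lemma moll_pdiff_le:
  assumes K: "mollifier C \<epsilon> K" and f: "periodic_L1 f" and v: "v \<in> Basis"
  shows "\<bar>moll (pdiff K v) f y\<bar> \<le> (\<integral>z. \<bar>pdiff K v z\<bar> * \<bar>f (y + z) - f y\<bar> \<partial>cylinder)"
proof -
  note m = mollifier_facts[OF K v]
  obtain B where B: "\<And>z. \<bar>pdiff K v z\<bar> \<le> B" using kernel_borel_bounded(5)[OF m(1), of v] by blast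
  have "moll (pdiff K v) f y = (\<integral>z. pdiff K v z * (f (y + z) - f y) \<partial>cylinder)"
    using moll_diff_eq(1)[OF f kernel_borel_bounded(2,4)[OF m(1)] B m(9), of y] m(10) by simp
  also have "\<bar>\<dots>\<bar> \<le> (\<integral>z. \<bar>pdiff K v z * (f (y + z) - f y)\<bar> \<partial>cylinder)" by (rule integral_abs_bound)
  finally show ?thesis by (simp add: abs_mult)
qed

text \<open>The commutator of mollification and multiplication is quadratic in the increments: it is the
  average of the product of the increments of \<open>f\<close> and \<open>g\<close>, minus the product of their averages.\<close>

lemma moll_commutator_le:
  assumes K: "mollifier C \<epsilon> K" and f: "periodic_L1 f" and g: "periodic_L1 g" and fg: "periodic_L1 (\<lambda>y. f y * g y)"
  shows "\<bar>moll K (\<lambda>y. f y * g y) y - moll K f y * moll K g y\<bar> \<le>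
    (\<integral>z. K z * \<bar>(f (y + z) - f y) * (g (y + z) - g y)\<bar> \<partial>cylinder) +
    (\<integral>z. K z * \<bar>f (y + z) - f y\<bar> \<partial>cylinder) * (\<integral>z. K z * \<bar>g (y + z) - g y\<bar> \<partial>cylinder)"
proof -
  obtain v :: "real \<times> (real ^ 'a)" where v: "v \<in> Basis" using nonempty_Basis by blast
  note m = mollifier_facts[OF K v]
  obtain B where B: "\<And>z. \<bar>K z\<bar> \<le> B" using kernel_borel_bounded(5)[OF m(1), of v] by blast
  note k = kernel_borel_bounded(1,3)[OF m(1)]
  note I = periodic_L1_integrable_mult[OF _ k(1) B]
  have i: "integrable cylinder (\<lambda>z. K z * f (y + z))" "integrable cylinder (\<lambda>z. K z * g (y + z))"
    "integrable cylinder (\<lambda>z. K z * (f (y + z) * g (y + z)))"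
    using I[OF f] I[OF g] I[OF fg] by auto
  let ?F = "moll K f y" and ?G = "moll K g y"
  have eqF: "?F = (\<integral>z. K z * f (y + z) \<partial>cylinder)" and eqG: "?G = (\<integral>z. K z * g (y + z) \<partial>cylinder)"
    and eqFG: "moll K (\<lambda>y. f y * g y) y = (\<integral>z. K z * (f (y + z) * g (y + z)) \<partial>cylinder)"
    by (rule moll_eq[OF f k] moll_eq[OF g k] moll_eq[OF fg k])+
  have "(\<integral>z. K z * ((f (y + z) - f y) * (g (y + z) - g y)) \<partial>cylinder)
     = (\<integral>z. K z * (f (y + z) * g (y + z)) - g y * (K z * f (y + z)) - f y * (K z * g (y + z)) + f y * g y * K z \<partial>cylinder)"
    by (intro Bochner_Integration.integral_cong refl) (simp add: algebra_simps)
  also have "\<dots> = moll K (\<lambda>y. f y * g y) y - g y * ?F - f y * ?G + f y * g y"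
    unfolding eqF eqG eqFG using i m(3,4) by simp
  finally have "moll K (\<lambda>y. f y * g y) y - ?F * ?G =
    (\<integral>z. K z * ((f (y + z) - f y) * (g (y + z) - g y)) \<partial>cylinder) - (?F - f y) * (?G - g y)"
    by (simp add: algebra_simps)
  also have "\<bar>\<dots>\<bar> \<le> \<bar>\<integral>z. K z * ((f (y + z) - f y) * (g (y + z) - g y)) \<partial>cylinder\<bar> + \<bar>?F - f y\<bar> * \<bar>?G - g y\<bar>"
    unfolding abs_mult[symmetric] by (rule abs_triangle_ineq4)
  also have "\<dots> \<le> (\<integral>z. \<bar>K z * ((f (y + z) - f y) * (g (y + z) - g y))\<bar> \<partial>cylinder) +
    (\<integral>z. K z * \<bar>f (y + z) - f y\<bar> \<partial>cylinder) * (\<integral>z. K z * \<bar>g (y + z) - g y\<bar> \<partial>cylinder)"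
    by (intro add_mono integral_abs_bound mult_mono moll_error_le[OF K] f g) (auto intro!: integral_nonneg_AE simp: m(2))
  finally show ?thesis using m(2) by (simp add: abs_mult)
qed

text \<open>Nonnegativity is also asked for the values of \<open>\<epsilon>\<close> for which \<open>K \<epsilon>\<close> is not a mollifier, to have
  signs of integrals without a side condition on \<open>\<epsilon>\<close>.\<close>

locale mollifier_family =
  fixes a b T C :: real and K :: "real \<Rightarrow> real \<times> (real ^ 'n::finite) \<Rightarrow> real"
  assumes ab: "0 < a" "b < T" and C: "0 < C"
    and K: "\<And>\<epsilon>. 0 < \<epsilon> \<Longrightarrow> \<epsilon> < 1 \<Longrightarrow> mollifier C \<epsilon> (K \<epsilon>)"
    and K_nonneg: "\<And>\<epsilon> z. 0 \<le> K \<epsilon> z"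
begin

definition eps0 :: real where "eps0 = min 1 (min a (T - b))"

lemma eps0: "0 < eps0" "eps0 \<le> 1" "eps0 \<le> min a (T - b)"
  using ab by (auto simp: eps0_def)

lemma modular_increment_measurable:
  assumes [measurable]: "f \<in> borel_measurable borel"
  shows "case_prod (\<lambda>z y. modular s A (f (y + z) - f y)) \<in> borel_measurable (borel \<Otimes>\<^sub>M (borel :: (real \<times> (real ^ 'n)) measure))"
  by (simp add: case_prod_beta')

text \<open>The four averages of increments that occur: in errors of mollification, derivatives, commutators
  with a product, and the Taylor remainder of the pressure.\<close>

lemma decay_average_increments:
  assumes f: "besov_comp T s \<kappa> f" and g: "besov_comp T s' \<kappa>' g" and ss: "s + s' \<le> 1" and v: "v \<in> Basis"
    and \<gamma>: "1 \<le> \<gamma>" "\<gamma> * s \<le> 1"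
  shows "decay (slab a b) s \<kappa> (\<lambda>\<epsilon> y. \<integral>z. K \<epsilon> z * \<bar>f (y + z) - f y\<bar> \<partial>cylinder)"
    "decay (slab a b) s (\<kappa> - 1) (\<lambda>\<epsilon> y. \<integral>z. \<bar>pdiff (K \<epsilon>) v z\<bar> * \<bar>f (y + z) - f y\<bar> \<partial>cylinder)"
    "decay (slab a b) (s + s') (\<kappa> + \<kappa>') (\<lambda>\<epsilon> y. \<integral>z. K \<epsilon> z * \<bar>(f (y + z) - f y) * (g (y + z) - g y)\<bar> \<partial>cylinder)"
    "decay (slab a b) (\<gamma> * s) (\<gamma> * \<kappa>) (\<lambda>\<epsilon> y. \<integral>z. K \<epsilon> z * \<bar>\<bar>f (y + z) - f y\<bar> powr \<gamma>\<bar> \<partial>cylinder)"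
proof -
  have fs: "besov_shift T s \<kappa> f" "space_periodic UNIV f" "0 \<le> s" "s \<le> 1" "0 \<le> \<kappa>" and fm[measurable]: "f \<in> borel_measurable borel"
    using f by (auto simp: besov_comp_def periodic_L1_def)
  have gs: "besov_shift T s' \<kappa>' g" "space_periodic UNIV g" "0 \<le> s'" "s' \<le> 1" "0 \<le> \<kappa>'" and gm[measurable]: "g \<in> borel_measurable borel"
    using g by (auto simp: besov_comp_def periodic_L1_def)
  obtain A where A: "A > 0" "\<And>\<epsilon> z. 0 < \<epsilon> \<Longrightarrow> \<epsilon> < eps0 \<Longrightarrow> close_shift C \<epsilon> z \<Longrightarrow>
    (\<integral>\<^sup>+y. modular s (A * \<epsilon> powr \<kappa>) (f (y + z) - f y) \<partial>slab a b) \<le> 1"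
    using besov_slab[OF fs(1,2) fm fs(3,5) C, of a b] eps0(3) by (meson less_le_trans)
  obtain B where B: "B > 0" "\<And>\<epsilon> z. 0 < \<epsilon> \<Longrightarrow> \<epsilon> < eps0 \<Longrightarrow> close_shift C \<epsilon> z \<Longrightarrow>
    (\<integral>\<^sup>+y. modular s' (B * \<epsilon> powr \<kappa>') (g (y + z) - g y) \<partial>slab a b) \<le> 1"
    using besov_slab[OF gs(1,2) gm gs(3,5) C, of a b] eps0(3) by (meson less_le_trans)
  have m: "mollifier C \<epsilon> (K \<epsilon>)" if "0 < \<epsilon>" "\<epsilon> < eps0" for \<epsilon> using that eps0(2) by (intro K) auto
  have Km: "K \<epsilon> \<in> borel_measurable borel" "(\<lambda>z. \<bar>pdiff (K \<epsilon>) v z\<bar>) \<in> borel_measurable borel"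
      "(\<integral>\<^sup>+z. ennreal (K \<epsilon> z) \<partial>cylinder) \<le> ennreal (1 * \<epsilon> powr 0)"
      "(\<integral>\<^sup>+z. ennreal \<bar>pdiff (K \<epsilon>) v z\<bar> \<partial>cylinder) \<le> ennreal (C * \<epsilon> powr (- 1))"
      "\<And>z. K \<epsilon> z \<noteq> 0 \<Longrightarrow> close_shift C \<epsilon> z" "\<And>z. \<bar>pdiff (K \<epsilon>) v z\<bar> \<noteq> 0 \<Longrightarrow> close_shift C \<epsilon> z"
    if e: "0 < \<epsilon>" "\<epsilon> < eps0" for \<epsilon>
    using mollifier_facts[OF m[OF e] v] kernel_borel_bounded[OF mollifier_facts(1)[OF m[OF e] v]] e
    by (auto simp: powr_minus divide_inverse)
  let ?G = "\<lambda>\<epsilon> z y. modular s (A * \<epsilon> powr \<kappa>) (f (y + z) - f y)"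
  let ?H = "\<lambda>\<epsilon> z y. modular s' (B * \<epsilon> powr \<kappa>') (g (y + z) - g y)"
  have bf: "\<bar>f (y + z) - f y\<bar> \<le> A * \<epsilon> powr \<kappa> * max 1 (enn2real (?G \<epsilon> z y)) powr s"
    if "0 < \<epsilon>" "?G \<epsilon> z y < \<infinity>" for \<epsilon> z y
    using that A(1) fs by (intro modular_bound) auto
  have bg: "\<bar>g (y + z) - g y\<bar> \<le> B * \<epsilon> powr \<kappa>' * max 1 (enn2real (?H \<epsilon> z y)) powr s'"
    if "0 < \<epsilon>" "?H \<epsilon> z y < \<infinity>" for \<epsilon> z y
    using that B(1) gs by (intro modular_bound) auto
  show "decay (slab a b) s \<kappa> (\<lambda>\<epsilon> y. \<integral>z. K \<epsilon> z * \<bar>f (y + z) - f y\<bar> \<partial>cylinder)"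
    using decay_average[where G = ?G and k = K and F = "\<lambda>\<epsilon> z y. f (y + z) - f y" and m = 0 and c = 1 and A = A and e = eps0 and s = s and \<kappa> = \<kappa> and a = a and b = b]
      eps0 fs A Km K_nonneg bf modular_increment_measurable[OF fm] by simp
  show "decay (slab a b) s (\<kappa> - 1) (\<lambda>\<epsilon> y. \<integral>z. \<bar>pdiff (K \<epsilon>) v z\<bar> * \<bar>f (y + z) - f y\<bar> \<partial>cylinder)"
    using decay_average[where G = ?G and k = "\<lambda>\<epsilon> z. \<bar>pdiff (K \<epsilon>) v z\<bar>" and F = "\<lambda>\<epsilon> z y. f (y + z) - f y" and m = "- 1" and c = C and A = A and e = eps0 and s = s and \<kappa> = \<kappa> and a = a and b = b]
      eps0 fs A Km C bf modular_increment_measurable[OF fm] by simp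
  have "decay (slab a b) (\<gamma> * s) (\<gamma> * \<kappa> + 0) (\<lambda>\<epsilon> y. \<integral>z. K \<epsilon> z * \<bar>\<bar>f (y + z) - f y\<bar> powr \<gamma>\<bar> \<partial>cylinder)"
  proof (rule decay_average[where G = ?G and c = 1 and A = "A powr \<gamma>" and e = eps0])
    fix \<epsilon> z y assume e: "0 < \<epsilon>" "\<epsilon> < eps0" "?G \<epsilon> z y < \<infinity>"
    let ?x = "max 1 (enn2real (?G \<epsilon> z y))"
    have "\<bar>f (y + z) - f y\<bar> powr \<gamma> \<le> (A * \<epsilon> powr \<kappa> * ?x powr s) powr \<gamma>"
      using bf[OF e(1,3)] \<gamma> by (intro powr_mono2) auto
    also have "\<dots> = A powr \<gamma> * \<epsilon> powr (\<gamma> * \<kappa>) * ?x powr (\<gamma> * s)"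
      using A(1) e by (simp add: powr_mult powr_powr mult.commute)
    finally show "\<bar>\<bar>f (y + z) - f y\<bar> powr \<gamma>\<bar> \<le> A powr \<gamma> * \<epsilon> powr (\<gamma> * \<kappa>) * ?x powr (\<gamma> * s)" by simp
  qed (use eps0 fs A Km K_nonneg modular_increment_measurable[OF fm] \<gamma> in auto)
  then show "decay (slab a b) (\<gamma> * s) (\<gamma> * \<kappa>) (\<lambda>\<epsilon> y. \<integral>z. K \<epsilon> z * \<bar>\<bar>f (y + z) - f y\<bar> powr \<gamma>\<bar> \<partial>cylinder)"
    by simp
  let ?J = "\<lambda>\<epsilon> z y. ennreal (1/2) * (?G \<epsilon> z y + ?H \<epsilon> z y)"
  have "decay (slab a b) (s + s') (\<kappa> + \<kappa>' + 0) (\<lambda>\<epsilon> y. \<integral>z. K \<epsilon> z * \<bar>(f (y + z) - f y) * (g (y + z) - g y)\<bar> \<partial>cylinder)"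
  proof (rule decay_average[where G = ?J and c = 1 and A = "2 powr (s + s') * A * B" and e = eps0])
    fix \<epsilon> z y assume e: "0 < \<epsilon>" "\<epsilon> < eps0" "?J \<epsilon> z y < \<infinity>"
    note mean = ennreal_mean_bounds[OF e(3)]
    let ?x = "max 1 (enn2real (?J \<epsilon> z y))"
    have "A * \<epsilon> powr \<kappa> * max 1 (enn2real (?G \<epsilon> z y)) powr s \<le> A * \<epsilon> powr \<kappa> * (2 * ?x) powr s"
      using A(1) by (intro mult_left_mono powr_mono2 mean(3) fs(3)) auto
    with bf[OF e(1) mean(1)] have "\<bar>f (y + z) - f y\<bar> \<le> A * \<epsilon> powr \<kappa> * (2 * ?x) powr s"
      by (rule order_trans)
    moreover
    have "B * \<epsilon> powr \<kappa>' * max 1 (enn2real (?H \<epsilon> z y)) powr s' \<le> B * \<epsilon> powr \<kappa>' * (2 * ?x) powr s'"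
      using B(1) by (intro mult_left_mono powr_mono2 mean(4) gs(3)) auto
    with bg[OF e(1) mean(2)] have "\<bar>g (y + z) - g y\<bar> \<le> B * \<epsilon> powr \<kappa>' * (2 * ?x) powr s'"
      by (rule order_trans)
    ultimately have "\<bar>(f (y + z) - f y) * (g (y + z) - g y)\<bar> \<le>
        (A * \<epsilon> powr \<kappa> * (2 * ?x) powr s) * (B * \<epsilon> powr \<kappa>' * (2 * ?x) powr s')"
      unfolding abs_mult using A(1) by (intro mult_mono) auto
    also have "\<dots> = 2 powr (s + s') * A * B * \<epsilon> powr (\<kappa> + \<kappa>') * ?x powr (s + s')"
      by (simp add: powr_mult powr_add mult_ac)
    finally show "\<bar>(f (y + z) - f y) * (g (y + z) - g y)\<bar> \<le>
        2 powr (s + s') * A * B * \<epsilon> powr (\<kappa> + \<kappa>') * ?x powr (s + s')" .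
  next
    fix \<epsilon> z assume e: "0 < \<epsilon>" "\<epsilon> < eps0" "K \<epsilon> z \<noteq> 0"
    show "(\<integral>\<^sup>+y. ?J \<epsilon> z y \<partial>slab a b) \<le> 1"
      using A(2)[OF e(1,2) Km(5)[OF e]] B(2)[OF e(1,2) Km(5)[OF e]] by (intro nn_integral_mean_le_1) auto
  next
    fix \<epsilon>
    have "(\<lambda>(z, y). ?G \<epsilon> z y) \<in> borel_measurable (borel \<Otimes>\<^sub>M borel)" "(\<lambda>(z, y). ?H \<epsilon> z y) \<in> borel_measurable (borel \<Otimes>\<^sub>M borel)"
      using modular_increment_measurable fm gm by blast+
    then show "case_prod (?J \<epsilon>) \<in> borel_measurable (borel \<Otimes>\<^sub>M borel)"
      by (simp add: case_prod_beta')
  qed (use eps0 fs gs A B Km K_nonneg ss in auto)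
  then show "decay (slab a b) (s + s') (\<kappa> + \<kappa>') (\<lambda>\<epsilon> y. \<integral>z. K \<epsilon> z * \<bar>(f (y + z) - f y) * (g (y + z) - g y)\<bar> \<partial>cylinder)"
    by simp
qed

lemma integral_kernel_nonneg [simp]: "0 \<le> (\<integral>z. K \<epsilon> z * \<bar>h z\<bar> \<partial>cylinder)"
  by (intro integral_nonneg_AE AE_I2) (simp add: K_nonneg)

lemma decay_moll_error:
  assumes f: "besov_comp T s \<kappa> f"
  shows "decay (slab a b) s \<kappa> (\<lambda>\<epsilon> y. moll (K \<epsilon>) f y - f y)"
proof -
  obtain v :: "real \<times> (real ^ 'n)" where v: "v \<in> Basis" using nonempty_Basis by blast
  have s: "s \<le> 1" "periodic_L1 f" using f by (auto simp: besov_comp_def)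
  show ?thesis
    using decay_average_increments(1)[OF f besov_comp_zero _ v, of 1] s
    by (rule_tac decay_mono[where e = eps0 and s = s and \<kappa> = \<kappa> and H = "\<lambda>\<epsilon> y. \<integral>z. K \<epsilon> z * \<bar>f (y + z) - f y\<bar> \<partial>cylinder"])
       (use eps0 in \<open>auto intro!: moll_error_le[OF K]\<close>)
qed

lemma decay_moll_pdiff:
  assumes f: "besov_comp T s \<kappa> f" and v: "v \<in> Basis"
  shows "decay (slab a b) s (\<kappa> - 1) (\<lambda>\<epsilon> y. - moll (pdiff (K \<epsilon>) v) f y)"
proof -
  have s: "s \<le> 1" "periodic_L1 f" using f by (auto simp: besov_comp_def)
  have "decay (slab a b) s (\<kappa> - 1) (\<lambda>\<epsilon> y. \<integral>z. \<bar>pdiff (K \<epsilon>) v z\<bar> * \<bar>f (y + z) - f y\<bar> \<partial>cylinder)"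
    using decay_average_increments(2)[OF f besov_comp_zero _ v, of 1] s by simp
  then show ?thesis
  proof (rule decay_mono[where e = eps0])
    fix \<epsilon> y assume e: "0 < \<epsilon>" "\<epsilon> < eps0"
    show "\<bar>- moll (pdiff (K \<epsilon>) v) f y\<bar> \<le> \<bar>\<integral>z. \<bar>pdiff (K \<epsilon>) v z\<bar> * \<bar>f (y + z) - f y\<bar> \<partial>cylinder\<bar>"
      using moll_pdiff_le[OF K s(2) v, of \<epsilon> y] e eps0 by simp
  qed (use eps0 in auto)
qed

lemma decay_moll_commutator:
  assumes f: "besov_comp T s \<kappa> f" and g: "besov_comp T s' \<kappa>' g" and ss: "s + s' \<le> 1"
    and fg: "periodic_L1 (\<lambda>y. f y * g y)"
  shows "decay (slab a b) (s + s') (\<kappa> + \<kappa>') (\<lambda>\<epsilon> y. moll (K \<epsilon>) (\<lambda>y. f y * g y) y - moll (K \<epsilon>) f y * moll (K \<epsilon>) g y)"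
proof -
  obtain v :: "real \<times> (real ^ 'n)" where v: "v \<in> Basis" using nonempty_Basis by blast
  have s: "0 \<le> s" "s \<le> 1" "periodic_L1 f" "0 \<le> s'" "s' \<le> 1" "periodic_L1 g" using f g by (auto simp: besov_comp_def)
  note I = decay_average_increments
  have "decay (slab a b) (s + s') (\<kappa> + \<kappa>') (\<lambda>\<epsilon> y.
     (\<integral>z. K \<epsilon> z * \<bar>(f (y + z) - f y) * (g (y + z) - g y)\<bar> \<partial>cylinder) +
     (\<integral>z. K \<epsilon> z * \<bar>f (y + z) - f y\<bar> \<partial>cylinder) * (\<integral>z. K \<epsilon> z * \<bar>g (y + z) - g y\<bar> \<partial>cylinder))"
    using s ss by (intro decay_add decay_mult I(3)[OF f g ss v, of 1] I(1)[OF f g ss v, of 1] I(1)[OF g f _ v, of 1]) auto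
  then show ?thesis
  proof (rule decay_mono[where e = eps0])
    fix \<epsilon> y assume e: "0 < \<epsilon>" "\<epsilon> < eps0"
    show "\<bar>moll (K \<epsilon>) (\<lambda>y. f y * g y) y - moll (K \<epsilon>) f y * moll (K \<epsilon>) g y\<bar> \<le>
      \<bar>(\<integral>z. K \<epsilon> z * \<bar>(f (y + z) - f y) * (g (y + z) - g y)\<bar> \<partial>cylinder) +
     (\<integral>z. K \<epsilon> z * \<bar>f (y + z) - f y\<bar> \<partial>cylinder) * (\<integral>z. K \<epsilon> z * \<bar>g (y + z) - g y\<bar> \<partial>cylinder)\<bar>"
      using moll_commutator_le[OF K s(3,6) fg, of \<epsilon> y] e eps0 by (meson abs_ge_self order_trans less_le_trans)
  qed (use eps0 in auto)
qed

end

section \<open>The energy balance of the mollified fields\<close>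

lemma Ck_shift: "Ck k f \<Longrightarrow> Ck k (\<lambda>x. f (x - c))"
proof (induction k arbitrary: f)
  case 0
  then have "continuous_on UNIV f" by simp
  then have "continuous_on UNIV (\<lambda>x. f (x - c))"
    by (rule continuous_on_compose2) (auto intro!: continuous_intros)
  then show ?case by simp
next
  case (Suc k)
  show ?case
  proof (rule Ck_Suc_I)
    show "((\<lambda>x. f (x - c)) has_derivative frechet_derivative f (at (x - c))) (at x)" for x
    proof -
      have "((\<lambda>x. x - c) has_derivative (\<lambda>v. v)) (at x)" by (auto intro!: derivative_eq_intros)
      from has_derivative_compose[OF this Ck_Suc_D(1)[OF Suc.prems]] show ?thesis .
    qed
    show "Ck k (\<lambda>x. frechet_derivative f (at (x - c)) v)" for v
      using Suc.IH Ck_Suc_D(2)[OF Suc.prems] by blast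
  qed
qed

text \<open>Translated kernels are admissible in the weak form of the equations, which thereby get
  mollified.\<close>

lemma smooth_in_shift:
  assumes k: "smooth_in c d k"
  shows "smooth_in (c + fst y) (d + fst y) (\<lambda>y'. k (y' - y))" "pdiff (\<lambda>y'. k (y' - y)) v y' = pdiff k v (y' - y)"
proof -
  have Ck: "Ck j k" for j using k by (simp add: smooth_in_def)
  have Ck': "Ck j (\<lambda>y'. k (y' - y))" for j by (rule Ck_shift[OF Ck])
  have "space_periodic UNIV (\<lambda>y'. k (y' + (- y)))"
    using k unfolding smooth_in_def by (intro space_periodic_shift) blast
  moreover have "fst y' \<in> {c + fst y..d + fst y}" if "k (y' - y) \<noteq> 0" for y'
  proof -
    have "fst (y' - y) \<in> {c..d}" using k that unfolding smooth_in_def by blast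
    then show ?thesis by auto
  qed
  ultimately show "smooth_in (c + fst y) (d + fst y) (\<lambda>y'. k (y' - y))"
    using Ck' by (simp add: smooth_in_def)
  have 1: "((\<lambda>h. k (y' - y + h *\<^sub>R v)) has_real_derivative pdiff k v (y' - y)) (at 0)"
    using Ck_has_pdiff[OF Ck] unfolding has_pdiff_def by blast
  have 2: "((\<lambda>h. k (y' + h *\<^sub>R v - y)) has_real_derivative pdiff (\<lambda>y'. k (y' - y)) v y') (at 0)"
    using Ck_has_pdiff[OF Ck'] unfolding has_pdiff_def by blast
  have eq: "y' + h *\<^sub>R v - y = y' - y + h *\<^sub>R v" for h by simp
  show "pdiff (\<lambda>y'. k (y' - y)) v y' = pdiff k v (y' - y)"
    by (rule DERIV_unique[OF 2[unfolded eq] 1])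
qed

text \<open>The energy identity for smooth fields, as algebra: the divergence of the regularised energy flux
  is a combination of the mass and momentum equations and of commutators. Suffixes \<open>t\<close> and \<open>x\<close> mark time
  and space derivatives.\<close>

lemma energy_flux_divergence:
  fixes U M Ut Mt Px Rx qx :: "'n::finite \<Rightarrow> real" and FF Ux Fx Mx :: "'n \<Rightarrow> 'n \<Rightarrow> real"
  assumes mass: "Rt + (\<Sum>j\<in>UNIV. Mx j j) = 0"
    and momentum: "\<And>i. Mt i + (\<Sum>j\<in>UNIV. Fx i j) + Px i = 0"
    and S: "S = (\<Sum>i\<in>UNIV. U i * U i)" and qx: "\<And>j. qx j = R * b'' * Rx j"
  shows "((\<Sum>i\<in>UNIV. Ut i * M i + Mt i * U i) - 1/2 * ((\<Sum>i\<in>UNIV. Ut i * U i + Ut i * U i) * R + Rt * S) + b' * Rt)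
    + (\<Sum>j\<in>UNIV. (\<Sum>i\<in>UNIV. Ux i j * FF i j + Fx i j * U i) + (Ux j j * Pm + Px j * U j)
        + (b'' * Rx j * M j + Mx j j * b') - 1/2 * ((\<Sum>i\<in>UNIV. Ux i j * U i + Ux i j * U i) * M j + Mx j j * S)
        - (Ux j j * q + qx j * U j))
    = (\<Sum>i\<in>UNIV. Ut i * (M i - R * U i)) + (\<Sum>j\<in>UNIV. \<Sum>i\<in>UNIV. Ux i j * (FF i j - M j * U i))
      + (\<Sum>j\<in>UNIV. Ux j j * (Pm - q)) + (\<Sum>j\<in>UNIV. b'' * Rx j * (M j - R * U j))"
    (is "?L = ?R")
proof -
  have "(\<Sum>i\<in>UNIV. U i * (Mt i + (\<Sum>j\<in>UNIV. Fx i j) + Px i)) = 0" using momentum by simp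
  then have "(\<Sum>i\<in>UNIV. Mt i * U i) + (\<Sum>i\<in>UNIV. \<Sum>j\<in>UNIV. Fx i j * U i) + (\<Sum>j\<in>UNIV. Px j * U j) = 0"
    by (simp add: distrib_left sum.distrib sum_distrib_left mult.commute)
  then have mom: "(\<Sum>i\<in>UNIV. Mt i * U i) + (\<Sum>j\<in>UNIV. \<Sum>i\<in>UNIV. Fx i j * U i) + (\<Sum>j\<in>UNIV. Px j * U j) = 0"
    by (subst sum.swap)
  have "?L - ?R = ((\<Sum>i\<in>UNIV. Mt i * U i) + (\<Sum>j\<in>UNIV. \<Sum>i\<in>UNIV. Fx i j * U i) + (\<Sum>j\<in>UNIV. Px j * U j))
      + (b' - 1/2 * S) * (Rt + (\<Sum>j\<in>UNIV. Mx j j))"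
    unfolding qx
    by (simp add: distrib_left distrib_right left_diff_distrib right_diff_distrib sum.distrib sum_subtractf
        sum_distrib_left sum_distrib_right mult.commute mult.left_commute)
  then show ?thesis using mom mass by simp
qed

lemma decay_product_error:
  assumes "decay M s1 \<kappa>1 (\<lambda>\<epsilon> y. F \<epsilon> y - f y)" "decay M s1 0 (\<lambda>\<epsilon>. f)"
    and "decay M s2 \<kappa>2 (\<lambda>\<epsilon> y. H \<epsilon> y - h y)" "decay M s2 0 (\<lambda>\<epsilon>. h)"
    and "0 \<le> s1" "0 \<le> s2" "0 \<le> \<kappa>1" "0 \<le> \<kappa>2"
  shows "decay M (s1 + s2) (min \<kappa>1 \<kappa>2) (\<lambda>\<epsilon> y. F \<epsilon> y * H \<epsilon> y - f y * h y)"
proof -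
  have "decay M s1 0 (\<lambda>\<epsilon> y. (F \<epsilon> y - f y) + f y)"
    using assms by (intro decay_add decay_weaken[OF assms(1)]) auto
  then have F: "decay M s1 0 F" by simp
  have "decay M (s1 + s2) (min \<kappa>1 \<kappa>2) (\<lambda>\<epsilon> y. F \<epsilon> y * (H \<epsilon> y - h y) + (F \<epsilon> y - f y) * h y)"
    using assms
    by (intro decay_add decay_weaken[OF decay_mult[OF F assms(3)]] decay_weaken[OF decay_mult[OF assms(1,4)]]) auto
  then show ?thesis by (simp add: algebra_simps)
qed

lemma decay_const_integrable:
  assumes "decay M s \<kappa> (\<lambda>\<epsilon>. f)" "s \<le> 1" "emeasure M (space M) < \<infinity>" and [measurable]: "f \<in> borel_measurable M"
  shows "integrable M f"
proof -
  obtain A where A: "Lq_bound M s A f"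
    using decayD[OF assms(1)] dense by metis
  have "(\<integral>\<^sup>+y. ennreal \<bar>f y\<bar> \<partial>M) \<le> ennreal A * (emeasure M (space M) + 1)"
    by (rule Lq_bound_integral[OF A assms(2)])
  also have "\<dots> < \<infinity>" using assms(3) by (simp add: ennreal_mult_less_top ennreal_add_less_top less_top)
  finally show ?thesis by (intro integrableI_bounded) auto
qed

text \<open>The Euler system for Borel representatives. The fields have integrability exponents \<open>1 / s\<close> (for
  \<open>\<rho>\<close> and \<open>\<rho> u\<close>) and \<open>1 / \<sigma>\<close> (for \<open>u\<close>); the bounds on the density hold everywhere, not only almost
  everywhere. \<open>B \<delta>\<close> is the potential regularised below density \<open>\<delta>\<close>.\<close>

locale vacuum_euler = mollifier_family a b T C K
  for a b T C and K :: "real \<Rightarrow> real \<times> (real ^ 'n::finite) \<Rightarrow> real" +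
  fixes \<gamma> \<alpha> \<beta> lo hi s \<sigma> Cp :: real
    and \<rho> pr :: "real \<times> (real ^ 'n) \<Rightarrow> real" and u :: "'n \<Rightarrow> real \<times> (real ^ 'n) \<Rightarrow> real"
    and p p' P :: "real \<Rightarrow> real" and B B' B'' :: "real \<Rightarrow> real \<Rightarrow> real"
  assumes s: "0 \<le> s" "0 \<le> \<sigma>" "s + 2 * \<sigma> \<le> 1" "\<sigma> + 2 * s \<le> 1"
    and \<gamma>: "1 < \<gamma>" "\<gamma> < 2" and \<alpha>: "0 \<le> \<alpha>" "\<alpha> \<le> 1" and \<beta>: "0 \<le> \<beta>" "\<beta> \<le> 1"
    and smooth: "\<alpha> + \<gamma> * \<beta> > 1" "2 * \<alpha> + \<beta> > 1" and lo: "0 \<le> lo" "lo \<le> hi"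
    and \<rho>: "besov_comp T s \<beta> \<rho>" and u: "\<And>i. besov_comp T \<sigma> \<alpha> (u i)"
    and m: "\<And>i. besov_comp T s \<beta> (\<lambda>y. \<rho> y * u i y)"
    and flux: "\<And>i j. periodic_L1 (\<lambda>y. (\<rho> y * u j y) * u i y)"
    and pr: "periodic_L1 pr" "\<And>y. fst y \<in> {0<..<T} \<Longrightarrow> pr y = p (\<rho> y)"
    and u_bound: "\<And>i. decay (slab a b) \<sigma> 0 (\<lambda>\<epsilon>. u i)"
    and m_bound: "\<And>i. decay (slab a b) s 0 (\<lambda>\<epsilon> y. \<rho> y * u i y)"
    and range: "\<And>y. fst y \<in> {0<..<T} \<Longrightarrow> \<rho> y \<in> {lo..hi}"
    and Cp: "0 \<le> Cp"
    and p_Lip: "\<And>x t. x \<in> {lo..hi} \<Longrightarrow> t \<in> {lo..hi} \<Longrightarrow> \<bar>p x - p t\<bar> \<le> Cp * \<bar>x - t\<bar>"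
    and p_Taylor: "\<And>x t. x \<in> {lo..hi} \<Longrightarrow> t \<in> {lo..hi} \<Longrightarrow> \<bar>p x - p t - p' t * (x - t)\<bar> \<le> Cp * \<bar>x - t\<bar> powr \<gamma>"
    and potential: "\<And>\<delta> x. 0 < \<delta> \<Longrightarrow> \<delta> \<le> 1 \<Longrightarrow> (B \<delta> has_real_derivative B' \<delta> x) (at x)"
      "\<And>\<delta> x. 0 < \<delta> \<Longrightarrow> \<delta> \<le> 1 \<Longrightarrow> (B' \<delta> has_real_derivative B'' \<delta> x) (at x)"
      "\<And>\<delta>. 0 < \<delta> \<Longrightarrow> \<delta> \<le> 1 \<Longrightarrow> continuous_on UNIV (B'' \<delta>)"
      "\<And>\<delta> x. 0 < \<delta> \<Longrightarrow> \<delta> \<le> 1 \<Longrightarrow> x \<in> {lo..hi} \<Longrightarrow> \<bar>B'' \<delta> x\<bar> \<le> Cp * \<delta> powr (\<gamma> - 2)"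
      "\<And>\<delta> x. 0 < \<delta> \<Longrightarrow> \<delta> \<le> 1 \<Longrightarrow> x \<in> {lo..hi} \<Longrightarrow> \<bar>B' \<delta> x\<bar> \<le> Cp * \<delta> powr (\<gamma> - 2)"
      "\<And>\<delta> x. 0 < \<delta> \<Longrightarrow> \<delta> \<le> 1 \<Longrightarrow> x \<in> {lo..hi} \<Longrightarrow> \<bar>x * B' \<delta> x - B \<delta> x - p x\<bar> \<le> Cp * \<delta> powr \<gamma>"
      "\<And>\<delta> x. 0 < \<delta> \<Longrightarrow> \<delta> \<le> 1 \<Longrightarrow> x \<in> {lo..hi} \<Longrightarrow> \<bar>B \<delta> x - P x\<bar> \<le> Cp * \<delta> powr \<gamma>"
    and mass: "\<And>c d \<psi>. 0 < c \<Longrightarrow> d < T \<Longrightarrow> smooth_in c d \<psi> \<Longrightarrow>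
      (\<integral>y. pdiff \<psi> (1, 0) y * \<rho> y \<partial>cylinder) +
      (\<Sum>j\<in>UNIV. \<integral>y. pdiff \<psi> (0, axis j 1) y * (\<rho> y * u j y) \<partial>cylinder) = 0"
    and momentum: "\<And>c d \<psi> i. 0 < c \<Longrightarrow> d < T \<Longrightarrow> smooth_in c d \<psi> \<Longrightarrow>
      (\<integral>y. pdiff \<psi> (1, 0) y * (\<rho> y * u i y) \<partial>cylinder) +
      (\<Sum>j\<in>UNIV. \<integral>y. pdiff \<psi> (0, axis j 1) y * ((\<rho> y * u j y) * u i y) \<partial>cylinder) +
      (\<integral>y. pdiff \<psi> (0, axis i 1) y * pr y \<partial>cylinder) = 0"
begin

lemma slab_time: "y \<in> space (slab a b) \<Longrightarrow> fst y \<in> {0<..<T}"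
  using ab by (auto simp: space_slab)

lemma L1: "periodic_L1 \<rho>" "periodic_L1 (u i)" "periodic_L1 (\<lambda>y. \<rho> y * u i y)"
  using \<rho> u m by (auto simp: besov_comp_def)

text \<open>Mollified fields, their derivatives, and the density \<open>\<epsilon> powr \<beta>\<close> below which the potential is
  regularised: it is the order of the error of mollification of \<open>\<rho>\<close>.\<close>

abbreviation "R \<epsilon> \<equiv> moll (K \<epsilon>) \<rho>"
abbreviation "U \<epsilon> i \<equiv> moll (K \<epsilon>) (u i)"
abbreviation "M \<epsilon> i \<equiv> moll (K \<epsilon>) (\<lambda>y. \<rho> y * u i y)"
abbreviation "FF \<epsilon> i j \<equiv> moll (K \<epsilon>) (\<lambda>y. (\<rho> y * u j y) * u i y)"
abbreviation "PP \<epsilon> \<equiv> moll (K \<epsilon>) pr"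
abbreviation "D \<epsilon> v f y \<equiv> - moll (pdiff (K \<epsilon>) v) f y"
abbreviation "dl \<epsilon> \<equiv> \<epsilon> powr \<beta>"

lemma basis_in: "(1, 0) \<in> (Basis :: (real \<times> (real ^ 'n)) set)" "(0, axis j 1) \<in> (Basis :: (real \<times> (real ^ 'n)) set)"
  by (auto simp: Basis_spacetime)

lemma K_facts:
  assumes "0 < \<epsilon>" "\<epsilon> < eps0"
  shows "mollifier C \<epsilon> (K \<epsilon>)" "smooth_in (-\<epsilon>) \<epsilon> (K \<epsilon>)" "\<epsilon> < 1" "\<epsilon> < a" "\<epsilon> < T - b" "0 < dl \<epsilon>" "dl \<epsilon> \<le> 1"
proof -
  show m: "mollifier C \<epsilon> (K \<epsilon>)" "\<epsilon> < 1" "\<epsilon> < a" "\<epsilon> < T - b" using assms eps0 by (auto intro: K)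
  show "smooth_in (-\<epsilon>) \<epsilon> (K \<epsilon>)" by (rule mollifier_facts(1)[OF m(1) basis_in(1)])
  show "0 < dl \<epsilon>" "dl \<epsilon> \<le> 1" using assms(1) m(2) \<beta> by (auto simp: powr_le1)
qed

lemma mollified_mass:
  assumes e: "0 < \<epsilon>" "\<epsilon> < eps0" and y: "y \<in> space (slab a b)"
  shows "D \<epsilon> (1, 0) \<rho> y + (\<Sum>j\<in>UNIV. D \<epsilon> (0, axis j 1) (\<lambda>y. \<rho> y * u j y) y) = 0"
proof -
  note k = K_facts[OF e]
  have "0 < - \<epsilon> + fst y" "\<epsilon> + fst y < T" using y k by (auto simp: space_slab)
  from mass[OF this smooth_in_shift(1)[OF k(2), of y]] show ?thesis
    unfolding smooth_in_shift(2)[OF k(2)] moll_def by (simp add: sum_negf)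
qed

lemma mollified_momentum:
  assumes e: "0 < \<epsilon>" "\<epsilon> < eps0" and y: "y \<in> space (slab a b)"
  shows "D \<epsilon> (1, 0) (\<lambda>y. \<rho> y * u i y) y + (\<Sum>j\<in>UNIV. D \<epsilon> (0, axis j 1) (\<lambda>y. (\<rho> y * u j y) * u i y) y)
    + D \<epsilon> (0, axis i 1) pr y = 0"
proof -
  note k = K_facts[OF e]
  have "0 < - \<epsilon> + fst y" "\<epsilon> + fst y < T" using y k by (auto simp: space_slab)
  from momentum[OF this smooth_in_shift(1)[OF k(2), of y], of i] show ?thesis
    unfolding smooth_in_shift(2)[OF k(2)] moll_def by (simp add: sum_negf)
qed

text \<open>Regularised energy density and flux. The kinetic energy density is written as
  \<open>U \<cdot> M - R \<bar>U\<bar>\<^sup>2 / 2\<close>, so that the momentum equation enters without a division by \<open>R\<close>; \<open>q\<close> is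
  the pressure that belongs to the regularised potential, and \<open>X\<close> collects the commutators.\<close>

definition Wt :: "real \<Rightarrow> real \<times> (real ^ 'n) \<Rightarrow> real" where
  "Wt \<epsilon> y = (\<Sum>i\<in>UNIV. U \<epsilon> i y * M \<epsilon> i y) - 1/2 * ((\<Sum>i\<in>UNIV. U \<epsilon> i y * U \<epsilon> i y) * R \<epsilon> y) + B (dl \<epsilon>) (R \<epsilon> y)"

definition q :: "real \<Rightarrow> real \<times> (real ^ 'n) \<Rightarrow> real" where
  "q \<epsilon> y = R \<epsilon> y * B' (dl \<epsilon>) (R \<epsilon> y) - B (dl \<epsilon>) (R \<epsilon> y)"

definition Wx :: "real \<Rightarrow> 'n \<Rightarrow> real \<times> (real ^ 'n) \<Rightarrow> real" where
  "Wx \<epsilon> j y = (\<Sum>i\<in>UNIV. U \<epsilon> i y * FF \<epsilon> i j y) + U \<epsilon> j y * PP \<epsilon> y + B' (dl \<epsilon>) (R \<epsilon> y) * M \<epsilon> j y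
    - 1/2 * ((\<Sum>i\<in>UNIV. U \<epsilon> i y * U \<epsilon> i y) * M \<epsilon> j y) - U \<epsilon> j y * q \<epsilon> y"

definition X :: "real \<Rightarrow> real \<times> (real ^ 'n) \<Rightarrow> real" where
  "X \<epsilon> y = (\<Sum>i\<in>UNIV. D \<epsilon> (1, 0) (u i) y * (M \<epsilon> i y - R \<epsilon> y * U \<epsilon> i y))
    + (\<Sum>j\<in>UNIV. \<Sum>i\<in>UNIV. D \<epsilon> (0, axis j 1) (u i) y * (FF \<epsilon> i j y - M \<epsilon> j y * U \<epsilon> i y))
    + (\<Sum>j\<in>UNIV. D \<epsilon> (0, axis j 1) (u j) y * (PP \<epsilon> y - q \<epsilon> y))
    + (\<Sum>j\<in>UNIV. B'' (dl \<epsilon>) (R \<epsilon> y) * D \<epsilon> (0, axis j 1) \<rho> y * (M \<epsilon> j y - R \<epsilon> y * U \<epsilon> j y))"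

text \<open>The divergence of \<open>\<phi> (Wt, Wx)\<close> has mean zero on the cylinder, and the divergence of \<open>(Wt, Wx)\<close>
  is \<open>X\<close> by the mollified equations.\<close>

lemma energy_identity:
  assumes e: "0 < \<epsilon>" "\<epsilon> < eps0" and \<phi>: "smooth_in a b \<phi>"
  shows "(\<integral>y. pdiff \<phi> (1, 0) y * Wt \<epsilon> y + (\<Sum>j\<in>UNIV. pdiff \<phi> (0, axis j 1) y * Wx \<epsilon> j y) + \<phi> y * X \<epsilon> y \<partial>slab a b) = 0"
    "integrable (slab a b) (\<lambda>y. pdiff \<phi> (1, 0) y * Wt \<epsilon> y + (\<Sum>j\<in>UNIV. pdiff \<phi> (0, axis j 1) y * Wx \<epsilon> j y) + \<phi> y * X \<epsilon> y)"
proof -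
  note k = K_facts[OF e]
  have per: "space_periodic UNIV (K \<epsilon>)" using k(2) by (simp add: smooth_in_def)
  note d = moll_bounded_pdiff[OF _ k(2)]
  have cB': "continuous_on UNIV (B' (dl \<epsilon>))"
    using potential(2)[OF k(6,7)] DERIV_isCont continuous_at_imp_continuous_on by blast
  note dB = bounded_pdiff_compose[OF d[OF L1(1)] potential(1)[OF k(6,7)] cB']
  note dB' = bounded_pdiff_compose[OF d[OF L1(1)] potential(2)[OF k(6,7)] potential(3)[OF k(6,7)]]
  let ?U = "\<lambda>i. U \<epsilon> i" and ?M = "\<lambda>i. M \<epsilon> i" and ?R = "R \<epsilon>"
  define Wt' where "Wt' y = (\<Sum>i\<in>UNIV. D \<epsilon> (1, 0) (u i) y * ?M i y + D \<epsilon> (1, 0) (\<lambda>y. \<rho> y * u i y) y * ?U i y)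
      - 1/2 * ((\<Sum>i\<in>UNIV. D \<epsilon> (1, 0) (u i) y * ?U i y + D \<epsilon> (1, 0) (u i) y * ?U i y) * ?R y
        + D \<epsilon> (1, 0) \<rho> y * (\<Sum>i\<in>UNIV. ?U i y * ?U i y))
      + B' (dl \<epsilon>) (?R y) * D \<epsilon> (1, 0) \<rho> y" for y
  have Wt': "bounded_pdiff (1, 0) (Wt \<epsilon>) Wt'"
    unfolding Wt_def[abs_def] Wt'_def[abs_def]
    by (intro bounded_pdiff_add bounded_pdiff_diff bounded_pdiff_sum bounded_pdiff_mult bounded_pdiff_cmult d L1 dB finite)
  define q' where "q' j y = (D \<epsilon> (0, axis j 1) \<rho> y * B' (dl \<epsilon>) (?R y) + B'' (dl \<epsilon>) (?R y) * D \<epsilon> (0, axis j 1) \<rho> y * ?R y)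
      - B' (dl \<epsilon>) (?R y) * D \<epsilon> (0, axis j 1) \<rho> y" for j y
  have dq: "bounded_pdiff (0, axis j 1) (q \<epsilon>) (q' j)" for j
    unfolding q_def[abs_def] q'_def[abs_def] by (intro bounded_pdiff_diff bounded_pdiff_mult d L1 dB dB')
  have q'_eq: "q' j y = R \<epsilon> y * B'' (dl \<epsilon>) (R \<epsilon> y) * D \<epsilon> (0, axis j 1) \<rho> y" for j y
    by (simp add: q'_def algebra_simps)
  define Wx' where "Wx' j y = (\<Sum>i\<in>UNIV. D \<epsilon> (0, axis j 1) (u i) y * FF \<epsilon> i j y
        + D \<epsilon> (0, axis j 1) (\<lambda>y. (\<rho> y * u j y) * u i y) y * ?U i y)
      + (D \<epsilon> (0, axis j 1) (u j) y * PP \<epsilon> y + D \<epsilon> (0, axis j 1) pr y * ?U j y)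
      + (B'' (dl \<epsilon>) (?R y) * D \<epsilon> (0, axis j 1) \<rho> y * ?M j y + D \<epsilon> (0, axis j 1) (\<lambda>y. \<rho> y * u j y) y * B' (dl \<epsilon>) (?R y))
      - 1/2 * ((\<Sum>i\<in>UNIV. D \<epsilon> (0, axis j 1) (u i) y * ?U i y + D \<epsilon> (0, axis j 1) (u i) y * ?U i y) * ?M j y
        + D \<epsilon> (0, axis j 1) (\<lambda>y. \<rho> y * u j y) y * (\<Sum>i\<in>UNIV. ?U i y * ?U i y))
      - (D \<epsilon> (0, axis j 1) (u j) y * q \<epsilon> y + q' j y * ?U j y)" for j y
  have Wx': "bounded_pdiff (0, axis j 1) (Wx \<epsilon> j) (Wx' j)" for j
    unfolding Wx_def[abs_def] Wx'_def[abs_def]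
    by (intro bounded_pdiff_add bounded_pdiff_diff bounded_pdiff_sum bounded_pdiff_mult bounded_pdiff_cmult d L1 dB' dq finite pr flux)
  have mp: "moll (K \<epsilon>) f (t, x + axis i 1) = moll (K \<epsilon>) f (t, x)" for f t x i
    using moll_periodic[OF per, of f] by (simp add: space_periodic_def)
  have W_per: "space_periodic UNIV (Wt \<epsilon>)" "space_periodic UNIV (Wx \<epsilon> j)" for j
    by (simp_all add: space_periodic_def Wt_def Wx_def q_def mp)
  have \<phi>p: "space_periodic UNIV \<phi>" and \<phi>s: "\<And>y. \<phi> y \<noteq> 0 \<Longrightarrow> fst y \<in> {a..b}" using \<phi> unfolding smooth_in_def by blast+
  have zero: "(\<integral>y. pdiff \<phi> v y * W y + W' y * \<phi> y \<partial>slab a b) = 0 \<and>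
      integrable (slab a b) (\<lambda>y. pdiff \<phi> v y * W y + W' y * \<phi> y)"
    if W: "bounded_pdiff v W W'" "space_periodic UNIV W" for v W W'
  proof
    have bp: "bounded_pdiff v (\<lambda>y. \<phi> y * W y) (\<lambda>y. pdiff \<phi> v y * W y + W' y * \<phi> y)"
      by (rule bounded_pdiff_mult[OF smooth_in_bounded_pdiff[OF \<phi>] W(1)])
    have "(\<integral>y. pdiff \<phi> v y * W y + W' y * \<phi> y \<partial>cylinder) = 0"
      by (rule integral_pdiff_zero[where a = a and b = b, OF bp]) (use W(2) \<phi>p \<phi>s in \<open>auto simp: space_periodic_def\<close>)
    moreover have "(\<integral>y. pdiff \<phi> v y * W y + W' y * \<phi> y \<partial>cylinder) = (\<integral>y. pdiff \<phi> v y * W y + W' y * \<phi> y \<partial>slab a b)"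
    proof (rule integral_cylinder_eq_slab)
      fix y assume "pdiff \<phi> v y * W y + W' y * \<phi> y \<noteq> 0"
      then have "pdiff \<phi> v y \<noteq> 0 \<or> \<phi> y \<noteq> 0" by auto
      then show "fst y \<in> {a..b}" using \<phi>s smooth_in_pdiff(3)[OF \<phi>] by blast
    qed
    ultimately show "(\<integral>y. pdiff \<phi> v y * W y + W' y * \<phi> y \<partial>slab a b) = 0" by simp
    obtain A where A: "\<And>y. \<bar>pdiff \<phi> v y * W y + W' y * \<phi> y\<bar> \<le> A" using bounded_pdiffD(3)[OF bp] by blast
    interpret finite_measure "slab a b :: (real \<times> (real ^ 'n)) measure"
      using slab_finite by (intro finite_measureI) (auto simp: less_top)
    show "integrable (slab a b) (\<lambda>y. pdiff \<phi> v y * W y + W' y * \<phi> y)"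
      using A by (intro integrable_const_bound[of _ A]) (auto intro!: borel_measurable_slab bounded_pdiff_borel_deriv[OF bp])
  qed
  let ?Z = "\<lambda>y. (pdiff \<phi> (1, 0) y * Wt \<epsilon> y + Wt' y * \<phi> y) + (\<Sum>j\<in>UNIV. pdiff \<phi> (0, axis j 1) y * Wx \<epsilon> j y + Wx' j y * \<phi> y)"
  have Z: "(\<integral>y. ?Z y \<partial>slab a b) = 0" "integrable (slab a b) ?Z"
    using zero[OF Wt' W_per(1)] zero[OF Wx' W_per(2)] by simp_all
  have eq: "pdiff \<phi> (1, 0) y * Wt \<epsilon> y + (\<Sum>j\<in>UNIV. pdiff \<phi> (0, axis j 1) y * Wx \<epsilon> j y) + \<phi> y * X \<epsilon> y = ?Z y"
    if y: "y \<in> space (slab a b)" for y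
  proof -
    have "Wt' y + (\<Sum>j\<in>UNIV. Wx' j y) = X \<epsilon> y"
      using energy_flux_divergence[where Rt = "D \<epsilon> (1, 0) \<rho> y" and Mx = "\<lambda>i j. D \<epsilon> (0, axis j 1) (\<lambda>y. \<rho> y * u i y) y"
        and Mt = "\<lambda>i. D \<epsilon> (1, 0) (\<lambda>y. \<rho> y * u i y) y" and Fx = "\<lambda>i j. D \<epsilon> (0, axis j 1) (\<lambda>y. (\<rho> y * u j y) * u i y) y"
        and Px = "\<lambda>i. D \<epsilon> (0, axis i 1) pr y" and S = "\<Sum>i\<in>UNIV. U \<epsilon> i y * U \<epsilon> i y" and U = "\<lambda>i. U \<epsilon> i y"
        and Ut = "\<lambda>i. D \<epsilon> (1, 0) (u i) y" and M = "\<lambda>i. M \<epsilon> i y" and R = "R \<epsilon> y" and b' = "B' (dl \<epsilon>) (R \<epsilon> y)"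
        and Ux = "\<lambda>i j. D \<epsilon> (0, axis j 1) (u i) y" and FF = "\<lambda>i j. FF \<epsilon> i j y" and Pm = "PP \<epsilon> y"
        and b'' = "B'' (dl \<epsilon>) (R \<epsilon> y)" and Rx = "\<lambda>j. D \<epsilon> (0, axis j 1) \<rho> y" and q = "q \<epsilon> y"
        and qx = "\<lambda>j. q' j y", OF mollified_mass[OF e y] mollified_momentum[OF e y] refl q'_eq]
      unfolding X_def Wt'_def Wx'_def .
    from this[symmetric] have "\<phi> y * X \<epsilon> y = Wt' y * \<phi> y + (\<Sum>j\<in>UNIV. Wx' j y * \<phi> y)"
      by (simp only: distrib_left sum_distrib_left mult.commute)
    then show ?thesis by (simp add: sum.distrib)
  qed
  show "(\<integral>y. pdiff \<phi> (1, 0) y * Wt \<epsilon> y + (\<Sum>j\<in>UNIV. pdiff \<phi> (0, axis j 1) y * Wx \<epsilon> j y) + \<phi> y * X \<epsilon> y \<partial>slab a b) = 0"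
    by (rule trans[OF Bochner_Integration.integral_cong[OF refl eq] Z(1)])
  show "integrable (slab a b) (\<lambda>y. pdiff \<phi> (1, 0) y * Wt \<epsilon> y + (\<Sum>j\<in>UNIV. pdiff \<phi> (0, axis j 1) y * Wx \<epsilon> j y) + \<phi> y * X \<epsilon> y)"
    by (rule Bochner_Integration.integrable_cong[OF refl eq, THEN iffD2, OF _ Z(2)])
qed

lemma R_range:
  assumes e: "0 < \<epsilon>" "\<epsilon> < eps0" and y: "y \<in> space (slab a b)"
  shows "R \<epsilon> y \<in> {lo..hi}" "\<And>z. K \<epsilon> z \<noteq> 0 \<Longrightarrow> fst (y + z) \<in> {0<..<T}"
proof -
  note k = K_facts[OF e]
  note f = mollifier_facts[OF k(1) basis_in(1)]
  show t: "fst (y + z) \<in> {0<..<T}" if "K \<epsilon> z \<noteq> 0" for z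
    using f(5)[OF that] k y by (auto simp: close_shift_def space_slab)
  obtain A where A: "\<And>z. \<bar>K \<epsilon> z\<bar> \<le> A" using kernel_borel_bounded(5)[OF k(2), of "(1,0)"] by blast
  have i: "integrable cylinder (\<lambda>z. K \<epsilon> z * \<rho> (y + z))"
    by (rule periodic_L1_integrable_mult[OF L1(1) kernel_borel_bounded(1)[OF k(2)] A])
  have eq: "R \<epsilon> y = (\<integral>z. K \<epsilon> z * \<rho> (y + z) \<partial>cylinder)"
    by (rule moll_eq[OF L1(1) kernel_borel_bounded(1,3)[OF k(2)]])
  have c: "integrable cylinder (\<lambda>z. K \<epsilon> z * c)" "(\<integral>z. K \<epsilon> z * c \<partial>cylinder) = c" for c
    using f(3,4) by simp_all
  have "K \<epsilon> z * lo \<le> K \<epsilon> z * \<rho> (y + z)" "K \<epsilon> z * \<rho> (y + z) \<le> K \<epsilon> z * hi" for z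
    using range[OF t, of z] f(2)[of z] by (cases "K \<epsilon> z = 0"; auto intro: mult_left_mono)+
  then have "(\<integral>z. K \<epsilon> z * lo \<partial>cylinder) \<le> R \<epsilon> y" "R \<epsilon> y \<le> (\<integral>z. K \<epsilon> z * hi \<partial>cylinder)"
    unfolding eq by (intro integral_mono i c; simp)+
  then show "R \<epsilon> y \<in> {lo..hi}" unfolding c by simp
qed

end

section \<open>Convergence of the energy balance\<close>

context vacuum_euler
begin

text \<open>The exponents of \<open>\<epsilon>\<close> that occur in the error terms; the last two are those of the commutators in
  the energy balance.\<close>

lemma pos: "0 < \<alpha>" "0 < \<beta>" "0 < (\<gamma> - 1) * \<beta>" "0 < (\<gamma> - 2) * \<beta> + (\<alpha> + \<beta>)" "0 < (\<alpha> - 1) + (\<alpha> + \<beta>)"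
  "0 < (\<alpha> - 1) + \<gamma> * \<beta>"
proof -
  show \<alpha>0: "0 < \<alpha>" using smooth(2) \<beta> by linarith
  show \<beta>0: "0 < \<beta>"
  proof (rule ccontr)
    assume "\<not> 0 < \<beta>"
    then have "\<beta> = 0" using \<beta> by simp
    then show False using smooth(1) \<alpha> by simp
  qed
  show g: "0 < (\<gamma> - 1) * \<beta>" using \<gamma> \<beta>0 by simp
  show "0 < (\<gamma> - 2) * \<beta> + (\<alpha> + \<beta>)" using g \<alpha>0 by (simp add: algebra_simps)
  show "0 < (\<alpha> - 1) + (\<alpha> + \<beta>)" "0 < (\<alpha> - 1) + \<gamma> * \<beta>" using smooth by linarith+
qed

abbreviation L :: "(real \<times> (real ^ 'n)) measure" where "L \<equiv> slab a b"

lemma R_decay_0: "decay L 0 0 R" "decay L 0 0 (\<lambda>\<epsilon>. \<rho>)"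
proof -
  show "decay L 0 0 R"
  proof (rule decay_bounded[OF eps0(1), where C = hi])
    fix \<epsilon> y assume "0 < \<epsilon>" "\<epsilon> < eps0" "y \<in> space L"
    then show "\<bar>R \<epsilon> y\<bar> \<le> hi * \<epsilon> powr 0" using R_range(1)[of \<epsilon> y] lo by auto
  qed (use lo in linarith)
  show "decay L 0 0 (\<lambda>\<epsilon>. \<rho>)"
  proof (rule decay_bounded[OF zero_less_one, where C = hi])
    fix \<epsilon> y assume "0 < (\<epsilon>::real)" "y \<in> space L"
    then show "\<bar>\<rho> y\<bar> \<le> hi * \<epsilon> powr 0" using range[OF slab_time, of y] lo by auto
  qed (use lo in linarith)
qed

lemma u_decay: "decay L \<sigma> \<alpha> (\<lambda>\<epsilon> y. U \<epsilon> i y - u i y)" and R_decay: "decay L s \<beta> (\<lambda>\<epsilon> y. R \<epsilon> y - \<rho> y)"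
  and M_decay: "decay L s \<beta> (\<lambda>\<epsilon> y. M \<epsilon> i y - \<rho> y * u i y)"
  by (rule decay_moll_error[OF u] decay_moll_error[OF \<rho>] decay_moll_error[OF m])+

lemma mass_commutator: "decay L (s + \<sigma>) (\<alpha> + \<beta>) (\<lambda>\<epsilon> y. M \<epsilon> i y - R \<epsilon> y * U \<epsilon> i y)"
  using decay_moll_commutator[OF \<rho> u, of i] s L1(3)[of i] by (simp add: add.commute)

lemma momentum_commutator: "decay L (s + \<sigma>) (\<alpha> + \<beta>) (\<lambda>\<epsilon> y. FF \<epsilon> i j y - M \<epsilon> j y * U \<epsilon> i y)"
  using decay_moll_commutator[OF m u, of j i] s flux[of j i] by (simp add: add.commute)

text \<open>To first order the Taylor expansion of \<open>p\<close> at \<open>\<rho> y\<close> commutes with mollification. Hence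
  \<open>PP - p R\<close> is an average of Taylor remainders minus the remainder at \<open>R y\<close>, each of order \<open>\<gamma>\<close> in
  the increments of \<open>\<rho>\<close>. The second estimate is the one that Lipschitz continuity of \<open>p\<close> gives.\<close>

lemma pressure_commutator: "decay L (\<gamma> * s) (\<gamma> * \<beta>) (\<lambda>\<epsilon> y. PP \<epsilon> y - p (R \<epsilon> y))"
  and pressure_error: "decay L s \<beta> (\<lambda>\<epsilon> y. PP \<epsilon> y - pr y)"
proof -
  let ?I = "\<lambda>\<epsilon> y. \<integral>z. K \<epsilon> z * \<bar>\<rho> (y + z) - \<rho> y\<bar> \<partial>cylinder"
  let ?J = "\<lambda>\<epsilon> y. \<integral>z. K \<epsilon> z * \<bar>\<bar>\<rho> (y + z) - \<rho> y\<bar> powr \<gamma>\<bar> \<partial>cylinder"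
  have \<gamma>s: "\<gamma> * s \<le> 1" "0 \<le> \<gamma> * s"
    using mult_right_mono[of \<gamma> 2 s] \<gamma> s by auto
  have s1: "s + 0 \<le> 1" "1 \<le> \<gamma>" using s \<gamma> by auto
  note I = decay_average_increments[OF \<rho> besov_comp_zero s1(1) basis_in(1) s1(2) \<gamma>s(1)]
  have Lp: "periodic_L1 \<rho>" by (rule L1)
  have [measurable]: "\<rho> \<in> borel_measurable borel" using Lp by (simp add: periodic_L1_def)
  have facts: "\<bar>PP \<epsilon> y - p (\<rho> y) - p' (\<rho> y) * (R \<epsilon> y - \<rho> y)\<bar> \<le> Cp * ?J \<epsilon> y" "\<bar>PP \<epsilon> y - pr y\<bar> \<le> Cp * ?I \<epsilon> y"
    if e: "0 < \<epsilon>" "\<epsilon> < eps0" and y: "y \<in> space L" for \<epsilon> y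
  proof -
    note k = K_facts[OF e]
    note f = mollifier_facts[OF k(1) basis_in(1)]
    note kb = kernel_borel_bounded[OF k(2)]
    note [measurable] = kb(1)
    obtain A where A: "\<And>z. \<bar>K \<epsilon> z\<bar> \<le> A" using kb(5)[of "(1, 0)"] by blast
    have ry: "\<rho> y \<in> {lo..hi}" by (rule range[OF slab_time[OF y]])
    have rz: "\<rho> (y + z) \<in> {lo..hi}" "pr (y + z) = p (\<rho> (y + z))" if "K \<epsilon> z \<noteq> 0" for z
      using range[OF R_range(2)[OF e y that]] pr(2)[OF R_range(2)[OF e y that]] by auto
    have pry: "pr y = p (\<rho> y)" by (rule pr(2)[OF slab_time[OF y]])
    have Ip: "integrable cylinder (\<lambda>z. K \<epsilon> z * pr (y + z))" and Ir: "integrable cylinder (\<lambda>z. K \<epsilon> z * \<rho> (y + z))"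
      by (rule periodic_L1_integrable_mult[OF _ kb(1) A] pr(1) Lp)+
    have ep: "PP \<epsilon> y = (\<integral>z. K \<epsilon> z * pr (y + z) \<partial>cylinder)" and er: "R \<epsilon> y = (\<integral>z. K \<epsilon> z * \<rho> (y + z) \<partial>cylinder)"
      by (rule moll_eq[OF _ kb(1,3)] pr(1) Lp)+
    have id: "integrable cylinder (\<lambda>z. K \<epsilon> z * \<bar>\<rho> (y + z) - \<rho> y\<bar>)"
    proof -
      have "integrable cylinder (\<lambda>z. \<bar>K \<epsilon> z * (\<rho> (y + z) - \<rho> y)\<bar>)"
        by (intro integrable_abs moll_diff_eq(2)[OF Lp kb(1,3) A f(3)])
      then show ?thesis by (simp add: abs_mult K_nonneg)
    qed
    have ipw: "integrable cylinder (\<lambda>z. K \<epsilon> z * \<bar>\<bar>\<rho> (y + z) - \<rho> y\<bar> powr \<gamma>\<bar>)"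
    proof (rule Bochner_Integration.integrable_bound[where f = "\<lambda>z. K \<epsilon> z * (hi - lo) powr \<gamma>"])
      show "integrable cylinder (\<lambda>z. K \<epsilon> z * (hi - lo) powr \<gamma>)" using f(3) by simp
      show "AE z in cylinder. norm (K \<epsilon> z * \<bar>\<bar>\<rho> (y + z) - \<rho> y\<bar> powr \<gamma>\<bar>) \<le> norm (K \<epsilon> z * (hi - lo) powr \<gamma>)"
      proof (rule AE_I2)
        fix z
        show "norm (K \<epsilon> z * \<bar>\<bar>\<rho> (y + z) - \<rho> y\<bar> powr \<gamma>\<bar>) \<le> norm (K \<epsilon> z * (hi - lo) powr \<gamma>)"
        proof (cases "K \<epsilon> z = 0")
          case False
          have "\<bar>\<rho> (y + z) - \<rho> y\<bar> powr \<gamma> \<le> (hi - lo) powr \<gamma>"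
            using rz(1)[OF False] ry \<gamma> by (intro powr_mono2) auto
          then show ?thesis by (simp add: abs_mult mult_left_mono)
        qed simp
      qed
    qed measurable
    have e1: "PP \<epsilon> y - p (\<rho> y) - p' (\<rho> y) * (R \<epsilon> y - \<rho> y)
        = (\<integral>z. K \<epsilon> z * pr (y + z) - p (\<rho> y) * K \<epsilon> z - p' (\<rho> y) * (K \<epsilon> z * \<rho> (y + z) - \<rho> y * K \<epsilon> z) \<partial>cylinder)"
      unfolding ep er using Ip Ir f(3,4) by simp
    have "\<bar>PP \<epsilon> y - p (\<rho> y) - p' (\<rho> y) * (R \<epsilon> y - \<rho> y)\<bar> \<le> (\<integral>z. \<bar>K \<epsilon> z * pr (y + z) - p (\<rho> y) * K \<epsilon> z - p' (\<rho> y) * (K \<epsilon> z * \<rho> (y + z) - \<rho> y * K \<epsilon> z)\<bar> \<partial>cylinder)"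
      unfolding e1 by (rule integral_abs_bound)
    also have "\<dots> \<le> (\<integral>z. Cp * (K \<epsilon> z * \<bar>\<bar>\<rho> (y + z) - \<rho> y\<bar> powr \<gamma>\<bar>) \<partial>cylinder)"
    proof (rule integral_mono)
      show "integrable cylinder (\<lambda>z. \<bar>K \<epsilon> z * pr (y + z) - p (\<rho> y) * K \<epsilon> z - p' (\<rho> y) * (K \<epsilon> z * \<rho> (y + z) - \<rho> y * K \<epsilon> z)\<bar>)"
        by (intro integrable_abs Bochner_Integration.integrable_diff integrable_mult_right Ip Ir f(3))
      show "integrable cylinder (\<lambda>z. Cp * (K \<epsilon> z * \<bar>\<bar>\<rho> (y + z) - \<rho> y\<bar> powr \<gamma>\<bar>))"
        by (intro integrable_mult_right ipw)
      fix z
      have eq: "K \<epsilon> z * pr (y + z) - p (\<rho> y) * K \<epsilon> z - p' (\<rho> y) * (K \<epsilon> z * \<rho> (y + z) - \<rho> y * K \<epsilon> z)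
        = K \<epsilon> z * (pr (y + z) - p (\<rho> y) - p' (\<rho> y) * (\<rho> (y + z) - \<rho> y))" by (simp add: algebra_simps)
      show "\<bar>K \<epsilon> z * pr (y + z) - p (\<rho> y) * K \<epsilon> z - p' (\<rho> y) * (K \<epsilon> z * \<rho> (y + z) - \<rho> y * K \<epsilon> z)\<bar>
        \<le> Cp * (K \<epsilon> z * \<bar>\<bar>\<rho> (y + z) - \<rho> y\<bar> powr \<gamma>\<bar>)"
      proof (cases "K \<epsilon> z = 0")
        case False
        have "K \<epsilon> z * \<bar>pr (y + z) - p (\<rho> y) - p' (\<rho> y) * (\<rho> (y + z) - \<rho> y)\<bar>
          \<le> K \<epsilon> z * (Cp * \<bar>\<rho> (y + z) - \<rho> y\<bar> powr \<gamma>)"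
          using p_Taylor[OF rz(1)[OF False] ry] rz(2)[OF False] K_nonneg by (intro mult_left_mono) auto
        then show ?thesis unfolding eq abs_mult using K_nonneg[of \<epsilon> z] by (simp add: mult_ac)
      qed simp
    qed
    finally show "\<bar>PP \<epsilon> y - p (\<rho> y) - p' (\<rho> y) * (R \<epsilon> y - \<rho> y)\<bar> \<le> Cp * ?J \<epsilon> y" by simp
    have e2: "PP \<epsilon> y - pr y = (\<integral>z. K \<epsilon> z * (pr (y + z) - pr y) \<partial>cylinder)"
      using moll_diff_eq(1)[OF pr(1) kb(1,3) A f(3), of y] f(4) by simp
    have "\<bar>PP \<epsilon> y - pr y\<bar> \<le> (\<integral>z. \<bar>K \<epsilon> z * (pr (y + z) - pr y)\<bar> \<partial>cylinder)"
      unfolding e2 by (rule integral_abs_bound)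
    also have "\<dots> \<le> (\<integral>z. Cp * (K \<epsilon> z * \<bar>\<rho> (y + z) - \<rho> y\<bar>) \<partial>cylinder)"
    proof (rule integral_mono)
      show "integrable cylinder (\<lambda>z. \<bar>K \<epsilon> z * (pr (y + z) - pr y)\<bar>)"
        by (intro integrable_abs moll_diff_eq(2)[OF pr(1) kb(1,3) A f(3)])
      show "integrable cylinder (\<lambda>z. Cp * (K \<epsilon> z * \<bar>\<rho> (y + z) - \<rho> y\<bar>))"
        by (intro integrable_mult_right id)
      fix z
      show "\<bar>K \<epsilon> z * (pr (y + z) - pr y)\<bar> \<le> Cp * (K \<epsilon> z * \<bar>\<rho> (y + z) - \<rho> y\<bar>)"
      proof (cases "K \<epsilon> z = 0")
        case False
        have "K \<epsilon> z * \<bar>pr (y + z) - pr y\<bar> \<le> K \<epsilon> z * (Cp * \<bar>\<rho> (y + z) - \<rho> y\<bar>)"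
          using p_Lip[OF rz(1)[OF False] ry] rz(2)[OF False] pry K_nonneg by (intro mult_left_mono) auto
        then show ?thesis unfolding abs_mult using K_nonneg[of \<epsilon> z] by (simp add: mult_ac)
      qed simp
    qed
    finally show "\<bar>PP \<epsilon> y - pr y\<bar> \<le> Cp * ?I \<epsilon> y" by simp
  qed
  have Cpd: "decay L 0 0 (\<lambda>\<epsilon> y. Cp)" by (rule decay_bounded[OF zero_less_one, where C = Cp]) (use Cp in auto)
  have "decay L s \<beta> (\<lambda>\<epsilon> y. Cp * ?I \<epsilon> y)" using decay_mult[OF Cpd I(1)] s by simp
  then show "decay L s \<beta> (\<lambda>\<epsilon> y. PP \<epsilon> y - pr y)"
    by (rule decay_mono[OF _ order_refl order_refl eps0(1)]) (use facts(2) in force)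
  have "decay L (\<gamma> * s) (\<gamma> * \<beta>) (\<lambda>\<epsilon> y. ?J \<epsilon> y + \<bar>R \<epsilon> y - \<rho> y\<bar> powr \<gamma>)"
    using \<gamma> \<gamma>s by (intro decay_add I(4) decay_powr[OF R_decay]) auto
  from decay_mult[OF Cpd this] have "decay L (\<gamma> * s) (\<gamma> * \<beta>) (\<lambda>\<epsilon> y. Cp * (?J \<epsilon> y + \<bar>R \<epsilon> y - \<rho> y\<bar> powr \<gamma>))"
    using \<gamma>s by simp
  then show "decay L (\<gamma> * s) (\<gamma> * \<beta>) (\<lambda>\<epsilon> y. PP \<epsilon> y - p (R \<epsilon> y))"
  proof (rule decay_mono[OF _ order_refl order_refl eps0(1)])
    fix \<epsilon> y assume e: "0 < \<epsilon>" "\<epsilon> < eps0" and y: "y \<in> space L"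
    have "\<bar>p (R \<epsilon> y) - p (\<rho> y) - p' (\<rho> y) * (R \<epsilon> y - \<rho> y)\<bar> \<le> Cp * \<bar>R \<epsilon> y - \<rho> y\<bar> powr \<gamma>"
      by (rule p_Taylor[OF R_range(1)[OF e y] range[OF slab_time[OF y]]])
    then have "\<bar>PP \<epsilon> y - p (R \<epsilon> y)\<bar> \<le> Cp * ?J \<epsilon> y + Cp * \<bar>R \<epsilon> y - \<rho> y\<bar> powr \<gamma>"
      using facts(1)[OF e y] by linarith
    also have "\<dots> = Cp * (?J \<epsilon> y + \<bar>R \<epsilon> y - \<rho> y\<bar> powr \<gamma>)" by (simp add: distrib_left)
    finally show "\<bar>PP \<epsilon> y - p (R \<epsilon> y)\<bar> \<le> \<bar>Cp * (?J \<epsilon> y + \<bar>R \<epsilon> y - \<rho> y\<bar> powr \<gamma>)\<bar>" by linarith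
  qed
qed

lemma dl_powr: "0 < \<epsilon> \<Longrightarrow> dl \<epsilon> powr x = \<epsilon> powr (x * \<beta>)"
  by (simp add: powr_powr mult.commute)

lemma q_decay: "decay L (\<gamma> * s) (\<gamma> * \<beta>) (\<lambda>\<epsilon> y. PP \<epsilon> y - q \<epsilon> y)"
proof -
  have \<gamma>s: "0 \<le> \<gamma> * s" using \<gamma> s by auto
  have d: "decay L 0 (\<gamma> * \<beta>) (\<lambda>\<epsilon> y. q \<epsilon> y - p (R \<epsilon> y))"
  proof (rule decay_bounded[OF eps0(1) _ Cp])
    fix \<epsilon> y assume e: "0 < \<epsilon>" "\<epsilon> < eps0" and y: "y \<in> space L"
    show "\<bar>q \<epsilon> y - p (R \<epsilon> y)\<bar> \<le> Cp * \<epsilon> powr (\<gamma> * \<beta>)"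
      using potential(6)[OF K_facts(6,7)[OF e] R_range(1)[OF e y]] unfolding q_def dl_powr[OF e(1)] .
  qed
  have "decay L (\<gamma> * s) (\<gamma> * \<beta>) (\<lambda>\<epsilon> y. (PP \<epsilon> y - p (R \<epsilon> y)) - (q \<epsilon> y - p (R \<epsilon> y)))"
    by (rule decay_diff[OF pressure_commutator decay_weaken[OF d]]) (use \<gamma>s in auto)
  then show ?thesis by simp
qed

lemma B'_decay: "decay L 0 ((\<gamma> - 2) * \<beta>) (\<lambda>\<epsilon> y. B' (dl \<epsilon>) (R \<epsilon> y))"
  and B''_decay: "decay L 0 ((\<gamma> - 2) * \<beta>) (\<lambda>\<epsilon> y. B'' (dl \<epsilon>) (R \<epsilon> y))"
proof -
  show "decay L 0 ((\<gamma> - 2) * \<beta>) (\<lambda>\<epsilon> y. B' (dl \<epsilon>) (R \<epsilon> y))"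
  proof (rule decay_bounded[OF eps0(1) _ Cp])
    fix \<epsilon> y assume e: "0 < \<epsilon>" "\<epsilon> < eps0" and y: "y \<in> space L"
    show "\<bar>B' (dl \<epsilon>) (R \<epsilon> y)\<bar> \<le> Cp * \<epsilon> powr ((\<gamma> - 2) * \<beta>)"
      using potential(5)[OF K_facts(6,7)[OF e] R_range(1)[OF e y]] unfolding dl_powr[OF e(1)] .
  qed
  show "decay L 0 ((\<gamma> - 2) * \<beta>) (\<lambda>\<epsilon> y. B'' (dl \<epsilon>) (R \<epsilon> y))"
  proof (rule decay_bounded[OF eps0(1) _ Cp])
    fix \<epsilon> y assume e: "0 < \<epsilon>" "\<epsilon> < eps0" and y: "y \<in> space L"
    show "\<bar>B'' (dl \<epsilon>) (R \<epsilon> y)\<bar> \<le> Cp * \<epsilon> powr ((\<gamma> - 2) * \<beta>)"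
      using potential(4)[OF K_facts(6,7)[OF e] R_range(1)[OF e y]] unfolding dl_powr[OF e(1)] .
  qed
qed

text \<open>By the mean value theorem the error of mollification of \<open>\<rho>\<close> is amplified by \<open>B'\<close>, of order
  \<open>\<epsilon> powr ((\<gamma> - 2) * \<beta>)\<close>, and a positive rate remains since \<open>\<gamma> > 1\<close>.\<close>

lemma B_decay: "decay L s ((\<gamma> - 1) * \<beta>) (\<lambda>\<epsilon> y. B (dl \<epsilon>) (R \<epsilon> y) - P (\<rho> y))"
proof -
  have Cpd: "decay L 0 ((\<gamma> - 2) * \<beta>) (\<lambda>\<epsilon> y. Cp * \<epsilon> powr ((\<gamma> - 2) * \<beta>))"
    by (rule decay_bounded[OF zero_less_one, where C = Cp]) (use Cp in auto)
  from decay_mult[OF Cpd R_decay order_refl s(1)]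
  have 1: "decay L s ((\<gamma> - 1) * \<beta>) (\<lambda>\<epsilon> y. Cp * \<epsilon> powr ((\<gamma> - 2) * \<beta>) * (R \<epsilon> y - \<rho> y))"
    by (simp add: algebra_simps)
  have a: "decay L s ((\<gamma> - 1) * \<beta>) (\<lambda>\<epsilon> y. B (dl \<epsilon>) (R \<epsilon> y) - B (dl \<epsilon>) (\<rho> y))"
  proof (rule decay_mono[OF 1 order_refl order_refl eps0(1)])
    fix \<epsilon> y assume e: "0 < \<epsilon>" "\<epsilon> < eps0" and y: "y \<in> space L"
    note k = K_facts[OF e]
    note r = R_range(1)[OF e y] and r' = range[OF slab_time[OF y]]
    show "\<bar>B (dl \<epsilon>) (R \<epsilon> y) - B (dl \<epsilon>) (\<rho> y)\<bar> \<le> \<bar>Cp * \<epsilon> powr ((\<gamma> - 2) * \<beta>) * (R \<epsilon> y - \<rho> y)\<bar>"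
    proof (cases "\<rho> y = R \<epsilon> y")
      case False
      have "\<exists>x\<in>{min (\<rho> y) (R \<epsilon> y)<..<max (\<rho> y) (R \<epsilon> y)}. B (dl \<epsilon>) (R \<epsilon> y) - B (dl \<epsilon>) (\<rho> y) = B' (dl \<epsilon>) x * (R \<epsilon> y - \<rho> y)"
        by (rule mean_value_within[OF False]) (use potential(1)[OF k(6,7)] in \<open>auto intro: has_field_derivative_at_within\<close>)
      then obtain x where x: "x \<in> {min (\<rho> y) (R \<epsilon> y)<..<max (\<rho> y) (R \<epsilon> y)}"
        and eq: "B (dl \<epsilon>) (R \<epsilon> y) - B (dl \<epsilon>) (\<rho> y) = B' (dl \<epsilon>) x * (R \<epsilon> y - \<rho> y)" by blast
      have "x \<in> {lo..hi}" using x r r' by auto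
      then have "\<bar>B' (dl \<epsilon>) x\<bar> \<le> Cp * \<epsilon> powr ((\<gamma> - 2) * \<beta>)" using potential(5)[OF k(6,7)] unfolding dl_powr[OF e(1)] by blast
      then show ?thesis unfolding eq abs_mult[of _ "R \<epsilon> y - \<rho> y"] by (intro mult_right_mono) auto
    qed simp
  qed
  have b: "decay L 0 (\<gamma> * \<beta>) (\<lambda>\<epsilon> y. B (dl \<epsilon>) (\<rho> y) - P (\<rho> y))"
  proof (rule decay_bounded[OF eps0(1) _ Cp])
    fix \<epsilon> y assume e: "0 < \<epsilon>" "\<epsilon> < eps0" and y: "y \<in> space L"
    show "\<bar>B (dl \<epsilon>) (\<rho> y) - P (\<rho> y)\<bar> \<le> Cp * \<epsilon> powr (\<gamma> * \<beta>)"
      using potential(7)[OF K_facts(6,7)[OF e] range[OF slab_time[OF y]]] unfolding dl_powr[OF e(1)] .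
  qed
  have "decay L s ((\<gamma> - 1) * \<beta>) (\<lambda>\<epsilon> y. (B (dl \<epsilon>) (R \<epsilon> y) - B (dl \<epsilon>) (\<rho> y)) + (B (dl \<epsilon>) (\<rho> y) - P (\<rho> y)))"
    using s \<beta> by (intro decay_add a decay_weaken[OF b]) (auto simp: algebra_simps)
  then show ?thesis by simp
qed

lemma P_decay_0: "decay L 0 0 (\<lambda>\<epsilon> y. P (\<rho> y))" and pr_decay_0: "decay L 0 0 (\<lambda>\<epsilon>. pr)"
proof -
  have cont: "continuous_on UNIV (B 1)" 
    using potential(1)[OF zero_less_one order_refl] DERIV_isCont continuous_at_imp_continuous_on by blast
  have "bounded (B 1 ` {lo..hi})"
    by (intro compact_imp_bounded compact_continuous_image continuous_on_subset[OF cont]) auto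
  then obtain A where A: "A > 0" "\<And>x. x \<in> {lo..hi} \<Longrightarrow> \<bar>B 1 x\<bar> \<le> A" unfolding bounded_pos by auto
  show "decay L 0 0 (\<lambda>\<epsilon> y. P (\<rho> y))"
  proof (rule decay_bounded[OF zero_less_one, where C = "A + Cp"])
    fix \<epsilon> :: real and y assume e: "0 < \<epsilon>" and y: "y \<in> space L"
    note r = range[OF slab_time[OF y]]
    have "\<bar>B 1 (\<rho> y) - P (\<rho> y)\<bar> \<le> Cp" using potential(7)[OF zero_less_one order_refl r] by simp
    then show "\<bar>P (\<rho> y)\<bar> \<le> (A + Cp) * \<epsilon> powr 0" using A(2)[OF r] e by simp
  qed (use A Cp in auto)
  show "decay L 0 0 (\<lambda>\<epsilon>. pr)"
  proof (rule decay_bounded[OF zero_less_one, where C = "\<bar>p lo\<bar> + Cp * (hi - lo)"])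
    fix \<epsilon> :: real and y assume e: "0 < \<epsilon>" and y: "y \<in> space L"
    note r = range[OF slab_time[OF y]]
    have "\<bar>p (\<rho> y) - p lo\<bar> \<le> Cp * \<bar>\<rho> y - lo\<bar>" by (rule p_Lip[OF r]) (use lo in auto)
    also have "\<dots> \<le> Cp * (hi - lo)" using r Cp by (intro mult_left_mono) auto
    finally show "\<bar>pr y\<bar> \<le> (\<bar>p lo\<bar> + Cp * (hi - lo)) * \<epsilon> powr 0"
      using pr(2)[OF slab_time[OF y]] e by simp
  qed (use Cp lo in auto)
qed

definition Et :: "real \<times> (real ^ 'n) \<Rightarrow> real" where
  "Et y = 1/2 * \<rho> y * (\<Sum>i\<in>UNIV. u i y * u i y) + P (\<rho> y)"

definition Ex :: "'n \<Rightarrow> real \<times> (real ^ 'n) \<Rightarrow> real" where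
  "Ex j y = (1/2 * \<rho> y * (\<Sum>i\<in>UNIV. u i y * u i y) + p (\<rho> y) + P (\<rho> y)) * u j y"

definition rate :: real where
  "rate = Min {\<alpha>, \<beta>, (\<gamma> - 1) * \<beta>, (\<gamma> - 2) * \<beta> + (\<alpha> + \<beta>), (\<alpha> - 1) + (\<alpha> + \<beta>), (\<alpha> - 1) + \<gamma> * \<beta>}"

lemma rate: "0 < rate" "rate \<le> \<alpha>" "rate \<le> \<beta>" "rate \<le> (\<gamma> - 1) * \<beta>" "rate \<le> (\<gamma> - 2) * \<beta> + (\<alpha> + \<beta>)"
  "rate \<le> (\<alpha> - 1) + (\<alpha> + \<beta>)" "rate \<le> (\<alpha> - 1) + \<gamma> * \<beta>"
  using pos unfolding rate_def by simp_all

text \<open>In the last term \<open>B''\<close>, a derivative of \<open>R\<close> and a commutator combine to the exponent \<open>(\<gamma> - 2) *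
  \<beta> + (\<beta> - 1) + (\<alpha> + \<beta>) = \<alpha> - 1 + \<gamma> * \<beta>\<close>, the same as for the pressure term.\<close>

lemma X_decay: "decay L 1 rate X"
proof -
  have \<gamma>s: "\<gamma> * s \<le> 2 * s" "0 \<le> \<gamma> * s" using mult_right_mono[of \<gamma> 2 s] \<gamma> s by auto
  note dU = decay_moll_pdiff[OF u] and dR = decay_moll_pdiff[OF \<rho>]
  have 1: "decay L 1 rate (\<lambda>\<epsilon> y. D \<epsilon> (1, 0) (u i) y * (M \<epsilon> i y - R \<epsilon> y * U \<epsilon> i y))" for i
    by (rule decay_weaken[OF decay_mult[OF dU mass_commutator]]) (use s rate basis_in in auto)
  have 2: "decay L 1 rate (\<lambda>\<epsilon> y. D \<epsilon> (0, axis j 1) (u i) y * (FF \<epsilon> i j y - M \<epsilon> j y * U \<epsilon> i y))" for i j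
    by (rule decay_weaken[OF decay_mult[OF dU momentum_commutator]]) (use s rate basis_in in auto)
  have 3: "decay L 1 rate (\<lambda>\<epsilon> y. D \<epsilon> (0, axis j 1) (u j) y * (PP \<epsilon> y - q \<epsilon> y))" for j
    by (rule decay_weaken[OF decay_mult[OF dU q_decay]]) (use s \<gamma>s rate basis_in in auto)
  have 4: "decay L 1 rate (\<lambda>\<epsilon> y. B'' (dl \<epsilon>) (R \<epsilon> y) * D \<epsilon> (0, axis j 1) \<rho> y * (M \<epsilon> j y - R \<epsilon> y * U \<epsilon> j y))" for j
  proof (rule decay_weaken[OF decay_mult[OF decay_mult[OF B''_decay dR] mass_commutator]])
    show "rate \<le> (\<gamma> - 2) * \<beta> + (\<beta> - 1) + (\<alpha> + \<beta>)" using rate(7) by (simp add: algebra_simps)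
  qed (use s basis_in in auto)
  show ?thesis
    unfolding X_def[abs_def] by (intro decay_add decay_sum 1 2 3 4) auto
qed

lemma U_product_error:
  assumes "decay L s' \<beta> (\<lambda>\<epsilon> y. F \<epsilon> y - f y)" "decay L s' 0 (\<lambda>\<epsilon>. f)" "0 \<le> s'"
  shows "decay L (\<sigma> + s') (min \<alpha> \<beta>) (\<lambda>\<epsilon> y. U \<epsilon> i y * F \<epsilon> y - u i y * f y)"
  using decay_product_error[OF u_decay u_bound assms(1,2)] s \<alpha> \<beta> assms(3) by simp

lemma Wt_decay: "decay L 1 rate (\<lambda>\<epsilon> y. Et y - Wt \<epsilon> y)"
proof -
  have 1: "decay L (\<sigma> + s) (min \<alpha> \<beta>) (\<lambda>\<epsilon> y. U \<epsilon> i y * M \<epsilon> i y - u i y * (\<rho> y * u i y))" for i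
    by (rule U_product_error[OF M_decay m_bound s(1)])
  have ur: "decay L (\<sigma> + s) (min \<alpha> \<beta>) (\<lambda>\<epsilon> y. U \<epsilon> i y * R \<epsilon> y - u i y * \<rho> y)" for i
    by (rule U_product_error[OF R_decay _ s(1)]) (rule decay_weaken[OF R_decay_0(2)], use s in auto)
  have "decay L (\<sigma> + s) 0 (\<lambda>\<epsilon> y. u i y * \<rho> y)" for i
    using decay_weaken[OF m_bound[of i], of "\<sigma> + s" 0] s by (simp add: mult.commute)
  from decay_product_error[OF u_decay u_bound ur this]
  have 2: "decay L (\<sigma> + (\<sigma> + s)) (min \<alpha> (min \<alpha> \<beta>)) (\<lambda>\<epsilon> y. U \<epsilon> i y * (U \<epsilon> i y * R \<epsilon> y) - u i y * (u i y * \<rho> y))" for i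
    using s \<alpha> \<beta> by simp
  have half: "decay L 0 0 (\<lambda>\<epsilon> y. 1/2 :: real)" by (rule decay_bounded[OF zero_less_one, where C = "1/2"]) auto
  have s1: "decay L 1 rate (\<lambda>\<epsilon> y. \<Sum>i\<in>UNIV. U \<epsilon> i y * M \<epsilon> i y - u i y * (\<rho> y * u i y))"
    by (intro decay_sum decay_weaken[OF 1]) (use s rate in auto)
  have s2: "decay L 1 rate (\<lambda>\<epsilon> y. \<Sum>i\<in>UNIV. U \<epsilon> i y * (U \<epsilon> i y * R \<epsilon> y) - u i y * (u i y * \<rho> y))"
    by (intro decay_sum decay_weaken[OF 2]) (use s rate in auto)
  have s2': "decay L 1 rate (\<lambda>\<epsilon> y. 1/2 * (\<Sum>i\<in>UNIV. U \<epsilon> i y * (U \<epsilon> i y * R \<epsilon> y) - u i y * (u i y * \<rho> y)))"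
    using decay_mult[OF half s2] by simp
  have s3: "decay L 1 rate (\<lambda>\<epsilon> y. B (dl \<epsilon>) (R \<epsilon> y) - P (\<rho> y))"
    by (rule decay_weaken[OF B_decay]) (use s rate in auto)
  have "decay L 1 rate (\<lambda>\<epsilon> y. - (\<Sum>i\<in>UNIV. U \<epsilon> i y * M \<epsilon> i y - u i y * (\<rho> y * u i y))
      + 1/2 * (\<Sum>i\<in>UNIV. U \<epsilon> i y * (U \<epsilon> i y * R \<epsilon> y) - u i y * (u i y * \<rho> y)) - (B (dl \<epsilon>) (R \<epsilon> y) - P (\<rho> y)))"
    by (rule decay_diff[OF decay_add[OF decay_uminus[OF s1] s2'] s3]) simp_all
  moreover have "- (\<Sum>i\<in>UNIV. U \<epsilon> i y * M \<epsilon> i y - u i y * (\<rho> y * u i y))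
      + 1/2 * (\<Sum>i\<in>UNIV. U \<epsilon> i y * (U \<epsilon> i y * R \<epsilon> y) - u i y * (u i y * \<rho> y)) - (B (dl \<epsilon>) (R \<epsilon> y) - P (\<rho> y))
      = Et y - Wt \<epsilon> y" for \<epsilon> y
  proof -
    have "(\<Sum>i\<in>UNIV. u i y * (\<rho> y * u i y)) = \<rho> y * (\<Sum>i\<in>UNIV. u i y * u i y)"
      "(\<Sum>i\<in>UNIV. u i y * (u i y * \<rho> y)) = \<rho> y * (\<Sum>i\<in>UNIV. u i y * u i y)"
      "(\<Sum>i\<in>UNIV. U \<epsilon> i y * (U \<epsilon> i y * R \<epsilon> y)) = (\<Sum>i\<in>UNIV. U \<epsilon> i y * U \<epsilon> i y) * R \<epsilon> y"
      by (simp_all add: sum_distrib_left sum_distrib_right mult_ac)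
    then show ?thesis by (simp add: Et_def Wt_def sum_subtractf) (simp add: field_simps)
  qed
  ultimately show ?thesis by simp
qed

lemma Wx_decay: "decay L 1 rate (\<lambda>\<epsilon> y. Ex j y - Wx \<epsilon> j y)"
proof -
  have mu: "decay L (\<sigma> + s) (min \<alpha> \<beta>) (\<lambda>\<epsilon> y. U \<epsilon> i y * M \<epsilon> j y - u i y * (\<rho> y * u j y))" for i
    by (rule U_product_error[OF M_decay m_bound s(1)])
  have mu0: "decay L (\<sigma> + s) 0 (\<lambda>\<epsilon> y. u i y * (\<rho> y * u j y))" for i
    using decay_mult[OF u_bound m_bound] s by simp
  have F: "decay L (\<sigma> + s) (min \<alpha> \<beta>) (\<lambda>\<epsilon> y. FF \<epsilon> i j y - u i y * (\<rho> y * u j y))" for i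
  proof -
    have "decay L (\<sigma> + s) (min \<alpha> \<beta>) (\<lambda>\<epsilon> y. (FF \<epsilon> i j y - M \<epsilon> j y * U \<epsilon> i y) + (U \<epsilon> i y * M \<epsilon> j y - u i y * (\<rho> y * u j y)))"
      using s \<alpha> \<beta> by (intro decay_add mu decay_weaken[OF momentum_commutator]) auto
    then show ?thesis by (simp add: mult.commute)
  qed
  have 1: "decay L (\<sigma> + (\<sigma> + s)) (min \<alpha> (min \<alpha> \<beta>)) (\<lambda>\<epsilon> y. U \<epsilon> i y * FF \<epsilon> i j y - u i y * (u i y * (\<rho> y * u j y)))" for i
    using decay_product_error[OF u_decay u_bound F mu0] s \<alpha> \<beta> by simp
  have 2: "decay L (\<sigma> + s) (min \<alpha> \<beta>) (\<lambda>\<epsilon> y. U \<epsilon> j y * PP \<epsilon> y - u j y * pr y)"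
    by (rule U_product_error[OF pressure_error _ s(1)]) (rule decay_weaken[OF pr_decay_0], use s in auto)
  have 3: "decay L (\<sigma> + (\<sigma> + s)) (min \<alpha> (min \<alpha> \<beta>)) (\<lambda>\<epsilon> y. U \<epsilon> i y * (U \<epsilon> i y * M \<epsilon> j y) - u i y * (u i y * (\<rho> y * u j y)))" for i
    using decay_product_error[OF u_decay u_bound mu mu0] s \<alpha> \<beta> by simp
  have 4: "decay L (s + \<sigma>) ((\<gamma> - 2) * \<beta> + (\<alpha> + \<beta>)) (\<lambda>\<epsilon> y. B' (dl \<epsilon>) (R \<epsilon> y) * (M \<epsilon> j y - R \<epsilon> y * U \<epsilon> j y))"
    using decay_mult[OF B'_decay mass_commutator] s by simp
  have 5: "decay L (\<sigma> + s) (min \<alpha> ((\<gamma> - 1) * \<beta>)) (\<lambda>\<epsilon> y. U \<epsilon> j y * B (dl \<epsilon>) (R \<epsilon> y) - u j y * P (\<rho> y))"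
    by (rule decay_product_error[OF u_decay u_bound B_decay])
       (use s pos \<alpha> in \<open>auto intro: decay_weaken[OF P_decay_0]\<close>)
  have half: "decay L 0 0 (\<lambda>\<epsilon> y. 1/2 :: real)" by (rule decay_bounded[OF zero_less_one, where C = "1/2"]) auto
  have s1: "decay L 1 rate (\<lambda>\<epsilon> y. \<Sum>i\<in>UNIV. U \<epsilon> i y * FF \<epsilon> i j y - u i y * (u i y * (\<rho> y * u j y)))"
    by (intro decay_sum decay_weaken[OF 1]) (use s rate in auto)
  have s2: "decay L 1 rate (\<lambda>\<epsilon> y. U \<epsilon> j y * PP \<epsilon> y - u j y * pr y)"
    by (rule decay_weaken[OF 2]) (use s rate in auto)
  have s3: "decay L 1 rate (\<lambda>\<epsilon> y. \<Sum>i\<in>UNIV. U \<epsilon> i y * (U \<epsilon> i y * M \<epsilon> j y) - u i y * (u i y * (\<rho> y * u j y)))"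
    by (intro decay_sum decay_weaken[OF 3]) (use s rate in auto)
  have s3': "decay L 1 rate (\<lambda>\<epsilon> y. 1/2 * (\<Sum>i\<in>UNIV. U \<epsilon> i y * (U \<epsilon> i y * M \<epsilon> j y) - u i y * (u i y * (\<rho> y * u j y))))"
    using decay_mult[OF half s3] by simp
  have s4: "decay L 1 rate (\<lambda>\<epsilon> y. B' (dl \<epsilon>) (R \<epsilon> y) * (M \<epsilon> j y - R \<epsilon> y * U \<epsilon> j y))"
    by (rule decay_weaken[OF 4]) (use s rate in auto)
  have s5: "decay L 1 rate (\<lambda>\<epsilon> y. U \<epsilon> j y * B (dl \<epsilon>) (R \<epsilon> y) - u j y * P (\<rho> y))"
    by (rule decay_weaken[OF 5]) (use s rate in auto)
  have "decay L 1 rate (\<lambda>\<epsilon> y. - (\<Sum>i\<in>UNIV. U \<epsilon> i y * FF \<epsilon> i j y - u i y * (u i y * (\<rho> y * u j y)))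
      - (U \<epsilon> j y * PP \<epsilon> y - u j y * pr y)
      + 1/2 * (\<Sum>i\<in>UNIV. U \<epsilon> i y * (U \<epsilon> i y * M \<epsilon> j y) - u i y * (u i y * (\<rho> y * u j y)))
      - B' (dl \<epsilon>) (R \<epsilon> y) * (M \<epsilon> j y - R \<epsilon> y * U \<epsilon> j y) - (U \<epsilon> j y * B (dl \<epsilon>) (R \<epsilon> y) - u j y * P (\<rho> y)))"
    by (rule decay_diff[OF decay_diff[OF decay_add[OF decay_diff[OF decay_uminus[OF s1] s2] s3'] s4] s5]) simp_all
  then show ?thesis
  proof (rule decay_mono[OF _ order_refl order_refl eps0(1)])
    fix \<epsilon> y assume y: "y \<in> space L"
    have "(\<Sum>i\<in>UNIV. u i y * (u i y * (\<rho> y * u j y))) = (\<Sum>i\<in>UNIV. u i y * u i y) * (\<rho> y * u j y)"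
      "(\<Sum>i\<in>UNIV. U \<epsilon> i y * (U \<epsilon> i y * M \<epsilon> j y)) = (\<Sum>i\<in>UNIV. U \<epsilon> i y * U \<epsilon> i y) * M \<epsilon> j y"
      by (simp_all only: sum_distrib_right mult.assoc)
    then have "- (\<Sum>i\<in>UNIV. U \<epsilon> i y * FF \<epsilon> i j y - u i y * (u i y * (\<rho> y * u j y)))
      - (U \<epsilon> j y * PP \<epsilon> y - u j y * pr y)
      + 1/2 * (\<Sum>i\<in>UNIV. U \<epsilon> i y * (U \<epsilon> i y * M \<epsilon> j y) - u i y * (u i y * (\<rho> y * u j y)))
      - B' (dl \<epsilon>) (R \<epsilon> y) * (M \<epsilon> j y - R \<epsilon> y * U \<epsilon> j y) - (U \<epsilon> j y * B (dl \<epsilon>) (R \<epsilon> y) - u j y * P (\<rho> y))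
      = Ex j y - Wx \<epsilon> j y"
      by (simp add: Ex_def Wx_def q_def sum_subtractf pr(2)[OF slab_time[OF y]] algebra_simps)
    then show "\<bar>Ex j y - Wx \<epsilon> j y\<bar> \<le> \<bar>- (\<Sum>i\<in>UNIV. U \<epsilon> i y * FF \<epsilon> i j y - u i y * (u i y * (\<rho> y * u j y)))
      - (U \<epsilon> j y * PP \<epsilon> y - u j y * pr y)
      + 1/2 * (\<Sum>i\<in>UNIV. U \<epsilon> i y * (U \<epsilon> i y * M \<epsilon> j y) - u i y * (u i y * (\<rho> y * u j y)))
      - B' (dl \<epsilon>) (R \<epsilon> y) * (M \<epsilon> j y - R \<epsilon> y * U \<epsilon> j y) - (U \<epsilon> j y * B (dl \<epsilon>) (R \<epsilon> y) - u j y * P (\<rho> y))\<bar>"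
      by simp
  qed
qed

text \<open>Measurability of \<open>P\<close> along the density comes from the regularised potentials, which are
  continuous and converge to \<open>P\<close> on the range of the density.\<close>

lemma energy_integrable: "integrable L Et" "integrable L (Ex j)"
proof -
  have [measurable]: "\<rho> \<in> borel_measurable L" "u i \<in> borel_measurable L" "pr \<in> borel_measurable L" for i
    using L1(1) L1(2)[of i] pr(1) by (auto simp: periodic_L1_def intro!: borel_measurable_slab)
  have [measurable]: "(\<lambda>y. P (\<rho> y)) \<in> borel_measurable L"
  proof (rule borel_measurable_LIMSEQ_real)
    fix i :: nat
    have \<delta>: "0 < 1 / real (Suc i)" "1 / real (Suc i) \<le> 1" by auto
    have "continuous_on UNIV (B (1 / real (Suc i)))"
      using potential(1)[OF \<delta>] DERIV_isCont continuous_at_imp_continuous_on by blast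
    then have [measurable]: "B (1 / real (Suc i)) \<in> borel_measurable borel" by (rule borel_measurable_continuous_onI)
    show "(\<lambda>y. B (1 / real (Suc i)) (\<rho> y)) \<in> borel_measurable L" by measurable
  next
    fix y assume y: "y \<in> space L"
    have "(\<lambda>i. (1 / real (Suc i)) powr \<gamma>) \<longlonglongrightarrow> 0 powr \<gamma>"
      using \<gamma> by (intro tendsto_powr' LIMSEQ_Suc[OF lim_1_over_n]) auto
    then have lim: "(\<lambda>i. Cp * (1 / real (Suc i)) powr \<gamma>) \<longlonglongrightarrow> 0" by (auto intro: tendsto_mult_right_zero)
    have "(\<lambda>i. B (1 / real (Suc i)) (\<rho> y) - P (\<rho> y)) \<longlonglongrightarrow> 0"
      by (rule Lim_null_comparison[OF _ lim])
         (use potential(7)[OF _ _ range[OF slab_time[OF y]]] in \<open>auto intro!: always_eventually\<close>)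
    then show "(\<lambda>i. B (1 / real (Suc i)) (\<rho> y)) \<longlonglongrightarrow> P (\<rho> y)" by (simp add: LIM_zero_iff)
  qed
  have half: "decay L 0 0 (\<lambda>\<epsilon> y. 1/2 :: real)" by (rule decay_bounded[OF zero_less_one, where C = "1/2"]) auto
  have uu: "decay L (s + \<sigma>) 0 (\<lambda>\<epsilon> y. (\<rho> y * u i y) * u i y)" for i
    using decay_mult[OF m_bound u_bound] s by simp
  have uuu: "decay L (s + \<sigma> + \<sigma>) 0 (\<lambda>\<epsilon> y. (\<rho> y * u i y) * u i y * u j y)" for i j
    using decay_mult[OF uu u_bound] s by simp
  have "decay L 1 0 (\<lambda>\<epsilon> y. 1/2 * (\<Sum>i\<in>UNIV. (\<rho> y * u i y) * u i y) + P (\<rho> y))"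
  proof (intro decay_add decay_weaken[OF P_decay_0])
    have "decay L 1 0 (\<lambda>\<epsilon> y. \<Sum>i\<in>UNIV. (\<rho> y * u i y) * u i y)"
      by (intro decay_sum decay_weaken[OF uu]) (use s in auto)
    from decay_mult[OF half this] show "decay L 1 0 (\<lambda>\<epsilon> y. 1/2 * (\<Sum>i\<in>UNIV. (\<rho> y * u i y) * u i y))" by simp
  qed auto
  moreover have "1/2 * (\<Sum>i\<in>UNIV. (\<rho> y * u i y) * u i y) + P (\<rho> y) = Et y" for y
    by (simp add: Et_def sum_distrib_left mult.assoc)
  ultimately have d: "decay L 1 0 (\<lambda>\<epsilon>. Et)" by simp
  show "integrable L Et"
    by (rule decay_const_integrable[OF d _ slab_finite]) (simp_all add: Et_def[abs_def])
  have "decay L 1 0 (\<lambda>\<epsilon> y. 1/2 * (\<Sum>i\<in>UNIV. (\<rho> y * u i y) * u i y * u j y) + pr y * u j y + P (\<rho> y) * u j y)"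
  proof (intro decay_add)
    have "decay L 1 0 (\<lambda>\<epsilon> y. \<Sum>i\<in>UNIV. (\<rho> y * u i y) * u i y * u j y)"
      by (intro decay_sum decay_weaken[OF uuu]) (use s in auto)
    from decay_mult[OF half this] show "decay L 1 0 (\<lambda>\<epsilon> y. 1/2 * (\<Sum>i\<in>UNIV. (\<rho> y * u i y) * u i y * u j y))" by simp
    show "decay L 1 0 (\<lambda>\<epsilon> y. pr y * u j y)" "decay L 1 0 (\<lambda>\<epsilon> y. P (\<rho> y) * u j y)"
      by (rule decay_weaken[OF decay_mult[OF pr_decay_0 u_bound]] decay_weaken[OF decay_mult[OF P_decay_0 u_bound]]; use s in auto)+
  qed auto
  then have d: "decay L 1 0 (\<lambda>\<epsilon>. Ex j)"
  proof (rule decay_mono[OF _ order_refl order_refl zero_less_one])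
    fix \<epsilon> :: real and y assume y: "y \<in> space L"
    show "\<bar>Ex j y\<bar> \<le> \<bar>1/2 * (\<Sum>i\<in>UNIV. (\<rho> y * u i y) * u i y * u j y) + pr y * u j y + P (\<rho> y) * u j y\<bar>"
      by (simp add: Ex_def pr(2)[OF slab_time[OF y]] sum_distrib_left sum_distrib_right algebra_simps)
  qed
  have "(\<lambda>y. (1/2 * \<rho> y * (\<Sum>i\<in>UNIV. u i y * u i y) + pr y + P (\<rho> y)) * u j y) \<in> borel_measurable L" by measurable
  then have "Ex j \<in> borel_measurable L"
    by (rule measurable_cong[THEN iffD1, rotated]) (simp add: Ex_def pr(2)[OF slab_time])
  then show "integrable L (Ex j)" by (intro decay_const_integrable[OF d _ slab_finite]) auto
qed

lemma energy_conserved_slab: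
  assumes \<phi>: "smooth_in a b \<phi>"
  shows "(\<integral>y. pdiff \<phi> (1, 0) y * Et y + (\<Sum>j\<in>UNIV. pdiff \<phi> (0, axis j 1) y * Ex j y) \<partial>slab a b) = 0"
proof -
  have bnd: "\<exists>A\<ge>0. \<forall>y. \<bar>\<phi> y\<bar> \<le> A \<and> \<bar>pdiff \<phi> v y\<bar> \<le> A" for v
    using bounded_pdiffD(3)[OF smooth_in_bounded_pdiff[OF \<phi>]] .
  have d\<phi>: "decay L 0 0 (\<lambda>\<epsilon>. \<phi>)" "decay L 0 0 (\<lambda>\<epsilon>. pdiff \<phi> v)" for v
  proof -
    obtain A where A: "0 \<le> A" "\<And>y. \<bar>\<phi> y\<bar> \<le> A" "\<And>y. \<bar>pdiff \<phi> v y\<bar> \<le> A" using bnd by blast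
    show "decay L 0 0 (\<lambda>\<epsilon>. \<phi>)" "decay L 0 0 (\<lambda>\<epsilon>. pdiff \<phi> v)"
      by (rule decay_bounded[OF zero_less_one _ A(1)]; use A in simp)+
  qed
  note im = integrable_slab_pdiff_mult[OF \<phi>]
  define Z where "Z \<epsilon> y = pdiff \<phi> (1, 0) y * (Et y - Wt \<epsilon> y)
      + (\<Sum>j\<in>UNIV. pdiff \<phi> (0, axis j 1) y * (Ex j y - Wx \<epsilon> j y)) - \<phi> y * X \<epsilon> y" for \<epsilon> y
  have "decay L (0 + 1) (0 + rate) Z"
    unfolding Z_def[abs_def]
    by (rule decay_diff[OF decay_add[OF decay_mult[OF d\<phi>(2) Wt_decay] decay_sum[OF finite decay_mult[OF d\<phi>(2) Wx_decay]]] decay_mult[OF d\<phi>(1) X_decay]])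
       simp_all
  then have Z: "decay L 1 rate Z" by simp
  show ?thesis
  proof (rule decay_integral_zero[OF Z order_refl rate(1) slab_finite eps0(1)])
    fix \<epsilon> assume e: "0 < \<epsilon>" "\<epsilon> < eps0"
    let ?A = "\<lambda>y. pdiff \<phi> (1, 0) y * Et y + (\<Sum>j\<in>UNIV. pdiff \<phi> (0, axis j 1) y * Ex j y)"
    let ?B = "\<lambda>y. pdiff \<phi> (1, 0) y * Wt \<epsilon> y + (\<Sum>j\<in>UNIV. pdiff \<phi> (0, axis j 1) y * Wx \<epsilon> j y) + \<phi> y * X \<epsilon> y"
    have "integrable L ?A"
      using im energy_integrable by simp
    then have "(\<integral>y. ?A y - ?B y \<partial>L) = (\<integral>y. ?A y \<partial>L)"
      using energy_identity[OF e \<phi>] by simp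
    moreover have "?A y - ?B y = Z \<epsilon> y" for y
      by (simp add: Z_def right_diff_distrib sum_subtractf)
    ultimately show "(\<integral>y. ?A y \<partial>L) = (\<integral>y. Z \<epsilon> y \<partial>L)" by simp
  qed
qed

end

section \<open>Borel representatives\<close>

lemma Omega_borel [measurable]: "Omega T \<in> sets (borel :: (real \<times> (real ^ 'n::finite)) measure)"
  unfolding Omega_def by (auto simp: borel_prod[symmetric])

lemma Omega_shift_borel: "Omega_shift T \<xi> \<in> sets (borel :: (real \<times> (real ^ 'n::finite)) measure)"
proof -
  have "Omega_shift T \<xi> = Omega T \<inter> {y. fst (y + \<xi>) \<in> {0<..<T}}" by (auto simp: Omega_shift_def)
  then show ?thesis using time_in_borel[of \<xi> T] by (simp add: sets.Int)
qed

lemma lebesgue_on_eq_borel: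
  fixes f :: "'a::euclidean_space \<Rightarrow> real"
  assumes S: "S \<in> sets borel" and g: "g \<in> borel_measurable (restrict_space lborel S)"
    and ae: "AE y in lebesgue_on S. f y = g y"
  shows "integral\<^sup>L (lebesgue_on S) f = integral\<^sup>L (restrict_space lborel S) g"
    "integrable (lebesgue_on S) f \<longleftrightarrow> integrable (restrict_space lborel S) g"
proof -
  let ?f = "\<lambda>y. indicator S y *\<^sub>R f y" and ?g = "\<lambda>y. indicator S y *\<^sub>R g y"
  have SL: "S \<in> sets lebesgue" using S by simp
  have gm: "?g \<in> borel_measurable lborel"
    using g S by (subst borel_measurable_restrict_space_iff[symmetric]) auto
  then have gl: "?g \<in> borel_measurable lebesgue" by (rule measurable_completion)
  have "AE y in lebesgue. y \<in> S \<longrightarrow> f y = g y"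
    using ae SL by (subst (asm) AE_restrict_space_iff) auto
  then have eq: "AE y in lebesgue. ?g y = ?f y" by eventually_elim auto
  have fl: "?f \<in> borel_measurable lebesgue" by (rule borel_measurable_AE[OF gl eq])
  have "integral\<^sup>L (lebesgue_on S) f = integral\<^sup>L lebesgue ?f"
    using SL by (subst integral_restrict_space) auto
  also have "\<dots> = integral\<^sup>L lebesgue ?g" using fl gl eq by (intro integral_cong_AE) auto
  also have "\<dots> = integral\<^sup>L lborel ?g" by (rule integral_completion[OF gm])
  also have "\<dots> = integral\<^sup>L (restrict_space lborel S) g"
    using S by (subst integral_restrict_space) auto
  finally show "integral\<^sup>L (lebesgue_on S) f = integral\<^sup>L (restrict_space lborel S) g" .
  have "integrable (lebesgue_on S) f \<longleftrightarrow> integrable lebesgue ?f"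
    using SL by (subst integrable_restrict_space) auto
  also have "\<dots> \<longleftrightarrow> integrable lebesgue ?g" using fl gl eq by (intro integrable_cong_AE) auto
  also have "\<dots> \<longleftrightarrow> integrable lborel ?g" by (rule integrable_completion[OF gm])
  also have "\<dots> \<longleftrightarrow> integrable (restrict_space lborel S) g"
    using S by (subst integrable_restrict_space) auto
  finally show "integrable (lebesgue_on S) f \<longleftrightarrow> integrable (restrict_space lborel S) g" .
qed

lemma AE_lebesgue_on_iff:
  fixes P :: "'a::euclidean_space \<Rightarrow> bool"
  assumes "S \<in> sets borel"
  shows "(AE y in lebesgue_on S. P y) \<longleftrightarrow> (AE y in lborel. y \<in> S \<longrightarrow> P y)"
  using assms by (subst AE_restrict_space_iff) (auto simp: AE_completion_iff)

lemma AE_lebesgue_on_subset: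
  fixes P :: "'a::euclidean_space \<Rightarrow> bool"
  assumes "AE y in lebesgue_on S. P y" "R \<subseteq> S" "S \<in> sets borel" "R \<in> sets borel"
  shows "AE y in lebesgue_on R. P y"
  using assms(1) unfolding AE_lebesgue_on_iff[OF assms(3)] AE_lebesgue_on_iff[OF assms(4)]
  by eventually_elim (use assms(2) in blast)

lemma AE_Omega_shift:
  fixes Q :: "real \<times> (real ^ 'n::finite) \<Rightarrow> bool"
  assumes ae: "AE y in lebesgue_on (Omega T). Q y"
    and per: "\<And>y. fst y \<in> {0<..<T} \<Longrightarrow> Q (fold_cell y) \<Longrightarrow> Q y"
  shows "AE y in lebesgue_on (Omega_shift T \<xi>). Q (y + \<xi>)"
proof -
  have "AE y in lborel. y \<in> Omega T \<longrightarrow> Q y" using ae by (subst (asm) AE_lebesgue_on_iff) auto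
  then have "AE y in cylinder. y \<in> Omega T \<longrightarrow> Q y"
    unfolding cylinder_def by (subst AE_restrict_space_iff) auto
  then have "AE y in distr cylinder cylinder (\<lambda>y. fold_cell (y + \<xi>)). y \<in> Omega T \<longrightarrow> Q y"
    by (simp only: distr_fold_cell_shift)
  then have "AE y in cylinder. fold_cell (y + \<xi>) \<in> Omega T \<longrightarrow> Q (fold_cell (y + \<xi>))"
    by (rule AE_distrD[OF fold_cell_shift_measurable])
  then have "AE y in lborel. y \<in> UNIV \<times> unit_cell \<longrightarrow> fold_cell (y + \<xi>) \<in> Omega T \<longrightarrow> Q (fold_cell (y + \<xi>))"
    unfolding cylinder_def by (subst (asm) AE_restrict_space_iff) auto
  then have "AE y in lborel. y \<in> Omega_shift T \<xi> \<longrightarrow> Q (y + \<xi>)"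
  proof eventually_elim
    case (elim y)
    show ?case
    proof
      assume y: "y \<in> Omega_shift T \<xi>"
      then have t: "fst (y + \<xi>) \<in> {0<..<T}" and "y \<in> UNIV \<times> unit_cell"
        by (auto simp: Omega_shift_def Omega_def)
      moreover have "fold_cell (y + \<xi>) \<in> Omega T"
        using t fold_cell_in[of "y + \<xi>"] by (auto simp: Omega_def mem_Times_iff)
      ultimately show "Q (y + \<xi>)" using elim per by blast
    qed
  qed
  then show ?thesis by (subst AE_lebesgue_on_iff[OF Omega_shift_borel])
qed

text \<open>Zero values outside \<open>(0,T)\<close> turn integrals over \<open>Omega T\<close> into integrals over the cylinder.\<close>

definition representative :: "real \<Rightarrow> (real \<times> (real ^ 'n::finite) \<Rightarrow> real) \<Rightarrow> (real \<times> (real ^ 'n) \<Rightarrow> real) \<Rightarrow> bool" where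
  "representative T F f \<longleftrightarrow> f \<in> borel_measurable borel \<and> space_periodic UNIV f \<and>
     (\<forall>y. fst y \<notin> {0<..<T} \<longrightarrow> f y = 0) \<and> space_periodic {0<..<T} F \<and>
     (AE y in lebesgue_on (Omega T). F y = f y)"

lemma representative_exists:
  fixes F :: "real \<times> (real ^ 'n::finite) \<Rightarrow> real"
  assumes F: "F \<in> borel_measurable (lebesgue_on (Omega T))" "space_periodic {0<..<T} F"
  shows "\<exists>f. representative T F f"
proof -
  have "(\<lambda>y. if y \<in> Omega T then F y else 0) \<in> borel_measurable lebesgue"
    by (rule borel_measurable_if_I[OF F(1)]) simp
  then obtain g where g[measurable]: "g \<in> borel_measurable borel"
    and ae: "AE y in lborel. (if y \<in> Omega T then F y else 0) = g y"
    using completion_ex_borel_measurable_real by fastforce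
  define f where "f y = (if fst y \<in> {0<..<T} then g (fold_cell y) else 0)" for y :: "real \<times> (real ^ 'n)"
  have "f \<in> borel_measurable borel"
    unfolding f_def[abs_def]
  proof (rule measurable_If)
    show "{y \<in> space borel. fst (y :: real \<times> (real ^ 'n)) \<in> {0<..<T}} \<in> sets borel"
      using time_in_borel[of 0 T] by simp
  qed measurable
  moreover have "space_periodic UNIV f"
  proof -
    have "fold_cell (t, x + axis k 1) = fold_cell (t, x)" for t and x :: "real ^ 'n" and k
    proof -
      have "frac (x $ i + axis k 1 $ i) = frac (x $ i)" for i
        by (cases "i = k") (simp_all add: axis_def frac_def)
      then show ?thesis by (simp add: fold_cell_def)
    qed
    then show ?thesis by (auto simp: space_periodic_def f_def)
  qed
  moreover have "AE y in lborel. y \<in> Omega T \<longrightarrow> F y = f y"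
    using ae
  proof eventually_elim
    case (elim y)
    show ?case
    proof
      assume y: "y \<in> Omega T"
      then have "fold_cell y = y" by (intro fold_cell_id) (auto simp: Omega_def)
      moreover have "fst y \<in> {0<..<T}" using y by (auto simp: Omega_def)
      ultimately show "F y = f y" using elim y by (simp add: f_def)
    qed
  qed
  then have "AE y in lebesgue_on (Omega T). F y = f y" by (subst AE_lebesgue_on_iff) auto
  ultimately show ?thesis
    using F(2) unfolding representative_def by (intro exI[of _ f]) (auto simp: f_def)
qed

lemma representative_mult:
  assumes "representative T F f" "representative T G g"
  shows "representative T (\<lambda>y. F y * G y) (\<lambda>y. f y * g y)"
proof -
  have "AE y in lebesgue_on (Omega T). F y = f y" "AE y in lebesgue_on (Omega T). G y = g y"
    using assms by (auto simp: representative_def)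
  then have "AE y in lebesgue_on (Omega T). F y * G y = f y * g y" by eventually_elim simp
  then show ?thesis using assms by (auto simp: representative_def space_periodic_def)
qed

lemma representative_AE_shift:
  fixes F f :: "real \<times> (real ^ 'n::finite) \<Rightarrow> real"
  assumes "representative T F f"
  shows "AE y in lebesgue_on (Omega_shift T \<xi>). F (y + \<xi>) - F y = f (y + \<xi>) - f y"
proof -
  have f: "space_periodic UNIV f" "space_periodic {0<..<T} F" "AE y in lebesgue_on (Omega T). F y = f y"
    using assms by (auto simp: representative_def)
  have 1: "AE y in lebesgue_on (Omega_shift T \<xi>). F (y + \<xi>) = f (y + \<xi>)"
  proof (rule AE_Omega_shift[OF f(3)])
    fix y :: "real \<times> (real ^ 'n)" assume "fst y \<in> {0<..<T}" "F (fold_cell y) = f (fold_cell y)"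
    then show "F y = f y"
      using periodic_fold_cell[OF f(2), of y] periodic_UNIV_fold_cell[OF f(1), of y] by simp
  qed
  have "AE y in lebesgue_on (Omega_shift T \<xi>). F y = f y"
    by (rule AE_lebesgue_on_subset[OF f(3) _ Omega_borel Omega_shift_borel]) (auto simp: Omega_shift_def)
  with 1 show ?thesis by eventually_elim simp
qed

lemma inverse_exponent:
  fixes q :: ennreal
  assumes "1 \<le> q"
  shows "1 / q \<le> 1" "1 / q = ennreal (enn2real (1 / q))" "2 / q = ennreal (2 * enn2real (1 / q))"
proof -
  show le: "1 / q \<le> 1"
  proof (rule divide_le_posI_ennreal)
    show "0 < q" using assms by (rule less_le_trans[rotated]) simp
  qed (use assms in simp)
  have "1 / q \<noteq> \<infinity>" using le by (auto simp: top_unique)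
  then show 1: "1 / q = ennreal (enn2real (1 / q))" by (simp add: less_top)
  have "2 / q = 2 * (1 / q)" by (simp add: ennreal_times_divide)
  also have "\<dots> = ennreal 2 * ennreal (enn2real (1 / q))" using 1 by simp
  also have "\<dots> = ennreal (2 * enn2real (1 / q))" by (rule ennreal_mult[symmetric]) auto
  finally show "2 / q = ennreal (2 * enn2real (1 / q))" .
qed

text \<open>A bound on the norm is turned into a bound on the modular, for finite and infinite exponents at
  once, and for a function dominated by the given one, such as a component of a vector field.\<close>

lemma Lp_norm_modular:
  fixes F :: "'a \<Rightarrow> 'b::real_normed_vector" and h :: "'a \<Rightarrow> real"
  assumes norm: "Lp_norm q M F \<le> ennreal A" and A: "0 < A" and q: "1 \<le> q"
    and h [measurable]: "h \<in> borel_measurable M" and le: "AE y in M. \<bar>h y\<bar> \<le> norm (F y)"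
  shows "(\<integral>\<^sup>+y. modular (enn2real (1 / q)) A (h y) \<partial>M) \<le> 1"
proof (cases "q = \<infinity>")
  case True
  have "AE y in M. ennreal (norm (F y)) \<le> ennreal A"
    using esssup_AE[of "\<lambda>y. ennreal (norm (F y))" M] norm True
    by (auto simp: Lp_norm_def elim!: eventually_mono intro: order_trans)
  with le have "AE y in M. modular (enn2real (1 / q)) A (h y) = 0"
  proof eventually_elim
    case (elim y)
    have "norm (F y) \<le> A" using elim(2) A by (simp add: ennreal_le_iff)
    then have "\<bar>h y\<bar> \<le> A" using elim(1) by linarith
    then show ?case using True by (simp add: modular_def)
  qed
  then have "(\<integral>\<^sup>+y. modular (enn2real (1 / q)) A (h y) \<partial>M) = (\<integral>\<^sup>+y. 0 \<partial>M)"
    by (rule nn_integral_cong_AE)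
  then show ?thesis by simp
next
  case False
  define Q where "Q = enn2real q"
  have qQ: "q = ennreal Q" using False by (simp add: Q_def less_top)
  have Q: "1 \<le> Q" using q unfolding qQ by (simp add: ennreal_1[symmetric] ennreal_le_iff2 del: ennreal_1)
  have s: "enn2real (1 / q) = 1 / Q" using Q unfolding qQ
    by (simp add: ennreal_1[symmetric] divide_ennreal del: ennreal_1)
  define I where "I = (\<integral>\<^sup>+y. ennreal (norm (F y) powr Q) \<partial>M)"
  have I: "I \<noteq> \<infinity>" and J: "ennreal (enn2real I powr (1 / Q)) \<le> ennreal A"
    using norm False unfolding Lp_norm_def Let_def I_def Q_def by (auto split: if_splits simp: top_unique)
  have "enn2real I powr (1 / Q) \<le> A" using J A by (simp add: ennreal_le_iff)
  then have "(enn2real I powr (1 / Q)) powr Q \<le> A powr Q" using Q by (intro powr_mono2) auto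
  then have "enn2real I \<le> A powr Q" using Q by (simp add: powr_powr)
  then have IA: "I \<le> ennreal (A powr Q)" using I by (metis ennreal_enn2real ennreal_leI infinity_ennreal_def less_top)
  have "(\<integral>\<^sup>+y. modular (enn2real (1 / q)) A (h y) \<partial>M) = (\<integral>\<^sup>+y. ennreal (1 / A powr Q) * ennreal (\<bar>h y\<bar> powr Q) \<partial>M)"
  proof (rule nn_integral_cong)
    fix y
    have "modular (enn2real (1 / q)) A (h y) = ennreal ((\<bar>h y\<bar> / A) powr Q)" using Q by (simp add: modular_def s)
    also have "(\<bar>h y\<bar> / A) powr Q = 1 / A powr Q * \<bar>h y\<bar> powr Q" using A by (simp add: powr_divide)
    also have "ennreal \<dots> = ennreal (1 / A powr Q) * ennreal (\<bar>h y\<bar> powr Q)" by (rule ennreal_mult) auto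
    finally show "modular (enn2real (1 / q)) A (h y) = ennreal (1 / A powr Q) * ennreal (\<bar>h y\<bar> powr Q)" .
  qed
  also have "\<dots> = ennreal (1 / A powr Q) * (\<integral>\<^sup>+y. ennreal (\<bar>h y\<bar> powr Q) \<partial>M)"
    by (rule nn_integral_cmult) measurable
  also have "(\<integral>\<^sup>+y. ennreal (\<bar>h y\<bar> powr Q) \<partial>M) \<le> I"
    unfolding I_def
  proof (rule nn_integral_mono_AE)
    show "AE y in M. ennreal (\<bar>h y\<bar> powr Q) \<le> ennreal (norm (F y) powr Q)"
      using le by eventually_elim (use Q in \<open>auto intro!: ennreal_leI powr_mono2\<close>)
  qed
  also note IA
  also have "ennreal (1 / A powr Q) * ennreal (A powr Q) = 1"
    using A by (subst ennreal_mult[symmetric]) auto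
  finally show ?thesis by (simp add: mult_left_mono)
qed

text \<open>The components of Besov fields, through representatives of them. \<open>F\<close> is to be thought of as a
  component of \<open>w\<close>.\<close>

lemma Besov_representative:
  fixes w :: "real \<times> (real ^ 'n::finite) \<Rightarrow> 'b::real_normed_vector"
  assumes w: "w \<in> Besov T \<kappa> q" and q: "1 \<le> q" and \<kappa>: "0 \<le> \<kappa>"
    and f: "representative T F f" and le: "\<And>y y'. \<bar>F y - F y'\<bar> \<le> norm (w y - w y')" "\<And>y. \<bar>F y\<bar> \<le> norm (w y)"
  shows "besov_comp T (enn2real (1 / q)) \<kappa> f" "decay (slab a b) (enn2real (1 / q)) 0 (\<lambda>\<epsilon>. f)"
proof -
  let ?s = "enn2real (1 / q)"
  have fm[measurable]: "f \<in> borel_measurable borel" and fp: "space_periodic UNIV f"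
    and f0: "\<And>y. fst y \<notin> {0<..<T} \<Longrightarrow> f y = 0" and fae: "AE y in lebesgue_on (Omega T). F y = f y"
    using f by (auto simp: representative_def)
  have fl: "g \<in> borel_measurable (lebesgue_on S)" if "g \<in> borel_measurable borel"
    for g :: "real \<times> (real ^ 'n) \<Rightarrow> real" and S
    using that by (intro measurable_restrict_space1 measurable_completion) auto
  have s: "0 \<le> ?s" "?s \<le> 1" using inverse_exponent(1)[OF q] by (auto simp: enn2real_leI)
  have fin: "Besov_norm T \<kappa> q w < \<infinity>" using w by (simp add: Besov_def)
  define N where "N = enn2real (Besov_norm T \<kappa> q w) + 1"
  have N: "N > 0" "Besov_norm T \<kappa> q w \<le> ennreal N"
    using fin by (auto simp: N_def add_nonneg_pos)
  have n0: "Lp_norm q (lebesgue_on (Omega T)) w \<le> ennreal N"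
    using N(2) unfolding Besov_norm_def by (rule order_trans[rotated]) simp
  have ns: "Lp_norm q (lebesgue_on (Omega_shift T \<xi>)) (\<lambda>y. w (y + \<xi>) - w y) \<le> ennreal (N * norm \<xi> powr \<kappa>)"
    if \<xi>: "\<xi> \<noteq> 0" for \<xi>
  proof -
    let ?L = "Lp_norm q (lebesgue_on (Omega_shift T \<xi>)) (\<lambda>y. w (y + \<xi>) - w y)"
    have c: "0 < norm \<xi> powr \<kappa>" using \<xi> by simp
    let ?f = "\<lambda>\<xi>. Lp_norm q (lebesgue_on (Omega_shift T \<xi>)) (\<lambda>y. w (y + \<xi>) - w y) / ennreal (norm \<xi> powr \<kappa>)"
    have "?f \<xi> \<le> (SUP \<xi>\<in>-{0}. ?f \<xi>)"
      using \<xi> by (intro SUP_upper[of \<xi> "-{0}" ?f]) simp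
    also have "\<dots> \<le> Besov_norm T \<kappa> q w"
      unfolding Besov_norm_def by (rule add_increasing) simp_all
    finally have "?L / ennreal (norm \<xi> powr \<kappa>) \<le> ennreal N" using N(2) by (rule order_trans)
    then have "?L / ennreal (norm \<xi> powr \<kappa>) * ennreal (norm \<xi> powr \<kappa>) \<le> ennreal N * ennreal (norm \<xi> powr \<kappa>)"
      by (rule mult_right_mono) simp
    moreover have "?L / ennreal (norm \<xi> powr \<kappa>) * ennreal (norm \<xi> powr \<kappa>) = ?L"
      using c by (simp add: ennreal_divide_times ennreal_divide_self)
    ultimately show ?thesis using N(1) by (simp add: ennreal_mult)
  qed
  have conv: "(\<integral>\<^sup>+y. g y \<partial>lebesgue_on S) = (\<integral>\<^sup>+y. g y * indicator S y \<partial>lborel)"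
    if "S \<in> sets borel" for g :: "real \<times> (real ^ 'n) \<Rightarrow> ennreal" and S
    using that by (subst nn_integral_restrict_space) (auto simp: nn_integral_completion)
  have cyl: "(\<integral>\<^sup>+y. g y \<partial>cylinder) = (\<integral>\<^sup>+y. g y * indicator (UNIV \<times> unit_cell) y \<partial>lborel)"
    for g :: "real \<times> (real ^ 'n) \<Rightarrow> ennreal"
    unfolding cylinder_def by (subst nn_integral_restrict_space) auto
  have base: "(\<integral>\<^sup>+y. modular ?s N (f y) \<partial>cylinder) \<le> 1"
  proof -
    have "(\<integral>\<^sup>+y. modular ?s N (f y) \<partial>cylinder) = (\<integral>\<^sup>+y. modular ?s N (f y) \<partial>lebesgue_on (Omega T))"
      unfolding cyl conv[OF Omega_borel]
    proof (rule nn_integral_cong)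
      fix y :: "real \<times> (real ^ 'n)"
      show "modular ?s N (f y) * indicator (UNIV \<times> unit_cell) y = modular ?s N (f y) * indicator (Omega T) y"
        using f0[of y] modular_0[OF s(1) N(1)] by (cases "fst y \<in> {0<..<T}") (auto simp: Omega_def indicator_def mem_Times_iff)
    qed
    also have "\<dots> \<le> 1"
    proof (rule Lp_norm_modular[OF n0 N(1) q fl[OF fm]])
      show "AE y in lebesgue_on (Omega T). \<bar>f y\<bar> \<le> norm (w y)"
        using fae by eventually_elim (use le(2) in metis)
    qed
    finally show ?thesis .
  qed
  have Lq: "Lq_bound (slab c d) ?s N f" for c d
  proof (rule Lq_bound_modular[OF s(1) N(1)])
    show "(\<integral>\<^sup>+y. modular ?s N (f y) \<partial>slab c d) \<le> 1"
      by (rule order_trans[OF nn_integral_slab_le base]) auto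
  qed measurable
  show "decay (slab a b) ?s 0 (\<lambda>\<epsilon>. f)"
    by (rule decayI[OF zero_less_one, where C = N]) (use Lq in simp)
  have "(\<integral>\<^sup>+y. ennreal \<bar>f y\<bar> \<partial>slab 0 T) < \<infinity>"
  proof -
    have "(\<integral>\<^sup>+y. ennreal \<bar>f y\<bar> \<partial>slab 0 T) \<le> ennreal N * (emeasure (slab 0 T) (space (slab 0 T :: (real \<times> (real ^ 'n)) measure)) + 1)"
      by (rule Lq_bound_integral[OF Lq s(2)])
    also have "\<dots> < \<infinity>" using slab_finite[of 0 T, where 'n = 'n] by (simp add: ennreal_mult_less_top less_top)
    finally show ?thesis .
  qed
  then have int0: "integrable (slab 0 T) f" by (intro integrableI_bounded) auto
  have supp: "fst y \<in> {0..T}" if "f y \<noteq> 0" for y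
    using f0[of y] that by (cases "fst y \<in> {0<..<T}") auto
  have "integrable cylinder f"
    using integrable_cylinder_iff_slab[OF supp] int0 by simp
  then have "periodic_L1 f" using fp by (simp add: periodic_L1_def)
  moreover have "besov_shift T ?s \<kappa> f"
    unfolding besov_shift_def
  proof (intro exI[of _ N] conjI N(1) allI impI)
    fix \<xi> :: "real \<times> (real ^ 'n)" assume \<xi>: "\<xi> \<noteq> 0"
    have "(\<integral>\<^sup>+y. modular ?s (N * norm \<xi> powr \<kappa>) (f (y + \<xi>) - f y) *
        indicator {y. fst y \<in> {0<..<T} \<and> fst (y + \<xi>) \<in> {0<..<T}} y \<partial>cylinder)
      = (\<integral>\<^sup>+y. modular ?s (N * norm \<xi> powr \<kappa>) (f (y + \<xi>) - f y) \<partial>lebesgue_on (Omega_shift T \<xi>))"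
      unfolding cyl conv[OF Omega_shift_borel]
      by (rule nn_integral_cong) (auto simp: Omega_shift_def Omega_def indicator_def)
    also have "\<dots> \<le> 1"
    proof (rule Lp_norm_modular[OF ns[OF \<xi>] _ q])
      show "0 < N * norm \<xi> powr \<kappa>" using N(1) \<xi> by simp
      show "(\<lambda>y. f (y + \<xi>) - f y) \<in> borel_measurable (lebesgue_on (Omega_shift T \<xi>))" by (rule fl) measurable
      show "AE y in lebesgue_on (Omega_shift T \<xi>). \<bar>f (y + \<xi>) - f y\<bar> \<le> norm (w (y + \<xi>) - w y)"
        using representative_AE_shift[OF f] by eventually_elim (use le(1) in metis)
    qed
    finally show "(\<integral>\<^sup>+y. modular ?s (N * norm \<xi> powr \<kappa>) (f (y + \<xi>) - f y) *
        indicator {y. fst y \<in> {0<..<T} \<and> fst (y + \<xi>) \<in> {0<..<T}} y \<partial>cylinder) \<le> 1" .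
  qed
  ultimately show "besov_comp T ?s \<kappa> f" using s \<kappa> by (simp add: besov_comp_def)
qed

lemma representative_integral:
  fixes F f :: "real \<times> (real ^ 'n::finite) \<Rightarrow> real"
  assumes f: "representative T F f" and \<psi>: "smooth_in c d \<psi>"
  shows "(LINT y|lebesgue_on (Omega T). F y * pdiff \<psi> v y) = (\<integral>y. pdiff \<psi> v y * f y \<partial>cylinder)"
proof -
  have [measurable]: "f \<in> borel_measurable borel" and f0: "\<And>y. fst y \<notin> {0<..<T} \<Longrightarrow> f y = 0"
    and fae: "AE y in lebesgue_on (Omega T). F y = f y"
    using f by (auto simp: representative_def)
  have [measurable]: "pdiff \<psi> v \<in> borel_measurable borel"
    by (rule bounded_pdiff_borel_deriv[OF smooth_in_bounded_pdiff[OF \<psi>]])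
  have "AE y in lebesgue_on (Omega T). F y * pdiff \<psi> v y = pdiff \<psi> v y * f y"
    using fae by eventually_elim simp
  then have "(LINT y|lebesgue_on (Omega T). F y * pdiff \<psi> v y) = (\<integral>y. pdiff \<psi> v y * f y \<partial>restrict_space lborel (Omega T))"
    by (intro lebesgue_on_eq_borel(1) measurable_restrict_space1) auto
  also have "\<dots> = (\<integral>y. indicator (Omega T) y *\<^sub>R (pdiff \<psi> v y * f y) \<partial>lborel)"
    by (subst integral_restrict_space) auto
  also have "\<dots> = (\<integral>y. indicator (UNIV \<times> unit_cell) y *\<^sub>R (pdiff \<psi> v y * f y) \<partial>lborel)"
  proof (rule Bochner_Integration.integral_cong[OF refl])
    fix y :: "real \<times> (real ^ 'n)"
    show "indicator (Omega T) y *\<^sub>R (pdiff \<psi> v y * f y) = indicator (UNIV \<times> unit_cell) y *\<^sub>R (pdiff \<psi> v y * f y)"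
      using f0[of y] by (cases "fst y \<in> {0<..<T}") (auto simp: Omega_def indicator_def mem_Times_iff)
  qed
  also have "\<dots> = (\<integral>y. pdiff \<psi> v y * f y \<partial>cylinder)"
    unfolding cylinder_def by (subst integral_restrict_space) auto
  finally show ?thesis .
qed

lemma slab_integral:
  fixes F f :: "real \<times> (real ^ 'n::finite) \<Rightarrow> real"
  assumes ab: "0 < a" "b < T" and f: "f \<in> borel_measurable (slab a b)"
    and ae: "AE y in lebesgue_on ({a..b} \<times> unit_cell). F y = f y" and \<psi>: "smooth_in a b \<psi>"
  shows "(LINT y|lebesgue_on (Omega T). F y * pdiff \<psi> v y) = (\<integral>y. pdiff \<psi> v y * f y \<partial>slab a b)"
proof -
  have [measurable]: "pdiff \<psi> v \<in> borel_measurable (slab a b)" 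
    by (intro borel_measurable_slab bounded_pdiff_borel_deriv[OF smooth_in_bounded_pdiff[OF \<psi>]])
  note [measurable] = f
  have "(LINT y|lebesgue_on (Omega T). F y * pdiff \<psi> v y) = (\<integral>y. indicator (Omega T) y *\<^sub>R (F y * pdiff \<psi> v y) \<partial>lebesgue)"
    by (subst integral_restrict_space) auto
  also have "\<dots> = (\<integral>y. indicator ({a..b} \<times> unit_cell) y *\<^sub>R (F y * pdiff \<psi> v y) \<partial>lebesgue)"
  proof (rule Bochner_Integration.integral_cong[OF refl])
    fix y :: "real \<times> (real ^ 'n)"
    show "indicator (Omega T) y *\<^sub>R (F y * pdiff \<psi> v y) = indicator ({a..b} \<times> unit_cell) y *\<^sub>R (F y * pdiff \<psi> v y)"
      using smooth_in_pdiff(3)[OF \<psi>, of v y] ab by (cases "pdiff \<psi> v y = 0") (auto simp: Omega_def indicator_def mem_Times_iff)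
  qed
  also have "\<dots> = (LINT y|lebesgue_on ({a..b} \<times> unit_cell). F y * pdiff \<psi> v y)"
    by (subst integral_restrict_space) auto
  also have "\<dots> = (\<integral>y. pdiff \<psi> v y * f y \<partial>slab a b)"
    unfolding slab_def
  proof (rule lebesgue_on_eq_borel(1))
    show "(\<lambda>y. pdiff \<psi> v y * f y) \<in> borel_measurable (restrict_space lborel ({a..b} \<times> unit_cell))"
      unfolding slab_def[symmetric] by measurable
    show "AE y in lebesgue_on ({a..b} \<times> unit_cell). F y * pdiff \<psi> v y = pdiff \<psi> v y * f y"
      using ae by eventually_elim simp
  qed simp
  finally show ?thesis .
qed

section \<open>Local energy conservation\<close>

lemma smooth_in_test_function:
  assumes "0 < c" "d < T" "smooth_in c d \<psi>"
  shows "\<psi> \<in> test_functions T"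
proof -
  have "\<exists>a b. 0 < a \<and> b < T \<and> (\<forall>t x. \<psi> (t, x) \<noteq> 0 \<longrightarrow> t \<in> {a..b})"
    by (rule exI[of _ c], rule exI[of _ d]) (use assms in \<open>auto simp: smooth_in_def\<close>)
  then show ?thesis using assms(3) by (simp add: smooth_in_def test_functions_def)
qed

lemma test_function_smooth_in:
  assumes "\<psi> \<in> test_functions T"
  shows "\<exists>c d. 0 < c \<and> d < T \<and> smooth_in c d \<psi>"
  using assms unfolding smooth_in_def test_functions_def by fastforce

lemma Omega_not_null:
  assumes "0 < T" "AE y in lebesgue_on (Omega T :: (real \<times> (real ^ 'n::finite)) set). P y"
  shows "\<exists>y \<in> (Omega T :: (real \<times> (real ^ 'n)) set). P y"
proof (rule ccontr)
  assume none: "\<not> ?thesis"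
  let ?B = "box (0, 0) (T, \<chi> i. 1) :: (real \<times> (real ^ 'n)) set"
  have "AE y in lborel. y \<in> (Omega T :: (real \<times> (real ^ 'n)) set) \<longrightarrow> P y"
    using assms(2) by (subst (asm) AE_lebesgue_on_iff) auto
  then have "AE y in lborel. y \<notin> ?B"
  proof eventually_elim
    case (elim y)
    have "y \<in> ?B \<Longrightarrow> y \<in> Omega T"
      by (cases y) (auto simp: Omega_def unit_cell_def mem_box Basis_spacetime inner_axis less_imp_le)
    then show ?case using elim none by blast
  qed
  then have "emeasure lborel ?B = 0"
    by (subst (asm) AE_iff_measurable[where N = ?B]) auto
  moreover have "emeasure lborel ?B = (\<Prod>b\<in>(Basis :: (real \<times> (real ^ 'n)) set). ((T, \<chi> i. 1) - (0, 0)) \<bullet> b)"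
    by (rule emeasure_lborel_box) (use assms(1) in \<open>auto simp: Basis_spacetime inner_axis\<close>)
  moreover have "0 < (\<Prod>b\<in>(Basis :: (real \<times> (real ^ 'n)) set). ((T, \<chi> i. 1) - (0, 0)) \<bullet> b)"
    by (rule prod_pos) (use assms(1) in \<open>auto simp: Basis_spacetime inner_axis\<close>)
  ultimately show False by (metis ennreal_eq_0_iff not_le)
qed

theorem corollary4p6:
  fixes T \<gamma> \<alpha> \<beta> \<rho>lo \<rho>hi :: real
    and r q :: ennreal
    and \<rho> :: "real \<times> (real ^ 'n::finite) \<Rightarrow> real"
    and u :: "real \<times> (real ^ 'n) \<Rightarrow> real ^ 'n"
    and p p' :: "real \<Rightarrow> real"
  assumes "0 < T"
    and "1 < \<gamma>" and "\<gamma> < 2"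
    and "euler_solution T p \<rho> u"
    and "u \<in> Besov T \<alpha> r"
    and "\<rho> \<in> Besov T \<beta> q"
    and "(\<lambda>y. \<rho> y *\<^sub>R u y) \<in> Besov T \<beta> q"
    and "0 \<le> \<rho>lo"
    and "AE y in lebesgue_on (Omega T). \<rho>lo \<le> \<rho> y \<and> \<rho> y \<le> \<rho>hi"
    and "0 \<le> \<alpha>" and "\<alpha> \<le> 1" and "0 \<le> \<beta>" and "\<beta> \<le> 1"
    and "1 / r + 2 / q \<le> 1" and "2 / r + 1 / q \<le> 1"
    and "2 \<le> r" and "2 \<le> q"
    and "\<alpha> + \<gamma> * \<beta> > 1" and "2 * \<alpha> + \<beta> > 1"
    and "(\<lambda>y. 1 / \<rho> y) \<in> Lp q (lebesgue_on {y \<in> Omega T. \<rho> y \<noteq> 0})"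
    and "C1_Hoelder (\<gamma> - 1) \<rho>lo \<rho>hi p p'"
    and "\<rho>lo = 0 \<Longrightarrow> p' 0 = 0"
    and "pressure_law_on \<rho>lo \<rho>hi p"
  shows "energy_locally_conserved T p \<rho> u"
proof -
  note range_ae = assms(9)
  let ?P = "pressure_potential p"
  define s where "s = enn2real (1 / q)"
  define \<sigma> where "\<sigma> = enn2real (1 / r)"
  have q1: "1 \<le> q" "1 \<le> r" using assms(16,17) by (auto intro: order_trans[rotated])
  have s: "0 \<le> s" "0 \<le> \<sigma>" by (auto simp: s_def \<sigma>_def)
  have exps: "s + 2 * \<sigma> \<le> 1" "\<sigma> + 2 * s \<le> 1"
  proof -
    have "ennreal (2 * \<sigma> + s) \<le> ennreal 1" "ennreal (\<sigma> + 2 * s) \<le> ennreal 1"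
      using assms(14,15) inverse_exponent(2,3)[OF q1(1), folded s_def] inverse_exponent(2,3)[OF q1(2), folded \<sigma>_def] s
      by (simp_all add: ennreal_plus)
    then show "s + 2 * \<sigma> \<le> 1" "\<sigma> + 2 * s \<le> 1" by (simp_all add: ennreal_le_iff del: ennreal_1)
  qed
  have lohi: "\<rho>lo \<le> \<rho>hi" using Omega_not_null[OF assms(1) range_ae] by force
  have per: "space_periodic {0<..<T} \<rho>" "space_periodic {0<..<T} u"
    and meas: "\<rho> \<in> borel_measurable (lebesgue_on (Omega T))" "u \<in> borel_measurable (lebesgue_on (Omega T))"
    using assms(5,6) by (auto simp: Besov_def)

  \<comment> \<open>The bounds on the density hold almost everywhere; clamping a representative makes them hold at all
    times in \<open>(0,T)\<close>, where the regularised potentials are controlled.\<close>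
  define cl where "cl x = max \<rho>lo (min \<rho>hi x)" for x
  obtain \<rho>0 where \<rho>0: "representative T (\<lambda>y. cl (\<rho> y)) \<rho>0"
    using representative_exists[of "\<lambda>y. cl (\<rho> y)" T] meas(1) per(1) by (auto simp: cl_def space_periodic_def)
  define R where "R y = (if fst y \<in> {0<..<T} then cl (\<rho>0 y) else 0)" for y
  have time_borel: "{y. fst (y :: real \<times> (real ^ 'n)) \<in> {0<..<T}} \<in> sets borel"
    using time_in_borel[of 0 T] by simp
  have if_borel: "(\<lambda>y :: real \<times> (real ^ 'n). if fst y \<in> {0<..<T} then f y else 0) \<in> borel_measurable borel"
    if "f \<in> borel_measurable borel" for f :: "real \<times> (real ^ 'n) \<Rightarrow> real"
    using that time_borel by (intro measurable_If) auto
  have cl_in: "cl x \<in> {\<rho>lo..\<rho>hi}" for x using lohi by (auto simp: cl_def)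
  have cl_id: "cl x = x" if "x \<in> {\<rho>lo..\<rho>hi}" for x using that by (auto simp: cl_def)
  have in_time: "fst y \<in> {0<..<T}" if "y \<in> Omega T" for y :: "real \<times> (real ^ 'n)"
    using that by (auto simp: Omega_def)
  have ae_in: "AE y in lebesgue_on (Omega T). y \<in> (Omega T :: (real \<times> (real ^ 'n)) set)"
    by (subst AE_lebesgue_on_iff) auto
  have repR: "representative T \<rho> R"
  proof -
    have [measurable]: "\<rho>0 \<in> borel_measurable borel" using \<rho>0 by (simp add: representative_def)
    have "R \<in> borel_measurable borel"
      unfolding R_def[abs_def] by (rule if_borel) (simp add: cl_def)
    moreover have "space_periodic UNIV R" using \<rho>0 by (auto simp: representative_def space_periodic_def R_def)
    moreover have "AE y in lebesgue_on (Omega T). cl (\<rho> y) = \<rho>0 y" using \<rho>0 by (simp add: representative_def)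
    with range_ae ae_in have "AE y in lebesgue_on (Omega T). \<rho> y = R y"
    proof eventually_elim
      case (elim y)
      then have "cl (\<rho> y) = \<rho> y" by (intro cl_id) simp
      then have "\<rho>0 y = \<rho> y" using elim by simp
      then show ?case using in_time[OF elim(2)] \<open>cl (\<rho> y) = \<rho> y\<close> by (simp add: R_def)
    qed
    ultimately show ?thesis using per(1) by (auto simp: representative_def R_def)
  qed
  have R_range: "R y \<in> {\<rho>lo..\<rho>hi}" if "fst y \<in> {0<..<T}" for y using that cl_in by (simp add: R_def)
  have "\<exists>f. representative T (\<lambda>y. u y $ i) f" for i
  proof (rule representative_exists)
    have "(\<lambda>y. u y \<bullet> axis i 1) \<in> borel_measurable (lebesgue_on (Omega T))" using meas(2) by simp
    then show "(\<lambda>y. u y $ i) \<in> borel_measurable (lebesgue_on (Omega T))" by (simp add: inner_axis)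
    show "space_periodic {0<..<T} (\<lambda>y. u y $ i)" using per(2) by (simp add: space_periodic_def)
  qed
  then obtain v where repv: "\<And>i. representative T (\<lambda>y. u y $ i) (v i)" by metis
  have repm: "representative T (\<lambda>y. \<rho> y * u y $ i) (\<lambda>y. R y * v i y)" for i
    by (rule representative_mult[OF repR repv])
  have repf: "representative T (\<lambda>y. (\<rho> y * u y $ j) * u y $ i) (\<lambda>y. (R y * v j y) * v i y)" for i j
    by (rule representative_mult[OF repm repv])

  have bR: "besov_comp T s \<beta> R"
    unfolding s_def by (rule Besov_representative(1)[OF assms(6) q1(1) assms(12) repR]) auto
  have nth_diff: "\<bar>x $ i - y $ i\<bar> \<le> norm (x - y)" for x y :: "real ^ 'n" and i
    using component_le_norm_cart[of "x - y" i] by simp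
  have bv: "besov_comp T \<sigma> \<alpha> (v i)" "decay (slab a b) \<sigma> 0 (\<lambda>\<epsilon>. v i)" for i a b
    unfolding \<sigma>_def
    by (rule Besov_representative[OF assms(5) q1(2) assms(10) repv]; rule nth_diff component_le_norm_cart)+
  have bm: "besov_comp T s \<beta> (\<lambda>y. R y * v i y)" "decay (slab a b) s 0 (\<lambda>\<epsilon> y. R y * v i y)" for i a b
  proof -
    have d: "\<bar>\<rho> y * u y $ i - \<rho> y' * u y' $ i\<bar> \<le> norm (\<rho> y *\<^sub>R u y - \<rho> y' *\<^sub>R u y')" for y y'
      using nth_diff[of "\<rho> y *\<^sub>R u y" i "\<rho> y' *\<^sub>R u y'"] by simp
    have n: "\<bar>\<rho> y * u y $ i\<bar> \<le> norm (\<rho> y *\<^sub>R u y)" for y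
      using component_le_norm_cart[of "\<rho> y *\<^sub>R u y" i] by simp
    show "besov_comp T s \<beta> (\<lambda>y. R y * v i y)" "decay (slab a b) s 0 (\<lambda>\<epsilon> y. R y * v i y)"
      unfolding s_def by (rule Besov_representative[OF assms(7) q1(1) assms(12) repm d n])+
  qed
  have borelR: "R \<in> borel_measurable borel" "v i \<in> borel_measurable borel" for i
    using repR repv by (auto simp: representative_def)
  note [measurable] = borelR
  have zero: "R y = 0" "v i y = 0" if "fst y \<notin> {0<..<T}" for y i
    using repR repv that unfolding representative_def by blast+
  have flux: "periodic_L1 (\<lambda>y. (R y * v j y) * v i y)" for i j
  proof -
    have "decay (slab 0 T) (s + \<sigma>) 0 (\<lambda>\<epsilon> y. (R y * v j y) * v i y)"
      using decay_mult[OF bm(2) bv(2)] s by simp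
    then have "integrable (slab 0 T) (\<lambda>y. (R y * v j y) * v i y)"
      by (rule decay_const_integrable[OF _ _ slab_finite]) (use s exps in auto)
    moreover have "fst y \<in> {0..T}" if "(R y * v j y) * v i y \<noteq> 0" for y
      using zero(1)[of y] that by (cases "fst y \<in> {0<..<T}") auto
    ultimately have "integrable cylinder (\<lambda>y. (R y * v j y) * v i y)"
      by (intro iffD2[OF integrable_cylinder_iff_slab[of "\<lambda>y. (R y * v j y) * v i y" 0 T]])
    then show ?thesis using repf[of j i] by (simp add: periodic_L1_def representative_def)
  qed

  obtain C1 where C1: "0 \<le> C1" "\<And>x t. x \<in> {\<rho>lo..\<rho>hi} \<Longrightarrow> t \<in> {\<rho>lo..\<rho>hi} \<Longrightarrow> \<bar>p x - p t\<bar> \<le> C1 * \<bar>x - t\<bar>"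
    "\<And>x t. x \<in> {\<rho>lo..\<rho>hi} \<Longrightarrow> t \<in> {\<rho>lo..\<rho>hi} \<Longrightarrow> \<bar>p x - p t - p' t * (x - t)\<bar> \<le> C1 * \<bar>x - t\<bar> powr \<gamma>"
    using C1_Hoelder_Taylor[OF assms(21,2,8,22)] by blast
  obtain C2 where C2: "0 \<le> C2" "\<forall>\<delta>. 0 < \<delta> \<longrightarrow> \<delta> \<le> 1 \<longrightarrow> (\<exists>b b' b''.
    (\<forall>s. (b has_real_derivative b' s) (at s)) \<and> (\<forall>s. (b' has_real_derivative b'' s) (at s)) \<and>
    continuous_on UNIV b'' \<and>
    (\<forall>s\<in>{\<rho>lo..\<rho>hi}. \<bar>b'' s\<bar> \<le> C2 * \<delta> powr (\<gamma> - 2) \<and> \<bar>b' s\<bar> \<le> C2 * \<delta> powr (\<gamma> - 2) \<and>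
       \<bar>s * b' s - b s - p s\<bar> \<le> C2 * \<delta> powr \<gamma> \<and> \<bar>b s - ?P s\<bar> \<le> C2 * \<delta> powr \<gamma>))"
    using regularised_potential[OF assms(21,2,3,8) lohi assms(22,23)] by blast
  obtain B B' B'' where B: "\<And>\<delta>. 0 < \<delta> \<Longrightarrow> \<delta> \<le> 1 \<Longrightarrow>
    (\<forall>s. (B \<delta> has_real_derivative B' \<delta> s) (at s)) \<and> (\<forall>s. (B' \<delta> has_real_derivative B'' \<delta> s) (at s)) \<and>
    continuous_on UNIV (B'' \<delta>) \<and>
    (\<forall>s\<in>{\<rho>lo..\<rho>hi}. \<bar>B'' \<delta> s\<bar> \<le> C2 * \<delta> powr (\<gamma> - 2) \<and> \<bar>B' \<delta> s\<bar> \<le> C2 * \<delta> powr (\<gamma> - 2) \<and>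
       \<bar>s * B' \<delta> s - B \<delta> s - p s\<bar> \<le> C2 * \<delta> powr \<gamma> \<and> \<bar>B \<delta> s - ?P s\<bar> \<le> C2 * \<delta> powr \<gamma>)"
    using C2(2) by metis
  define Cp where "Cp = max C1 C2"
  have Cp: "0 \<le> Cp" "x * C1 \<le> x * Cp" "x * C2 \<le> x * Cp" if "0 \<le> x" for x
    using C1(1) that by (auto simp: Cp_def intro: mult_left_mono)

  \<comment> \<open>Composition with \<open>p\<close> would not give a function that vanishes outside \<open>(0,T)\<close>.\<close>
  define pr where "pr y = (if fst y \<in> {0<..<T} then p (R y) else 0)" for y
  have pr: "periodic_L1 pr"
  proof -
    have "continuous_on {\<rho>lo..\<rho>hi} p"
      using assms(21) unfolding C1_Hoelder_def by (intro DERIV_continuous_on) blast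
    then have "continuous_on UNIV (\<lambda>x. p (cl x))"
      by (rule continuous_on_compose2) (use cl_in in \<open>auto simp: cl_def intro!: continuous_intros\<close>)
    then have [measurable]: "(\<lambda>x. p (cl x)) \<in> borel_measurable borel" by (rule borel_measurable_continuous_onI)
    have "(\<lambda>y. if fst y \<in> {0<..<T} then p (cl (R y)) else 0) \<in> borel_measurable borel"
      by (rule if_borel) measurable
    moreover have pr_eq: "pr y = (if fst y \<in> {0<..<T} then p (cl (R y)) else 0)" for y
      using cl_id[OF R_range] by (simp add: pr_def)
    ultimately have m: "pr \<in> borel_measurable borel" by (simp add: pr_eq[abs_def])
    have "bounded ((\<lambda>x. p x) ` {\<rho>lo..\<rho>hi})"
      by (intro compact_imp_bounded compact_continuous_image \<open>continuous_on {\<rho>lo..\<rho>hi} p\<close>) auto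
    then obtain A where A: "A > 0" "\<And>x. x \<in> {\<rho>lo..\<rho>hi} \<Longrightarrow> \<bar>p x\<bar> \<le> A" unfolding bounded_pos by auto
    have "integrable cylinder pr"
    proof (rule integrable_cylinder_bounded[OF m, where B = A and a = 0 and b = T])
      show "\<bar>pr y\<bar> \<le> A" for y using A R_range[of y] by (auto simp: pr_def)
      show "fst y \<in> {0..T}" if "pr y \<noteq> 0" for y using that by (auto simp: pr_def split: if_splits)
    qed
    moreover have "space_periodic UNIV pr"
      using repR by (auto simp: representative_def space_periodic_def pr_def)
    ultimately show ?thesis using m by (simp add: periodic_L1_def)
  qed
  have reppr: "representative T (\<lambda>y. p (\<rho> y)) pr"
  proof -
    have "AE y in lebesgue_on (Omega T). \<rho> y = R y" using repR by (simp add: representative_def)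
    with ae_in have "AE y in lebesgue_on (Omega T). p (\<rho> y) = pr y"
      by eventually_elim (use in_time in \<open>auto simp: pr_def\<close>)
    then show ?thesis using pr per(1) by (auto simp: representative_def periodic_L1_def pr_def space_periodic_def)
  qed

  have mass: "(\<integral>y. pdiff \<psi> (1, 0) y * R y \<partial>cylinder) +
      (\<Sum>j\<in>UNIV. \<integral>y. pdiff \<psi> (0, axis j 1) y * (R y * v j y) \<partial>cylinder) = 0"
    if "0 < c" "d < T" "smooth_in c d \<psi>" for c d \<psi>
  proof -
    have "dist_dt T \<rho> \<psi> + dist_div T (\<lambda>y. \<rho> y *\<^sub>R u y) \<psi> = 0"
      using assms(4) smooth_in_test_function[OF that] unfolding euler_solution_def continuity_equation_def by blast
    then show ?thesis
      using representative_integral[OF repR that(3), of "(1, 0)"] representative_integral[OF repm that(3)]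
      by (simp add: dist_dt_def dist_div_def dist_dx_def pdiff_def[symmetric] sum_negf)
  qed
  have momentum: "(\<integral>y. pdiff \<psi> (1, 0) y * (R y * v i y) \<partial>cylinder) +
      (\<Sum>j\<in>UNIV. \<integral>y. pdiff \<psi> (0, axis j 1) y * ((R y * v j y) * v i y) \<partial>cylinder) +
      (\<integral>y. pdiff \<psi> (0, axis i 1) y * pr y \<partial>cylinder) = 0"
    if "0 < c" "d < T" "smooth_in c d \<psi>" for c d \<psi> i
  proof -
    have "dist_dt T (\<lambda>y. \<rho> y * u y $ i) \<psi> + dist_div T (\<lambda>y. (\<rho> y * u y $ i) *\<^sub>R u y) \<psi> + dist_dx T i (\<lambda>y. p (\<rho> y)) \<psi> = 0"
      using assms(4) smooth_in_test_function[OF that] unfolding euler_solution_def momentum_equation_def by blast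
    moreover have "(LINT y|lebesgue_on (Omega T). \<rho> y * u y $ i * u y $ j * pdiff \<psi> w y)
        = (\<integral>y. pdiff \<psi> w y * ((R y * v j y) * v i y) \<partial>cylinder)" for j w
      using representative_integral[OF repf[of j i] that(3), of w] by (simp add: mult_ac)
    ultimately show ?thesis
      using representative_integral[OF repm[of i] that(3), of "(1, 0)"] representative_integral[OF reppr that(3), of "(0, axis i 1)"]
      by (simp add: dist_dt_def dist_div_def dist_dx_def pdiff_def[symmetric] sum_negf)
  qed

  obtain C where C: "C > 0" "\<forall>\<epsilon>. 0 < \<epsilon> \<longrightarrow> \<epsilon> < 1 \<longrightarrow> (\<exists>K :: real \<times> (real ^ 'n) \<Rightarrow> real. mollifier C \<epsilon> K)"
    using mollifier_exists by blast
  then obtain K0 where K0: "\<And>\<epsilon>. 0 < \<epsilon> \<Longrightarrow> \<epsilon> < 1 \<Longrightarrow> mollifier C \<epsilon> (K0 \<epsilon> :: real \<times> (real ^ 'n) \<Rightarrow> real)" by metis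
  define K where "K \<epsilon> = (if 0 < \<epsilon> \<and> \<epsilon> < 1 then K0 \<epsilon> else (\<lambda>_. 0))" for \<epsilon>
  have loc: "vacuum_euler a b T C K \<gamma> \<alpha> \<beta> \<rho>lo \<rho>hi s \<sigma> Cp R pr v p p' ?P B B' B''" if ab: "0 < a" "b < T" for a b
  proof (unfold_locales)
    show "mollifier C \<epsilon> (K \<epsilon>)" if "0 < \<epsilon>" "\<epsilon> < 1" for \<epsilon> using K0[OF that] that by (simp add: K_def)
    show "0 \<le> K \<epsilon> z" for \<epsilon> z
    proof (cases "0 < \<epsilon> \<and> \<epsilon> < 1")
      case True
      then have "mollifier C \<epsilon> (K0 \<epsilon>)" using K0 by blast
      then have "0 \<le> K0 \<epsilon> z" unfolding mollifier_def by blast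
      then show ?thesis using True by (simp add: K_def)
    qed (auto simp: K_def)
    show "pr y = p (R y)" if "fst y \<in> {0<..<T}" for y using that by (simp add: pr_def)
    show "\<bar>p x - p t\<bar> \<le> Cp * \<bar>x - t\<bar>" "\<bar>p x - p t - p' t * (x - t)\<bar> \<le> Cp * \<bar>x - t\<bar> powr \<gamma>"
      if "x \<in> {\<rho>lo..\<rho>hi}" "t \<in> {\<rho>lo..\<rho>hi}" for x t
      using C1(2,3)[OF that] Cp(2)[of "\<bar>x - t\<bar>"] Cp(2)[of "\<bar>x - t\<bar> powr \<gamma>"] by (simp_all add: mult.commute)
    show "\<bar>B'' \<delta> x\<bar> \<le> Cp * \<delta> powr (\<gamma> - 2)" "\<bar>B' \<delta> x\<bar> \<le> Cp * \<delta> powr (\<gamma> - 2)"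
      "\<bar>x * B' \<delta> x - B \<delta> x - p x\<bar> \<le> Cp * \<delta> powr \<gamma>" "\<bar>B \<delta> x - ?P x\<bar> \<le> Cp * \<delta> powr \<gamma>"
      if \<delta>: "0 < \<delta>" "\<delta> \<le> 1" and x: "x \<in> {\<rho>lo..\<rho>hi}" for \<delta> x
    proof -
      have le: "C2 * \<delta> powr z \<le> Cp * \<delta> powr z" for z by (intro mult_right_mono) (auto simp: Cp_def)
      have b: "\<bar>B'' \<delta> x\<bar> \<le> C2 * \<delta> powr (\<gamma> - 2)" "\<bar>B' \<delta> x\<bar> \<le> C2 * \<delta> powr (\<gamma> - 2)"
        "\<bar>x * B' \<delta> x - B \<delta> x - p x\<bar> \<le> C2 * \<delta> powr \<gamma>" "\<bar>B \<delta> x - ?P x\<bar> \<le> C2 * \<delta> powr \<gamma>"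
        using B[OF \<delta>] x by blast+
      show "\<bar>B'' \<delta> x\<bar> \<le> Cp * \<delta> powr (\<gamma> - 2)" "\<bar>B' \<delta> x\<bar> \<le> Cp * \<delta> powr (\<gamma> - 2)"
        "\<bar>x * B' \<delta> x - B \<delta> x - p x\<bar> \<le> Cp * \<delta> powr \<gamma>" "\<bar>B \<delta> x - ?P x\<bar> \<le> Cp * \<delta> powr \<gamma>"
        by (rule order_trans[OF b(1) le] order_trans[OF b(2) le] order_trans[OF b(3) le] order_trans[OF b(4) le])+
    qed
  qed (use ab C(1) s exps assms(2,3,8,10-13,18,19) lohi bR bv bm flux pr R_range Cp(1)[OF order_refl] B mass momentum in auto)

  have Rae: "AE y in lebesgue_on (Omega T). \<rho> y = R y \<and> (\<forall>i. u y $ i = v i y)"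
  proof -
    have "AE y in lebesgue_on (Omega T). \<rho> y = R y" using repR by (simp add: representative_def)
    moreover have "AE y in lebesgue_on (Omega T). \<forall>i\<in>UNIV. u y $ i = v i y"
      by (rule AE_finite_allI) (use repv in \<open>auto simp: representative_def\<close>)
    ultimately show ?thesis by eventually_elim auto
  qed
  let ?E = "energy_density p \<rho> u" and ?F = "energy_flux p \<rho> u"
  let ?Et = "vacuum_euler.Et R v ?P" and ?Ex = "vacuum_euler.Ex R v p ?P"
  have ae: "AE y in lebesgue_on ({a..b} \<times> unit_cell). ?E y = ?Et y" "AE y in lebesgue_on ({a..b} \<times> unit_cell). ?F y $ j = ?Ex j y"
    if ab: "0 < a" "b < T" for a b j
  proof -
    interpret vacuum_euler a b T C K \<gamma> \<alpha> \<beta> \<rho>lo \<rho>hi s \<sigma> Cp R pr v p p' ?P B B' B'' by (rule loc[OF ab])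
    have nrm: "(norm (u y))\<^sup>2 = (\<Sum>i\<in>UNIV. u y $ i * u y $ i)" for y
      by (simp add: power2_norm_eq_inner inner_vec_def)
    have sub: "AE y in lebesgue_on ({a..b} \<times> unit_cell). \<rho> y = R y \<and> (\<forall>i. u y $ i = v i y)"
      by (rule AE_lebesgue_on_subset[OF Rae]) (use ab in \<open>auto simp: Omega_def borel_prod[symmetric]\<close>)
    show "AE y in lebesgue_on ({a..b} \<times> unit_cell). ?E y = ?Et y"
      using sub by eventually_elim (simp add: energy_density_def Et_def nrm)
    show "AE y in lebesgue_on ({a..b} \<times> unit_cell). ?F y $ j = ?Ex j y"
      using sub by eventually_elim (simp add: energy_flux_def Ex_def nrm)
  qed
  have int: "integrable (slab a b) ?Et" "integrable (slab a b) (?Ex j)" if ab: "0 < a" "b < T" for a b j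
  proof -
    interpret vacuum_euler a b T C K \<gamma> \<alpha> \<beta> \<rho>lo \<rho>hi s \<sigma> Cp R pr v p p' ?P B B' B'' by (rule loc[OF ab])
    show "integrable (slab a b) ?Et" "integrable (slab a b) (?Ex j)" by (rule energy_integrable)+
  qed
  show ?thesis
    unfolding energy_locally_conserved_def
  proof (intro conjI ballI)
    show "?E \<in> L1_loc T"
      unfolding L1_loc_def
    proof (intro CollectI conjI allI impI)
      show "space_periodic {0<..<T} ?E" using per by (simp add: space_periodic_def energy_density_def)
      fix a b :: real assume ab: "0 < a" "b < T"
      show "integrable (lebesgue_on ({a..b} \<times> unit_cell)) ?E"
        using lebesgue_on_eq_borel(2)[OF slab_set_borel _ ae(1)[OF ab], folded slab_def] int(1)[OF ab] by blast
    qed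
    show "?F \<in> L1_loc T"
      unfolding L1_loc_def
    proof (intro CollectI conjI allI impI)
      show "space_periodic {0<..<T} ?F" using per by (simp add: space_periodic_def energy_flux_def)
      fix a b :: real assume ab: "0 < a" "b < T"
      have "integrable (lebesgue_on ({a..b} \<times> unit_cell)) (\<lambda>y. ?F y $ j)" for j
        using lebesgue_on_eq_borel(2)[OF slab_set_borel _ ae(2)[OF ab], folded slab_def] int(2)[OF ab] by blast
      then have "integrable (lebesgue_on ({a..b} \<times> unit_cell)) (\<lambda>y. \<Sum>j\<in>UNIV. ?F y $ j *\<^sub>R axis j (1::real))"
        by (intro Bochner_Integration.integrable_sum integrable_scaleR_left)
      moreover have "(\<Sum>j\<in>UNIV. ?F y $ j *\<^sub>R axis j (1::real)) = ?F y" for y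
        using basis_expansion[of "?F y"] by (simp add: scalar_mult_eq_scaleR)
      ultimately show "integrable (lebesgue_on ({a..b} \<times> unit_cell)) ?F" by simp
    qed
    fix \<phi> :: "real \<times> (real ^ 'n) \<Rightarrow> real" assume "\<phi> \<in> test_functions T"
    then obtain a b where ab: "0 < a" "b < T" and \<phi>: "smooth_in a b \<phi>" using test_function_smooth_in by blast
    interpret vacuum_euler a b T C K \<gamma> \<alpha> \<beta> \<rho>lo \<rho>hi s \<sigma> Cp R pr v p p' ?P B B' B'' by (rule loc[OF ab])
    note im = integrable_slab_pdiff_mult[OF \<phi>]
    have "(LINT y|lebesgue_on (Omega T). ?E y * pdiff \<phi> (1, 0) y) = (\<integral>y. pdiff \<phi> (1, 0) y * ?Et y \<partial>slab a b)"
      by (rule slab_integral[OF ab _ ae(1)[OF ab] \<phi>]) (use int(1)[OF ab] in auto)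
    moreover have "(LINT y|lebesgue_on (Omega T). ?F y $ j * pdiff \<phi> (0, axis j 1) y) = (\<integral>y. pdiff \<phi> (0, axis j 1) y * ?Ex j y \<partial>slab a b)" for j
      by (rule slab_integral[OF ab _ ae(2)[OF ab] \<phi>]) (use int(2)[OF ab] in auto)
    moreover have "(\<integral>y. pdiff \<phi> (1, 0) y * ?Et y \<partial>slab a b) + (\<Sum>j\<in>UNIV. \<integral>y. pdiff \<phi> (0, axis j 1) y * ?Ex j y \<partial>slab a b) = 0"
      using energy_conserved_slab[OF \<phi>] im[OF int(1)[OF ab]] im[OF int(2)[OF ab]] by simp
    ultimately show "dist_dt T ?E \<phi> + dist_div T ?F \<phi> = 0"
      by (simp add: dist_dt_def dist_div_def dist_dx_def pdiff_def[symmetric] sum_negf)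
  qed
qed

end
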